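(* Let $\Omega\subset\mathbb{R}^n$ be a domain, let $0\leq\gamma<\infty$ and $1<p<\infty$. Then the following hold. (i) For every $f\in W^{1,p}(\Omega)$ one has $M_{\varphi,\Omega}f\in W^{1,p}(\Omega)$, and for almost every $x\in\Omega$ $$|\nabla M_{\varphi,\Omega}f(x)|\leq \gamma n\,M_{\varphi,\Omega}f(x)+2M_{\varphi,\Omega}|\nabla f|(x).$$ (ii) The map $M_{\varphi,\Omega}:W^{1,p}(\Omega)\to W^{1,p}(\Omega)$ is bounded; that is, there exists a constant $C>0$ such that for every $f\in W^{1,p}(\Omega)$ $$\|M_{\varphi,\Omega}f\|_{W^{1,p}(\Omega)}\leq C\|f\|_{W^{1,p}(\Omega)}.$$ (iii) If $f\in W_0^{1,p}(\Omega)$, then $M_{\varphi,\Omega}f\in W_0^{1,p}(\Omega)$.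
   Context: For $\gamma\ge 0$ put $\varphi(t)=(1+t)^{\gamma}$ for $t\geq 0$. For a domain $\Omega\subset\mathbb{R}^n$ with complement $\Omega^c=\mathbb{R}^n\setminus\Omega$, the local new maximal operator is $$M_{\varphi,\Omega}f(x)=\sup_{0<r<\mathrm{dist}(x,\Omega^c)}\frac{1}{\varphi(|B(x,r)|)\,|B(x,r)|}\int_{B(x,r)}|f(y)|\,dy,\qquad x\in\Omega,$$ where $B(x,r)$ is the ball with center $x$ and radius $r$ and $|\cdot|$ is Lebesgue measure; if $\Omega=\mathbb{R}^n$ the supremum is over all $r>0$. The Sobolev space $W^{1,p}(\Omega)$ consists of the functions $f:\Omega\to\mathbb{R}$ with $\|f\|_{W^{1,p}(\Omega)}=\|f\|_{L^p(\Omega)}+\|\nabla f\|_{L^p(\Omega)}<\infty$, where $\nabla f$ is the weak gradient. The Sobolev space with zero boundary values $W_0^{1,p}(\Omega)$ is the completion of $C_0^\infty(\Omega)$ with respect to the norm $\|\cdot\|_{W^{1,p}(\Omega)}$. *)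

theory Defs
  imports "HOL-Analysis.Analysis"
begin

text \<open>
  Functions on \<open>\<Omega>\<close> are rendered as functions on the whole Euclidean space; every notion
  below that refers to \<open>\<Omega>\<close> depends only on their values in \<open>\<Omega>\<close>.
\<close>

definition growth :: "real \<Rightarrow> real \<Rightarrow> real" where
  "growth \<gamma> t = (1 + t) powr \<gamma>"

text \<open>
  The case distinction is needed because \<^term>\<open>infdist x {} = 0\<close>, whereas the distance to
  the empty set is meant to be infinite.
\<close>

definition admissible_radii :: "'a::euclidean_space set \<Rightarrow> 'a \<Rightarrow> real set" where
  "admissible_radii \<Omega> x = {r. 0 < r \<and> (\<Omega> = UNIV \<or> r < infdist x (- \<Omega>))}"

text \<open>
  The supremum may be infinite, so the operator takes values in \<^typ>\<open>ennreal\<close>.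
\<close>

definition local_maximal ::
  "(real \<Rightarrow> real) \<Rightarrow> 'a::euclidean_space set \<Rightarrow> ('a \<Rightarrow> real) \<Rightarrow> 'a \<Rightarrow> ennreal" where
  "local_maximal \<phi> \<Omega> f x =
    (SUP r\<in>admissible_radii \<Omega> x.
      (\<integral>\<^sup>+ y\<in>ball x r. ennreal \<bar>f y\<bar> \<partial>lebesgue) /
      ennreal (\<phi> (measure lebesgue (ball x r)) * measure lebesgue (ball x r)))"

text \<open>
  The real-valued version sends the value \<open>\<infinity>\<close> to 0; it represents \<^const>\<open>local_maximal\<close>
  only where the latter is finite.
\<close>

definition local_maximal_real ::
  "(real \<Rightarrow> real) \<Rightarrow> 'a::euclidean_space set \<Rightarrow> ('a \<Rightarrow> real) \<Rightarrow> 'a \<Rightarrow> real" where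
  "local_maximal_real \<phi> \<Omega> f x = enn2real (local_maximal \<phi> \<Omega> f x)"

text \<open>
  \<open>Ck k f\<close>: \<open>f\<close> is \<open>k\<close> times continuously differentiable on the whole space; the derivative
  is \<open>C\<^sup>k\<close> iff all partial derivatives are.
\<close>

fun Ck :: "nat \<Rightarrow> ('a::euclidean_space \<Rightarrow> real) \<Rightarrow> bool" where
  "Ck 0 f \<longleftrightarrow> continuous_on UNIV f"
| "Ck (Suc k) f \<longleftrightarrow>
    (\<forall>x. f differentiable (at x)) \<and> (\<forall>b\<in>Basis. Ck k (\<lambda>x. frechet_derivative f (at x) b))"

text \<open>\<open>C\<^sub>0\<^sup>\<infinity>(\<Omega>)\<close>, each function being extended by zero to the whole space.\<close>

definition test_functions :: "'a::euclidean_space set \<Rightarrow> ('a \<Rightarrow> real) set" where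
  "test_functions \<Omega> =
    {\<psi>. (\<forall>k. Ck k \<psi>) \<and> compact (closure {x. \<psi> x \<noteq> 0}) \<and> closure {x. \<psi> x \<noteq> 0} \<subseteq> \<Omega>}"

definition Lp_space ::
  "real \<Rightarrow> 'a::euclidean_space set \<Rightarrow> ('a \<Rightarrow> 'b::euclidean_space) set" where
  "Lp_space p \<Omega> =
    {f. f \<in> borel_measurable (lebesgue_on \<Omega>) \<and>
        integrable (lebesgue_on \<Omega>) (\<lambda>x. norm (f x) powr p)}"

definition Lp_norm ::
  "real \<Rightarrow> 'a::euclidean_space set \<Rightarrow> ('a \<Rightarrow> 'b::euclidean_space) \<Rightarrow> real" where
  "Lp_norm p \<Omega> f = (LINT x|lebesgue_on \<Omega>. norm (f x) powr p) powr (1 / p)"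

definition locally_integrable ::
  "'a::euclidean_space set \<Rightarrow> ('a \<Rightarrow> 'b::euclidean_space) \<Rightarrow> bool" where
  "locally_integrable \<Omega> f \<longleftrightarrow>
    (\<forall>K. compact K \<and> K \<subseteq> \<Omega> \<longrightarrow> integrable (lebesgue_on K) f)"

definition has_weak_gradient ::
  "'a::euclidean_space set \<Rightarrow> ('a \<Rightarrow> real) \<Rightarrow> ('a \<Rightarrow> 'a) \<Rightarrow> bool" where
  "has_weak_gradient \<Omega> f g \<longleftrightarrow>
    locally_integrable \<Omega> f \<and> locally_integrable \<Omega> g \<and>
    (\<forall>\<psi>\<in>test_functions \<Omega>. \<forall>b\<in>Basis.
      (LINT x|lebesgue_on \<Omega>. f x * frechet_derivative \<psi> (at x) b) =
      - (LINT x|lebesgue_on \<Omega>. (g x \<bullet> b) * \<psi> x))"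

text \<open>
  A weak gradient is unique up to null sets; the following fixes a representative, and it is
  meaningful only if a weak gradient exists.
\<close>

definition weak_gradient :: "'a::euclidean_space set \<Rightarrow> ('a \<Rightarrow> real) \<Rightarrow> 'a \<Rightarrow> 'a" where
  "weak_gradient \<Omega> f = (SOME g. has_weak_gradient \<Omega> f g)"

definition sobolev_W1 :: "real \<Rightarrow> 'a::euclidean_space set \<Rightarrow> ('a \<Rightarrow> real) set" where
  "sobolev_W1 p \<Omega> =
    {f \<in> Lp_space p \<Omega>. \<exists>g. has_weak_gradient \<Omega> f g \<and> g \<in> Lp_space p \<Omega>}"

definition sobolev_norm :: "real \<Rightarrow> 'a::euclidean_space set \<Rightarrow> ('a \<Rightarrow> real) \<Rightarrow> real" where
  "sobolev_norm p \<Omega> f = Lp_norm p \<Omega> f + Lp_norm p \<Omega> (weak_gradient \<Omega> f)"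

text \<open>
  The completion of \<open>C\<^sub>0\<^sup>\<infinity>(\<Omega>)\<close> is realised as its closure in the complete space
  \<open>W\<^sup>1\<^sup>,\<^sup>p(\<Omega>)\<close>.
\<close>

definition sobolev_W1_zero :: "real \<Rightarrow> 'a::euclidean_space set \<Rightarrow> ('a \<Rightarrow> real) set" where
  "sobolev_W1_zero p \<Omega> =
    {f \<in> sobolev_W1 p \<Omega>. \<exists>\<psi>. (\<forall>k::nat. \<psi> k \<in> test_functions \<Omega>) \<and>
      (\<lambda>k. sobolev_norm p \<Omega> (\<lambda>x. f x - \<psi> k x)) \<longlonglongrightarrow> 0}"

end

theory Submission
  imports Defs
begin

text \<open>
  The key point is a one-sided comparison. If \<open>r\<close> is admissible at \<open>x\<close> and the centre moves along a
  segment from \<open>x\<close> to \<open>y\<close>, let the radius shrink linearly so that the moving balls stay in \<open>\<Omega>\<close>. Every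
  point of the moving ball has speed at most \<open>2 |x - y|\<close>, and the factor \<open>1 / \<phi>(|B|)\<close> only increases
  when the ball shrinks, whence \<open>M f x \<le> M f y + 2 \<integral> M |\<nabla>f|\<close> with the integral taken over the segment.
  So \<open>2 M |\<nabla>f|\<close> is a local upper gradient of \<open>M f\<close>, and the term with \<open>\<gamma> n\<close> is only slack.

  A bound of the difference quotients of \<open>u\<close> by segment averages of some \<open>g\<close> gives
  \<open>\<bar>\<integral> u \<partial>\<^sub>e\<psi>\<bar> \<le> |e| \<integral> g \<bar>\<psi>\<bar>\<close> for test functions, and a Riesz argument in a weighted \<open>L\<^sup>2\<close> space then
  produces a weak gradient with \<open>|\<nabla>u| \<le> g\<close>. Integrability comes from the Hardy--Littlewood maximal theorem.

  For zero boundary values take test functions \<open>\<psi>\<^sub>k\<close> tending to \<open>f\<close> and put \<open>u = M f\<close>, \<open>e\<^sub>k = M (f - \<psi>\<^sub>k)\<close>.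
  Then \<open>(u - e\<^sub>k)\<^sup>+ \<le> M \<psi>\<^sub>k\<close> vanishes near the boundary, hence can be mollified and cut off, and it
  converges to \<open>u\<close> in the Sobolev norm.
\<close>

section \<open>Smooth functions and mollifiers\<close>

text \<open>A ball of fixed radius could leave \<open>\<Omega>\<close> when its centre moves, and a
  growing ball lowers \<open>1 / \<phi>(|B|)\<close>. Shrinking is harmless on both counts, but it
  bounds only the value at the starting point; exchanging the endpoints restores the absolute value.
  The constant 2 is one unit of speed for the centre and at most one for the radius. Since
  \<open>M |\<nabla>f|\<close> may be infinite at some points, the comparison bounds real
  differences only almost everywhere, and the gradient of \<open>M f\<close> is obtained by duality.
  Testing in every direction \<open>e\<close>, not only along the axes, keeps
  \<open>|\<nabla>u| \<le> g\<close> free of a dimensional factor. For zero boundary values the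
  obstacle is that \<open>M\<close> is sublinear but not linear: closeness of \<open>f\<close> and
  \<open>\<psi>\<^sub>k\<close> does not by itself make the gradients of \<open>M f\<close> and
  \<open>M \<psi>\<^sub>k\<close> close. Truncation circumvents this, since the gradient of
  \<open>min u e\<^sub>k\<close> is controlled by the small gradient bound of
  \<open>e\<^sub>k\<close> and, only where \<open>u < e\<^sub>k\<close>, by that of
  \<open>u\<close>.\<close>

lemma Ck_SucD: "Ck (Suc k) f \<Longrightarrow> Ck k f"
proof (induction k arbitrary: f)
  case 0
  then show ?case
    by (auto intro!: differentiable_imp_continuous_on simp: differentiable_on_def intro: differentiable_at_withinI)
next
  case (Suc k)
  then show ?case by auto
qed

text \<open>\<open>Ck\<close> refers to the chosen \<open>frechet_derivative\<close>; by uniqueness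
  of derivatives an explicit formula \<open>D\<close> may be used in its place.\<close>

lemma Ck_SucI:
  assumes D: "\<And>x. (f has_derivative D x) (at x)" and C: "\<And>b. b \<in> Basis \<Longrightarrow> Ck k (\<lambda>x. D x b)"
  shows "Ck (Suc k) f"
proof -
  have "frechet_derivative f (at x) = D x" for x
    using frechet_derivative_at[OF D] by simp
  then show ?thesis
    using D C by (auto simp: differentiable_def)
qed

lemma Ck_Suc_has_derivative:
  "Ck (Suc k) f \<Longrightarrow> (f has_derivative frechet_derivative f (at x)) (at x)"
  by (simp add: frechet_derivative_works)

lemma Ck_const [simp]: "Ck k (\<lambda>_. c)"
proof (induction k arbitrary: c)
  case (Suc k)
  show ?case by (rule Ck_SucI[where D="\<lambda>_ _. 0"]) (auto simp: Suc)
qed simp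

lemma Ck_add: "Ck k f \<Longrightarrow> Ck k g \<Longrightarrow> Ck k (\<lambda>x. f x + g x)"
proof (induction k arbitrary: f g)
  case 0
  then show ?case by (simp add: continuous_on_add)
next
  case (Suc k)
  show ?case
    by (rule Ck_SucI[OF has_derivative_add[OF Ck_Suc_has_derivative[OF Suc.prems(1)]
          Ck_Suc_has_derivative[OF Suc.prems(2)]]]) (use Suc in auto)
qed

lemma Ck_mult: "Ck k f \<Longrightarrow> Ck k g \<Longrightarrow> Ck k (\<lambda>x. f x * g x)"
proof (induction k arbitrary: f g)
  case 0
  then show ?case by (simp add: continuous_on_mult)
next
  case (Suc k)
  have "Ck k f" "Ck k g" using Suc.prems Ck_SucD by blast+
  then show ?case
    by (intro Ck_SucI[OF has_derivative_mult[OF Ck_Suc_has_derivative[OF Suc.prems(1)]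
          Ck_Suc_has_derivative[OF Suc.prems(2)]]] Ck_add Suc.IH) (use Suc in auto)
qed

lemma Ck_inner_left: "Ck k (\<lambda>x. x \<bullet> a)"
  by (cases k) (auto intro!: continuous_intros Ck_SucI derivative_eq_intros simp del: Ck.simps(2))

lemma Ck_sum: "(\<And>i. i \<in> I \<Longrightarrow> Ck k (f i)) \<Longrightarrow> Ck k (\<lambda>x. \<Sum>i\<in>I. f i x)"
  by (induction I rule: infinite_finite_induct) (auto intro: Ck_add)

lemma Ck_inner_self: "Ck k (\<lambda>x. x \<bullet> x)"
proof -
  have "(\<lambda>x. x \<bullet> x) = (\<lambda>x::'a. \<Sum>b\<in>Basis. (x \<bullet> b) * (x \<bullet> b))"
    by (rule ext) (rule euclidean_inner)
  then show ?thesis by (auto intro!: Ck_sum Ck_mult Ck_inner_left)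
qed

text \<open>The linear part is a scalar because only reflections \<open>y \<mapsto> x - y\<close>
  and dilations of cut-offs occur. The scalar comes out of each partial derivative, so the induction
  closes.\<close>

lemma Ck_affine: "Ck k f \<Longrightarrow> Ck k (\<lambda>x. f (c *\<^sub>R x + a))"
proof (induction k arbitrary: f)
  case 0
  then show ?case by (auto intro!: continuous_intros continuous_on_compose2[of UNIV f])
next
  case (Suc k)
  have 1: "((\<lambda>x. f (c *\<^sub>R x + a)) has_derivative
     (\<lambda>h. frechet_derivative f (at (c *\<^sub>R x + a)) (c *\<^sub>R h))) (at x)" for x
    by (rule has_derivative_compose[OF _ Ck_Suc_has_derivative[OF Suc.prems]])
      (auto intro!: derivative_eq_intros)
  have "Ck k (\<lambda>x. frechet_derivative f (at (c *\<^sub>R x + a)) (c *\<^sub>R b))" if "b \<in> Basis" for b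
  proof -
    have "frechet_derivative f (at y) (c *\<^sub>R b) = c * frechet_derivative f (at y) b" for y
      using has_derivative_bounded_linear[OF Ck_Suc_has_derivative[OF Suc.prems]]
      by (metis linear_simps(5) real_scaleR_def)
    moreover have "Ck k (\<lambda>x. c * frechet_derivative f (at (c *\<^sub>R x + a)) b)"
      using Suc.prems that by (intro Ck_mult Ck_const Suc.IH[of "\<lambda>x. frechet_derivative f (at x) b"]) auto
    ultimately show ?thesis by simp
  qed
  then show ?case by (rule Ck_SucI[OF 1])
qed

text \<open>For \<open>m = 0\<close> this is the standard smooth function that is flat at the
  origin. The powers of \<open>s\<close> in the denominator make the family closed under
  differentiation up to linear combinations.\<close>

definition exp_bump :: "nat \<Rightarrow> real \<Rightarrow> real" where
  "exp_bump m s = (if 0 < s then exp (- (1 / s)) / s ^ m else 0)"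

lemma exp_bump_tendsto_0: "(exp_bump m \<longlongrightarrow> 0) (at 0)"
proof -
  have "((\<lambda>s::real. (inverse s) ^ m / exp (inverse s)) \<longlongrightarrow> 0) (at_right 0)"
    by (rule filterlim_compose[OF tendsto_power_div_exp_0 filterlim_inverse_at_top_right])
  then have "(exp_bump m \<longlongrightarrow> 0) (at_right 0)"
    by (rule Lim_transform_eventually)
      (auto simp: exp_bump_def eventually_at_filter exp_minus field_simps)
  moreover have "(exp_bump m \<longlongrightarrow> 0) (at_left 0)"
    by (rule Lim_transform_eventually[OF tendsto_const])
      (auto simp: exp_bump_def eventually_at_filter)
  ultimately show ?thesis by (simp add: filterlim_split_at)
qed

lemma exp_bump_has_derivative:
  "(exp_bump m has_real_derivative exp_bump (m+2) s - m * exp_bump (m+1) s) (at s)"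
proof -
  consider "s > 0" | "s < 0" | "s = 0" by linarith
  then show ?thesis
  proof cases
    case 1
    have e: "exp_bump m t = exp (- (1 / t)) / t ^ m" if "t \<in> {0<..}" for t
      using that by (simp add: exp_bump_def)
    have "((\<lambda>s. exp (- inverse s) * inverse s ^ m) has_real_derivative
        exp (- inverse s) * inverse s ^ 2 * inverse s ^ m
          + exp (- inverse s) * (m * (inverse s ^ (m - 1) * (- (inverse s ^ 2))))) (at s)"
      using 1 by (auto intro!: derivative_eq_intros simp: power2_eq_square)
    moreover have "exp (- inverse s) * inverse s ^ 2 * inverse s ^ m
          + exp (- inverse s) * (m * (inverse s ^ (m - 1) * (- (inverse s ^ 2))))
        = exp_bump (m+2) s - m * exp_bump (m+1) s"
      using 1 by (cases m) (auto simp: exp_bump_def field_simps power2_eq_square)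
    moreover have "(\<lambda>s::real. exp (- inverse s) * inverse s ^ m) = (\<lambda>s. exp (- (1 / s)) / s ^ m)"
      by (simp add: field_simps)
    ultimately have "((\<lambda>s. exp (- (1 / s)) / s ^ m) has_real_derivative exp_bump (m+2) s - m * exp_bump (m+1) s) (at s)"
      by (simp only:)
    then show ?thesis
      by (rule has_field_derivative_transform_within_open[of _ _ _ "{0<..}"]) (use 1 e in auto)
  next
    case 2
    have "((\<lambda>s. 0) has_real_derivative exp_bump (m+2) s - m * exp_bump (m+1) s) (at s)"
      using 2 by (auto simp: exp_bump_def)
    then show ?thesis
      by (rule has_field_derivative_transform_within_open[of _ _ _ "{..<0}"])
        (use 2 in \<open>auto simp: exp_bump_def\<close>)
  next
    case 3
    \<comment> \<open>At the origin the difference quotient of \<open>exp_bump m\<close> is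
      \<open>exp_bump (Suc m)\<close> itself, whose limit is already known.\<close>
    have "((\<lambda>h. (exp_bump m (0 + h) - exp_bump m 0) / h) \<longlongrightarrow> 0) (at 0)"
      by (rule Lim_transform_eventually[OF exp_bump_tendsto_0[of "Suc m"]])
        (auto simp: exp_bump_def eventually_at_filter field_simps)
    then show ?thesis using 3 by (simp add: DERIV_def exp_bump_def)
  qed
qed

text \<open>The induction keeps \<open>m\<close> arbitrary: a partial derivative is one of
  \<open>q\<close> times a combination of members of the same family with larger index.\<close>

lemma Ck_exp_bump:
  assumes q: "\<And>k. Ck k q"
  shows "Ck k (\<lambda>x. exp_bump m (q x))"
proof (induction k arbitrary: m)
  case 0
  have "isCont (exp_bump m) s" for s
    using exp_bump_has_derivative by (rule DERIV_isCont)
  then have "continuous_on UNIV (exp_bump m)"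
    by (simp add: continuous_at_imp_continuous_on)
  then show ?case
    using q[of 0] by (simp add: continuous_on_compose2)
next
  case (Suc k)
  have "((\<lambda>x. exp_bump m (q x)) has_derivative
    (\<lambda>h. frechet_derivative q (at x) h * (exp_bump (m+2) (q x) + (- m) * exp_bump (m+1) (q x)))) (at x)" for x
    using DERIV_compose_FDERIV[OF exp_bump_has_derivative Ck_Suc_has_derivative[OF q[of "Suc 0"]], of m x]
    by (simp add: o_def)
  then show ?case
    by (rule Ck_SucI) (intro Ck_mult Ck_add Suc.IH Ck_const, use q[of "Suc k"] in auto)
qed


section \<open>Test functions: algebra, derivatives and uniform bounds\<close>

lemma test_functions_Ck: "\<psi> \<in> test_functions \<Omega> \<Longrightarrow> Ck k \<psi>"
  by (simp add: test_functions_def)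

lemma test_functionsI:
  assumes "\<And>k. Ck k \<psi>" "compact K" "K \<subseteq> \<Omega>" "\<And>x. x \<notin> K \<Longrightarrow> \<psi> x = 0"
  shows "\<psi> \<in> test_functions \<Omega>"
proof -
  have "closure {x. \<psi> x \<noteq> 0} \<subseteq> K"
    using assms(2,4) by (intro closure_minimal) (auto simp: compact_imp_closed)
  then show ?thesis
    using assms by (auto simp: test_functions_def dest: compact_imp_bounded intro: bounded_subset[OF _ order_trans[OF closure_subset]])
qed

lemma test_functions_support:
  assumes "\<psi> \<in> test_functions \<Omega>"
  obtains K where "compact K" "K \<subseteq> \<Omega>" "\<And>x. x \<notin> K \<Longrightarrow> \<psi> x = 0"
proof (rule that)
  show "compact (closure {x. \<psi> x \<noteq> 0})" "closure {x. \<psi> x \<noteq> 0} \<subseteq> \<Omega>"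
    using assms by (auto simp: test_functions_def)
  show "\<And>x. x \<notin> closure {x. \<psi> x \<noteq> 0} \<Longrightarrow> \<psi> x = 0"
    using closure_subset[of "{x. \<psi> x \<noteq> 0}"] by auto
qed

lemma test_functions_mono: "\<psi> \<in> test_functions \<Omega> \<Longrightarrow> \<Omega> \<subseteq> \<Omega>' \<Longrightarrow> \<psi> \<in> test_functions \<Omega>'"
  by (auto simp: test_functions_def)

lemma test_functions_mult:
  assumes "\<And>k. Ck k \<zeta>" "\<psi> \<in> test_functions \<Omega>"
  shows "(\<lambda>x. \<zeta> x * \<psi> x) \<in> test_functions \<Omega>"
proof -
  obtain K where "compact K" "K \<subseteq> \<Omega>" "\<And>x. x \<notin> K \<Longrightarrow> \<psi> x = 0"
    using assms(2) by (rule test_functions_support) blast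
  then show ?thesis
    using assms by (intro test_functionsI[of _ K] Ck_mult) (auto simp: test_functions_Ck)
qed

lemma test_functions_cmult: "\<psi> \<in> test_functions \<Omega> \<Longrightarrow> (\<lambda>x. c * \<psi> x) \<in> test_functions \<Omega>"
  by (rule test_functions_mult) auto

lemma test_functions_add:
  assumes "\<psi> \<in> test_functions \<Omega>" "\<phi> \<in> test_functions \<Omega>"
  shows "(\<lambda>x. \<psi> x + \<phi> x) \<in> test_functions \<Omega>"
proof -
  obtain K where K: "compact K" "K \<subseteq> \<Omega>" "\<And>x. x \<notin> K \<Longrightarrow> \<psi> x = 0"
    using assms(1) by (rule test_functions_support) blast
  obtain L where L: "compact L" "L \<subseteq> \<Omega>" "\<And>x. x \<notin> L \<Longrightarrow> \<phi> x = 0"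
    using assms(2) by (rule test_functions_support) blast
  show ?thesis
    using assms K L by (intro test_functionsI[of _ "K \<union> L"] Ck_add) (auto simp: test_functions_Ck)
qed

lemma test_functions_diff:
  "\<psi> \<in> test_functions \<Omega> \<Longrightarrow> \<phi> \<in> test_functions \<Omega> \<Longrightarrow> (\<lambda>x. \<psi> x - \<phi> x) \<in> test_functions \<Omega>"
  using test_functions_add[of \<psi> \<Omega> "\<lambda>x. (- 1) * \<phi> x"] test_functions_cmult[of \<phi> \<Omega> "-1"] by simp

lemma test_functions_zero: "(\<lambda>_. 0) \<in> test_functions \<Omega>"
  by (rule test_functionsI[of _ "{}"]) auto

lemma test_functions_has_derivative:
  "\<psi> \<in> test_functions \<Omega> \<Longrightarrow> (\<psi> has_derivative frechet_derivative \<psi> (at x)) (at x)"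
  using Ck_Suc_has_derivative test_functions_Ck by blast

lemma test_functions_continuous: "\<psi> \<in> test_functions \<Omega> \<Longrightarrow> continuous_on UNIV \<psi>"
  using test_functions_Ck[of \<psi> \<Omega> 0] by simp

lemma test_functions_deriv_zero:
  assumes "\<psi> \<in> test_functions \<Omega>" "compact K" "\<And>x. x \<notin> K \<Longrightarrow> \<psi> x = 0" "x \<notin> K"
  shows "frechet_derivative \<psi> (at x) e = 0"
proof -
  have "((\<lambda>_. 0) has_derivative (\<lambda>_. 0)) (at x)" by simp
  then have "(\<psi> has_derivative (\<lambda>_. 0)) (at x)"
    by (rule has_derivative_transform_within_open[of _ _ _ _ "- K"])
      (use assms in \<open>auto simp: compact_imp_closed\<close>)
  then show ?thesis
    using frechet_derivative_at by metis
qed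

lemma test_functions_deriv:
  assumes "\<psi> \<in> test_functions \<Omega>" "b \<in> Basis"
  shows "(\<lambda>x. frechet_derivative \<psi> (at x) b) \<in> test_functions \<Omega>"
proof -
  obtain K where "compact K" "K \<subseteq> \<Omega>" "\<And>x. x \<notin> K \<Longrightarrow> \<psi> x = 0"
    using assms(1) by (rule test_functions_support) blast
  moreover have "Ck k (\<lambda>x. frechet_derivative \<psi> (at x) b)" for k
    using test_functions_Ck[OF assms(1), of "Suc k"] assms(2) by simp
  ultimately show ?thesis
    using assms(1) by (intro test_functionsI[of _ K]) (auto intro: test_functions_deriv_zero)
qed

lemma test_functions_deriv_eq_sum:
  assumes "\<psi> \<in> test_functions \<Omega>"
  shows "frechet_derivative \<psi> (at x) e = (\<Sum>b\<in>Basis. (e \<bullet> b) * frechet_derivative \<psi> (at x) b)"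
proof -
  have l: "linear (frechet_derivative \<psi> (at x))"
    using has_derivative_linear[OF test_functions_has_derivative[OF assms]] .
  have "frechet_derivative \<psi> (at x) (\<Sum>b\<in>Basis. (e \<bullet> b) *\<^sub>R b) = (\<Sum>b\<in>Basis. (e \<bullet> b) * frechet_derivative \<psi> (at x) b)"
    by (simp add: linear_sum[OF l] linear_cmul[OF l])
  then show ?thesis by (simp add: euclidean_representation)
qed

lemma test_functions_deriv_continuous:
  "\<psi> \<in> test_functions \<Omega> \<Longrightarrow> continuous_on UNIV (\<lambda>x. frechet_derivative \<psi> (at x) e)"
  by (subst test_functions_deriv_eq_sum)
    (auto intro!: continuous_intros test_functions_continuous[OF test_functions_deriv])

lemma test_functions_bounded:
  assumes "\<psi> \<in> test_functions \<Omega>"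
  obtains B where "0 \<le> B" "\<And>x. \<bar>\<psi> x\<bar> \<le> B"
proof -
  obtain K where K: "compact K" "K \<subseteq> \<Omega>" "\<And>x. x \<notin> K \<Longrightarrow> \<psi> x = 0"
    using assms(1) by (rule test_functions_support) blast
  have "compact (\<psi> ` K)"
    using K(1) test_functions_continuous[OF assms]
    by (intro compact_continuous_image) (auto intro: continuous_on_subset)
  then obtain B where "\<forall>y\<in>\<psi> ` K. norm y \<le> B"
    using bounded_iff compact_imp_bounded by blast
  then have "\<bar>\<psi> x\<bar> \<le> max 0 B" for x
    using K(3)[of x] by (cases "x \<in> K") (auto intro: max.coboundedI2)
  then show ?thesis using that[of "max 0 B"] by auto
qed

text \<open>Each partial derivative is again a test function and hence bounded; expanding
  \<open>e\<close> in the basis makes the bound uniform over all points and directions.\<close>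

lemma test_functions_deriv_bounded:
  assumes "\<psi> \<in> test_functions \<Omega>"
  obtains B where "0 \<le> B" "\<And>x e. \<bar>frechet_derivative \<psi> (at x) e\<bar> \<le> B * norm e"
proof -
  have "\<forall>b\<in>Basis. \<exists>B. \<forall>x. \<bar>frechet_derivative \<psi> (at x) b\<bar> \<le> B"
    using test_functions_bounded[OF test_functions_deriv[OF assms]] by metis
  then obtain B where B: "\<And>b x. b \<in> Basis \<Longrightarrow> \<bar>frechet_derivative \<psi> (at x) b\<bar> \<le> B b"
    by metis
  have B0: "0 \<le> B b" if "b \<in> Basis" for b
    using B[OF that, of undefined] by linarith
  have "\<bar>frechet_derivative \<psi> (at x) e\<bar> \<le> (\<Sum>b\<in>Basis. B b) * norm e" for x e
  proof -
    have "\<bar>frechet_derivative \<psi> (at x) e\<bar> \<le> (\<Sum>b\<in>Basis. \<bar>(e \<bullet> b) * frechet_derivative \<psi> (at x) b\<bar>)"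
      unfolding test_functions_deriv_eq_sum[OF assms, of x e] by (rule sum_abs)
    also have "\<dots> \<le> (\<Sum>b\<in>Basis. norm e * B b)"
      unfolding abs_mult by (intro sum_mono mult_mono) (auto simp: Basis_le_norm B)
    finally show ?thesis by (simp add: sum_distrib_left mult.commute)
  qed
  moreover have "0 \<le> (\<Sum>b\<in>Basis. B b)" by (intro sum_nonneg B0)
  ultimately show ?thesis using that by blast
qed

lemma test_functions_lipschitz:
  assumes "\<psi> \<in> test_functions \<Omega>"
  obtains B where "0 \<le> B" "\<And>x y. \<bar>\<psi> x - \<psi> y\<bar> \<le> B * norm (x - y)"
proof -
  obtain B where B: "0 \<le> B" "\<And>x e. \<bar>frechet_derivative \<psi> (at x) e\<bar> \<le> B * norm e"
    using assms by (rule test_functions_deriv_bounded) blast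
  have "norm (\<psi> x - \<psi> y) \<le> B * norm (x - y)" for x y
  proof (rule differentiable_bound[of UNIV])
    fix z show "(\<psi> has_derivative frechet_derivative \<psi> (at z)) (at z within UNIV)"
      using test_functions_has_derivative[OF assms] by simp
    show "onorm (frechet_derivative \<psi> (at z)) \<le> B"
      using B by (intro onorm_bound) auto
  qed auto
  then show ?thesis using that B(1) by auto
qed

lemma test_functions_borel:
  "\<psi> \<in> test_functions \<Omega> \<Longrightarrow> \<psi> \<in> borel_measurable borel"
  by (intro borel_measurable_continuous_onI test_functions_continuous)

lemma test_functions_deriv_borel:
  "\<psi> \<in> test_functions \<Omega> \<Longrightarrow> (\<lambda>x. frechet_derivative \<psi> (at x) e) \<in> borel_measurable borel"
  by (intro borel_measurable_continuous_onI test_functions_deriv_continuous)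

text \<open>The bump \<open>exp (- 1 / (r\<^sup>2 - |x|\<^sup>2))\<close> of the ball of radius
  \<open>r\<close>, divided by its integral. Each \<open>r\<close> has its own normalisation instead
  of being a rescaling of the case \<open>r = 1\<close>.\<close>

definition mollifier :: "real \<Rightarrow> 'a::euclidean_space \<Rightarrow> real" where
  "mollifier r x = exp_bump 0 (r\<^sup>2 - x \<bullet> x) / (\<integral>y. exp_bump 0 (r\<^sup>2 - y \<bullet> (y::'a)) \<partial>lborel)"

lemma mollifier_Ck: "Ck k (mollifier r)"
proof -
  have q: "Ck k (\<lambda>x::'a. r\<^sup>2 + (-1) * (x \<bullet> x))" for k
    by (intro Ck_add Ck_mult Ck_const Ck_inner_self)
  have "Ck k (\<lambda>x::'a. inverse (\<integral>y. exp_bump 0 (r\<^sup>2 - y \<bullet> (y::'a)) \<partial>lborel) * exp_bump 0 (r\<^sup>2 + (-1) * (x \<bullet> x)))"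
    by (intro Ck_mult Ck_const Ck_exp_bump q)
  then show ?thesis
    by (simp add: mollifier_def[abs_def] field_simps)
qed

lemma exp_bump_sphere_zero: "\<not> norm x < r \<Longrightarrow> 0 < r \<Longrightarrow> exp_bump m (r\<^sup>2 - x \<bullet> x) = 0"
  using power_mono[of r "norm x" 2] by (auto simp: exp_bump_def power2_norm_eq_inner)

lemma mollifier_support: "0 < r \<Longrightarrow> \<not> norm x < r \<Longrightarrow> mollifier r x = 0"
  by (simp add: mollifier_def exp_bump_sphere_zero)

lemma mollifier_minus: "mollifier r (- x) = mollifier r x"
  by (simp add: mollifier_def)

text \<open>The kernel seen as a function of the integration variable is admissible in the weak
  formulation on \<open>\<Omega>\<close>; this is how weak gradients become derivatives of
  mollifications.\<close>

lemma mollifier_reflect_test_functions: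
  fixes x :: "'a::euclidean_space"
  assumes "0 < r" "cball x r \<subseteq> \<Omega>"
  shows "(\<lambda>y. mollifier r (x - y)) \<in> test_functions \<Omega>"
proof (rule test_functionsI[of _ "cball x r"])
  show "Ck k (\<lambda>y. mollifier r (x - y))" for k
    using Ck_affine[OF mollifier_Ck, of k r "-1" x] by simp
qed (use assms in \<open>auto intro!: mollifier_support simp: dist_norm\<close>)

lemma mollifier_test_functions: "0 < r \<Longrightarrow> mollifier r \<in> test_functions UNIV"
  using mollifier_reflect_test_functions[of r 0 UNIV] by (simp add: mollifier_minus[abs_def])

lemma integrable_test_functions:
  assumes "\<psi> \<in> test_functions \<Omega>"
  shows "integrable lborel \<psi>"
proof -
  obtain K where K: "compact K" "K \<subseteq> \<Omega>" "\<And>x. x \<notin> K \<Longrightarrow> \<psi> x = 0"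
    using assms(1) by (rule test_functions_support) blast
  have "integrable lborel (\<lambda>x. indicator K x *\<^sub>R \<psi> x)"
    using K(1) test_functions_continuous[OF assms]
    by (intro borel_integrable_compact) (auto intro: continuous_on_subset)
  moreover have "(\<lambda>x. indicator K x *\<^sub>R \<psi> x) = \<psi>"
    using K(3) by (auto simp: indicator_def fun_eq_iff)
  ultimately show ?thesis by simp
qed

text \<open>A vanishing integral of a nonnegative function would force it to vanish almost
  everywhere, yet it is positive on the ball of radius \<open>r\<close>, which is not a null
  set.\<close>

lemma exp_bump_integral_pos:
  assumes "0 < r"
  shows "0 < (\<integral>y. exp_bump 0 (r\<^sup>2 - y \<bullet> (y::'a::euclidean_space)) \<partial>lborel)"
    and "integrable lborel (\<lambda>y. exp_bump 0 (r\<^sup>2 - y \<bullet> (y::'a)))"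
proof -
  let ?f = "\<lambda>y::'a. exp_bump 0 (r\<^sup>2 - y \<bullet> y)"
  have q: "Ck k (\<lambda>x::'a. r\<^sup>2 + (-1) * (x \<bullet> x))" for k
    by (intro Ck_add Ck_mult Ck_const Ck_inner_self)
  have "Ck k (\<lambda>x::'a. exp_bump 0 (r\<^sup>2 + (-1) * (x \<bullet> x)))" for k
    by (intro Ck_exp_bump q)
  then have t: "?f \<in> test_functions UNIV"
    using assms by (intro test_functionsI[of _ "cball 0 r"]) (auto intro!: exp_bump_sphere_zero)
  then show i: "integrable lborel ?f" by (rule integrable_test_functions)
  have "(\<integral>y. ?f y \<partial>lborel) \<noteq> 0"
  proof
    assume "(\<integral>y. ?f y \<partial>lborel) = 0"
    then have "AE y in lborel. ?f y = 0"
      using i by (subst (asm) integral_nonneg_eq_0_iff_AE) (auto simp: exp_bump_def)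
    then have "{y. ?f y \<noteq> 0} \<in> null_sets lborel"
      using test_functions_borel[OF t] by (subst (asm) AE_iff_null) auto
    moreover have "ball 0 r \<subseteq> {y. ?f y \<noteq> 0}"
      using assms by (auto simp: exp_bump_def power2_norm_eq_inner[symmetric] abs_square_less_1 power_strict_mono)
    ultimately have "ball (0::'a) r \<in> null_sets lborel"
      using null_sets_subset by force
    then show False
      using assms open_not_negligible[of "ball (0::'a) r"]
      by (auto simp: negligible_iff_null_sets null_sets_completion_iff)
  qed
  moreover have "(\<integral>y. ?f y \<partial>lborel) \<ge> 0"
    by (intro integral_nonneg_AE) (auto simp: exp_bump_def)
  ultimately show "0 < (\<integral>y. ?f y \<partial>lborel)" by simp
qed

lemma mollifier_nonneg: "0 < r \<Longrightarrow> 0 \<le> mollifier r (x::'a::euclidean_space)"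
  using exp_bump_integral_pos(1)[of r, where 'a='a] by (simp add: mollifier_def exp_bump_def)

lemma mollifier_pos: "0 < r \<Longrightarrow> norm x < r \<Longrightarrow> 0 < mollifier r (x::'a::euclidean_space)"
  using exp_bump_integral_pos(1)[of r, where 'a='a] power_strict_mono[of "norm x" r 2]
  by (simp add: mollifier_def exp_bump_def power2_norm_eq_inner)

lemma integral_mollifier: "0 < r \<Longrightarrow> (\<integral>x. mollifier r (x::'a::euclidean_space) \<partial>lborel) = 1"
  using exp_bump_integral_pos[of r, where 'a='a] by (simp add: mollifier_def[abs_def])

lemma borel_measurable_mollifier [measurable]: "mollifier r \<in> borel_measurable borel"
  using mollifier_Ck[of 0 r] by (intro borel_measurable_continuous_onI) simp

lemma nn_integral_mollifier: "0 < r \<Longrightarrow> (\<integral>\<^sup>+x. ennreal (mollifier r (x::'a::euclidean_space)) \<partial>lborel) = 1"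
  using integrable_test_functions[OF mollifier_test_functions] integral_mollifier[of r, where 'a='a]
  by (subst nn_integral_eq_integral) (auto simp: mollifier_nonneg)

section \<open>Translation and mollification in \<open>L\<^sup>p\<close>\<close>

lemma nn_integral_lborel_translate:
  fixes f :: "'a::euclidean_space \<Rightarrow> ennreal"
  assumes [measurable]: "f \<in> borel_measurable borel"
  shows "(\<integral>\<^sup>+x. f (x + h) \<partial>lborel) = (\<integral>\<^sup>+x. f x \<partial>lborel)"
proof -
  have "(\<integral>\<^sup>+x. f x \<partial>lborel) = (\<integral>\<^sup>+x. f x \<partial>distr lborel borel ((+) h))"
    by (simp add: lborel_distr_plus)
  also have "\<dots> = (\<integral>\<^sup>+x. f (h + x) \<partial>lborel)"
    by (subst nn_integral_distr) auto
  finally show ?thesis by (simp add: add.commute)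
qed

lemma integral_lborel_translate:
  fixes f :: "'a::euclidean_space \<Rightarrow> 'b::{banach, second_countable_topology}"
  assumes [measurable]: "f \<in> borel_measurable borel"
  shows "(\<integral>x. f (x + h) \<partial>lborel) = (\<integral>x. f x \<partial>lborel)"
proof -
  have "(\<integral>x. f x \<partial>lborel) = (\<integral>x. f x \<partial>distr lborel borel ((+) h))"
    by (simp add: lborel_distr_plus)
  also have "\<dots> = (\<integral>x. f (h + x) \<partial>lborel)"
    by (subst integral_distr) auto
  finally show ?thesis by (simp add: add.commute)
qed

lemma integrable_lborel_translate:
  fixes f :: "'a::euclidean_space \<Rightarrow> 'b::{banach, second_countable_topology}"
  assumes "integrable lborel f"
  shows "integrable lborel (\<lambda>x. f (x + h))"
proof -
  have [measurable]: "f \<in> borel_measurable borel"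
    using borel_measurable_integrable[OF assms] by simp
  have "integrable (distr lborel borel ((+) h)) f"
    using assms by (simp add: lborel_distr_plus)
  then show ?thesis
    by (subst (asm) integrable_distr_eq) (auto simp: add.commute)
qed

lemma AE_lborel_translate:
  fixes P :: "'a::euclidean_space \<Rightarrow> bool"
  assumes "AE x in lborel. P x"
  shows "AE x in lborel. P (x + h)"
proof -
  have "AE x in distr lborel borel ((+) h). P x"
    unfolding lborel_distr_plus by (rule assms)
  then have "AE x in lborel. P (h + x)"
    by (intro AE_distrD[of "(+) h" lborel borel]) auto
  then show ?thesis by (simp add: add.commute)
qed

text \<open>The \<open>p\<close>-th power of the norm, with values in \<open>ennreal\<close> so that
  no integrability has to be carried along. The triangle inequality survives up to the factor
  \<open>2 powr p\<close>, which is enough for all limit arguments.\<close>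

definition Lp_pow :: "real \<Rightarrow> ('a::euclidean_space \<Rightarrow> 'b::euclidean_space) \<Rightarrow> ennreal" where
  "Lp_pow p f = (\<integral>\<^sup>+x. ennreal (norm (f x) powr p) \<partial>lborel)"

lemma Lp_pow_translate:
  assumes [measurable]: "f \<in> borel_measurable borel"
  shows "Lp_pow p (\<lambda>x. f (x + h)) = Lp_pow p f"
  unfolding Lp_pow_def by (rule nn_integral_lborel_translate) simp

lemma Lp_pow_mono_AE:
  assumes "AE x in lborel. norm (f x) \<le> norm (g x)" "0 \<le> p"
  shows "Lp_pow p f \<le> Lp_pow p g"
  unfolding Lp_pow_def using assms(1)
  by (intro nn_integral_mono_AE, eventually_elim) (auto intro: powr_mono2 assms(2))

lemma powr_norm_add_le:
  fixes a b :: "'a::real_normed_vector"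
  assumes "0 \<le> p"
  shows "norm (a + b) powr p \<le> 2 powr p * (norm a powr p + norm b powr p)"
proof -
  have "norm (a + b) powr p \<le> (2 * max (norm a) (norm b)) powr p"
    using norm_triangle_ineq[of a b] by (intro powr_mono2 assms) auto
  also have "\<dots> = 2 powr p * max (norm a) (norm b) powr p"
    by (simp add: powr_mult)
  also have "max (norm a) (norm b) powr p \<le> norm a powr p + norm b powr p"
    by (auto simp: max_def)
  finally show ?thesis by simp
qed

lemma Lp_pow_add:
  assumes [measurable]: "f \<in> borel_measurable borel" "g \<in> borel_measurable borel" and "0 \<le> p"
  shows "Lp_pow p (\<lambda>x. f x + g x) \<le> ennreal (2 powr p) * (Lp_pow p f + Lp_pow p g)"
proof -
  have "Lp_pow p (\<lambda>x. f x + g x) \<le>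
      (\<integral>\<^sup>+x. ennreal (2 powr p) * (ennreal (norm (f x) powr p) + ennreal (norm (g x) powr p)) \<partial>lborel)"
    unfolding Lp_pow_def
    by (intro nn_integral_mono)
      (simp add: ennreal_plus[symmetric] ennreal_mult[symmetric] powr_norm_add_le assms del: ennreal_plus)
  also have "\<dots> = ennreal (2 powr p) * (Lp_pow p f + Lp_pow p g)"
    unfolding Lp_pow_def by (simp add: nn_integral_cmult nn_integral_add)
  finally show ?thesis .
qed

lemma Lp_pow_uminus: "Lp_pow p (\<lambda>x. - f x) = Lp_pow p f"
  by (simp add: Lp_pow_def)

lemma Lp_pow_minus_commute: "Lp_pow p (\<lambda>x. f x - g x) = Lp_pow p (\<lambda>x. g x - f x)"
  by (simp add: Lp_pow_def norm_minus_commute)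

lemma Lp_pow_diff:
  assumes "f \<in> borel_measurable borel" "g \<in> borel_measurable borel" and "0 \<le> p"
  shows "Lp_pow p (\<lambda>x. f x - g x) \<le> ennreal (2 powr p) * (Lp_pow p f + Lp_pow p g)"
  using Lp_pow_add[of f "\<lambda>x. - g x" p] assms by (simp add: Lp_pow_uminus)

lemma Lp_pow_finite_integrable:
  assumes "f \<in> borel_measurable borel" "Lp_pow p f < \<infinity>"
  shows "integrable lborel (\<lambda>x. norm (f x) powr p)"
  using assms by (intro integrableI_bounded) (auto simp: Lp_pow_def)

lemma Lp_pow_one: "Lp_pow 1 f = (\<integral>\<^sup>+x. ennreal (norm (f x)) \<partial>lborel)"
  by (simp add: Lp_pow_def)

lemma Lp_pow_dominated:
  fixes f :: "'a::euclidean_space \<Rightarrow> 'b::euclidean_space"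
  assumes [measurable]: "\<And>n. s n \<in> borel_measurable borel" "f \<in> borel_measurable borel" "w \<in> borel_measurable borel"
    and lim: "AE x in lborel. (\<lambda>n. s n x) \<longlonglongrightarrow> f x"
    and bd: "\<And>n. AE x in lborel. norm (s n x - f x) \<le> norm (w x :: 'c::euclidean_space)"
    and fin: "Lp_pow p w < \<infinity>" and p: "0 < p"
  shows "(\<lambda>n. Lp_pow p (\<lambda>x. s n x - f x)) \<longlonglongrightarrow> 0"
proof -
  have "(\<lambda>n. \<integral>\<^sup>+x. ennreal (norm (s n x - f x) powr p) \<partial>lborel) \<longlonglongrightarrow> (\<integral>\<^sup>+x. 0 \<partial>(lborel :: 'a measure))"
  proof (rule nn_integral_dominated_convergence[where w="\<lambda>x. ennreal (norm (w x) powr p)"])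
    show "AE x in lborel. (\<lambda>n. ennreal (norm (s n x - f x) powr p)) \<longlonglongrightarrow> 0"
      using lim
    proof eventually_elim
      case (elim x)
      then have "(\<lambda>n. norm (s n x - f x)) \<longlonglongrightarrow> 0"
        by (simp add: LIM_zero tendsto_norm_zero)
      then have "(\<lambda>n. norm (s n x - f x) powr p) \<longlonglongrightarrow> 0 powr p"
        using p by (intro tendsto_powr2) auto
      then show ?case
        using p tendsto_ennrealI by force
    qed
    show "AE x in lborel. ennreal (norm (s n x - f x) powr p) \<le> ennreal (norm (w x) powr p)" for n
      using bd[of n] by eventually_elim (use p in \<open>auto intro: powr_mono2\<close>)
    show "(\<integral>\<^sup>+x. ennreal (norm (w x) powr p) \<partial>lborel) < \<infinity>"
      using fin by (simp add: Lp_pow_def)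
  qed auto
  then show ?thesis by (simp add: Lp_pow_def)
qed

definition Lp_translation_continuous :: "real \<Rightarrow> ('a::euclidean_space \<Rightarrow> 'b::euclidean_space) \<Rightarrow> bool" where
  "Lp_translation_continuous p f \<longleftrightarrow>
    (\<forall>\<epsilon>>0. \<exists>d>0. \<forall>h. norm h < d \<longrightarrow> Lp_pow p (\<lambda>x. f (x + h) - f x) \<le> ennreal \<epsilon>)"

text \<open>Squeeze \<open>A\<close> between a compact \<open>K\<close> and an open \<open>U\<close>
  of nearly the same measure. A shift shorter than the distance from \<open>K\<close> to the
  complement of \<open>U\<close> keeps \<open>K\<close> inside \<open>U\<close>, so only the thin
  sets \<open>A - K\<close> and \<open>U - A\<close> are affected.\<close>

lemma Lp_translation_continuous_indicator:
  fixes A :: "'a::euclidean_space set" and c :: "'b::euclidean_space"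
  assumes A[measurable]: "A \<in> sets borel" and fin: "emeasure lborel A < \<infinity>" and p: "0 < p"
  shows "Lp_translation_continuous p (\<lambda>x. indicator A x *\<^sub>R c)"
  unfolding Lp_translation_continuous_def
proof (intro allI impI)
  fix \<epsilon> :: real assume "0 < \<epsilon>"
  \<comment> \<open>The 4 counts two thin sets, each at the points \<open>x\<close> and
    \<open>x + h\<close>; adding 1 keeps the denominator positive when \<open>c = 0\<close>.\<close>
  define e where "e = \<epsilon> / (4 * (norm c powr p + 1))"
  have e: "0 < e" using \<open>0 < \<epsilon>\<close> by (auto simp: e_def add_nonneg_pos)
  obtain U where U: "open U" "A \<subseteq> U" "emeasure lborel (U - A) < e"
    using outer_regular_lborel[OF A e] by blast
  obtain K where K: "compact K" "K \<subseteq> A" "emeasure lborel (A - K) < e"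
  proof -
    \<comment> \<open>Restricting the measure to \<open>A\<close> makes it finite, as inner
      regularity requires.\<close>
    let ?M = "density lborel (indicator A)"
    have "emeasure ?M A = (SUP K \<in> {K. K \<subseteq> A \<and> compact K}. emeasure ?M K)"
      using fin by (intro inner_regular) (auto simp: emeasure_density)
    moreover have "emeasure ?M K = emeasure lborel K" if "K \<subseteq> A" "compact K" for K
      using that borel_compact[of K]
      by (auto simp: emeasure_density indicator_inter_arith[symmetric] Int_absorb1)
    moreover have "emeasure ?M A = emeasure lborel A"
      by (simp add: emeasure_density indicator_inter_arith[symmetric])
    ultimately have *: "emeasure lborel A = (SUP K \<in> {K. K \<subseteq> A \<and> compact K}. emeasure lborel K)"
      by (metis (mono_tags, lifting) SUP_cong mem_Collect_eq)
    have "\<exists>K\<in>{K. K \<subseteq> A \<and> compact K}. emeasure lborel A < emeasure lborel K + e"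
      by (rule SUP_approx_ennreal[OF e _ *]) (use fin in auto)
    then obtain K where K: "K \<subseteq> A" "compact K" "emeasure lborel A < emeasure lborel K + e"
      by auto
    have "emeasure lborel A = emeasure lborel K + emeasure lborel (A - K)"
      using K borel_compact[of K] by (subst plus_emeasure) (auto intro!: arg_cong[where f="emeasure lborel"])
    then have "emeasure lborel (A - K) < e"
      using K emeasure_compact_finite[OF K(2)] by (auto simp: ennreal_add_left_cancel_less)
    then show ?thesis using K that by blast
  qed
  have [measurable]: "U \<in> sets borel" "K \<in> sets borel"
    using U K by (auto intro: borel_compact)
  obtain d where d: "0 < d" "\<And>x y. x \<in> K \<Longrightarrow> y \<in> - U \<Longrightarrow> d \<le> dist x y"
  proof -
    have "K \<inter> - U = {}" using K U by auto
    then show ?thesis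
      using separate_compact_closed[of K "- U"] K(1) U(1) that by (auto simp: closed_def)
  qed
  show "\<exists>d>0. \<forall>h. norm h < d \<longrightarrow>
      Lp_pow p (\<lambda>x. indicator A (x + h) *\<^sub>R c - indicator A x *\<^sub>R c) \<le> ennreal \<epsilon>"
  proof (intro exI[of _ d] conjI allI impI d(1))
    fix h :: 'a assume h: "norm h < d"
    have 1: "x + h \<in> U" if "x \<in> K" for x
      using d(2)[OF that, of "x + h"] h by (auto simp: dist_norm)
    have 2: "x \<in> U" if "x + h \<in> K" for x
      using d(2)[OF that, of "x"] h by (auto simp: dist_norm)
    \<comment> \<open>If exactly one of \<open>x\<close> and \<open>x + h\<close> lies in
      \<open>A\<close>, then either that point is in \<open>A - K\<close>, or it is in
      \<open>K\<close> and the other one is in \<open>U - A\<close>.\<close>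
    let ?g = "\<lambda>x. indicator (A - K) x + indicator (U - A) x :: ennreal"
    have "Lp_pow p (\<lambda>x. indicator A (x + h) *\<^sub>R c - indicator A x *\<^sub>R c)
        \<le> (\<integral>\<^sup>+x. ennreal (norm c powr p) * (?g x + ?g (x + h)) \<partial>lborel)"
      unfolding Lp_pow_def
    proof (rule nn_integral_mono)
      fix x
      show "ennreal (norm (indicator A (x + h) *\<^sub>R c - indicator A x *\<^sub>R c) powr p)
        \<le> ennreal (norm c powr p) * (?g x + ?g (x + h))"
        using 1[of x] 2[of x] K(2) U(2) p
        by (cases "x \<in> A"; cases "x + h \<in> A"; cases "x \<in> K"; cases "x + h \<in> K")
          (auto simp: indicator_def distrib_left)
    qed
    also have "\<dots> = ennreal (norm c powr p) * (2 * (emeasure lborel (A - K) + emeasure lborel (U - A)))"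
    proof -
      have "(\<integral>\<^sup>+x. (?g x + ?g (x + h)) \<partial>lborel) = (\<integral>\<^sup>+x. ?g x \<partial>lborel) + (\<integral>\<^sup>+x. ?g (x + h) \<partial>lborel)"
        by (rule nn_integral_add) auto
      also have "(\<integral>\<^sup>+x. ?g (x + h) \<partial>lborel) = (\<integral>\<^sup>+x. ?g x \<partial>lborel)"
        by (rule nn_integral_lborel_translate) simp
      also have "(\<integral>\<^sup>+x. ?g x \<partial>lborel) = emeasure lborel (A - K) + emeasure lborel (U - A)"
        by (subst nn_integral_add) auto
      finally show ?thesis by (subst nn_integral_cmult) (auto simp: mult_2 ac_simps)
    qed
    also have "\<dots> \<le> ennreal (norm c powr p) * (2 * (ennreal e + ennreal e))"
      using K U by (intro mult_left_mono add_mono) auto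
    also have "\<dots> = ennreal (norm c powr p * (4 * e))"
    proof -
      have "2 * (ennreal e + ennreal e) = ennreal (4 * e)"
        using e by (simp add: ennreal_plus[symmetric] ennreal_numeral[symmetric] ennreal_mult[symmetric]
            del: ennreal_plus ennreal_numeral)
      then show ?thesis using e by (simp add: ennreal_mult)
    qed
    also have "\<dots> \<le> ennreal \<epsilon>"
    proof (rule ennreal_leI)
      have "norm c powr p + 1 > 0" by (simp add: add_nonneg_pos)
      then have "(4 * (norm c powr p + 1)) * e = \<epsilon>" by (simp add: e_def)
      then show "norm c powr p * (4 * e) \<le> \<epsilon>" using e by (simp add: algebra_simps)
    qed
    finally show "Lp_pow p (\<lambda>x. indicator A (x + h) *\<^sub>R c - indicator A x *\<^sub>R c) \<le> ennreal \<epsilon>" .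
  qed
qed

lemma Lp_translation_continuous_add:
  assumes [measurable]: "f \<in> borel_measurable borel" "g \<in> borel_measurable borel"
    and f: "Lp_translation_continuous p f" and g: "Lp_translation_continuous p g" and p: "0 \<le> p"
  shows "Lp_translation_continuous p (\<lambda>x. f x + g x)"
  unfolding Lp_translation_continuous_def
proof (intro allI impI)
  fix \<epsilon> :: real assume \<epsilon>: "0 < \<epsilon>"
  define e where "e = \<epsilon> / (2 * 2 powr p)"
  have e: "0 < e" using \<epsilon> by (simp add: e_def)
  obtain d1 where d1: "d1 > 0" "\<And>h. norm h < d1 \<Longrightarrow> Lp_pow p (\<lambda>x. f (x + h) - f x) \<le> ennreal e"
    using f e unfolding Lp_translation_continuous_def by blast
  obtain d2 where d2: "d2 > 0" "\<And>h. norm h < d2 \<Longrightarrow> Lp_pow p (\<lambda>x. g (x + h) - g x) \<le> ennreal e"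
    using g e unfolding Lp_translation_continuous_def by blast
  show "\<exists>d>0. \<forall>h. norm h < d \<longrightarrow> Lp_pow p (\<lambda>x. f (x + h) + g (x + h) - (f x + g x)) \<le> ennreal \<epsilon>"
  proof (intro exI[of _ "min d1 d2"] conjI allI impI)
    fix h :: 'a assume h: "norm h < min d1 d2"
    have "Lp_pow p (\<lambda>x. f (x + h) + g (x + h) - (f x + g x)) = Lp_pow p (\<lambda>x. (f (x + h) - f x) + (g (x + h) - g x))"
      by (simp add: algebra_simps)
    also have "\<dots> \<le> ennreal (2 powr p) * (Lp_pow p (\<lambda>x. f (x + h) - f x) + Lp_pow p (\<lambda>x. g (x + h) - g x))"
      by (intro Lp_pow_add) (auto simp: p)
    also have "\<dots> \<le> ennreal (2 powr p) * (ennreal e + ennreal e)"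
      using h by (intro mult_left_mono add_mono d1 d2) auto
    also have "\<dots> = ennreal \<epsilon>"
      using e by (simp add: ennreal_plus[symmetric] ennreal_mult[symmetric] del: ennreal_plus) (simp add: e_def)
    finally show "Lp_pow p (\<lambda>x. f (x + h) + g (x + h) - (f x + g x)) \<le> ennreal \<epsilon>" .
  qed (use d1 d2 in auto)
qed

lemma Lp_translation_continuous_sum:
  assumes "\<And>i. i \<in> I \<Longrightarrow> f i \<in> borel_measurable borel" "finite I"
    and "\<And>i. i \<in> I \<Longrightarrow> Lp_translation_continuous p (f i)" and p: "0 < p"
  shows "Lp_translation_continuous p (\<lambda>x. \<Sum>i\<in>I. f i x)"
  using assms(2,1,3)
proof (induction I rule: finite_induct)
  case empty
  then show ?case using p by (auto simp: Lp_translation_continuous_def Lp_pow_def intro!: exI[of _ 1])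
next
  case (insert i I)
  then show ?case using p
    by (simp add: Lp_translation_continuous_add)
qed

text \<open>The usual three-term splitting; translation invariance makes the error at
  \<open>x + h\<close> equal to the error at \<open>x\<close>.\<close>

lemma Lp_translation_continuous_lim:
  assumes [measurable]: "f \<in> borel_measurable borel" "\<And>n. s n \<in> borel_measurable borel"
    and s: "\<And>n. Lp_translation_continuous p (s n)"
    and lim: "(\<lambda>n. Lp_pow p (\<lambda>x. s n x - f x)) \<longlonglongrightarrow> 0" and p: "0 \<le> p"
  shows "Lp_translation_continuous p f"
  unfolding Lp_translation_continuous_def
proof (intro allI impI)
  fix \<epsilon> :: real assume \<epsilon>: "0 < \<epsilon>"
  define c where "c = 2 powr p"
  have c: "c > 0" by (simp add: c_def)
  \<comment> \<open>The quasi-triangle inequality is applied twice, so two errors carry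
    \<open>c * c\<close> and one carries \<open>c\<close>.\<close>
  define e where "e = \<epsilon> / (c * (c * 2 + 1))"
  have e: "0 < e" using \<epsilon> c by (auto simp: e_def)
  have "eventually (\<lambda>n. Lp_pow p (\<lambda>x. s n x - f x) < ennreal e) sequentially"
    using lim e by (auto simp: order_tendsto_iff)
  then obtain n where n: "Lp_pow p (\<lambda>x. s n x - f x) < ennreal e"
    by (auto simp: eventually_sequentially)
  obtain d where d: "d > 0" "\<And>h. norm h < d \<Longrightarrow> Lp_pow p (\<lambda>x. s n (x + h) - s n x) \<le> ennreal e"
    using s[of n] e unfolding Lp_translation_continuous_def by blast
  show "\<exists>d>0. \<forall>h. norm h < d \<longrightarrow> Lp_pow p (\<lambda>x. f (x + h) - f x) \<le> ennreal \<epsilon>"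
  proof (intro exI[of _ d] conjI allI impI d(1))
    fix h :: 'a assume h: "norm h < d"
    have *: "Lp_pow p (\<lambda>x. s n (x + h) - f (x + h)) = Lp_pow p (\<lambda>x. s n x - f x)"
      by (rule Lp_pow_translate) simp
    have "Lp_pow p (\<lambda>x. f (x + h) - f x) =
       Lp_pow p (\<lambda>x. ((s n x - f x) - (s n (x + h) - f (x + h))) + (s n (x + h) - s n x))"
      by (simp add: algebra_simps)
    also have "\<dots> \<le> ennreal c * (Lp_pow p (\<lambda>x. (s n x - f x) - (s n (x + h) - f (x + h)))
        + Lp_pow p (\<lambda>x. s n (x + h) - s n x))"
      unfolding c_def by (intro Lp_pow_add) (auto simp: p)
    also have "\<dots> \<le> ennreal c * (ennreal c * (Lp_pow p (\<lambda>x. s n x - f x) + Lp_pow p (\<lambda>x. s n (x + h) - f (x + h)))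
       + ennreal e)"
      unfolding c_def by (intro mult_left_mono add_mono Lp_pow_diff d(2)[OF h]) (auto simp: p)
    also have "\<dots> \<le> ennreal c * (ennreal c * (ennreal e + ennreal e) + ennreal e)"
      unfolding * using n by (intro mult_left_mono add_mono) auto
    also have "\<dots> = ennreal (c * (c * (e + e) + e))"
      using e c by (simp add: ennreal_plus[symmetric] ennreal_mult[symmetric] del: ennreal_plus)
    also have "c * (c * (e + e) + e) = e * (c * (c * 2 + 1))"
      by (simp add: algebra_simps)
    also have "\<dots> = \<epsilon>"
      using c unfolding e_def by (intro nonzero_divide_eq_eq[THEN iffD1, symmetric] nonzero_mult_div_cancel_right) (simp_all add: add_pos_pos less_imp_neq[symmetric])
    finally show "Lp_pow p (\<lambda>x. f (x + h) - f x) \<le> ennreal \<epsilon>" .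
  qed
qed

text \<open>The level set of 0 may have infinite measure but contributes nothing; every other level
  set has finite measure by Chebyshev's inequality.\<close>

lemma Lp_translation_continuous_simple:
  fixes s :: "'a::euclidean_space \<Rightarrow> 'b::euclidean_space"
  assumes s: "simple_function lborel s" and fin: "Lp_pow p s < \<infinity>" and p: "0 < p"
  shows "Lp_translation_continuous p s"
proof -
  let ?A = "\<lambda>y. s -` {y}"
  have S: "?A y \<in> sets borel" for y
    using simple_functionD(2)[OF s, of "{y}"] by simp
  have f: "finite (range s)"
    using simple_functionD(1)[OF s] by simp
  have "s = (\<lambda>x. \<Sum>y\<in>range s. indicator (?A y) x *\<^sub>R y)"
  proof
    fix x
    have "(\<Sum>y\<in>range s. indicator (?A y) x *\<^sub>R y) = (\<Sum>y\<in>range s. if y = s x then y else 0)"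
      by (intro sum.cong) (auto simp: indicator_def)
    then show "s x = (\<Sum>y\<in>range s. indicator (?A y) x *\<^sub>R y)"
      using f by (simp add: sum.delta)
  qed
  moreover have *: "Lp_translation_continuous p (\<lambda>x. indicator (?A y) x *\<^sub>R y)" for y
  proof (cases "y = 0")
    case True
    then show ?thesis using p by (auto simp: Lp_translation_continuous_def Lp_pow_def intro!: exI[of _ 1])
  next
    case False
    have "ennreal (norm y powr p) * emeasure lborel (?A y) = (\<integral>\<^sup>+x. ennreal (norm y powr p) * indicator (?A y) x \<partial>lborel)"
      using S by (subst nn_integral_cmult_indicator) auto
    also have "\<dots> \<le> Lp_pow p s"
      unfolding Lp_pow_def by (intro nn_integral_mono) (auto simp: indicator_def)
    also have "\<dots> < \<infinity>" by (rule fin)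
    finally have "emeasure lborel (?A y) < \<infinity>"
      using False by (auto simp: ennreal_mult_less_top)
    then show ?thesis using S p by (intro Lp_translation_continuous_indicator)
  qed
  from * have "Lp_translation_continuous p (\<lambda>x. \<Sum>y\<in>range s. indicator (?A y) x *\<^sub>R y)"
    using f S p by (intro Lp_translation_continuous_sum) auto
  ultimately show ?thesis by simp
qed

theorem Lp_translation_continuous:
  fixes f :: "'a::euclidean_space \<Rightarrow> 'b::euclidean_space"
  assumes f[measurable]: "f \<in> borel_measurable borel" and fin: "Lp_pow p f < \<infinity>" and p: "0 < p"
  shows "Lp_translation_continuous p f"
proof -
  have "f \<in> borel_measurable lborel" by simp
  from borel_measurable_implies_sequence_metric[OF this, of 0] obtain s where
    s: "simple_function lborel (s i)" and
    lim: "(\<lambda>i. s i x) \<longlonglongrightarrow> f x" and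
    bound: "norm (s i x) \<le> 2 * norm (f x)" for i x
    by auto
  have [measurable]: "s i \<in> borel_measurable borel" for i
    using borel_measurable_simple_function[OF s[of i]] by simp
  \<comment> \<open>The approximating simple functions satisfy
    \<open>norm (s i x) \<le> 2 * norm (f x)\<close>, so \<open>3 *\<^sub>R f\<close> dominates them
    and their distance to \<open>f\<close>.\<close>
  have 3: "Lp_pow p (\<lambda>x. 3 *\<^sub>R f x) < \<infinity>"
    using fin by (simp add: Lp_pow_def powr_mult ennreal_mult nn_integral_cmult ennreal_mult_less_top)
  have "Lp_pow p (s i) < \<infinity>" for i
  proof -
    have "norm (s i x) \<le> 3 * norm (f x)" for x using bound[of i x] norm_ge_zero[of "f x"] by linarith
    then have "Lp_pow p (s i) \<le> Lp_pow p (\<lambda>x. 3 *\<^sub>R f x)"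
      using p by (intro Lp_pow_mono_AE) auto
    then show ?thesis using 3 by (rule le_less_trans)
  qed
  then have "Lp_translation_continuous p (s i)" for i
    using s p by (intro Lp_translation_continuous_simple)
  moreover have "(\<lambda>n. Lp_pow p (\<lambda>x. s n x - f x)) \<longlonglongrightarrow> 0"
  proof (rule Lp_pow_dominated[OF _ _ _ _ _ 3 p])
    have "norm (s n x - f x) \<le> norm (3 *\<^sub>R f x)" for n x
      using bound[of n x] norm_triangle_ineq4[of "s n x" "f x"] by simp
    then show "AE x in lborel. norm (s n x - f x) \<le> norm (3 *\<^sub>R f x)" for n
      by simp
  qed (use lim in auto)
  ultimately show ?thesis
    using p by (intro Lp_translation_continuous_lim[of f s]) auto
qed


section \<open>Jensen's inequality and convergence of mollifications\<close>

lemma powr_tangent_le: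
  fixes a c p :: real
  assumes "0 \<le> a" "0 \<le> c" "1 \<le> p"
  shows "c powr p + p * c powr (p - 1) * (a - c) \<le> a powr p"
proof -
  consider "c = 0" | "c > 0" "a = 0" | "c > 0" "a > 0" using assms by linarith
  then show ?thesis
  proof cases
    case 1
    then show ?thesis by simp
  next
    case 2
    have "c powr p = c powr (p - 1) * c"
      using 2 by (simp add: powr_mult_base[symmetric] powr_diff)
    then have "c powr p + p * c powr (p - 1) * (a - c) = (1 - p) * c powr p"
      using 2 by (simp add: algebra_simps)
    also have "\<dots> \<le> 0" using assms by (intro mult_nonpos_nonneg) auto
    finally show ?thesis using 2 by simp
  next
    case 3
    have "((\<lambda>x. x powr p) has_real_derivative p * c powr (p - 1)) (at c within {0<..})"
      using 3 by (auto intro!: derivative_eq_intros)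
    then have "a powr p - c powr p \<ge> p * c powr (p - 1) * (a - c)"
      using 3 by (intro convex_on_imp_above_tangent[OF powr_convex[OF assms(3)]])
        (auto simp: interior_open)
    then show ?thesis by simp
  qed
qed

text \<open>Jensen's inequality for the probability density \<open>q\<close>: integrate the tangent
  of \<open>t powr p\<close> at the mean \<open>c\<close>, whose linear term has integral
  zero.\<close>

lemma powr_integral_le:
  fixes q a :: "'a \<Rightarrow> real"
  assumes q: "integrable M q" "\<And>x. 0 \<le> q x" "(\<integral>x. q x \<partial>M) = 1"
    and a: "integrable M (\<lambda>x. q x * a x)" "\<And>x. 0 \<le> a x" "a \<in> borel_measurable M" and p: "1 \<le> p"
  shows "ennreal ((\<integral>x. q x * a x \<partial>M) powr p) \<le> (\<integral>\<^sup>+x. ennreal (q x * a x powr p) \<partial>M)"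
proof (cases "(\<integral>\<^sup>+x. ennreal (q x * a x powr p) \<partial>M) = \<infinity>")
  case False
  have [measurable]: "q \<in> borel_measurable M" "a \<in> borel_measurable M" using q a by auto
  define c where "c = (\<integral>x. q x * a x \<partial>M)"
  have c: "0 \<le> c" unfolding c_def by (intro integral_nonneg_AE) (auto simp: q a)
  have i: "integrable M (\<lambda>x. q x * a x powr p)"
    using False by (intro integrableI_nonneg) (auto simp: q less_top)
  have "c powr p = (\<integral>x. q x * c powr p + p * c powr (p - 1) * (q x * a x - c * q x) \<partial>M)"
    using q a by (simp add: c_def)
  also have "\<dots> \<le> (\<integral>x. q x * a x powr p \<partial>M)"
  proof (rule integral_mono[OF _ i])
    show "integrable M (\<lambda>x. q x * c powr p + p * c powr (p - 1) * (q x * a x - c * q x))"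
      using q a by simp
    fix x
    have "q x * (c powr p + p * c powr (p - 1) * (a x - c)) \<le> q x * a x powr p"
      by (intro mult_left_mono powr_tangent_le q a c p)
    then show "q x * c powr p + p * c powr (p - 1) * (q x * a x - c * q x) \<le> q x * a x powr p"
      by (simp add: algebra_simps)
  qed
  finally have "ennreal (c powr p) \<le> ennreal (\<integral>x. q x * a x powr p \<partial>M)"
    by (rule ennreal_leI)
  also have "\<dots> = (\<integral>\<^sup>+x. ennreal (q x * a x powr p) \<partial>M)"
    by (rule nn_integral_eq_integral[OF i, symmetric]) (auto simp: q)
  finally show ?thesis by (simp add: c_def)
qed simp

text \<open>Vector-valued, so that a function and its weak gradient field are smoothed by the same
  operator.\<close>

definition mollify :: "real \<Rightarrow> ('a::euclidean_space \<Rightarrow> 'b::euclidean_space) \<Rightarrow> 'a \<Rightarrow> 'b" where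
  "mollify r v x = (\<integral>y. mollifier r (x - y) *\<^sub>R v y \<partial>lborel)"

lemma borel_measurable_mollify [measurable]:
  assumes [measurable]: "v \<in> borel_measurable borel"
  shows "mollify r v \<in> borel_measurable borel"
proof -
  have "(\<lambda>x. \<integral>y. mollifier r (x - y) *\<^sub>R v y \<partial>lborel) \<in> borel_measurable lborel"
    by (rule lborel.borel_measurable_lebesgue_integral) simp
  then show ?thesis by (simp add: mollify_def[abs_def])
qed

lemma le_one_plus_powr: "0 \<le> (t::real) \<Longrightarrow> 1 \<le> p \<Longrightarrow> t \<le> 1 + t powr p"
  using powr_mono[of 1 p t] by (cases "t \<le> 1") (auto intro: order_trans[of t 1])

text \<open>The bound \<open>t \<le> 1 + t powr p\<close> takes the place of Hoelder's inequality,
  so no conjugate exponent is needed.\<close>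

lemma integrable_kernel_mult_Lp:
  fixes v :: "'a::euclidean_space \<Rightarrow> 'b::euclidean_space"
  assumes v[measurable]: "v \<in> borel_measurable borel" and fin: "Lp_pow p v < \<infinity>" and p: "1 \<le> p"
    and k: "k \<in> borel_measurable borel" "integrable lborel k" "\<And>y. \<bar>k y\<bar> \<le> B"
  shows "integrable lborel (\<lambda>y. k y *\<^sub>R v y)"
proof (rule Bochner_Integration.integrable_bound)
  show "integrable lborel (\<lambda>y. \<bar>k y\<bar> + B * norm (v y) powr p)"
    using k Lp_pow_finite_integrable[OF v fin] by simp
  have "norm (k y *\<^sub>R v y) \<le> norm (\<bar>k y\<bar> + B * norm (v y) powr p)" for y
  proof -
    have "\<bar>k y\<bar> * norm (v y) \<le> \<bar>k y\<bar> * (1 + norm (v y) powr p)"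
      using p by (intro mult_left_mono le_one_plus_powr) auto
    also have "\<dots> \<le> \<bar>k y\<bar> + B * norm (v y) powr p"
      using mult_right_mono[OF k(3)[of y], of "norm (v y) powr p"] by (simp add: distrib_left)
    finally show ?thesis by simp
  qed
  then show "AE y in lborel. norm (k y *\<^sub>R v y) \<le> norm (\<bar>k y\<bar> + B * norm (v y) powr p)"
    by simp
qed (use k in simp)

lemma mollifier_bounded:
  assumes "0 < r"
  obtains B where "\<And>x::'a::euclidean_space. \<bar>mollifier r x\<bar> \<le> B"
  using test_functions_bounded[OF mollifier_test_functions[OF assms]] by blast

lemma integrable_mollifier_translate: "0 < r \<Longrightarrow> integrable lborel (\<lambda>y. mollifier r (x - y))"
  by (rule integrable_test_functions[OF mollifier_reflect_test_functions[where \<Omega>=UNIV]]) auto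

lemma integral_mollifier_translate:
  assumes "0 < r" shows "(\<integral>y. mollifier r (x - (y::'a::euclidean_space)) \<partial>lborel) = 1"
proof -
  have "(\<integral>y. mollifier r (x - y) \<partial>lborel) = (\<integral>y. mollifier r (y + - x) \<partial>lborel)"
    using mollifier_minus[of r "y - x" for y :: 'a] by simp
  also have "\<dots> = 1"
    by (subst integral_lborel_translate) (auto simp: integral_mollifier assms)
  finally show ?thesis .
qed

text \<open>The error at \<open>x\<close> is a weighted mean of \<open>v y - v x\<close> with weight
  of total mass one. Jensen's inequality and Fubini bound its \<open>p\<close>-th power by a mean
  over shifts \<open>h\<close> in the support of the kernel.\<close>

lemma Lp_pow_mollify_diff_le:
  fixes v :: "'a::euclidean_space \<Rightarrow> 'b::euclidean_space"
  assumes v[measurable]: "v \<in> borel_measurable borel" and fin: "Lp_pow p v < \<infinity>" and p: "1 \<le> p"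
    and r: "0 < r" and h: "\<And>h. norm h < r \<Longrightarrow> Lp_pow p (\<lambda>x. v (x + h) - v x) \<le> \<epsilon>"
  shows "Lp_pow p (\<lambda>x. mollify r v x - v x) \<le> \<epsilon>"
proof -
  obtain B where B: "\<And>x::'a. \<bar>mollifier r x\<bar> \<le> B" using mollifier_bounded[OF r] by blast
  have i: "integrable lborel (\<lambda>y. mollifier r (x - y) *\<^sub>R v y)" for x
    by (rule integrable_kernel_mult_Lp[OF v fin p _ integrable_mollifier_translate[OF r] B]) simp
  have i': "integrable lborel (\<lambda>y. mollifier r (x - y) *\<^sub>R (v y - v x))" for x
    using i[of x] integrable_mollifier_translate[OF r, of x] by (simp add: scaleR_diff_right)
  have "ennreal (norm (mollify r v x - v x) powr p)
      \<le> (\<integral>\<^sup>+h. ennreal (mollifier r h) * ennreal (norm (v (x + h) - v x) powr p) \<partial>lborel)" for x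
  proof -
    have "mollify r v x - v x = (\<integral>y. mollifier r (x - y) *\<^sub>R (v y - v x) \<partial>lborel)"
      using i[of x] integrable_mollifier_translate[OF r, of x] integral_mollifier_translate[OF r, of x]
      by (simp add: mollify_def scaleR_diff_right)
    also have "norm \<dots> \<le> (\<integral>y. norm (mollifier r (x - y) *\<^sub>R (v y - v x)) \<partial>lborel)"
      by (rule integral_norm_bound)
    also have "\<dots> = (\<integral>y. mollifier r (x - y) * norm (v y - v x) \<partial>lborel)"
      by (simp add: abs_of_nonneg[OF mollifier_nonneg[OF r]])
    finally have "ennreal (norm (mollify r v x - v x) powr p)
        \<le> ennreal ((\<integral>y. mollifier r (x - y) * norm (v y - v x) \<partial>lborel) powr p)"
      using p by (intro ennreal_leI powr_mono2) auto
    also have "\<dots> \<le> (\<integral>\<^sup>+y. ennreal (mollifier r (x - y) * norm (v y - v x) powr p) \<partial>lborel)"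
      using integrable_norm[OF i'[of x]] mollifier_nonneg[OF r]
      by (intro powr_integral_le integrable_mollifier_translate integral_mollifier_translate r p) auto
    also have "\<dots> = (\<integral>\<^sup>+h. ennreal (mollifier r (x - (h + x)) * norm (v (h + x) - v x) powr p) \<partial>lborel)"
      by (rule nn_integral_lborel_translate[symmetric]) simp
    also have "\<dots> = (\<integral>\<^sup>+h. ennreal (mollifier r h) * ennreal (norm (v (x + h) - v x) powr p) \<partial>lborel)"
      by (intro nn_integral_cong) (simp add: ennreal_mult mollifier_nonneg[OF r] mollifier_minus add.commute)
    finally show ?thesis .
  qed
  then have "Lp_pow p (\<lambda>x. mollify r v x - v x)
      \<le> (\<integral>\<^sup>+x. \<integral>\<^sup>+h. ennreal (mollifier r h) * ennreal (norm (v (x + h) - v x) powr p) \<partial>lborel \<partial>lborel)"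
    unfolding Lp_pow_def by (intro nn_integral_mono)
  also have "\<dots> = (\<integral>\<^sup>+h. \<integral>\<^sup>+x. ennreal (mollifier r h) * ennreal (norm (v (x + h) - v x) powr p) \<partial>lborel \<partial>lborel)"
    by (rule lborel_pair.Fubini'[symmetric]) simp
  also have "\<dots> = (\<integral>\<^sup>+h. ennreal (mollifier r h) * Lp_pow p (\<lambda>x. v (x + h) - v x) \<partial>lborel)"
    by (simp add: nn_integral_cmult Lp_pow_def)
  also have "\<dots> \<le> (\<integral>\<^sup>+h. ennreal (mollifier r (h::'a)) * \<epsilon> \<partial>lborel)"
  proof (rule nn_integral_mono)
    fix h' :: 'a
    show "ennreal (mollifier r h') * Lp_pow p (\<lambda>x. v (x + h') - v x) \<le> ennreal (mollifier r h') * \<epsilon>"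
      using h[of h'] mollifier_support[OF r, of h']
      by (cases "norm h' < r") (auto intro: mult_left_mono)
  qed
  also have "\<dots> = \<epsilon>"
    by (simp add: nn_integral_multc nn_integral_mollifier r)
  finally show ?thesis .
qed

theorem mollify_tendsto_Lp:
  fixes v :: "'a::euclidean_space \<Rightarrow> 'b::euclidean_space"
  assumes v: "v \<in> borel_measurable borel" and fin: "Lp_pow p v < \<infinity>" and p: "1 \<le> p"
  shows "((\<lambda>r. Lp_pow p (\<lambda>x. mollify r v x - v x)) \<longlongrightarrow> 0) (at_right 0)"
proof (rule tendsto_zero_ennreal)
  fix \<epsilon> :: real assume "0 < \<epsilon>"
  then have "0 < \<epsilon> / 2" by simp
  then obtain d where d: "d > 0" "\<And>h. norm h < d \<Longrightarrow> Lp_pow p (\<lambda>x. v (x + h) - v x) \<le> ennreal (\<epsilon> / 2)"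
    using Lp_translation_continuous[OF v fin] p unfolding Lp_translation_continuous_def
    by (metis less_le_trans zero_less_one)
  have "Lp_pow p (\<lambda>x. mollify r v x - v x) < ennreal \<epsilon>" if "0 < r" "r < d" for r
  proof -
    have "Lp_pow p (\<lambda>x. mollify r v x - v x) \<le> ennreal (\<epsilon> / 2)"
      using that d(2) by (intro Lp_pow_mollify_diff_le v fin p) auto
    also have "\<dots> < ennreal \<epsilon>" using \<open>0 < \<epsilon>\<close> by (simp add: ennreal_lessI)
    finally show ?thesis .
  qed
  then show "\<forall>\<^sub>F r in at_right 0. Lp_pow p (\<lambda>x. mollify r v x - v x) < ennreal \<epsilon>"
    using d(1) by (auto simp: eventually_at_right_field)
qed

section \<open>Distributional inequalities and convolutions\<close>

text \<open>The Borel counterpart of \<open>locally_integrable\<close>: measurability is asked on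
  the whole space so that translations and product measures stay available, integrability only on
  compact subsets of \<open>\<Omega>\<close>.\<close>

definition loc_int :: "'a::euclidean_space set \<Rightarrow> ('a \<Rightarrow> 'b::euclidean_space) \<Rightarrow> bool" where
  "loc_int \<Omega> f \<longleftrightarrow> f \<in> borel_measurable borel \<and>
    (\<forall>K. compact K \<and> K \<subseteq> \<Omega> \<longrightarrow> integrable lborel (\<lambda>x. indicator K x *\<^sub>R f x))"

lemma loc_int_borel: "loc_int \<Omega> f \<Longrightarrow> f \<in> borel_measurable borel"
  by (simp add: loc_int_def)

lemma loc_int_compact: "loc_int \<Omega> f \<Longrightarrow> compact K \<Longrightarrow> K \<subseteq> \<Omega> \<Longrightarrow> integrable lborel (\<lambda>x. indicator K x *\<^sub>R f x)"
  by (simp add: loc_int_def)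

lemma integrable_bounded_support_mult:
  fixes f :: "'a::euclidean_space \<Rightarrow> 'b::euclidean_space"
  assumes f: "loc_int \<Omega> f" and K: "compact K" "K \<subseteq> \<Omega>"
    and k[measurable]: "k \<in> borel_measurable borel" and z: "\<And>x. x \<notin> K \<Longrightarrow> k x = 0" and B: "\<And>x. \<bar>k x\<bar> \<le> B"
  shows "integrable lborel (\<lambda>x. k x *\<^sub>R f x)"
proof (rule Bochner_Integration.integrable_bound)
  have [measurable]: "f \<in> borel_measurable borel" using f by (rule loc_int_borel)
  show "integrable lborel (\<lambda>x. B *\<^sub>R (indicator K x *\<^sub>R f x))"
    by (intro integrable_scaleR_right loc_int_compact[OF f K])
  show "(\<lambda>x. k x *\<^sub>R f x) \<in> borel_measurable lborel" by simp
  have "norm (k x *\<^sub>R f x) \<le> norm (B *\<^sub>R (indicator K x *\<^sub>R f x))" for x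
    using z[of x] B[of x] by (cases "x \<in> K") (auto intro!: mult_right_mono)
  then show "AE x in lborel. norm (k x *\<^sub>R f x) \<le> norm (B *\<^sub>R (indicator K x *\<^sub>R f x))"
    by simp
qed

lemma loc_int_test:
  assumes f: "loc_int \<Omega> f" and t: "\<psi> \<in> test_functions \<Omega>"
  shows "integrable lborel (\<lambda>x. \<psi> x *\<^sub>R f x)"
proof -
  obtain K where K: "compact K" "K \<subseteq> \<Omega>" "\<And>x. x \<notin> K \<Longrightarrow> \<psi> x = 0"
    using t by (rule test_functions_support) blast
  obtain B where "\<And>x. \<bar>\<psi> x\<bar> \<le> B"
    using t by (rule test_functions_bounded) blast
  then show ?thesis
    using K t by (intro integrable_bounded_support_mult[OF f K(1,2)]) (auto intro: test_functions_borel)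
qed

lemma loc_int_test_deriv:
  assumes f: "loc_int \<Omega> f" and t: "\<psi> \<in> test_functions \<Omega>"
  shows "integrable lborel (\<lambda>x. frechet_derivative \<psi> (at x) e *\<^sub>R f x)"
proof -
  obtain K where K: "compact K" "K \<subseteq> \<Omega>" "\<And>x. x \<notin> K \<Longrightarrow> \<psi> x = 0"
    using t by (rule test_functions_support) blast
  obtain B where "\<And>x e. \<bar>frechet_derivative \<psi> (at x) e\<bar> \<le> B * norm e"
    using t by (rule test_functions_deriv_bounded) blast
  then show ?thesis
    using K t by (intro integrable_bounded_support_mult[OF f K(1,2)])
      (auto intro: test_functions_deriv_zero test_functions_deriv_borel)
qed

lemma loc_int_Lp:
  assumes f: "f \<in> borel_measurable borel" "Lp_pow p f < \<infinity>" and p: "1 \<le> p"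
  shows "loc_int \<Omega> f"
  unfolding loc_int_def
proof (intro conjI allI impI f(1))
  fix K assume K: "compact K \<and> K \<subseteq> \<Omega>"
  then have [measurable]: "K \<in> sets borel" by (simp add: borel_compact)
  have "emeasure lborel K < \<infinity>" using K by (intro emeasure_compact_finite) auto
  then show "integrable lborel (\<lambda>x. indicator K x *\<^sub>R f x)"
    by (intro integrable_kernel_mult_Lp[OF f p, of "indicator K" 1]) (auto split: split_indicator)
qed

text \<open>By the Lindeloef property countably many of the balls already cover
  \<open>\<Omega>\<close>, so their exceptional sets add up to a null set.\<close>

lemma AE_open_local:
  fixes \<Omega> :: "'a::euclidean_space set"
  assumes "\<And>x. x \<in> \<Omega> \<Longrightarrow> \<exists>R>0. AE y in M. y \<in> ball x R \<longrightarrow> P y"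
  shows "AE y in M. y \<in> \<Omega> \<longrightarrow> P y"
proof -
  obtain R where R: "\<And>x. x \<in> \<Omega> \<Longrightarrow> R x > 0 \<and> (AE y in M. y \<in> ball x (R x) \<longrightarrow> P y)"
    using assms by metis
  obtain \<F> where \<F>: "\<F> \<subseteq> (\<lambda>x. ball x (R x)) ` \<Omega>" "countable \<F>" "\<Union>\<F> = \<Union>((\<lambda>x. ball x (R x)) ` \<Omega>)"
    using Lindelof[of "(\<lambda>x. ball x (R x)) ` \<Omega>"] by auto
  have "AE y in M. \<forall>B\<in>\<F>. y \<in> B \<longrightarrow> P y"
    using \<F>(1,2) R by (subst AE_ball_countable) auto
  then show ?thesis
  proof eventually_elim
    case (elim y)
    show ?case
    proof
      assume "y \<in> \<Omega>"
      then have "y \<in> \<Union>\<F>" using R[of y] unfolding \<F>(3) by force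
      then show "P y" using elim by auto
    qed
  qed
qed

text \<open>The mollifications of a locally integrable function are nonnegative as soon as the function
  is so in the sense of distributions, and they converge to it in \<open>L\<^sup>1\<close>.\<close>

lemma nonneg_AE_if_nonneg_test:
  fixes k :: "'a::euclidean_space \<Rightarrow> real"
  assumes \<Omega>: "open \<Omega>" and k: "loc_int \<Omega> k"
    and pos: "\<And>\<psi>. \<psi> \<in> test_functions \<Omega> \<Longrightarrow> (\<And>x. 0 \<le> \<psi> x) \<Longrightarrow> 0 \<le> (\<integral>x. k x * \<psi> x \<partial>lborel)"
  shows "AE x in lborel. x \<in> \<Omega> \<longrightarrow> 0 \<le> k x"
proof (rule AE_open_local)
  fix x0 assume "x0 \<in> \<Omega>"
  then obtain R' where R': "R' > 0" "cball x0 R' \<subseteq> \<Omega>"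
    using \<Omega> open_contains_cball by blast
  define R where "R = R' / 2"
  have R: "R > 0" "cball x0 (2 * R) \<subseteq> \<Omega>" using R' by (auto simp: R_def)
  have [measurable]: "k \<in> borel_measurable borel" using k by (rule loc_int_borel)
  let ?K = "cball x0 (2 * R)"
  \<comment> \<open>The radius \<open>2 * R\<close> leaves a margin: for \<open>r < R\<close> the
    mollification on \<open>ball x0 R\<close> only sees values where \<open>kk\<close> agrees with
    \<open>k\<close>.\<close>
  define kk where "kk = (\<lambda>x. indicator ?K x *\<^sub>R k x)"
  have [measurable]: "?K \<in> sets borel" "ball x0 R \<in> sets borel" by simp_all
  have [measurable]: "kk \<in> borel_measurable borel" unfolding kk_def by measurable
  have "integrable lborel kk"
    unfolding kk_def using R(2) by (intro loc_int_compact[OF k]) auto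
  then have fin: "Lp_pow 1 kk < \<infinity>"
    by (simp add: Lp_pow_one integrable_iff_bounded)
  have nn: "0 \<le> mollify r kk x" if r: "0 < r" "r < R" and x: "x \<in> ball x0 R" for r x
  proof -
    have sub: "cball x r \<subseteq> ?K"
    proof
      fix y assume "y \<in> cball x r"
      then show "y \<in> ?K"
        using r x dist_triangle[of x0 y x] by auto
    qed
    have "mollify r kk x = (\<integral>y. k y * mollifier r (x - y) \<partial>lborel)"
      unfolding mollify_def
    proof (intro Bochner_Integration.integral_cong refl)
      fix y
      have "mollifier r (x - y) = 0" if "y \<notin> ?K"
      proof (rule mollifier_support[OF r(1)])
        have "y \<notin> cball x r" using that sub by blast
        then show "\<not> norm (x - y) < r" by (simp add: dist_norm)
      qed
      then show "mollifier r (x - y) *\<^sub>R kk y = k y * mollifier r (x - y)"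
        by (auto simp: kk_def indicator_def)
    qed
    also have "\<dots> \<ge> 0"
      using r sub R(2) by (intro pos mollifier_reflect_test_functions mollifier_nonneg) auto
    finally show ?thesis .
  qed
  have "(\<integral>\<^sup>+x. ennreal (indicator (ball x0 R) x * max 0 (- k x)) \<partial>lborel) \<le> \<epsilon>" if \<epsilon>: "\<epsilon> > 0" for \<epsilon>
  proof -
    have "\<forall>\<^sub>F r in at_right 0. Lp_pow 1 (\<lambda>x. mollify r kk x - kk x) < \<epsilon>"
      using mollify_tendsto_Lp[OF _ fin] \<epsilon> by (auto simp: order_tendsto_iff)
    moreover have "\<forall>\<^sub>F r in at_right 0. 0 < r \<and> r < R"
      using R(1) by (auto simp: eventually_at_right_field)
    ultimately have "\<forall>\<^sub>F r in at_right 0. Lp_pow 1 (\<lambda>x. mollify r kk x - kk x) < \<epsilon> \<and> 0 < r \<and> r < R"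
      by eventually_elim simp
    then obtain r where r: "Lp_pow 1 (\<lambda>x. mollify r kk x - kk x) < \<epsilon>" "0 < r" "r < R"
      using eventually_happens[of _ "at_right (0::real)"] trivial_limit_at_right_real by blast
    have "(\<integral>\<^sup>+x. ennreal (indicator (ball x0 R) x * max 0 (- k x)) \<partial>lborel) \<le> Lp_pow 1 (\<lambda>x. mollify r kk x - kk x)"
      unfolding Lp_pow_one
    \<comment> \<open>Where \<open>k\<close> is negative the mollification is still nonnegative, so
      the negative part of \<open>k\<close> is at most the mollification error.\<close>
    proof (intro nn_integral_mono ennreal_leI)
      fix x
      show "indicator (ball x0 R) x * max 0 (- k x) \<le> norm (mollify r kk x - kk x)"
        using nn[of r x] r R(1) by (auto simp: indicator_def kk_def split: if_splits)
    qed
    then show ?thesis using r(1) by simp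
  qed
  then have "(\<integral>\<^sup>+x. ennreal (indicator (ball x0 R) x * max 0 (- k x)) \<partial>lborel) \<le> 0"
    by (rule dense_ge)
  then have "(\<integral>\<^sup>+x. ennreal (indicator (ball x0 R) x * max 0 (- k x)) \<partial>lborel) = 0"
    by simp
  then have "AE x in lborel. ennreal (indicator (ball x0 R) x * max 0 (- k x)) = 0"
    by (subst (asm) nn_integral_0_iff_AE) auto
  then have "AE x in lborel. x \<in> ball x0 R \<longrightarrow> 0 \<le> k x"
    by eventually_elim (auto simp: indicator_def max_def split: if_splits)
  then show "\<exists>R>0. AE x in lborel. x \<in> ball x0 R \<longrightarrow> 0 \<le> k x"
    using R(1) by blast
qed

lemma zero_AE_if_zero_test:
  fixes k :: "'a::euclidean_space \<Rightarrow> real"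
  assumes \<Omega>: "open \<Omega>" and k: "loc_int \<Omega> k"
    and z: "\<And>\<psi>. \<psi> \<in> test_functions \<Omega> \<Longrightarrow> (\<integral>x. k x * \<psi> x \<partial>lborel) = 0"
  shows "AE x in lborel. x \<in> \<Omega> \<longrightarrow> k x = 0"
proof -
  have m: "loc_int \<Omega> (\<lambda>x. - k x)"
    using k by (simp add: loc_int_def)
  have "AE x in lborel. x \<in> \<Omega> \<longrightarrow> 0 \<le> k x"
    using z by (intro nonneg_AE_if_nonneg_test[OF \<Omega> k]) simp
  moreover have "AE x in lborel. x \<in> \<Omega> \<longrightarrow> 0 \<le> - k x"
    using z by (intro nonneg_AE_if_nonneg_test[OF \<Omega> m]) simp
  ultimately show ?thesis by eventually_elim auto
qed

text \<open>Real-valued, but with an arbitrary kernel: differentiation replaces the kernel by one of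
  its partial derivatives, which stays within this form.\<close>

definition convolve :: "('a::euclidean_space \<Rightarrow> real) \<Rightarrow> ('a \<Rightarrow> real) \<Rightarrow> 'a \<Rightarrow> real" where
  "convolve \<psi> v x = (\<integral>y. \<psi> (x - y) * v y \<partial>lborel)"

lemma test_functions_reflect:
  assumes "\<psi> \<in> test_functions UNIV"
  shows "(\<lambda>y. \<psi> (x - y)) \<in> test_functions UNIV"
proof -
  obtain K where K: "compact K" "\<And>x. x \<notin> K \<Longrightarrow> \<psi> x = 0"
    using assms by (rule test_functions_support) blast
  show ?thesis
  proof (rule test_functionsI[of _ "(\<lambda>y. x - y) ` K"])
    show "Ck k (\<lambda>y. \<psi> (x - y))" for k
      using Ck_affine[OF test_functions_Ck[OF assms], of k "-1" x] by simp
    show "compact ((\<lambda>y. x - y) ` K)"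
      by (intro compact_continuous_image K continuous_intros)
    show "\<psi> (x - y) = 0" if "y \<notin> (\<lambda>y. x - y) ` K" for y
      using that by (intro K) (auto simp: image_iff)
  qed auto
qed

lemma frechet_derivative_reflect:
  assumes "\<psi> \<in> test_functions UNIV"
  shows "frechet_derivative (\<lambda>y. \<psi> (x - y)) (at y) e = - frechet_derivative \<psi> (at (x - y)) e"
proof -
  have "((\<lambda>y. \<psi> (x - y)) has_derivative (\<lambda>e. frechet_derivative \<psi> (at (x - y)) (- e))) (at y)"
    by (rule has_derivative_compose[OF _ test_functions_has_derivative[OF assms]])
      (auto intro!: derivative_eq_intros)
  then have "frechet_derivative (\<lambda>y. \<psi> (x - y)) (at y) e = frechet_derivative \<psi> (at (x - y)) (- e)"
    using frechet_derivative_at by metis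
  also have "\<dots> = - frechet_derivative \<psi> (at (x - y)) e"
    using has_derivative_linear[OF test_functions_has_derivative[OF assms]] by (simp add: linear_neg)
  finally show ?thesis .
qed

lemma integrable_convolve:
  assumes "\<psi> \<in> test_functions UNIV" "loc_int UNIV v"
  shows "integrable lborel (\<lambda>y. \<psi> (x - y) * v y)"
  using loc_int_test[OF assms(2) test_functions_reflect[OF assms(1)]] by simp

lemma integrable_convolve_deriv:
  assumes "\<psi> \<in> test_functions UNIV" "loc_int UNIV v"
  shows "integrable lborel (\<lambda>y. frechet_derivative \<psi> (at (x - y)) e * v y)"
  using loc_int_test_deriv[OF assms(2) test_functions_reflect[OF assms(1)], of x e]
  by (simp add: frechet_derivative_reflect[OF assms(1)])

text \<open>Differentiation under the integral sign by dominated convergence along sequences. The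
  Lipschitz constant of \<open>\<psi>\<close> and the bound of its derivative majorise the
  normalised remainder by \<open>B + B'\<close>.\<close>

lemma convolve_has_derivative:
  fixes \<psi> :: "'a::euclidean_space \<Rightarrow> real"
  assumes t: "\<psi> \<in> test_functions UNIV" and v: "loc_int UNIV v"
  shows "(convolve \<psi> v has_derivative (\<lambda>e. \<integral>y. frechet_derivative \<psi> (at (x - y)) e * v y \<partial>lborel)) (at x)"
proof -
  let ?D = "\<lambda>e. \<integral>y. frechet_derivative \<psi> (at (x - y)) e * v y \<partial>lborel"
  have [measurable]: "v \<in> borel_measurable borel" "\<psi> \<in> borel_measurable borel"
    using loc_int_borel[OF v] test_functions_borel[OF t] by auto
  have mD[measurable]: "(\<lambda>y. frechet_derivative \<psi> (at (x - y)) e) \<in> borel_measurable borel" for e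
    using measurable_compose[OF _ test_functions_deriv_borel[OF t, of e], of "\<lambda>y. x - y" borel] by simp
  obtain B where B: "0 \<le> B" "\<And>x y. \<bar>\<psi> x - \<psi> y\<bar> \<le> B * norm (x - y)"
    using t by (rule test_functions_lipschitz) blast
  obtain B' where B': "0 \<le> B'" "\<And>x e. \<bar>frechet_derivative \<psi> (at x) e\<bar> \<le> B' * norm e"
    using t by (rule test_functions_deriv_bounded) blast
  obtain K where K: "compact K" "\<And>x. x \<notin> K \<Longrightarrow> \<psi> x = 0"
    using t by (rule test_functions_support) blast
  obtain R where R: "\<And>x. x \<in> K \<Longrightarrow> norm x \<le> R"
    using compact_imp_bounded[OF K(1)] bounded_iff by metis
  have lin: "linear (frechet_derivative \<psi> (at z))" for z
    using has_derivative_linear[OF test_functions_has_derivative[OF t]] .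
  have bl: "bounded_linear ?D"
  proof -
    have "linear ?D"
      by (rule linearI) (simp_all add: linear_add[OF lin] linear_cmul[OF lin] distrib_right
          Bochner_Integration.integral_add[OF integrable_convolve_deriv[OF t v] integrable_convolve_deriv[OF t v]] mult.assoc)
    then show ?thesis by (simp add: linear_conv_bounded_linear)
  qed
  let ?q = "\<lambda>e y. (\<psi> (x + e - y) - \<psi> (x - y) - frechet_derivative \<psi> (at (x - y)) e) / norm e * v y"
  have eq: "(convolve \<psi> v (x + e) - convolve \<psi> v x - ?D e) / norm e = (\<integral>y. ?q e y \<partial>lborel)" for e
  proof -
    have "convolve \<psi> v (x + e) - convolve \<psi> v x - ?D e
        = (\<integral>y. \<psi> (x + e - y) * v y - \<psi> (x - y) * v y - frechet_derivative \<psi> (at (x - y)) e * v y \<partial>lborel)"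
      unfolding convolve_def
      using integrable_convolve[OF t v] integrable_convolve_deriv[OF t v] by simp
    then show ?thesis
      by (simp add: algebra_simps diff_divide_distrib flip: integral_divide_zero)
  qed
  have "((\<lambda>e. \<integral>y. ?q e y \<partial>lborel) \<longlongrightarrow> 0) (at 0)"
    unfolding tendsto_at_iff_sequentially comp_def
  proof (intro allI impI)
    fix s :: "nat \<Rightarrow> 'a" assume s: "\<forall>i. s i \<in> UNIV - {0}" "s \<longlonglongrightarrow> 0"
    have "bounded (range s)" using s(2) convergent_imp_bounded by auto
    then obtain S where S: "\<And>i. norm (s i) \<le> S" by (auto simp: bounded_iff)
    \<comment> \<open>For \<open>y\<close> outside this ball neither \<open>x - y\<close> nor
      \<open>x + s i - y\<close> lies in the support of \<open>\<psi>\<close>, so the remainder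
      vanishes there.\<close>
    let ?L = "cball x (R + S)"
    have "(\<lambda>i. \<integral>y. ?q (s i) y \<partial>lborel) \<longlonglongrightarrow> (\<integral>y. 0 \<partial>(lborel :: 'a measure))"
    proof (rule integral_dominated_convergence)
      show "integrable lborel (\<lambda>y. (B + B') * norm (indicator ?L y *\<^sub>R v y))"
        by (intro integrable_mult_right integrable_norm loc_int_compact[OF v]) auto
      show "AE y in lborel. (\<lambda>i. ?q (s i) y) \<longlonglongrightarrow> 0"
      proof (rule AE_I2)
        fix y
        have "((\<lambda>e. norm (\<psi> (x - y + e) - \<psi> (x - y) - frechet_derivative \<psi> (at (x - y)) e) / norm e) \<longlongrightarrow> 0) (at 0)"
          using test_functions_has_derivative[OF t, of "x - y"] unfolding has_derivative_at by blast
        then have "(\<lambda>i. norm (\<psi> (x - y + s i) - \<psi> (x - y) - frechet_derivative \<psi> (at (x - y)) (s i)) / norm (s i)) \<longlonglongrightarrow> 0"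
          using s unfolding tendsto_at_iff_sequentially comp_def by blast
        then have "(\<lambda>i. (\<psi> (x - y + s i) - \<psi> (x - y) - frechet_derivative \<psi> (at (x - y)) (s i)) / norm (s i)) \<longlonglongrightarrow> 0"
          by (subst tendsto_norm_zero_iff[symmetric]) simp
        from tendsto_mult_right[OF this, of "v y"]
        show "(\<lambda>i. ?q (s i) y) \<longlonglongrightarrow> 0" by (simp add: algebra_simps)
      qed
      show "AE y in lborel. norm (?q (s i) y) \<le> (B + B') * norm (indicator ?L y *\<^sub>R v y)" for i
      proof (rule AE_I2)
        fix y
        have pos: "norm (s i) > 0" using s(1) by auto
        show "norm (?q (s i) y) \<le> (B + B') * norm (indicator ?L y *\<^sub>R v y)"
        proof (cases "y \<in> ?L")
          case True
          have "\<bar>\<psi> (x + s i - y) - \<psi> (x - y) - frechet_derivative \<psi> (at (x - y)) (s i)\<bar>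
              \<le> B * norm (s i) + B' * norm (s i)"
            using B(2)[of "x + s i - y" "x - y"] B'(2)[of "x - y" "s i"] by (simp add: abs_le_iff)
          then have "\<bar>\<psi> (x + s i - y) - \<psi> (x - y) - frechet_derivative \<psi> (at (x - y)) (s i)\<bar> / norm (s i) \<le> B + B'"
            using pos by (simp add: divide_le_eq distrib_right)
          from mult_right_mono[OF this abs_ge_zero[of "v y"]] show ?thesis
            using True by (simp add: abs_mult)
        next
          case False
          then have n: "R + S < norm (x - y)" by (simp add: dist_norm)
          have "x - y \<notin> K" using R[of "x - y"] n S[of i] norm_ge_zero[of "s i"] by linarith
          moreover have "x + s i - y \<notin> K"
            using R[of "x + s i - y"] n S[of i] norm_triangle_ineq4[of "x + s i - y" "s i"]
            by (auto simp: algebra_simps)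
          ultimately show ?thesis
            using K test_functions_deriv_zero[OF t K(1,2)] B(1) B'(1) by simp
        qed
      qed
    qed auto
    then show "(\<lambda>i. \<integral>y. ?q (s i) y \<partial>lborel) \<longlonglongrightarrow> 0" by simp
  qed
  then have "((\<lambda>e. norm (convolve \<psi> v (x + e) - convolve \<psi> v x - ?D e) / norm e) \<longlongrightarrow> 0) (at 0)"
    unfolding eq[symmetric] by (subst (asm) tendsto_norm_zero_iff[symmetric]) simp
  then show ?thesis
    using bl unfolding has_derivative_at by blast
qed

lemma Ck_convolve:
  assumes v: "loc_int UNIV v"
  shows "\<psi> \<in> test_functions UNIV \<Longrightarrow> Ck k (convolve \<psi> v)"
proof (induction k arbitrary: \<psi>)
  case 0
  then show ?case
    using convolve_has_derivative[OF 0 v]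
    by (auto intro!: continuous_at_imp_continuous_on has_derivative_continuous)
next
  case (Suc k)
  show ?case
    by (rule Ck_SucI[OF convolve_has_derivative[OF Suc.prems v]])
      (use Suc.IH[OF test_functions_deriv[OF Suc.prems]] in \<open>simp add: convolve_def[abs_def]\<close>)
qed

section \<open>Representation of functionals on test functions\<close>

text \<open>Local integrability says nothing about infinity, so \<open>g\<close> is damped by a
  weight that stays away from zero on compact sets: a sum of small multiples of the indicators of
  growing balls.\<close>

lemma ex_integrable_weight:
  fixes g :: "'a::euclidean_space \<Rightarrow> real"
  assumes g: "loc_int UNIV g" "\<And>x. 0 \<le> g x"
  obtains m :: "'a \<Rightarrow> real" where "m \<in> borel_measurable borel" "\<And>x. 0 < m x"
    "\<And>K. compact K \<Longrightarrow> \<exists>c>0. \<forall>x\<in>K. c \<le> m x" "integrable lborel (\<lambda>x. g x * m x)"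
proof -
  have [measurable]: "g \<in> borel_measurable borel" using g(1) by (rule loc_int_borel)
  define A where "A N = cball (0::'a) (real N)" for N
  have [measurable]: "A N \<in> sets borel" for N by (simp add: A_def)
  define a where "a N = (\<integral>x. indicator (A N) x * g x \<partial>lborel)" for N
  have iA: "integrable lborel (\<lambda>x. indicator (A N) x * g x)" for N
    using loc_int_compact[OF g(1), of "A N"] by (simp add: A_def)
  have a0: "0 \<le> a N" for N
    unfolding a_def by (intro integral_nonneg_AE) (auto simp: g)
  \<comment> \<open>Dividing by \<open>1 + a N\<close> makes both \<open>c N\<close> and
    \<open>c N * a N\<close> at most \<open>(1/2) ^ N\<close>: the first gives convergence of
    \<open>m\<close>, the second integrability of \<open>g x * m x\<close>.\<close>
  define c where "c N = (1/2) ^ N / (1 + a N)" for N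
  have c0: "0 < c N" for N using a0[of N] by (auto simp: c_def)
  have c1: "c N \<le> (1/2) ^ N" for N using a0[of N] mult_left_mono[of 1 "1 + a N" "(1/2) ^ N :: real"] by (simp add: c_def divide_le_eq del: power_divide)
  have ca: "c N * a N \<le> (1/2) ^ N" for N using a0[of N] mult_left_mono[of "a N" "1 + a N" "(1/2) ^ N :: real"] by (simp add: c_def divide_le_eq del: power_divide)
  define m where "m x = (\<Sum>N. c N * indicator (A N) x)" for x
  have sm: "summable (\<lambda>N. c N * indicator (A N) x)" for x
    by (rule summable_comparison_test[OF _ summable_geometric[of "1/2::real"]])
      (use c0 c1 in \<open>auto intro!: exI[of _ 0] simp: indicator_def less_imp_le\<close>)
  have ge: "c N \<le> m x" if "x \<in> A N" for x N
  proof -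
    have "(\<Sum>n\<in>{N}. c n * indicator (A n) x) \<le> m x"
      unfolding m_def using c0 by (intro sum_le_suminf sm) (auto simp: less_imp_le)
    then show ?thesis using that by simp
  qed
  have cov: "x \<in> A (nat \<lceil>norm x\<rceil>)" for x by (simp add: A_def of_nat_nat)
  show ?thesis
  proof (rule that)
    show m[measurable]: "m \<in> borel_measurable borel" unfolding m_def[abs_def] by measurable
    show mpos: "0 < m x" for x using ge[OF cov[of x]] c0 less_le_trans by blast
    show "\<exists>c>0. \<forall>x\<in>K. c \<le> m x" if K: "compact K" for K
    proof -
      obtain B where B: "\<And>x. x \<in> K \<Longrightarrow> norm x \<le> B"
        using compact_imp_bounded[OF K] by (auto simp: bounded_iff)
      have "x \<in> A (nat \<lceil>B\<rceil>)" if "x \<in> K" for x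
        using B[OF that] by (simp add: A_def) linarith
      then show ?thesis using ge c0 by (intro exI[of _ "c (nat \<lceil>B\<rceil>)"]) auto
    qed
    show "integrable lborel (\<lambda>x. g x * m x)"
    proof (rule integrableI_nonneg)
      have "ennreal (g x * m x) = (\<Sum>N. ennreal (c N * (indicator (A N) x * g x)))" for x
      proof -
        have "g x * m x = (\<Sum>N. g x * (c N * indicator (A N) x))"
          unfolding m_def by (rule suminf_mult[OF sm, symmetric])
        then show ?thesis
          using c0 g(2) summable_mult[OF sm, of "g x" x]
          by (subst suminf_ennreal2) (auto simp: less_imp_le algebra_simps)
      qed
      then have "(\<integral>\<^sup>+x. ennreal (g x * m x) \<partial>lborel) = (\<Sum>N. \<integral>\<^sup>+x. ennreal (c N * (indicator (A N) x * g x)) \<partial>lborel)"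
        by (simp add: nn_integral_suminf)
      also have "\<dots> = (\<Sum>N. ennreal (c N * a N))"
        using iA c0 g(2) by (intro suminf_cong, subst nn_integral_eq_integral) (auto simp: a_def less_imp_le)
      also have "\<dots> \<le> (\<Sum>N. ennreal ((1/2) ^ N))"
        by (intro suminf_le ennreal_leI ca) auto
      also have "\<dots> = ennreal (\<Sum>N. (1/2) ^ N)"
        by (intro suminf_ennreal2) (auto intro: summable_geometric)
      finally show "(\<integral>\<^sup>+x. ennreal (g x * m x) \<partial>lborel) < \<infinity>"
        using le_less_trans ennreal_less_top by (metis infinity_ennreal_def)
    qed (use mpos g in \<open>auto simp: less_imp_le\<close>)
  qed
qed

text \<open>Riesz representation: the quadratic functional \<open>\<integral> (g/m) \<psi>\<^sup>2 / 2 - T \<psi>\<close> is minimised over the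
  test functions. By the parallelogram identity a minimising sequence is Cauchy in the weighted
  \<open>L\<^sup>2\<close> space, and its limit represents \<open>T\<close>; the weight \<open>m\<close> makes \<open>g m\<close> integrable.\<close>

lemma test_functional_representation:
  fixes g :: "'a::euclidean_space \<Rightarrow> real" and T :: "('a \<Rightarrow> real) \<Rightarrow> real"
  assumes g: "loc_int UNIV g" "\<And>x. 0 \<le> g x"
    and add: "\<And>\<psi> \<phi>. \<psi> \<in> test_functions \<Omega> \<Longrightarrow> \<phi> \<in> test_functions \<Omega> \<Longrightarrow> T (\<lambda>x. \<psi> x + \<phi> x) = T \<psi> + T \<phi>"
    and scl: "\<And>\<psi> c. \<psi> \<in> test_functions \<Omega> \<Longrightarrow> T (\<lambda>x. c * \<psi> x) = c * T \<psi>"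
    and bd: "\<And>\<psi>. \<psi> \<in> test_functions \<Omega> \<Longrightarrow> \<bar>T \<psi>\<bar> \<le> (\<integral>x. g x * \<bar>\<psi> x\<bar> \<partial>lborel)"
  obtains h where "loc_int \<Omega> h" "\<And>\<psi>. \<psi> \<in> test_functions \<Omega> \<Longrightarrow> T \<psi> = (\<integral>x. h x * \<psi> x \<partial>lborel)"
proof -
  let ?TF = "test_functions \<Omega>"
  have gm[measurable]: "g \<in> borel_measurable borel" using g(1) by (rule loc_int_borel)
  obtain m :: "'a \<Rightarrow> real" where m[measurable]: "m \<in> borel_measurable borel" and mpos: "\<And>x. 0 < m x"
    and mK: "\<And>K. compact K \<Longrightarrow> \<exists>c>0. \<forall>x\<in>K. c \<le> m x" and gmi: "integrable lborel (\<lambda>x. g x * m x)"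
    using ex_integrable_weight[OF g] by blast
  define I where "I = (\<integral>x. g x * m x \<partial>lborel)"
  have I0: "0 \<le> I" unfolding I_def using g(2) mpos by (intro integral_nonneg_AE) (auto simp: less_imp_le)
  \<comment> \<open>The weight of the quadratic form. It is locally integrable because
    \<open>1 / m\<close> is bounded on compact sets.\<close>
  define \<rho> where "\<rho> x = g x / m x" for x
  have [measurable]: "\<rho> \<in> borel_measurable borel" unfolding \<rho>_def[abs_def] by measurable
  have minv: "\<exists>B\<ge>0. \<forall>x\<in>K. 1 / m x \<le> B" if K: "compact K" for K
  proof -
    obtain c where c: "c > 0" "\<And>x. x \<in> K \<Longrightarrow> c \<le> m x" using mK[OF K] by blast
    then have "1 / m x \<le> 1 / c" if "x \<in> K" for x using that by (intro divide_left_mono) (auto simp: mpos)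
    then show ?thesis using c by (intro exI[of _ "1/c"]) auto
  qed
  have r: "loc_int UNIV \<rho>"
    unfolding loc_int_def
  proof (intro conjI allI impI)
    fix K :: "'a set" assume K: "compact K \<and> K \<subseteq> UNIV"
    then obtain B where B: "0 \<le> B" "\<And>x. x \<in> K \<Longrightarrow> 1 / m x \<le> B" using minv[of K] by blast
    have [measurable]: "K \<in> sets borel" using K by (simp add: borel_compact)
    have "\<bar>indicator K x / m x\<bar> \<le> B" for x
      using B mpos[of x] by (cases "x \<in> K") auto
    then have "integrable lborel (\<lambda>x. (indicator K x / m x) *\<^sub>R g x)"
      using K by (intro integrable_bounded_support_mult[OF g(1), of K _ B]) auto
    then show "integrable lborel (\<lambda>x. indicator K x *\<^sub>R \<rho> x)"
      by (simp add: \<rho>_def)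
  qed simp
  have iQ: "integrable lborel (\<lambda>x. \<rho> x * (\<phi> x * \<psi> x))" if "\<phi> \<in> ?TF" "\<psi> \<in> ?TF" for \<phi> \<psi>
    using loc_int_test[OF r, of "\<lambda>x. \<phi> x * \<psi> x"] that
    by (simp add: test_functions_mono[OF test_functions_mult] test_functions_Ck mult.commute)
  have ig: "integrable lborel (\<lambda>x. g x * \<psi> x)" if "\<psi> \<in> ?TF" for \<psi>
    using loc_int_test[OF g(1), of \<psi>] that by (simp add: test_functions_mono mult.commute)
  have iga: "integrable lborel (\<lambda>x. g x * \<bar>\<psi> x\<bar>)" if "\<psi> \<in> ?TF" for \<psi>
    using integrable_norm[OF ig[OF that]] g(2) by (simp add: abs_mult)
  define Q where "Q \<phi> \<psi> = (\<integral>x. \<rho> x * (\<phi> x * \<psi> x) \<partial>lborel)" for \<phi> \<psi>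
  have rho0: "0 \<le> \<rho> x" for x using g(2)[of x] mpos[of x] by (simp add: \<rho>_def)
  \<comment> \<open>Replaces the Cauchy-Schwarz inequality between \<open>g m\<close> and
    \<open>\<rho> \<psi>\<^sup>2\<close>. The free parameter is taken as \<open>s = 1\<close> to
    bound \<open>J\<close> below and as \<open>(1/2) ^ k\<close> for the increments of the
    minimising sequence.\<close>
  have amgm: "(\<integral>x. g x * \<bar>\<psi> x\<bar> \<partial>lborel) \<le> (s * I + Q \<psi> \<psi> / s) / 2" if t: "\<psi> \<in> ?TF" and s: "s > 0" for \<psi> s
  proof -
    have "(\<integral>x. g x * \<bar>\<psi> x\<bar> \<partial>lborel) \<le> (\<integral>x. (s * (g x * m x) + \<rho> x * (\<psi> x * \<psi> x) / s) / 2 \<partial>lborel)"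
    proof (rule integral_mono[OF iga[OF t]])
      show "integrable lborel (\<lambda>x. (s * (g x * m x) + \<rho> x * (\<psi> x * \<psi> x) / s) / 2)"
        using gmi iQ[OF t t] by simp
      fix x
      have "2 * (s * m x) * \<bar>\<psi> x\<bar> \<le> (s * m x)\<^sup>2 + \<bar>\<psi> x\<bar>\<^sup>2"
        by (rule sum_squares_bound)
      then have "\<bar>\<psi> x\<bar> \<le> (s * m x + \<psi> x * \<psi> x / (s * m x)) / 2"
        using s mpos[of x] by (simp add: field_simps power2_eq_square)
      then have "g x * \<bar>\<psi> x\<bar> \<le> g x * ((s * m x + \<psi> x * \<psi> x / (s * m x)) / 2)"
        using g(2) by (rule mult_left_mono)
      also have "\<dots> = (s * (g x * m x) + \<rho> x * (\<psi> x * \<psi> x) / s) / 2"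
        by (simp add: \<rho>_def algebra_simps add_divide_distrib)
      finally show "g x * \<bar>\<psi> x\<bar> \<le> (s * (g x * m x) + \<rho> x * (\<psi> x * \<psi> x) / s) / 2" .
    qed
    also have "\<dots> = (s * I + Q \<psi> \<psi> / s) / 2"
      using gmi iQ[OF t t] by (simp add: I_def Q_def)
    finally show ?thesis .
  qed
  define J where "J \<psi> = Q \<psi> \<psi> / 2 - T \<psi>" for \<psi>
  have Jlow: "- I / 2 \<le> J \<psi>" if t: "\<psi> \<in> ?TF" for \<psi>
    using amgm[OF t, of 1] bd[OF t] by (simp add: J_def)
  define i0 where "i0 = Inf (J ` ?TF)"
  have bdd: "bdd_below (J ` ?TF)" using Jlow by (auto simp: bdd_below_def)
  have i0: "i0 \<le> J \<psi>" if "\<psi> \<in> ?TF" for \<psi>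
    unfolding i0_def using that by (intro cInf_lower bdd) auto
  \<comment> \<open>The excess \<open>(1/4) ^ k\<close> is a square: its root
    \<open>(1/2) ^ k\<close> is the rate at which both the Euler-Lagrange equation and the
    increments converge.\<close>
  have "\<exists>\<psi>\<in>?TF. J \<psi> < i0 + (1/4) ^ k" for k :: nat
    using cInf_lessD[of "J ` ?TF" "i0 + (1/4) ^ k"] test_functions_zero[of \<Omega>] by (auto simp: i0_def)
  then obtain \<psi> where \<psi>: "\<And>k. \<psi> k \<in> ?TF" "\<And>k. J (\<psi> k) < i0 + (1/4) ^ k" by metis
  have Qpar: "Q (\<lambda>x. a x - b x) (\<lambda>x. a x - b x) \<le> 4 * (J a + J b - 2 * i0)" if t: "a \<in> ?TF" "b \<in> ?TF" for a b
  proof -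
    let ?c = "\<lambda>x. (1/2) * (a x + b x)"
    have tc: "?c \<in> ?TF" using t by (intro test_functions_cmult test_functions_add)
    have td: "(\<lambda>x. a x - b x) \<in> ?TF" using t by (rule test_functions_diff)
    have "Q ?c ?c = (\<integral>x. \<rho> x * (a x * a x) / 2 + \<rho> x * (b x * b x) / 2 - \<rho> x * ((a x - b x) * (a x - b x)) / 4 \<partial>lborel)"
      unfolding Q_def by (intro Bochner_Integration.integral_cong) (auto simp: field_simps)
    also have "\<dots> = Q a a / 2 + Q b b / 2 - Q (\<lambda>x. a x - b x) (\<lambda>x. a x - b x) / 4"
      unfolding Q_def using iQ[OF t(1) t(1)] iQ[OF t(2) t(2)] iQ[OF td td] by simp
    finally have Qc: "Q ?c ?c = Q a a / 2 + Q b b / 2 - Q (\<lambda>x. a x - b x) (\<lambda>x. a x - b x) / 4" .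
    have Tc: "T ?c = (T a + T b) / 2"
      using scl[OF test_functions_add[OF t], of "1/2"] add[OF t] by simp
    have "J ?c = J a / 2 + J b / 2 - Q (\<lambda>x. a x - b x) (\<lambda>x. a x - b x) / 8"
      unfolding J_def Qc Tc by (simp add: field_simps)
    then show ?thesis using i0[OF tc] by simp
  qed
  \<comment> \<open>Approximate Euler-Lagrange equation: perturbing \<open>\<psi> k\<close> by
    \<open>s * \<phi>\<close> can lower \<open>J\<close> by at most \<open>(1/4) ^ k\<close>.
    Choosing \<open>s\<close> as plus and minus \<open>(1/2) ^ k\<close> and dividing gives both
    signs.\<close>
  have EL: "\<bar>Q (\<psi> k) \<phi> - T \<phi>\<bar> \<le> (1/2) ^ k * (Q \<phi> \<phi> / 2 + 1)" if t: "\<phi> \<in> ?TF" for k \<phi>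
  proof -
    have exp: "J (\<lambda>x. \<psi> k x + s * \<phi> x) = J (\<psi> k) + s * (Q (\<psi> k) \<phi> - T \<phi>) + s\<^sup>2 / 2 * Q \<phi> \<phi>" for s
    proof -
      have "Q (\<lambda>x. \<psi> k x + s * \<phi> x) (\<lambda>x. \<psi> k x + s * \<phi> x) =
         (\<integral>x. \<rho> x * (\<psi> k x * \<psi> k x) + 2 * s * (\<rho> x * (\<psi> k x * \<phi> x)) + s\<^sup>2 * (\<rho> x * (\<phi> x * \<phi> x)) \<partial>lborel)"
        unfolding Q_def by (intro Bochner_Integration.integral_cong) (auto simp: algebra_simps power2_eq_square)
      also have "\<dots> = Q (\<psi> k) (\<psi> k) + 2 * s * Q (\<psi> k) \<phi> + s\<^sup>2 * Q \<phi> \<phi>"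
        unfolding Q_def using iQ \<psi>(1)[of k] t by simp
      finally show ?thesis
        using add[OF \<psi>(1) test_functions_cmult[OF t, of s], of k] scl[OF t, of s]
        by (simp add: J_def algebra_simps add_divide_distrib)
    qed
    have "- ((1/4) ^ k) \<le> s * (Q (\<psi> k) \<phi> - T \<phi>) + s\<^sup>2 / 2 * Q \<phi> \<phi>" for s
      using i0[OF test_functions_add[OF \<psi>(1)[of k] test_functions_cmult[OF t, of s]]] \<psi>(2)[of k] exp[of s] by simp
    note * = this[of "(1/2) ^ k"] this[of "- ((1/2) ^ k)"]
    have sq: "((1/2) ^ k)\<^sup>2 = (1/4 :: real) ^ k" "(1/4 :: real) ^ k = (1/2) ^ k * (1/2) ^ k"
      by (simp_all add: power2_eq_square flip: power_mult_distrib)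
    let ?X = "Q (\<psi> k) \<phi> - T \<phi>"
    let ?t = "(1/2 :: real) ^ k"
    have "?t * (- ?X) \<le> ?t * (?t * (Q \<phi> \<phi> / 2 + 1))" "?t * ?X \<le> ?t * (?t * (Q \<phi> \<phi> / 2 + 1))"
      using * by (simp_all add: sq algebra_simps power2_eq_square)
    then have "- ?X \<le> ?t * (Q \<phi> \<phi> / 2 + 1)" "?X \<le> ?t * (Q \<phi> \<phi> / 2 + 1)"
      by (simp_all only: mult_le_cancel_left_pos zero_less_power zero_less_divide_1_iff zero_less_numeral)
    then show ?thesis by (simp only: abs_le_iff)
  qed
  \<comment> \<open>The limit is formed for \<open>g * \<psi> k\<close> in \<open>L^1\<close>: the
    increments have summable integrals, which gives convergence almost everywhere and an integrable
    majorant at once.\<close>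
  define f where "f k x = g x * (\<psi> (Suc k) x - \<psi> k x)" for k x
  have [measurable]: "\<psi> k \<in> borel_measurable borel" for k using \<psi>(1) by (rule test_functions_borel)
  have [measurable]: "f k \<in> borel_measurable borel" for k unfolding f_def[abs_def] by measurable
  have dT: "(\<lambda>x. \<psi> (Suc k) x - \<psi> k x) \<in> ?TF" for k using \<psi>(1) by (intro test_functions_diff)
  have fi: "integrable lborel (f k)" for k unfolding f_def using ig[OF dT] .
  have fb: "(\<integral>x. \<bar>f k x\<bar> \<partial>lborel) \<le> (I + 8) * (1/2) ^ k" for k
  proof -
    have "Q (\<lambda>x. \<psi> (Suc k) x - \<psi> k x) (\<lambda>x. \<psi> (Suc k) x - \<psi> k x) \<le> 4 * (J (\<psi> (Suc k)) + J (\<psi> k) - 2 * i0)"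
      by (rule Qpar) (rule \<psi>)+
    also have "\<dots> \<le> 4 * ((1/4) ^ Suc k + (1/4) ^ k)"
      using \<psi>(2)[of k] \<psi>(2)[of "Suc k"] by (simp only: mult_le_cancel_left_pos zero_less_numeral)
    also have "\<dots> \<le> 8 * (1/4) ^ k" by simp
    finally have q: "Q (\<lambda>x. \<psi> (Suc k) x - \<psi> k x) (\<lambda>x. \<psi> (Suc k) x - \<psi> k x) / (1/2) ^ k \<le> 8 * (1/2) ^ k"
      by (simp add: divide_le_eq mult.assoc flip: power_mult_distrib)
    have "(\<integral>x. \<bar>f k x\<bar> \<partial>lborel) = (\<integral>x. g x * \<bar>\<psi> (Suc k) x - \<psi> k x\<bar> \<partial>lborel)"
      using g(2) by (simp add: f_def abs_mult)
    also have "\<dots> \<le> ((1/2) ^ k * I + 8 * (1/2) ^ k) / 2"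
      using amgm[OF dT[of k], of "(1/2) ^ k"] q by simp
    also have "\<dots> \<le> (I + 8) * (1/2) ^ k"
      using I0 by (simp add: field_simps)
    finally show ?thesis .
  qed
  define S where "S x = (\<Sum>k. ennreal \<bar>f k x\<bar>)" for x
  have [measurable]: "S \<in> borel_measurable borel" unfolding S_def[abs_def] by measurable
  have Sfin: "(\<integral>\<^sup>+x. S x \<partial>lborel) < \<infinity>"
  proof -
    have "(\<integral>\<^sup>+x. S x \<partial>lborel) = (\<Sum>k. \<integral>\<^sup>+x. ennreal \<bar>f k x\<bar> \<partial>lborel)"
      unfolding S_def by (rule nn_integral_suminf) simp
    also have "\<dots> = (\<Sum>k. ennreal (\<integral>x. \<bar>f k x\<bar> \<partial>lborel))"
      using fi by (intro suminf_cong nn_integral_eq_integral) auto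
    also have "\<dots> \<le> (\<Sum>k. ennreal ((I + 8) * (1/2) ^ k))"
      by (intro suminf_le ennreal_leI fb) auto
    also have "\<dots> = ennreal (\<Sum>k. (I + 8) * (1/2) ^ k)"
      using I0 by (intro suminf_ennreal2) (auto intro!: summable_mult summable_geometric)
    finally show ?thesis using le_less_trans ennreal_less_top by (metis infinity_ennreal_def)
  qed
  have SAE: "AE x in lborel. S x \<noteq> \<infinity>"
    using Sfin by (intro nn_integral_PInf_AE) auto
  have ps: "g x * \<psi> k x = g x * \<psi> 0 x + (\<Sum>j<k. f j x)" for k x
    by (induction k) (auto simp: f_def algebra_simps)
  have pb: "\<bar>g x * \<psi> k x\<bar> \<le> g x * \<bar>\<psi> 0 x\<bar> + enn2real (S x)" and cv: "convergent (\<lambda>k. g x * \<psi> k x)"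
    if "S x \<noteq> \<infinity>" for x k
  proof -
    have sa: "summable (\<lambda>k. \<bar>f k x\<bar>)"
      using that unfolding S_def by (intro summable_suminf_not_top) auto
    have Se: "enn2real (S x) = (\<Sum>k. \<bar>f k x\<bar>)"
      unfolding S_def using sa by (subst suminf_ennreal2) (auto simp: suminf_nonneg)
    have "\<bar>\<Sum>j<k. f j x\<bar> \<le> (\<Sum>j<k. \<bar>f j x\<bar>)" by (rule sum_abs)
    also have "\<dots> \<le> enn2real (S x)" unfolding Se by (intro sum_le_suminf sa) auto
    finally show "\<bar>g x * \<psi> k x\<bar> \<le> g x * \<bar>\<psi> 0 x\<bar> + enn2real (S x)"
      by (subst ps) (use g(2)[of x] in \<open>intro order_trans[OF abs_triangle_ineq] add_mono, auto simp: abs_mult\<close>)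
    have "convergent (\<lambda>k. \<Sum>j<k. f j x)"
      using summable_rabs_cancel[OF sa] by (simp add: summable_iff_convergent)
    then have "convergent (\<lambda>k. g x * \<psi> 0 x + (\<Sum>j<k. f j x))"
      by (intro convergent_add convergent_const)
    then show "convergent (\<lambda>k. g x * \<psi> k x)"
      by (simp only: ps[symmetric])
  qed
  define q where "q x = lim (\<lambda>k. g x * \<psi> k x)" for x
  have [measurable]: "q \<in> borel_measurable borel" unfolding q_def[abs_def] by measurable
  have ql: "(\<lambda>k. g x * \<psi> k x) \<longlonglongrightarrow> q x" if "S x \<noteq> \<infinity>" for x
    using cv[OF that] by (simp add: convergent_LIMSEQ_iff q_def)
  define W where "W x = g x * \<bar>\<psi> 0 x\<bar> + enn2real (S x)" for x
  have Wi: "integrable lborel W"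
  proof -
    have "integrable lborel (\<lambda>x. enn2real (S x))"
    proof (rule integrableI_nonneg)
      have "(\<integral>\<^sup>+x. ennreal (enn2real (S x)) \<partial>lborel) = (\<integral>\<^sup>+x. S x \<partial>lborel)"
        using SAE by (intro nn_integral_cong_AE) (auto simp: less_top)
      then show "(\<integral>\<^sup>+x. ennreal (enn2real (S x)) \<partial>lborel) < \<infinity>" using Sfin by simp
    qed auto
    then show ?thesis using iga[OF \<psi>(1)[of 0]] by (simp add: W_def[abs_def])
  qed
  have W0: "0 \<le> W x" for x using g(2)[of x] by (simp add: W_def)
  have qW: "\<bar>q x\<bar> \<le> W x" if "S x \<noteq> \<infinity>" for x
    using pb[OF that] by (intro LIMSEQ_le_const2[OF tendsto_rabs[OF ql[OF that]]]) (auto simp: W_def)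
  \<comment> \<open>\<open>Q (\<psi> k) \<phi>\<close> is the integral of
    \<open>g * \<psi> k\<close> against \<open>\<phi> / m\<close>. The factor \<open>1 / m\<close>
    therefore passes to the limit \<open>q\<close> and yields the representing function.\<close>
  define h where "h x = q x / m x" for x
  show ?thesis
  proof (rule that[of h])
    show "loc_int \<Omega> h"
      unfolding loc_int_def
    proof (intro conjI allI impI)
      show [measurable]: "h \<in> borel_measurable borel" unfolding h_def[abs_def] by measurable
      fix K :: "'a set" assume K: "compact K \<and> K \<subseteq> \<Omega>"
      then obtain B where B: "0 \<le> B" "\<And>x. x \<in> K \<Longrightarrow> 1 / m x \<le> B" using minv[of K] by blast
      have [measurable]: "K \<in> sets borel" using K by (simp add: borel_compact)
      show "integrable lborel (\<lambda>x. indicator K x *\<^sub>R h x)"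
      proof (rule Bochner_Integration.integrable_bound)
        show "integrable lborel (\<lambda>x. B * W x)" using Wi by simp
        show "AE x in lborel. norm (indicator K x *\<^sub>R h x) \<le> norm (B * W x)"
          using SAE
        proof eventually_elim
          case (elim x)
          have "\<bar>q x\<bar> * (1 / m x) \<le> W x * B" if "x \<in> K"
            using qW[OF elim] B(2)[OF that] mpos[of x] W0[of x] by (intro mult_mono) auto
          then show ?case using mpos[of x] W0[of x] B(1)
            by (auto simp: h_def indicator_def abs_mult mult.commute)
        qed
      qed simp
    qed
    fix \<phi> assume t: "\<phi> \<in> ?TF"
    have [measurable]: "\<phi> \<in> borel_measurable borel" using t by (rule test_functions_borel)
    obtain K where K: "compact K" "\<And>x. x \<notin> K \<Longrightarrow> \<phi> x = 0"
      using t by (rule test_functions_support) blast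
    obtain B1 where B1: "0 \<le> B1" "\<And>x. x \<in> K \<Longrightarrow> 1 / m x \<le> B1" using minv[OF K(1)] by blast
    obtain B2 where B2: "0 \<le> B2" "\<And>x. \<bar>\<phi> x\<bar> \<le> B2" using t by (rule test_functions_bounded) blast
    have B: "\<bar>\<phi> x / m x\<bar> \<le> B2 * B1" for x
    proof (cases "x \<in> K")
      case True
      have "\<bar>\<phi> x\<bar> * (1 / m x) \<le> B2 * B1"
        using B1(2)[OF True] B2(2)[of x] B2(1) mpos[of x] by (intro mult_mono) auto
      then show ?thesis using mpos[of x] by simp
    qed (use K B1 B2 in simp)
    have "(\<lambda>k. \<integral>x. (g x * \<psi> k x) * (\<phi> x / m x) \<partial>lborel) \<longlonglongrightarrow> (\<integral>x. q x * (\<phi> x / m x) \<partial>lborel)"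
    proof (rule integral_dominated_convergence)
      show "integrable lborel (\<lambda>x. W x * (B2 * B1))" using Wi by simp
      show "AE x in lborel. (\<lambda>k. (g x * \<psi> k x) * (\<phi> x / m x)) \<longlonglongrightarrow> q x * (\<phi> x / m x)"
        using SAE by eventually_elim (intro tendsto_mult_right ql)
      show "AE x in lborel. norm ((g x * \<psi> k x) * (\<phi> x / m x)) \<le> W x * (B2 * B1)" for k
        using SAE
      proof eventually_elim
        case (elim x)
        show ?case
          unfolding real_norm_def abs_mult[of "g x * \<psi> k x"] using pb[OF elim, of k] W0[of x]
          by (intro mult_mono B) (auto simp: W_def)
      qed
    qed auto
    moreover have "(\<integral>x. (g x * \<psi> k x) * (\<phi> x / m x) \<partial>lborel) = Q (\<psi> k) \<phi>" for k
      unfolding Q_def \<rho>_def by (intro Bochner_Integration.integral_cong) auto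
    moreover have "(\<lambda>k. Q (\<psi> k) \<phi>) \<longlonglongrightarrow> T \<phi>"
    proof (rule Lim_transform2[OF tendsto_const])
      have "(\<lambda>k. (1/2) ^ k * (Q \<phi> \<phi> / 2 + 1)) \<longlonglongrightarrow> 0 * (Q \<phi> \<phi> / 2 + 1)"
        by (intro tendsto_intros LIMSEQ_power_zero) simp
      then have "(\<lambda>k. Q (\<psi> k) \<phi> - T \<phi>) \<longlonglongrightarrow> 0"
        unfolding mult_zero_left
        by (rule Lim_null_comparison[rotated]) (intro always_eventually allI, unfold real_norm_def, rule EL[OF t])
      then show "(\<lambda>k. T \<phi> - Q (\<psi> k) \<phi>) \<longlonglongrightarrow> 0"
        using tendsto_minus[of "\<lambda>k. Q (\<psi> k) \<phi> - T \<phi>" 0] by simp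
    qed
    ultimately have "T \<phi> = (\<integral>x. q x * (\<phi> x / m x) \<partial>lborel)"
      by (simp add: LIMSEQ_unique)
    then show "T \<phi> = (\<integral>x. h x * \<phi> x \<partial>lborel)"
      by (simp add: h_def)
  qed
qed

section \<open>Weak gradients from difference quotients\<close>

text \<open>The counterpart of \<open>has_weak_gradient\<close> for Borel functions on the whole
  space, integrated against \<open>lborel\<close>; test functions vanish off
  \<open>\<Omega>\<close>, so the domain of integration can be the whole space.\<close>

definition wgrad :: "'a::euclidean_space set \<Rightarrow> ('a \<Rightarrow> real) \<Rightarrow> ('a \<Rightarrow> 'a) \<Rightarrow> bool" where
  "wgrad \<Omega> f g \<longleftrightarrow> loc_int \<Omega> f \<and> loc_int \<Omega> g \<and>
    (\<forall>\<psi>\<in>test_functions \<Omega>. \<forall>b\<in>Basis.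
      (\<integral>x. f x * frechet_derivative \<psi> (at x) b \<partial>lborel) = - (\<integral>x. (g x \<bullet> b) * \<psi> x \<partial>lborel))"

lemma frechet_derivative_add:
  assumes "\<psi> \<in> test_functions \<Omega>" "\<phi> \<in> test_functions \<Omega>"
  shows "frechet_derivative (\<lambda>x. \<psi> x + \<phi> x) (at x) e = frechet_derivative \<psi> (at x) e + frechet_derivative \<phi> (at x) e"
  by (simp add: frechet_derivative_at[OF has_derivative_add[OF test_functions_has_derivative[OF assms(1)]
        test_functions_has_derivative[OF assms(2)]], symmetric])

lemma frechet_derivative_cmult:
  assumes "\<psi> \<in> test_functions \<Omega>"
  shows "frechet_derivative (\<lambda>x. c * \<psi> x) (at x) e = c * frechet_derivative \<psi> (at x) e"
  by (simp add: frechet_derivative_at[OF has_derivative_mult_right[OF test_functions_has_derivative[OF assms]], symmetric])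

text \<open>The representation theorem supplies each component of \<open>h\<close>. The assumed
  bound in an arbitrary direction gives \<open>h x \<bullet> e \<le> norm e * g x\<close> almost
  everywhere for each fixed \<open>e\<close>, and taking \<open>e = h x\<close> at the end gives the
  Euclidean norm.\<close>

lemma wgrad_if_bounded:
  fixes u g :: "'a::euclidean_space \<Rightarrow> real"
  assumes \<Omega>: "open \<Omega>" and u: "loc_int \<Omega> u" and g: "loc_int UNIV g" "\<And>x. 0 \<le> g x"
    and bd: "\<And>\<psi> e. \<psi> \<in> test_functions \<Omega> \<Longrightarrow>
      \<bar>\<integral>x. u x * frechet_derivative \<psi> (at x) e \<partial>lborel\<bar> \<le> norm e * (\<integral>x. g x * \<bar>\<psi> x\<bar> \<partial>lborel)"
  obtains h where "wgrad \<Omega> u h" "AE x in lborel. x \<in> \<Omega> \<longrightarrow> norm (h x) \<le> g x"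
proof -
  have id: "integrable lborel (\<lambda>x. u x * frechet_derivative \<psi> (at x) e)" if "\<psi> \<in> test_functions \<Omega>" for \<psi> e
    using loc_int_test_deriv[OF u that, of e] by (simp add: mult.commute)
  have "\<forall>b\<in>Basis. \<exists>h. loc_int \<Omega> h \<and> (\<forall>\<psi>\<in>test_functions \<Omega>.
      - (\<integral>x. u x * frechet_derivative \<psi> (at x) b \<partial>lborel) = (\<integral>x. h x * \<psi> x \<partial>lborel))"
  proof
    fix b :: 'a assume b: "b \<in> Basis"
    show "\<exists>h. loc_int \<Omega> h \<and> (\<forall>\<psi>\<in>test_functions \<Omega>.
      - (\<integral>x. u x * frechet_derivative \<psi> (at x) b \<partial>lborel) = (\<integral>x. h x * \<psi> x \<partial>lborel))"
    proof (rule test_functional_representation[OF g, of \<Omega> "\<lambda>\<psi>. - (\<integral>x. u x * frechet_derivative \<psi> (at x) b \<partial>lborel)"])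
      show "\<bar>- (\<integral>x. u x * frechet_derivative \<psi> (at x) b \<partial>lborel)\<bar> \<le> (\<integral>x. g x * \<bar>\<psi> x\<bar> \<partial>lborel)"
        if "\<psi> \<in> test_functions \<Omega>" for \<psi>
        using bd[OF that, of b] b by simp
    qed (use id in \<open>auto simp: frechet_derivative_add frechet_derivative_cmult distrib_left mult.left_commute\<close>)
  qed
  then obtain hb where hb: "\<And>b. b \<in> Basis \<Longrightarrow> loc_int \<Omega> (hb b)"
    "\<And>b \<psi>. b \<in> Basis \<Longrightarrow> \<psi> \<in> test_functions \<Omega> \<Longrightarrow>
      - (\<integral>x. u x * frechet_derivative \<psi> (at x) b \<partial>lborel) = (\<integral>x. hb b x * \<psi> x \<partial>lborel)"
    by metis
  define h where "h x = (\<Sum>b\<in>Basis. hb b x *\<^sub>R b)" for x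
  have hbm[measurable]: "hb b \<in> borel_measurable borel" if "b \<in> Basis" for b
    using hb(1)[OF that] by (rule loc_int_borel)
  have [measurable]: "h \<in> borel_measurable borel" unfolding h_def[abs_def] by measurable
  have h: "loc_int \<Omega> h"
    unfolding loc_int_def
  proof (intro conjI allI impI)
    fix K :: "'a set" assume K: "compact K \<and> K \<subseteq> \<Omega>"
    have "integrable lborel (\<lambda>x. \<Sum>b\<in>Basis. (indicator K x *\<^sub>R hb b x) *\<^sub>R b)"
      using K by (intro Bochner_Integration.integrable_sum integrable_scaleR_left loc_int_compact[OF hb(1)]) auto
    then show "integrable lborel (\<lambda>x. indicator K x *\<^sub>R h x)"
      by (simp add: h_def scaleR_sum_right)
  qed simp
  have hin: "h x \<bullet> b = hb b x" if "b \<in> Basis" for x b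
    using that by (simp add: h_def inner_sum_left inner_Basis if_distrib cong: if_cong)
  have w: "wgrad \<Omega> u h"
    unfolding wgrad_def
  proof (intro conjI ballI u h)
    fix \<psi> b assume "\<psi> \<in> test_functions \<Omega>" "b \<in> (Basis :: 'a set)"
    then show "(\<integral>x. u x * frechet_derivative \<psi> (at x) b \<partial>lborel) = - (\<integral>x. (h x \<bullet> b) * \<psi> x \<partial>lborel)"
      using hb(2)[of b \<psi>] by (simp add: hin)
  qed
  have ih: "integrable lborel (\<lambda>x. (h x \<bullet> e) * \<psi> x)" if "\<psi> \<in> test_functions \<Omega>" for \<psi> e
    using integrable_inner_left[OF loc_int_test[OF h that], of e] by (simp add: mult.commute)
  have he: "\<bar>\<integral>x. (h x \<bullet> e) * \<psi> x \<partial>lborel\<bar> \<le> norm e * (\<integral>x. g x * \<bar>\<psi> x\<bar> \<partial>lborel)" if t: "\<psi> \<in> test_functions \<Omega>" for \<psi> e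
  proof -
    have "(\<integral>x. (h x \<bullet> e) * \<psi> x \<partial>lborel) = (\<integral>x. (\<Sum>b\<in>Basis. (e \<bullet> b) * ((h x \<bullet> b) * \<psi> x)) \<partial>lborel)"
    proof (intro Bochner_Integration.integral_cong refl)
      fix x
      show "(h x \<bullet> e) * \<psi> x = (\<Sum>b\<in>Basis. (e \<bullet> b) * ((h x \<bullet> b) * \<psi> x))"
        unfolding euclidean_inner[of "h x" e] sum_distrib_right by (intro sum.cong refl) (simp only: mult_ac)
    qed
    also have "\<dots> = (\<Sum>b\<in>Basis. (e \<bullet> b) * (\<integral>x. (h x \<bullet> b) * \<psi> x \<partial>lborel))"
      using ih[OF t] by (subst Bochner_Integration.integral_sum) auto
    also have "\<dots> = (\<Sum>b\<in>Basis. (e \<bullet> b) * - (\<integral>x. u x * frechet_derivative \<psi> (at x) b \<partial>lborel))"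
      using t by (intro sum.cong) (simp_all add: hin hb)
    also have "\<dots> = - (\<integral>x. (\<Sum>b\<in>Basis. (e \<bullet> b) * (u x * frechet_derivative \<psi> (at x) b)) \<partial>lborel)"
      using id[OF t] by (subst Bochner_Integration.integral_sum) (auto simp: sum_negf)
    also have "\<dots> = - (\<integral>x. u x * frechet_derivative \<psi> (at x) e \<partial>lborel)"
      by (subst test_functions_deriv_eq_sum[OF t, of _ e]) (simp add: sum_distrib_left mult_ac)
    finally show ?thesis using bd[OF t, of e] by simp
  qed
  have ig: "integrable lborel (\<lambda>x. g x * \<psi> x)" if "\<psi> \<in> test_functions \<Omega>" for \<psi>
    using loc_int_test[OF g(1), of \<psi>] that by (simp add: test_functions_mono mult.commute)
  have gl: "loc_int \<Omega> g" using g(1) by (auto simp: loc_int_def)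
  have one: "AE x in lborel. x \<in> \<Omega> \<longrightarrow> h x \<bullet> e \<le> norm e * g x" for e
  proof -
    have "AE x in lborel. x \<in> \<Omega> \<longrightarrow> 0 \<le> norm e * g x - h x \<bullet> e"
    proof (rule nonneg_AE_if_nonneg_test[OF \<Omega>])
      show "loc_int \<Omega> (\<lambda>x. norm e * g x - h x \<bullet> e)"
        unfolding loc_int_def
      proof (intro conjI allI impI)
        show "(\<lambda>x. norm e * g x - h x \<bullet> e) \<in> borel_measurable borel"
          using loc_int_borel[OF gl] by measurable
        fix K assume K: "compact K \<and> K \<subseteq> \<Omega>"
        have "integrable lborel (\<lambda>x. norm e * (indicator K x *\<^sub>R g x) - (indicator K x *\<^sub>R h x) \<bullet> e)"
          using K by (intro Bochner_Integration.integrable_diff integrable_mult_right integrable_inner_left loc_int_compact[OF gl] loc_int_compact[OF h]) auto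
        then show "integrable lborel (\<lambda>x. indicator K x *\<^sub>R (norm e * g x - h x \<bullet> e))"
          by (simp add: algebra_simps)
      qed
      fix \<psi> assume t: "\<psi> \<in> test_functions \<Omega>" and p: "\<And>x. 0 \<le> \<psi> x"
      have "(\<integral>x. (norm e * g x - h x \<bullet> e) * \<psi> x \<partial>lborel) = norm e * (\<integral>x. g x * \<psi> x \<partial>lborel) - (\<integral>x. (h x \<bullet> e) * \<psi> x \<partial>lborel)"
        using ih[OF t, of e] ig[OF t] by (simp add: left_diff_distrib mult.assoc)
      also have "\<dots> \<ge> 0" using he[OF t, of e] p by simp
      finally show "0 \<le> (\<integral>x. (norm e * g x - h x \<bullet> e) * \<psi> x \<partial>lborel)" .
    qed
    then show ?thesis by simp
  qed
  \<comment> \<open>The direction \<open>h x\<close> depends on the point, so one null set must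
    serve all directions: a countable dense set suffices, since the inequality is closed in
    \<open>e\<close>.\<close>
  obtain D :: "'a set" where D: "countable D" "\<And>X. open X \<Longrightarrow> X \<noteq> {} \<Longrightarrow> \<exists>d\<in>D. d \<in> X"
    by (rule countable_dense_setE) blast
  have "AE x in lborel. \<forall>e\<in>D. x \<in> \<Omega> \<longrightarrow> h x \<bullet> e \<le> norm e * g x"
    using D(1) one by (subst AE_ball_countable) auto
  then have "AE x in lborel. x \<in> \<Omega> \<longrightarrow> norm (h x) \<le> g x"
  proof eventually_elim
    case (elim x)
    show ?case
    proof
      assume x: "x \<in> \<Omega>"
      have "closed {e. h x \<bullet> e \<le> norm e * g x}"
        by (intro closed_Collect_le continuous_intros)
      then have "open {e. \<not> h x \<bullet> e \<le> norm e * g x}"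
        by (simp add: open_closed Collect_neg_eq[symmetric] Compl_eq[symmetric] set_eq_iff flip: Collect_neg_eq)
      with D(2)[of "{e. \<not> h x \<bullet> e \<le> norm e * g x}"] elim x have "h x \<bullet> h x \<le> norm (h x) * g x"
        by blast
      then have "norm (h x) * norm (h x) \<le> norm (h x) * g x"
        by (simp add: power2_norm_eq_inner[symmetric] power2_eq_square)
      then show "norm (h x) \<le> g x"
        using g(2)[of x] by (cases "h x = 0") auto
    qed
  qed
  with w show ?thesis by (rule that)
qed

section \<open>Difference quotients bounded by averages over segments\<close>

lemma compact_cball_enlarge:
  fixes K :: "'a::euclidean_space set"
  assumes "compact K"
  shows "compact {x + y | x y. x \<in> K \<and> y \<in> cball 0 r}"
  using assms by (intro compact_sums) auto

lemma loc_int_integrable: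
  fixes f :: "'a::euclidean_space \<Rightarrow> 'b::euclidean_space"
  assumes "integrable lborel f"
  shows "loc_int \<Omega> f"
  unfolding loc_int_def
  using borel_measurable_integrable[OF assms] assms
  by (auto intro!: integrable_mult_indicator simp: borel_compact)

lemma loc_int_indicator:
  fixes f :: "'a::euclidean_space \<Rightarrow> 'b::euclidean_space"
  assumes f: "loc_int \<Omega> f" and A[measurable]: "A \<in> sets borel"
  shows "loc_int \<Omega> (\<lambda>x. indicator A x *\<^sub>R f x)"
  unfolding loc_int_def
proof (intro conjI allI impI)
  have [measurable]: "f \<in> borel_measurable borel" using f by (rule loc_int_borel)
  show "(\<lambda>x. indicator A x *\<^sub>R f x) \<in> borel_measurable borel" by simp
  fix K assume "compact K \<and> K \<subseteq> \<Omega>"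
  then have "integrable lborel (\<lambda>x. indicator A x *\<^sub>R (indicator K x *\<^sub>R f x))"
    by (intro integrable_mult_indicator loc_int_compact[OF f]) auto
  then show "integrable lborel (\<lambda>x. indicator K x *\<^sub>R indicator A x *\<^sub>R f x)"
    by (simp add: mult.commute)
qed

text \<open>For shifts of length below 1 only values on the unit neighbourhood of \<open>K\<close>
  matter, and cutting \<open>g\<close> off there makes it globally integrable.\<close>

lemma L1_local_translation:
  fixes g :: "'a::euclidean_space \<Rightarrow> real"
  assumes g: "loc_int UNIV g" and K: "compact K" and \<epsilon>: "0 < \<epsilon>"
  shows "\<exists>d>0. \<forall>h. norm h < d \<longrightarrow> (\<integral>\<^sup>+x. ennreal (indicator K x * \<bar>g (x + h) - g x\<bar>) \<partial>lborel) \<le> ennreal \<epsilon>"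
proof -
  have [measurable]: "g \<in> borel_measurable borel" using g by (rule loc_int_borel)
  define K' where "K' = {x + y | x y. x \<in> K \<and> y \<in> cball (0::'a) 1}"
  have K': "compact K'" unfolding K'_def using K by (rule compact_cball_enlarge)
  then have [measurable]: "K' \<in> sets borel" by (rule borel_compact)
  define f where "f x = indicator K' x *\<^sub>R g x" for x
  have [measurable]: "f \<in> borel_measurable borel" unfolding f_def[abs_def] by measurable
  have "integrable lborel f" unfolding f_def using K' by (intro loc_int_compact[OF g]) auto
  then have "Lp_pow 1 f < \<infinity>" by (simp add: Lp_pow_one integrable_iff_bounded)
  then have "Lp_translation_continuous 1 f" by (intro Lp_translation_continuous) auto
  then obtain d where d: "d > 0" "\<And>h. norm h < d \<Longrightarrow> Lp_pow 1 (\<lambda>x. f (x + h) - f x) \<le> ennreal \<epsilon>"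
    unfolding Lp_translation_continuous_def using \<epsilon> by blast
  show ?thesis
  proof (intro exI[of _ "min d 1"] conjI allI impI)
    fix h :: 'a assume h: "norm h < min d 1"
    have "(\<integral>\<^sup>+x. ennreal (indicator K x * \<bar>g (x + h) - g x\<bar>) \<partial>lborel) \<le> Lp_pow 1 (\<lambda>x. f (x + h) - f x)"
      unfolding Lp_pow_one
    proof (intro nn_integral_mono ennreal_leI)
      fix x
      have "x + z \<in> K'" if "x \<in> K" "norm z \<le> 1" for z
        using that unfolding K'_def by auto
      from this[of 0] this[of h] h have "x \<in> K' \<and> x + h \<in> K'" if "x \<in> K"
        using that by simp
      then show "indicator K x * \<bar>g (x + h) - g x\<bar> \<le> norm (f (x + h) - f x)"
        by (auto simp: f_def indicator_def)
    qed
    also have "\<dots> \<le> ennreal \<epsilon>" using h by (intro d(2)) auto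
    finally show "(\<integral>\<^sup>+x. ennreal (indicator K x * \<bar>g (x + h) - g x\<bar>) \<partial>lborel) \<le> ennreal \<epsilon>" .
  qed (use d in auto)
qed

text \<open>As \<open>w\<close> tends to zero the averaged integrand tends to
  \<open>g1 + 2 * indicator A * g2\<close> in the weighted integral. The indicator at the far
  endpoint has no continuity of its own and is handled through the translate of the product
  \<open>indicator A * g2\<close>.\<close>

lemma segment_average_estimate:
  fixes g1 g2 \<psi> :: "'a::euclidean_space \<Rightarrow> real"
  assumes g1: "loc_int UNIV g1" "\<And>x. 0 \<le> g1 x" and g2: "loc_int UNIV g2" "\<And>x. 0 \<le> g2 x"
    and A[measurable]: "A \<in> sets borel" and K: "compact K"
    and \<psi>[measurable]: "\<psi> \<in> borel_measurable borel" and B: "\<And>x. \<bar>\<psi> x\<bar> \<le> B" and z: "\<And>x. x \<notin> K \<Longrightarrow> \<psi> x = 0"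
    and \<epsilon>: "0 < \<epsilon>"
  shows "\<exists>d>0. \<forall>w. norm w < d \<longrightarrow>
    (\<integral>\<^sup>+x. ennreal \<bar>\<psi> x\<bar> * (\<integral>\<^sup>+t. ennreal (g1 (x + t *\<^sub>R w) + (indicator A x + indicator A (x + w)) * g2 (x + t *\<^sub>R w))
        * indicator {0..1} t \<partial>lborel) \<partial>lborel)
    \<le> (\<integral>\<^sup>+x. ennreal (\<bar>\<psi> x\<bar> * (g1 x + 2 * indicator A x * g2 x)) \<partial>lborel) + ennreal (5 * B * \<epsilon>)"
proof -
  define k where "k x = indicator A x *\<^sub>R g2 x" for x
  have k: "loc_int UNIV k" unfolding k_def[abs_def] by (rule loc_int_indicator[OF g2(1) A])
  have [measurable]: "g1 \<in> borel_measurable borel" "g2 \<in> borel_measurable borel" "k \<in> borel_measurable borel"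
    using g1 g2 k loc_int_borel by blast+
  have [measurable]: "K \<in> sets borel" using K by (rule borel_compact)
  have B0: "0 \<le> B" using B[of undefined] by linarith
  let ?I = "\<lambda>g h. (\<integral>\<^sup>+x. ennreal (indicator K x * \<bar>g (x + h) - g x\<bar>) \<partial>lborel)"
  obtain d1 where d1: "d1 > 0" "\<And>h. norm h < d1 \<Longrightarrow> ?I g1 h \<le> ennreal \<epsilon>"
    using L1_local_translation[OF g1(1) K \<epsilon>] by blast
  obtain d2 where d2: "d2 > 0" "\<And>h. norm h < d2 \<Longrightarrow> ?I g2 h \<le> ennreal \<epsilon>"
    using L1_local_translation[OF g2(1) K \<epsilon>] by blast
  obtain d3 where d3: "d3 > 0" "\<And>h. norm h < d3 \<Longrightarrow> ?I k h \<le> ennreal \<epsilon>"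
    using L1_local_translation[OF k K \<epsilon>] by blast
  let ?G = "\<lambda>x. g1 x + 2 * indicator A x * g2 x"
  let ?N = "(\<integral>\<^sup>+x. ennreal (\<bar>\<psi> x\<bar> * ?G x) \<partial>lborel) + ennreal (5 * B * \<epsilon>)"
  show ?thesis
  proof (intro exI[of _ "min d1 (min d2 d3)"] conjI allI impI)
    fix w :: 'a assume w: "norm w < min d1 (min d2 d3)"
    let ?H = "\<lambda>x t. g1 (x + t *\<^sub>R w) + (indicator A x + indicator A (x + w)) * g2 (x + t *\<^sub>R w)"
    have H0: "0 \<le> ?H x t" for x t using g1(2) g2(2) by simp
    have inner: "(\<integral>\<^sup>+x. ennreal (\<bar>\<psi> x\<bar> * ?H x t) \<partial>lborel) \<le> ?N" if t: "0 \<le> t" "t \<le> 1" for t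
    proof -
      have tw: "norm (t *\<^sub>R w) \<le> norm w"
        using t by (simp add: mult_left_le_one_le)
      let ?D = "\<lambda>g h x. indicator K x * \<bar>g (x + h) - g x\<bar>"
      have "(\<integral>\<^sup>+x. ennreal (\<bar>\<psi> x\<bar> * ?H x t) \<partial>lborel) \<le>
        (\<integral>\<^sup>+x. ennreal (\<bar>\<psi> x\<bar> * ?G x) + ennreal B * (ennreal (?D g1 (t *\<^sub>R w) x) + 2 * ennreal (?D g2 (t *\<^sub>R w) x)
           + ennreal (?D g2 w x) + ennreal (?D k w x)) \<partial>lborel)"
      proof (rule nn_integral_mono)
        fix x
        have "\<bar>\<psi> x\<bar> * ?H x t \<le> \<bar>\<psi> x\<bar> * ?G x + B * (?D g1 (t *\<^sub>R w) x + 2 * ?D g2 (t *\<^sub>R w) x + ?D g2 w x + ?D k w x)"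
        proof (cases "x \<in> K")
          case True
          let ?R = "\<bar>g1 (x + t *\<^sub>R w) - g1 x\<bar> + 2 * \<bar>g2 (x + t *\<^sub>R w) - g2 x\<bar> + \<bar>g2 (x + w) - g2 x\<bar> + \<bar>k (x + w) - k x\<bar>"
          have "?H x t \<le> ?G x + ?R"
          proof -
            \<comment> \<open>The values \<open>a\<close>, \<open>b\<close> are the indicators at
              the two ends, and \<open>q\<close>, \<open>q0\<close>, \<open>qw\<close> those of
              \<open>g2\<close> at \<open>x + t w\<close>, \<open>x\<close>, \<open>x + w\<close>.
              One passes from \<open>b * q\<close> through \<open>b * qw\<close> to
              \<open>a * q0\<close>. Four kinds of error with weights 1, 2, 1, 1 give the factor
              5.\<close>
            have *: "p + (a + b) * q \<le> p0 + 2 * a * q0 + (\<bar>p - p0\<bar> + 2 * \<bar>q - q0\<bar> + \<bar>qw - q0\<bar> + \<bar>b * qw - a * q0\<bar>)"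
              if "a \<in> {0, 1}" "b \<in> {0, 1}" "0 \<le> q" "0 \<le> q0" "0 \<le> qw" for a b p p0 q q0 qw :: real
              using that by (auto simp: abs_if)
            show ?thesis
              using *[of "indicator A x" "indicator A (x + w)"] g2(2) by (simp add: k_def indicator_def)
          qed
          then have "\<bar>\<psi> x\<bar> * ?H x t \<le> \<bar>\<psi> x\<bar> * (?G x + ?R)" by (rule mult_left_mono) simp
          also have "\<dots> \<le> \<bar>\<psi> x\<bar> * ?G x + B * ?R"
            unfolding distrib_left[of "\<bar>\<psi> x\<bar>" "?G x"] by (intro add_mono order_refl mult_right_mono B) auto
          finally show ?thesis using True by simp
        qed (simp add: z)
        then have "ennreal (\<bar>\<psi> x\<bar> * ?H x t) \<le> ennreal (\<bar>\<psi> x\<bar> * ?G x + B * (?D g1 (t *\<^sub>R w) x + 2 * ?D g2 (t *\<^sub>R w) x + ?D g2 w x + ?D k w x))"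
          by (rule ennreal_leI)
        also have "\<dots> = ennreal (\<bar>\<psi> x\<bar> * ?G x) + ennreal B * (ennreal (?D g1 (t *\<^sub>R w) x) + 2 * ennreal (?D g2 (t *\<^sub>R w) x)
           + ennreal (?D g2 w x) + ennreal (?D k w x))"
          using g1(2)[of x] g2(2)[of x] B0 by (simp add: ennreal_plus ennreal_mult)
        finally show "ennreal (\<bar>\<psi> x\<bar> * ?H x t) \<le> \<dots>" .
      qed
      also have "\<dots> = (\<integral>\<^sup>+x. ennreal (\<bar>\<psi> x\<bar> * ?G x) \<partial>lborel) + ennreal B * (?I g1 (t *\<^sub>R w) + 2 * ?I g2 (t *\<^sub>R w) + ?I g2 w + ?I k w)"
        by (simp add: nn_integral_add nn_integral_cmult)
      also have "\<dots> \<le> (\<integral>\<^sup>+x. ennreal (\<bar>\<psi> x\<bar> * ?G x) \<partial>lborel) + ennreal B * (ennreal \<epsilon> + 2 * ennreal \<epsilon> + ennreal \<epsilon> + ennreal \<epsilon>)"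
        using w tw by (intro add_mono mult_left_mono order_refl d1 d2 d3) auto
      also have "ennreal B * (ennreal \<epsilon> + 2 * ennreal \<epsilon> + ennreal \<epsilon> + ennreal \<epsilon>) = ennreal (5 * B * \<epsilon>)"
      proof -
        have "ennreal \<epsilon> + 2 * ennreal \<epsilon> + ennreal \<epsilon> + ennreal \<epsilon> = ennreal (5 * \<epsilon>)"
          using \<epsilon> by (simp add: ennreal_mult[symmetric] ennreal_numeral[symmetric] ennreal_plus[symmetric] del: ennreal_plus ennreal_numeral)
        then show ?thesis using \<epsilon> B0 by (simp add: ennreal_mult[symmetric] mult_ac)
      qed
      finally show ?thesis .
    qed
    have "(\<integral>\<^sup>+x. ennreal \<bar>\<psi> x\<bar> * (\<integral>\<^sup>+t. ennreal (?H x t) * indicator {0..1} t \<partial>lborel) \<partial>lborel)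
      = (\<integral>\<^sup>+x. \<integral>\<^sup>+t. ennreal (\<bar>\<psi> x\<bar> * ?H x t) * indicator {0..1} t \<partial>lborel \<partial>lborel)"
      using H0 by (intro nn_integral_cong) (simp add: nn_integral_cmult[symmetric] ennreal_mult mult.assoc)
    also have "\<dots> = (\<integral>\<^sup>+t. \<integral>\<^sup>+x. ennreal (\<bar>\<psi> x\<bar> * ?H x t) * indicator {0..1} t \<partial>lborel \<partial>lborel)"
      by (rule lborel_pair.Fubini'[symmetric]) simp
    also have "\<dots> = (\<integral>\<^sup>+t. (\<integral>\<^sup>+x. ennreal (\<bar>\<psi> x\<bar> * ?H x t) \<partial>lborel) * indicator {0..1} t \<partial>lborel)"
      by (intro nn_integral_cong) (simp add: nn_integral_multc)
    also have "\<dots> \<le> (\<integral>\<^sup>+t. ?N * indicator {0..1::real} t \<partial>lborel)"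
      using inner by (intro nn_integral_mono) (auto simp: indicator_def)
    also have "\<dots> = ?N" by (simp add: nn_integral_cmult_indicator)
    finally show "(\<integral>\<^sup>+x. ennreal \<bar>\<psi> x\<bar> * (\<integral>\<^sup>+t. ennreal (?H x t) * indicator {0..1} t \<partial>lborel) \<partial>lborel) \<le> ?N" .
  qed (use d1 d2 d3 in auto)
qed


text \<open>Translating the test function instead of \<open>u\<close> turns the bound on differences
  of \<open>u\<close> into a bound on its distributional derivative. The second term, active only if
  an endpoint lies in \<open>A\<close>, serves minima of two functions; with \<open>A\<close> empty
  it disappears.\<close>

theorem wgrad_difference_quotient:
  fixes u g1 g2 :: "'a::euclidean_space \<Rightarrow> real"
  assumes \<Omega>: "open \<Omega>" and u: "loc_int \<Omega> u"
    and g1: "loc_int UNIV g1" "\<And>x. 0 \<le> g1 x" and g2: "loc_int UNIV g2" "\<And>x. 0 \<le> g2 x"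
    and A[measurable]: "A \<in> sets borel"
    and dq: "\<And>K. compact K \<Longrightarrow> K \<subseteq> \<Omega> \<Longrightarrow> \<exists>d>0. \<forall>w. norm w < d \<longrightarrow> (AE x in lborel. x \<in> K \<longrightarrow>
      ennreal \<bar>u (x + w) - u x\<bar> \<le> ennreal (norm w) *
      (\<integral>\<^sup>+t. ennreal (g1 (x + t *\<^sub>R w) + (indicator A x + indicator A (x + w)) * g2 (x + t *\<^sub>R w))
        * indicator {0..1} t \<partial>lborel))"
  obtains h where "wgrad \<Omega> u h"
    "AE x in lborel. x \<in> \<Omega> \<longrightarrow> norm (h x) \<le> g1 x + 2 * indicator A x * g2 x"
proof (rule wgrad_if_bounded[OF \<Omega> u])
  let ?G = "\<lambda>x. g1 x + 2 * indicator A x * g2 x"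
  show G0: "0 \<le> ?G x" for x using g1(2) g2(2) by simp
  show G: "loc_int UNIV ?G"
    unfolding loc_int_def
  proof (intro conjI allI impI)
    show "?G \<in> borel_measurable borel" using loc_int_borel[OF g1(1)] loc_int_borel[OF g2(1)] by measurable
    fix K :: "'a set" assume "compact K \<and> K \<subseteq> UNIV"
    then have "integrable lborel (\<lambda>x. indicator K x *\<^sub>R g1 x + 2 * (indicator K x *\<^sub>R (indicator A x *\<^sub>R g2 x)))"
      by (intro Bochner_Integration.integrable_add integrable_mult_right loc_int_compact[OF g1(1)]
          loc_int_compact[OF loc_int_indicator[OF g2(1) A]]) auto
    then show "integrable lborel (\<lambda>x. indicator K x *\<^sub>R ?G x)"
      by (simp add: algebra_simps)
  qed
  show ?thesis if "wgrad \<Omega> u h" "AE x in lborel. x \<in> \<Omega> \<longrightarrow> norm (h x) \<le> ?G x" for h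
    using that by (rule \<open>\<And>h. wgrad \<Omega> u h \<Longrightarrow> AE x in lborel. x \<in> \<Omega> \<longrightarrow> norm (h x) \<le> ?G x \<Longrightarrow> thesis\<close>)
  fix \<psi> :: "'a \<Rightarrow> real" and e :: 'a assume t: "\<psi> \<in> test_functions \<Omega>"
  have [measurable]: "\<psi> \<in> borel_measurable borel" "u \<in> borel_measurable borel"
    using t u test_functions_borel loc_int_borel by blast+
  have [measurable]: "g1 \<in> borel_measurable borel" "g2 \<in> borel_measurable borel"
    using g1(1) g2(1) loc_int_borel by blast+
  have t': "\<psi> \<in> test_functions UNIV" using t by (rule test_functions_mono) simp
  obtain K where K: "compact K" "K \<subseteq> \<Omega>" "\<And>x. x \<notin> K \<Longrightarrow> \<psi> x = 0"
    using t by (rule test_functions_support) blast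
  obtain B where B: "0 \<le> B" "\<And>x. \<bar>\<psi> x\<bar> \<le> B" using t by (rule test_functions_bounded) blast
  obtain r where r: "r > 0" "(\<Union>x\<in>K. cball x r) \<subseteq> \<Omega>"
    using compact_subset_open_imp_cball_epsilon_subset[OF K(1) \<Omega> K(2)] by blast
  define K' where "K' = {x + y | x y. x \<in> K \<and> y \<in> cball (0::'a) r}"
  have K': "compact K'" unfolding K'_def using K(1) by (rule compact_cball_enlarge)
  have K'\<Omega>: "K' \<subseteq> \<Omega>"
  proof
    fix z assume "z \<in> K'"
    then obtain x y where "z = x + y" "x \<in> K" "norm y \<le> r" by (auto simp: K'_def)
    then have "x \<in> K" "z \<in> cball x r" by (auto simp: dist_norm)
    then show "z \<in> \<Omega>" using r(2) by blast
  qed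
  have KK': "x + w \<in> K'" if "x \<in> K" "norm w \<le> r" for x w
    using that by (auto simp: K'_def)
  have KK0: "x \<in> K'" if "x \<in> K" for x using KK'[OF that, of 0] r by simp
  have [measurable]: "K' \<in> sets borel" using K' by (rule borel_compact)
  \<comment> \<open>Cutting off at a neighbourhood of the support makes the global convolution
    available without changing \<open>u\<close> at the points that short translates reach.\<close>
  define v where "v x = indicator K' x *\<^sub>R u x" for x
  have vi: "integrable lborel v" unfolding v_def by (rule loc_int_compact[OF u K' K'\<Omega>])
  have v: "loc_int UNIV v" using vi by (rule loc_int_integrable)
  have [measurable]: "v \<in> borel_measurable borel" using v by (rule loc_int_borel)
  define \<psi>' where "\<psi>' y = \<psi> (0 - y)" for y
  have ps': "\<psi>' \<in> test_functions UNIV" unfolding \<psi>'_def by (rule test_functions_reflect[OF t'])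
  \<comment> \<open>Because of the reflection in \<open>\<psi>'\<close> this is the integral of
    \<open>\<psi> (y - s e) * v y\<close>. Its derivative at 0 is minus the integral of
    \<open>u\<close> against the directional derivative of \<open>\<psi>\<close>.\<close>
  define F where "F s = convolve \<psi>' v (s *\<^sub>R e)" for s
  define Du where "Du = (\<integral>x. u x * frechet_derivative \<psi> (at x) e \<partial>lborel)"
  have F: "(F has_real_derivative - Du) (at 0)"
  proof -
    have a: "(convolve \<psi>' v has_derivative (\<lambda>e. \<integral>y. frechet_derivative \<psi>' (at (0 - y)) e * v y \<partial>lborel)) (at (0 *\<^sub>R e))"
      using convolve_has_derivative[OF ps' v, of 0] by simp
    have b: "((\<lambda>s. s *\<^sub>R e) has_derivative (\<lambda>s. s *\<^sub>R e)) (at 0)"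
      by (auto intro!: derivative_eq_intros)
    have "(F has_derivative (\<lambda>s. \<integral>y. frechet_derivative \<psi>' (at (0 - y)) (s *\<^sub>R e) * v y \<partial>lborel)) (at 0)"
      unfolding F_def[abs_def]
      using has_derivative_compose[of "\<lambda>s. s *\<^sub>R e" "\<lambda>s. s *\<^sub>R e" 0 UNIV "convolve \<psi>' v", OF b a] .
    moreover have "(\<integral>y. frechet_derivative \<psi>' (at (0 - y)) (s *\<^sub>R e) * v y \<partial>lborel) = - Du * s" for s
    proof -
      have "frechet_derivative \<psi>' (at (0 - y)) (s *\<^sub>R e) * v y = - s * (u y * frechet_derivative \<psi> (at y) e)" for y
      proof -
        have "frechet_derivative \<psi>' (at (0 - y)) (s *\<^sub>R e) = - frechet_derivative \<psi> (at y) (s *\<^sub>R e)"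
          unfolding \<psi>'_def[abs_def] by (subst frechet_derivative_reflect[OF t']) simp
        also have "\<dots> = - s * frechet_derivative \<psi> (at y) e"
          using has_derivative_linear[OF test_functions_has_derivative[OF t]] by (simp add: linear_cmul)
        finally show ?thesis
          using KK0[of y] test_functions_deriv_zero[OF t K(1,3), of y e] by (cases "y \<in> K") (auto simp: v_def)
      qed
      then show ?thesis by (simp add: Du_def mult.commute)
    qed
    ultimately show ?thesis unfolding has_field_derivative_def by (simp only:)
  qed
  define I where "I = (\<integral>x. ?G x * \<bar>\<psi> x\<bar> \<partial>lborel)"
  have Ii: "integrable lborel (\<lambda>x. ?G x * \<bar>\<psi> x\<bar>)"
    using integrable_norm[OF loc_int_test[OF G t']] G0 by (simp add: abs_mult mult.commute)
  have I0: "0 \<le> I" unfolding I_def using G0 by (intro integral_nonneg_AE) auto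
  have In: "(\<integral>\<^sup>+x. ennreal (\<bar>\<psi> x\<bar> * ?G x) \<partial>lborel) = ennreal I"
    unfolding I_def using Ii G0 by (subst nn_integral_eq_integral[symmetric]) (auto simp: mult.commute)
  have "\<bar>Du\<bar> \<le> norm e * I + \<epsilon>" if \<epsilon>: "\<epsilon> > 0" for \<epsilon>
  proof -
    \<comment> \<open>The summand 1 keeps the denominator positive when \<open>e = 0\<close> or
      \<open>B = 0\<close>.\<close>
    define \<delta> where "\<delta> = \<epsilon> / (norm e * (5 * B) + 1)"
    have pos1: "norm e * (5 * B) + 1 > 0" using B(1) by (intro add_nonneg_pos) auto
    then have \<delta>: "\<delta> > 0" using \<epsilon> by (simp add: \<delta>_def)
    obtain d1 where d1: "d1 > 0" "\<And>w. norm w < d1 \<Longrightarrow> 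
      (\<integral>\<^sup>+x. ennreal \<bar>\<psi> x\<bar> * (\<integral>\<^sup>+t. ennreal (g1 (x + t *\<^sub>R w) + (indicator A x + indicator A (x + w)) * g2 (x + t *\<^sub>R w))
        * indicator {0..1} t \<partial>lborel) \<partial>lborel)
      \<le> (\<integral>\<^sup>+x. ennreal (\<bar>\<psi> x\<bar> * ?G x) \<partial>lborel) + ennreal (5 * B * \<delta>)"
      using segment_average_estimate[where \<psi>=\<psi>, OF g1 g2 A K(1) _ B(2) K(3) \<delta>] by auto
    obtain d2 where d2: "d2 > 0" "\<And>w. norm w < d2 \<Longrightarrow> (AE x in lborel. x \<in> K \<longrightarrow>
      ennreal \<bar>u (x + w) - u x\<bar> \<le> ennreal (norm w) *
      (\<integral>\<^sup>+t. ennreal (g1 (x + t *\<^sub>R w) + (indicator A x + indicator A (x + w)) * g2 (x + t *\<^sub>R w))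
        * indicator {0..1} t \<partial>lborel))"
      using dq[OF K(1,2)] by auto
    have Fb: "\<bar>(F s - F 0) / s\<bar> \<le> norm e * (I + 5 * B * \<delta>)" if s: "0 < s" "norm (s *\<^sub>R e) < min r (min d1 d2)" for s
    proof -
      let ?w = "s *\<^sub>R e"
      let ?S = "\<lambda>x. (\<integral>\<^sup>+t. ennreal (g1 (x + t *\<^sub>R ?w) + (indicator A x + indicator A (x + ?w)) * g2 (x + t *\<^sub>R ?w))
        * indicator {0..1} t \<partial>lborel)"
      have wd2: "norm ?w < d2" using s(2) by simp
      have i1: "integrable lborel (\<lambda>y. \<psi> (y - ?w) * v y)"
        using integrable_convolve[OF ps' v, of ?w] by (simp add: \<psi>'_def)
      have i2: "integrable lborel (\<lambda>y. \<psi> y * v y)"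
        using integrable_convolve[OF ps' v, of 0] by (simp add: \<psi>'_def)
      have i1': "integrable lborel (\<lambda>x. \<psi> x * v (x + ?w))"
        using integrable_lborel_translate[OF i1, of ?w] by simp
      have "F s - F 0 = (\<integral>y. \<psi> (y - ?w) * v y \<partial>lborel) - (\<integral>y. \<psi> y * v y \<partial>lborel)"
        by (simp add: F_def convolve_def \<psi>'_def)
      also have "(\<integral>y. \<psi> (y - ?w) * v y \<partial>lborel) = (\<integral>x. \<psi> (x + ?w - ?w) * v (x + ?w) \<partial>lborel)"
        by (rule integral_lborel_translate[symmetric]) simp
      also have "\<dots> - (\<integral>y. \<psi> y * v y \<partial>lborel) = (\<integral>x. \<psi> x * (v (x + ?w) - v x) \<partial>lborel)"
        using i1' i2 by (simp add: right_diff_distrib)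
      finally have Feq: "F s - F 0 = (\<integral>x. \<psi> x * (v (x + ?w) - v x) \<partial>lborel)" .
      have "ennreal \<bar>F s - F 0\<bar> \<le> (\<integral>\<^sup>+x. ennreal \<bar>\<psi> x * (v (x + ?w) - v x)\<bar> \<partial>lborel)"
        using integral_norm_bound_ennreal[of lborel "\<lambda>x. \<psi> x * (v (x + ?w) - v x)"] i1' i2
        unfolding Feq by (simp add: right_diff_distrib)
      also have "\<dots> \<le> (\<integral>\<^sup>+x. ennreal (norm ?w) * (ennreal \<bar>\<psi> x\<bar> * ?S x) \<partial>lborel)"
      proof (rule nn_integral_mono_AE)
        show "AE x in lborel. ennreal \<bar>\<psi> x * (v (x + ?w) - v x)\<bar> \<le> ennreal (norm ?w) * (ennreal \<bar>\<psi> x\<bar> * ?S x)"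
          using d2(2)[OF wd2]
        proof eventually_elim
          case (elim x)
          show ?case
          proof (cases "x \<in> K")
            case True
            then have "v (x + ?w) = u (x + ?w)" "v x = u x"
              using KK'[OF True, of ?w] KK0[OF True] s by (auto simp: v_def)
            then have "ennreal \<bar>\<psi> x * (v (x + ?w) - v x)\<bar> = ennreal \<bar>\<psi> x\<bar> * ennreal \<bar>u (x + ?w) - u x\<bar>"
              by (simp add: abs_mult ennreal_mult)
            also have "\<dots> \<le> ennreal \<bar>\<psi> x\<bar> * (ennreal (norm ?w) * ?S x)"
              using elim True s by (intro mult_left_mono) auto
            finally show ?thesis using s by (simp add: mult_ac)
          qed (simp add: K(3))
        qed
      qed
      also have "\<dots> = ennreal (norm ?w) * (\<integral>\<^sup>+x. ennreal \<bar>\<psi> x\<bar> * ?S x \<partial>lborel)"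
        by (rule nn_integral_cmult) simp
      also have "\<dots> \<le> ennreal (norm ?w) * (ennreal I + ennreal (5 * B * \<delta>))"
        using d1(2)[of ?w] s unfolding In by (intro mult_left_mono) auto
      also have "\<dots> = ennreal (norm ?w * (I + 5 * B * \<delta>))"
        using I0 B(1) \<delta> by (simp add: ennreal_mult ennreal_plus)
      finally have "\<bar>F s - F 0\<bar> \<le> norm ?w * (I + 5 * B * \<delta>)"
        using I0 B(1) \<delta> by (subst (asm) ennreal_le_iff) auto
      also have "\<dots> = s * (norm e * (I + 5 * B * \<delta>))" using s(1) by simp
      finally show ?thesis using s(1) by (simp add: abs_divide divide_le_eq mult.commute)
    qed
    have "((\<lambda>s. (F s - F 0) / s) \<longlongrightarrow> - Du) (at 0)"
      using F by (simp add: DERIV_def)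
    then have "((\<lambda>s. (F s - F 0) / s) \<longlongrightarrow> - Du) (at_right 0)"
      by (simp add: filterlim_at_split)
    then have lim: "((\<lambda>s. \<bar>(F s - F 0) / s\<bar>) \<longlongrightarrow> \<bar>- Du\<bar>) (at_right 0)"
      by (rule tendsto_rabs)
    have "\<forall>\<^sub>F s in at_right 0. norm (s *\<^sub>R e) < min r (min d1 d2)"
    proof -
      have "((\<lambda>s. norm (s *\<^sub>R e)) \<longlongrightarrow> norm (0 *\<^sub>R e)) (at_right 0)"
        by (intro tendsto_intros)
      from order_tendstoD(2)[OF this, of "min r (min d1 d2)"] show ?thesis using r(1) d1(1) d2(1) by simp
    qed
    moreover have "\<forall>\<^sub>F s in at_right (0::real). 0 < s" by (rule eventually_at_right_less)
    ultimately have "\<forall>\<^sub>F s in at_right 0. \<bar>(F s - F 0) / s\<bar> \<le> norm e * (I + 5 * B * \<delta>)"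
      by eventually_elim (rule Fb)
    then have "\<bar>- Du\<bar> \<le> norm e * (I + 5 * B * \<delta>)"
      by (intro tendsto_upperbound[OF lim]) auto
    also have "\<dots> = norm e * I + norm e * (5 * B) * \<delta>" by (simp add: algebra_simps)
    also have "norm e * (5 * B) * \<delta> \<le> (norm e * (5 * B) + 1) * \<delta>"
      using \<delta> by (intro mult_right_mono) auto
    also have "\<dots> = \<epsilon>" using pos1 by (simp add: \<delta>_def)
    finally show ?thesis by simp
  qed
  then have "\<bar>Du\<bar> \<le> norm e * I" by (rule field_le_epsilon)
  then show "\<bar>\<integral>x. u x * frechet_derivative \<psi> (at x) e \<partial>lborel\<bar> \<le> norm e * (\<integral>x. ?G x * \<bar>\<psi> x\<bar> \<partial>lborel)"
    by (simp add: Du_def I_def)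
qed

section \<open>The Hardy--Littlewood maximal theorem\<close>

text \<open>The complement is closed, so a nonempty one attains its distance, and a radius strictly
  below it means that the closed ball stays inside. This form also absorbs the case of the whole
  space.\<close>

lemma admissible_radii_iff:
  fixes \<Omega> :: "'a::euclidean_space set"
  assumes "open \<Omega>"
  shows "r \<in> admissible_radii \<Omega> x \<longleftrightarrow> 0 < r \<and> cball x r \<subseteq> \<Omega>"
proof (cases "\<Omega> = UNIV")
  case False
  then have ne: "- \<Omega> \<noteq> {}" by auto
  have "r < infdist x (- \<Omega>) \<longleftrightarrow> cball x r \<subseteq> \<Omega>"
  proof
    assume "r < infdist x (- \<Omega>)"
    then show "cball x r \<subseteq> \<Omega>"
      using infdist_le[of _ "- \<Omega>" x] by (force simp: subset_iff)
  next
    assume *: "cball x r \<subseteq> \<Omega>"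
    obtain y where "y \<in> - \<Omega>" "infdist x (- \<Omega>) = dist x y"
      using infdist_attains_inf[of "- \<Omega>" x] ne assms by (auto simp: closed_def)
    then show "r < infdist x (- \<Omega>)" using * by (force simp: subset_iff)
  qed
  then show ?thesis using False by (simp add: admissible_radii_def)
qed (simp add: admissible_radii_def)

text \<open>The denominator is an arbitrary function of the radius, so that the Hardy-Littlewood
  operator and the local operator are two instances that can be compared directly.\<close>

definition ball_sup :: "(real \<Rightarrow> real) \<Rightarrow> 'a::euclidean_space set \<Rightarrow> ('a \<Rightarrow> ennreal) \<Rightarrow> 'a \<Rightarrow> ennreal" where
  "ball_sup W \<Omega> F x = (SUP r\<in>{r. 0 < r \<and> cball x r \<subseteq> \<Omega>}. (\<integral>\<^sup>+y\<in>ball x r. F y \<partial>lborel) / ennreal (W r))"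

lemma ennreal_less_divide_iff:
  "0 < w \<Longrightarrow> a < b / ennreal w \<longleftrightarrow> a * ennreal w < b"
  by (cases a rule: ennreal_cases; cases b rule: ennreal_cases)
    (auto simp: divide_ennreal ennreal_mult[symmetric] ennreal_less_iff less_divide_eq
      ennreal_top_divide ennreal_top_mult ennreal_mult_less_top)

lemma ennreal_divide_antimono:
  assumes "0 < v" "v \<le> w"
  shows "a / ennreal w \<le> a / ennreal v"
proof (cases a rule: ennreal_cases)
  case (real r)
  then show ?thesis using assms by (simp add: divide_ennreal ennreal_leI divide_left_mono)
qed (use assms in \<open>simp add: ennreal_top_divide\<close>)

text \<open>Continuity from below of the measure with density \<open>F\<close> along concentric
  smaller balls.\<close>

lemma nn_integral_ball_SUP:
  fixes F :: "'a::euclidean_space \<Rightarrow> ennreal"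
  assumes F[measurable]: "F \<in> borel_measurable borel" and a: "a < (\<integral>\<^sup>+y\<in>ball x r. F y \<partial>lborel)" and r: "0 < r"
  shows "\<exists>s. 0 < s \<and> s < r \<and> a < (\<integral>\<^sup>+y\<in>ball x s. F y \<partial>lborel)"
proof -
  let ?M = "density lborel F"
  \<comment> \<open>With \<open>n + 2\<close> the radii lie strictly between 0 and \<open>r\<close>
    already for \<open>n = 0\<close>.\<close>
  let ?A = "\<lambda>n. ball x (r - r / (real n + 2))"
  have e: "emeasure ?M (ball x s) = (\<integral>\<^sup>+y\<in>ball x s. F y \<partial>lborel)" for s
    by (simp add: emeasure_density)
  have inc: "incseq ?A"
    using r by (intro incseq_SucI subset_ball) (simp add: frac_le)
  have "(\<Union>n. ?A n) = ball x r"
  proof (intro equalityI subsetI)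
    fix y assume "y \<in> ball x r"
    then have "0 < r - dist x y" by simp
    then obtain n where n: "r / (r - dist x y) < real n" using reals_Archimedean2 by blast
    then have "r < real n * (r - dist x y)" using \<open>0 < r - dist x y\<close> by (simp add: divide_less_eq)
    also have "\<dots> \<le> (real n + 2) * (r - dist x y)" using \<open>0 < r - dist x y\<close> by (intro mult_right_mono) auto
    finally have "r / (real n + 2) < r - dist x y" by (simp add: divide_less_eq mult.commute)
    then show "y \<in> (\<Union>n. ?A n)" by (auto intro!: exI[of _ n])
  next
    fix y assume "y \<in> (\<Union>n. ?A n)"
    then obtain n where "dist x y < r - r / (real n + 2)" by auto
    moreover have "0 \<le> r / (real n + 2)" using r by simp
    ultimately show "y \<in> ball x r" by simp
  qed
  then have "(SUP n. emeasure ?M (?A n)) = emeasure ?M (ball x r)"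
    by (subst SUP_emeasure_incseq[OF _ inc]) auto
  then have "a < (SUP n. emeasure ?M (?A n))" using a by (simp add: e)
  then obtain n where "a < emeasure ?M (?A n)" by (auto simp: less_SUP_iff)
  moreover have "r / (real n + 2) < r" "0 < r / (real n + 2)" using r by (auto simp: divide_less_eq)
  ultimately show ?thesis by (intro exI[of _ "r - r / (real n + 2)"]) (auto simp: e)
qed

text \<open>The strict inequality persists when the integral is taken over a slightly smaller ball
  while the weight stays \<open>W r\<close>. That smaller ball lies in \<open>ball y r\<close> for
  every nearby \<open>y\<close>, and \<open>cball y r\<close> is still inside
  \<open>\<Omega>\<close>.\<close>

lemma open_ball_sup_superlevel:
  fixes F :: "'a::euclidean_space \<Rightarrow> ennreal"
  assumes F[measurable]: "F \<in> borel_measurable borel" and \<Omega>: "open \<Omega>" and W: "\<And>r. 0 < r \<Longrightarrow> 0 < W r"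
  shows "open {x. a < ball_sup W \<Omega> F x}"
  unfolding open_dist
proof (intro ballI)
  fix x assume "x \<in> {x. a < ball_sup W \<Omega> F x}"
  then obtain r where r: "0 < r" "cball x r \<subseteq> \<Omega>" "a < (\<integral>\<^sup>+y\<in>ball x r. F y \<partial>lborel) / ennreal (W r)"
    by (auto simp: ball_sup_def less_SUP_iff)
  then have "a * ennreal (W r) < (\<integral>\<^sup>+y\<in>ball x r. F y \<partial>lborel)"
    using W[OF r(1)] by (simp add: ennreal_less_divide_iff)
  then obtain s where s: "0 < s" "s < r" "a * ennreal (W r) < (\<integral>\<^sup>+y\<in>ball x s. F y \<partial>lborel)"
    using nn_integral_ball_SUP[OF F _ r(1)] by blast
  obtain e where e: "e > 0" "(\<Union>y\<in>cball x r. cball y e) \<subseteq> \<Omega>"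
    using compact_subset_open_imp_cball_epsilon_subset[OF _ \<Omega> r(2)] by auto
  show "\<exists>e>0. \<forall>y. dist y x < e \<longrightarrow> y \<in> {x. a < ball_sup W \<Omega> F x}"
  proof (intro exI[of _ "min e (r - s)"] conjI allI impI)
    fix y assume y: "dist y x < min e (r - s)"
    have sub: "ball x s \<subseteq> ball y r"
    proof
      fix z assume "z \<in> ball x s"
      then show "z \<in> ball y r" using y dist_triangle[of y z x] by simp
    qed
    have "cball y r \<subseteq> \<Omega>"
    proof
      fix z assume z: "z \<in> cball y r"
      have "z - (y - x) \<in> cball x r" using z by (simp add: dist_norm algebra_simps)
      moreover have "z \<in> cball (z - (y - x)) e" using y by (simp add: dist_norm norm_minus_commute)
      ultimately show "z \<in> \<Omega>" using e(2) by blast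
    qed
    then have "(\<integral>\<^sup>+z\<in>ball y r. F z \<partial>lborel) / ennreal (W r) \<le> ball_sup W \<Omega> F y"
      unfolding ball_sup_def using r(1) by (intro SUP_upper) auto
    moreover have "(\<integral>\<^sup>+z\<in>ball x s. F z \<partial>lborel) \<le> (\<integral>\<^sup>+z\<in>ball y r. F z \<partial>lborel)"
      using sub by (intro nn_integral_mono) (auto simp: indicator_def)
    then have "a < (\<integral>\<^sup>+z\<in>ball y r. F z \<partial>lborel) / ennreal (W r)"
      using s(3) W[OF r(1)] by (simp add: ennreal_less_divide_iff)
    ultimately show "y \<in> {x. a < ball_sup W \<Omega> F x}" by auto
  qed (use e s in auto)
qed

lemma borel_measurable_ball_sup:
  fixes F :: "'a::euclidean_space \<Rightarrow> ennreal"
  assumes "F \<in> borel_measurable borel" "open \<Omega>" "\<And>r. 0 < r \<Longrightarrow> 0 < W r"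
  shows "ball_sup W \<Omega> F \<in> borel_measurable borel"
  by (rule borel_measurableI_greater) (use open_ball_sup_superlevel[OF assms] in auto)

lemma ball_sup_mono:
  assumes "\<And>y. F y \<le> G y" "\<Omega> \<subseteq> \<Omega>'" "\<And>r. 0 < r \<Longrightarrow> 0 < V r \<and> V r \<le> W r"
  shows "ball_sup W \<Omega> F x \<le> ball_sup V \<Omega>' G x"
  unfolding ball_sup_def
proof (rule SUP_mono)
  fix r assume "r \<in> {r. 0 < r \<and> cball x r \<subseteq> \<Omega>}"
  then have r: "r \<in> {r. 0 < r \<and> cball x r \<subseteq> \<Omega>'}" and V: "0 < V r" "V r \<le> W r"
    using assms(2,3) by auto
  have "(\<integral>\<^sup>+y\<in>ball x r. F y \<partial>lborel) \<le> (\<integral>\<^sup>+y\<in>ball x r. G y \<partial>lborel)"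
    using assms(1) by (intro nn_integral_mono mult_right_mono) auto
  from order_trans[OF divide_right_mono_ennreal[OF this] ennreal_divide_antimono[OF V]]
  show "\<exists>m\<in>{r. 0 < r \<and> cball x r \<subseteq> \<Omega>'}. (\<integral>\<^sup>+y\<in>ball x r. F y \<partial>lborel) / ennreal (W r)
      \<le> (\<integral>\<^sup>+y\<in>ball x m. G y \<partial>lborel) / ennreal (V m)"
    using r by blast
qed

section \<open>Volumes of balls and the weak-type estimate\<close>

definition ball_vol :: "'a::euclidean_space itself \<Rightarrow> real \<Rightarrow> real" where
  "ball_vol _ r = unit_ball_vol (real DIM('a)) * r ^ DIM('a)"

lemma ball_vol_pos: "0 < r \<Longrightarrow> 0 < ball_vol TYPE('a::euclidean_space) r"
  by (simp add: ball_vol_def)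

lemma emeasure_ball_vol: "0 < r \<Longrightarrow> emeasure lborel (ball (x::'a::euclidean_space) r) = ennreal (ball_vol TYPE('a) r)"
  by (simp add: ball_vol_def emeasure_ball)

lemma measure_ball_vol: "0 < r \<Longrightarrow> measure lebesgue (ball (x::'a::euclidean_space) r) = ball_vol TYPE('a) r"
  by (simp add: ball_vol_def content_ball)

abbreviation HL_maximal :: "('a::euclidean_space \<Rightarrow> ennreal) \<Rightarrow> 'a \<Rightarrow> ennreal" where
  "HL_maximal \<equiv> ball_sup (ball_vol TYPE('a)) UNIV"

text \<open>Each point of the superlevel set has a ball on which \<open>F\<close> has mass more than
  \<open>c\<close> times the volume. Vitali's lemma selects disjoint ones whose fivefold
  enlargements cover the set, hence the factor \<open>5 ^ DIM('a)\<close>.\<close>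

lemma HL_maximal_weak_type:
  fixes F :: "'a::euclidean_space \<Rightarrow> ennreal"
  assumes F[measurable]: "F \<in> borel_measurable borel" and c: "0 < c"
  shows "emeasure lborel {x. ennreal c < HL_maximal F x} \<le> ennreal (5 ^ DIM('a) / c) * (\<integral>\<^sup>+x. F x \<partial>lborel)"
proof (cases "(\<integral>\<^sup>+x. F x \<partial>lborel) = \<infinity>")
  case True
  then show ?thesis using c by (simp add: ennreal_mult_top)
next
  case False
  let ?\<omega> = "unit_ball_vol (real DIM('a))"
  define S where "S = {x. ennreal c < HL_maximal F x}"
  define I where "I = enn2real (\<integral>\<^sup>+x. F x \<partial>lborel)"
  have I: "(\<integral>\<^sup>+x. F x \<partial>lborel) = ennreal I" using False by (simp add: I_def less_top)
  have \<omega>: "?\<omega> > 0" by simp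
  have "\<forall>x\<in>S. \<exists>r>0. ennreal c * ennreal (ball_vol TYPE('a) r) < (\<integral>\<^sup>+y\<in>ball x r. F y \<partial>lborel)"
    using ball_vol_pos[where 'a='a] by (auto simp: S_def ball_sup_def less_SUP_iff ennreal_less_divide_iff)
  then obtain r where r: "\<And>x. x \<in> S \<Longrightarrow> 0 < r x"
    "\<And>x. x \<in> S \<Longrightarrow> ennreal c * ennreal (ball_vol TYPE('a) (r x)) < (\<integral>\<^sup>+y\<in>ball x (r x). F y \<partial>lborel)"
    by metis
  \<comment> \<open>Vitali's lemma requires bounded radii. The mass of \<open>F\<close> bounds
    \<open>c * ?\<omega> * r x ^ DIM('a)\<close>, and for radii above 1 the power dominates the
    radius.\<close>
  have rb: "r x \<le> max 1 (I / (c * ?\<omega>))" if x: "x \<in> S" for x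
  proof (cases "r x \<le> 1")
    case False
    have "ennreal (c * ball_vol TYPE('a) (r x)) \<le> ennreal I"
    proof -
      have "(\<integral>\<^sup>+y\<in>ball x (r x). F y \<partial>lborel) \<le> ennreal I"
        unfolding I[symmetric] by (intro nn_integral_mono) (auto simp: indicator_def)
      then show ?thesis using r(2)[OF x] c ball_vol_pos[OF r(1)[OF x], where 'a='a]
        by (simp add: ennreal_mult less_imp_le)
    qed
    moreover have "0 \<le> I" by (simp add: I_def)
    ultimately have "c * (?\<omega> * r x ^ DIM('a)) \<le> I"
      by (simp add: ball_vol_def)
    moreover have "r x \<le> r x ^ DIM('a)" using False DIM_positive[where 'a='a] by (intro self_le_power) auto
    then have "c * (?\<omega> * r x) \<le> c * (?\<omega> * r x ^ DIM('a))"
      using c by (intro mult_left_mono) auto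
    ultimately have "r x * (c * ?\<omega>) \<le> I" by (simp add: mult_ac)
    then show ?thesis using c by (simp add: le_divide_eq le_max_iff_disj)
  qed simp
  have "S \<subseteq> (\<Union>x\<in>S. ball x (r x))" using r(1) by force
  from Vitali_covering_lemma_balls[OF this, of "max 1 (I / (c * ?\<omega>))"] r(1) rb
  obtain C where C: "countable C" "C \<subseteq> S" "pairwise (\<lambda>i j. disjnt (ball i (r i)) (ball j (r j))) C"
    "S \<subseteq> (\<Union>i\<in>C. ball i (5 * r i))"
    by auto
  let ?M = "density lborel F"
  define J where "J = to_nat_on C ` C"
  define P where "P k = (if k \<in> J then ball (from_nat_into C k) (5 * r (from_nat_into C k)) else {})" for k
  define Q where "Q k = (if k \<in> J then ball (from_nat_into C k) (r (from_nat_into C k)) else {})" for k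
  have JC: "from_nat_into C k \<in> C" if "k \<in> J" for k using that C(1) by (auto simp: J_def)
  have "S \<subseteq> (\<Union>k. P k)"
  proof
    fix x assume "x \<in> S"
    then obtain i where "i \<in> C" "x \<in> ball i (5 * r i)" using C(4) by auto
    then have "x \<in> P (to_nat_on C i)" using C(1) by (simp add: P_def J_def)
    then show "x \<in> (\<Union>k. P k)" by blast
  qed
  then have "emeasure lborel S \<le> emeasure lborel (\<Union>k. P k)"
    by (rule emeasure_mono) (auto simp: P_def)
  also have "\<dots> \<le> (\<Sum>k. emeasure lborel (P k))"
    by (rule emeasure_subadditive_countably) (auto simp: P_def)
  also have "\<dots> \<le> (\<Sum>k. ennreal (5 ^ DIM('a) / c) * emeasure ?M (Q k))"
  proof (rule suminf_le)
    fix k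
    show "emeasure lborel (P k) \<le> ennreal (5 ^ DIM('a) / c) * emeasure ?M (Q k)"
    proof (cases "k \<in> J")
      case True
      define x where "x = from_nat_into C k"
      have x: "x \<in> S" using JC[OF True] C(2) by (auto simp: x_def)
      have "emeasure lborel (P k) = ennreal (5 ^ DIM('a) / c * (c * ball_vol TYPE('a) (r x)))"
        using True c r(1)[OF x] by (simp add: P_def emeasure_ball_vol flip: x_def) (simp add: ball_vol_def power_mult_distrib mult_ac)
      also have "\<dots> = ennreal (5 ^ DIM('a) / c) * (ennreal c * ennreal (ball_vol TYPE('a) (r x)))"
        using c ball_vol_pos[OF r(1)[OF x], where 'a='a] by (simp add: ennreal_mult[symmetric] less_imp_le del: times_divide_eq_left)
      also have "\<dots> \<le> ennreal (5 ^ DIM('a) / c) * emeasure ?M (Q k)"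
        using r(2)[OF x] True by (intro mult_left_mono) (auto simp: Q_def emeasure_density less_imp_le simp flip: x_def)
      finally show ?thesis .
    qed (simp add: P_def)
  qed auto
  also have "\<dots> = ennreal (5 ^ DIM('a) / c) * (\<Sum>k. emeasure ?M (Q k))"
    by simp
  also have "(\<Sum>k. emeasure ?M (Q k)) = emeasure ?M (\<Union>k. Q k)"
  proof (rule suminf_emeasure)
    show "disjoint_family Q"
      unfolding disjoint_family_on_def
    proof (intro ballI impI)
      fix m n :: nat assume "m \<noteq> n"
      show "Q m \<inter> Q n = {}"
      proof (cases "m \<in> J \<and> n \<in> J")
        case True
        then have "from_nat_into C m \<noteq> from_nat_into C n" using \<open>m \<noteq> n\<close> C(1) by (auto simp: J_def)
        then show ?thesis
          using C(3) JC True by (auto simp: Q_def pairwise_def disjnt_def)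
      qed (auto simp: Q_def)
    qed
  qed (auto simp: Q_def)
  also have "\<dots> \<le> emeasure ?M UNIV"
    by (rule emeasure_mono) auto
  also have "emeasure ?M UNIV = (\<integral>\<^sup>+x. F x \<partial>lborel)" by (simp add: emeasure_density)
  finally show ?thesis unfolding S_def by (simp add: mult_left_mono)
qed

section \<open>Layer-cake formula and strong-type estimate\<close>

lemma nn_integral_powr_less:
  assumes "0 < q" "0 \<le> a"
  shows "(\<integral>\<^sup>+t. ennreal (t powr (q - 1)) * indicator {0<..<a} t \<partial>lborel) = ennreal (a powr q / q)"
proof -
  have "((\<lambda>t. t powr (q - 1)) has_integral (a powr (q - 1 + 1) / (q - 1 + 1))) {0..a}"
    using assms by (intro has_integral_powr_from_0) auto
  then have "(\<integral>\<^sup>+t. ennreal (indicator {0..a} t * t powr (q - 1)) \<partial>lborel) = ennreal (a powr q / q)"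
    by (intro nn_integral_has_integral_lebesgue) auto
  moreover have "(\<integral>\<^sup>+t. ennreal (t powr (q - 1)) * indicator {0<..<a} t \<partial>lborel) = (\<integral>\<^sup>+t. ennreal (indicator {0..a} t * t powr (q - 1)) \<partial>lborel)"
  proof (rule nn_integral_cong_AE)
    have "AE t in lborel. t \<noteq> 0 \<and> t \<noteq> a" by (auto simp: AE_lborel_singleton)
    then show "AE t in lborel. ennreal (t powr (q - 1)) * indicator {0<..<a} t = ennreal (indicator {0..a} t * t powr (q - 1))"
      by eventually_elim (auto simp: indicator_def)
  qed
  ultimately show ?thesis by simp
qed

text \<open>Infinity is kept as infinity, so that a finite integral of the power forces finiteness
  almost everywhere.\<close>

definition ennpow :: "ennreal \<Rightarrow> real \<Rightarrow> ennreal" where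
  "ennpow h p = (if h = \<infinity> then \<infinity> else ennreal (enn2real h powr p))"

lemma ennpow_layer_cake:
  assumes p: "1 < p"
  shows "ennpow h p = (\<integral>\<^sup>+t. ennreal (p * t powr (p - 1)) * indicator {t. 0 < t \<and> ennreal t < h} t \<partial>lborel)"
proof (cases "h = \<infinity>")
  case False
  define a where "a = enn2real h"
  have a: "0 \<le> a" "h = ennreal a" using False by (auto simp: a_def less_top)
  have "{t. 0 < t \<and> ennreal t < h} = {0<..<a}" using a by (auto simp: ennreal_less_iff)
  moreover have "(\<integral>\<^sup>+t. ennreal (p * t powr (p - 1)) * indicator {0<..<a} t \<partial>lborel)
      = (\<integral>\<^sup>+t. ennreal p * (ennreal (t powr (p - 1)) * indicator {0<..<a} t) \<partial>lborel)"
    using p by (simp add: ennreal_mult mult.assoc)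
  moreover have "\<dots> = ennreal p * ennreal (a powr p / p)"
    using p a nn_integral_powr_less[of p a] by (simp add: nn_integral_cmult)
  moreover have "\<dots> = ennreal (a powr p)"
    using p by (simp add: ennreal_mult[symmetric])
  ultimately show ?thesis using False a by (simp add: ennpow_def)
next
  case True
  \<comment> \<open>For \<open>h = \<infinity>\<close> the integral over \<open>{0<..<n}\<close>
    alone is \<open>n powr p\<close>, which is at least \<open>n\<close>; letting \<open>n\<close>
    grow shows that the whole integral is infinite.\<close>
  have "of_nat n \<le> (\<integral>\<^sup>+t. ennreal (p * t powr (p - 1)) * indicator {t. 0 < t \<and> ennreal t < h} t \<partial>lborel)" for n
  proof (cases "n = 0")
    case False
    have "real n \<le> real n powr p" using powr_mono[of 1 p "real n"] False p by simp
    then have "of_nat n \<le> ennreal (real n powr p)" by (simp add: ennreal_of_nat_eq_real_of_nat ennreal_leI)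
    also have "\<dots> = ennreal p * ennreal (real n powr p / p)"
      using p by (simp add: ennreal_mult[symmetric])
    also have "\<dots> = (\<integral>\<^sup>+t. ennreal p * (ennreal (t powr (p - 1)) * indicator {0<..<real n} t) \<partial>lborel)"
      using p nn_integral_powr_less[of p "real n"] by (simp add: nn_integral_cmult)
    also have "\<dots> \<le> (\<integral>\<^sup>+t. ennreal (p * t powr (p - 1)) * indicator {t. 0 < t \<and> ennreal t < h} t \<partial>lborel)"
      using p True by (intro nn_integral_mono) (auto simp: indicator_def ennreal_mult)
    finally show ?thesis .
  qed simp
  then have "(\<integral>\<^sup>+t. ennreal (p * t powr (p - 1)) * indicator {t. 0 < t \<and> ennreal t < h} t \<partial>lborel) = \<infinity>"
    by (metis ennreal_Ex_less_of_nat infinity_ennreal_def less_top not_le)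
  then show ?thesis using True by (simp add: ennpow_def)
qed


text \<open>Marcinkiewicz interpolation with the trivial \<open>L\<^sup>\<infinity>\<close> bound: at height \<open>t\<close> only the part of \<open>f\<close>
  above \<open>t/2\<close> matters.\<close>

theorem HL_maximal_strong_type:
  fixes f :: "'a::euclidean_space \<Rightarrow> real"
  assumes f[measurable]: "f \<in> borel_measurable borel" "\<And>x. 0 \<le> f x" and p: "1 < p"
  shows "(\<integral>\<^sup>+x. ennpow (HL_maximal (\<lambda>y. ennreal (f y)) x) p \<partial>lborel)
    \<le> ennreal (2 * 5 ^ DIM('a) * p * 2 powr (p - 1) / (p - 1)) * Lp_pow p f"
proof -
  let ?M = "HL_maximal (\<lambda>y. ennreal (f y))"
  let ?C = "5 ^ DIM('a) :: real"
  have M[measurable]: "?M \<in> borel_measurable borel"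
    by (intro borel_measurable_ball_sup) (auto simp: ball_vol_pos)
  have weak: "emeasure lborel {x. ennreal t < ?M x} \<le> (\<integral>\<^sup>+x. ennreal (2 * ?C / t * f x) * indicator {x. t / 2 < f x} x \<partial>lborel)"
    if t: "0 < t" for t
  proof -
    \<comment> \<open>The discarded part of \<open>f\<close> is at most \<open>t / 2\<close> and
      adds at most \<open>t / 2\<close> to any average. So a value of the maximal function above
      \<open>t\<close> forces that of \<open>F\<close> above \<open>t / 2\<close>.\<close>
    define F where "F y = ennreal (f y) * indicator {x. t / 2 < f x} y" for y
    have [measurable]: "F \<in> borel_measurable borel" unfolding F_def[abs_def] by measurable
    have "{x. ennreal t < ?M x} \<subseteq> {x. ennreal (t / 2) < HL_maximal F x}"
    proof
      fix x assume "x \<in> {x. ennreal t < ?M x}"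
      then obtain r where r: "0 < r" "ennreal t * ennreal (ball_vol TYPE('a) r) < (\<integral>\<^sup>+y\<in>ball x r. ennreal (f y) \<partial>lborel)"
        using ball_vol_pos[where 'a='a] by (auto simp: ball_sup_def less_SUP_iff ennreal_less_divide_iff)
      have [measurable]: "ball x r \<in> sets borel" by simp
      have bv: "0 < ball_vol TYPE('a) r" using r(1) by (rule ball_vol_pos)
      have "(\<integral>\<^sup>+y\<in>ball x r. ennreal (f y) \<partial>lborel) \<le> (\<integral>\<^sup>+y. F y * indicator (ball x r) y + ennreal (t / 2) * indicator (ball x r) y \<partial>lborel)"
        using t by (intro nn_integral_mono) (auto simp: F_def indicator_def intro: ennreal_leI)
      also have "\<dots> = (\<integral>\<^sup>+y\<in>ball x r. F y \<partial>lborel) + ennreal (t / 2) * ennreal (ball_vol TYPE('a) r)"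
        using r(1) by (subst nn_integral_add) (auto simp: nn_integral_cmult_indicator emeasure_ball_vol)
      finally have "ennreal t * ennreal (ball_vol TYPE('a) r) < (\<integral>\<^sup>+y\<in>ball x r. F y \<partial>lborel) + ennreal (t / 2) * ennreal (ball_vol TYPE('a) r)"
        using r(2) by simp
      moreover have "ennreal t * ennreal (ball_vol TYPE('a) r) = ennreal (t / 2) * ennreal (ball_vol TYPE('a) r) + ennreal (t / 2) * ennreal (ball_vol TYPE('a) r)"
        using t bv by (simp add: ennreal_mult[symmetric] ennreal_plus[symmetric] less_imp_le del: ennreal_plus)
      ultimately have "ennreal (t / 2) * ennreal (ball_vol TYPE('a) r) < (\<integral>\<^sup>+y\<in>ball x r. F y \<partial>lborel)"
        by (metis add_right_mono leD leI)
      then have "ennreal (t / 2) < (\<integral>\<^sup>+y\<in>ball x r. F y \<partial>lborel) / ennreal (ball_vol TYPE('a) r)"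
        using bv by (simp add: ennreal_less_divide_iff)
      also have "\<dots> \<le> HL_maximal F x"
        unfolding ball_sup_def using r(1) by (intro SUP_upper) auto
      finally show "x \<in> {x. ennreal (t / 2) < HL_maximal F x}" by simp
    qed
    then have "emeasure lborel {x. ennreal t < ?M x} \<le> emeasure lborel {x. ennreal (t / 2) < HL_maximal F x}"
    proof (rule emeasure_mono)
      have "HL_maximal F \<in> borel_measurable borel"
        by (intro borel_measurable_ball_sup) (auto simp: ball_vol_pos)
      then show "{x. ennreal (t / 2) < HL_maximal F x} \<in> sets lborel" by simp
    qed
    also have "\<dots> \<le> ennreal (?C / (t / 2)) * (\<integral>\<^sup>+x. F x \<partial>lborel)"
      using t by (intro HL_maximal_weak_type) auto
    also have "\<dots> = (\<integral>\<^sup>+x. ennreal (?C / (t / 2)) * F x \<partial>lborel)"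
      by (simp add: nn_integral_cmult)
    also have "\<dots> = (\<integral>\<^sup>+x. ennreal (2 * ?C / t * f x) * indicator {x. t / 2 < f x} x \<partial>lborel)"
      using t f(2) by (intro nn_integral_cong) (simp add: F_def ennreal_mult[symmetric] mult.assoc[symmetric] mult.commute)
    finally show ?thesis .
  qed
  have "(\<integral>\<^sup>+x. ennpow (?M x) p \<partial>lborel)
    = (\<integral>\<^sup>+x. \<integral>\<^sup>+t. ennreal (p * t powr (p - 1)) * indicator {t. 0 < t \<and> ennreal t < ?M x} t \<partial>lborel \<partial>lborel)"
    by (simp add: ennpow_layer_cake[OF p])
  also have "\<dots> = (\<integral>\<^sup>+t. \<integral>\<^sup>+x. ennreal (p * t powr (p - 1)) * indicator {t. 0 < t \<and> ennreal t < ?M x} t \<partial>lborel \<partial>lborel)"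
    by (rule lborel_pair.Fubini'[symmetric]) measurable
  also have "\<dots> \<le> (\<integral>\<^sup>+t. \<integral>\<^sup>+x. ennreal (2 * ?C * p * f x) * (ennreal (t powr (p - 1 - 1)) * indicator {t. 0 < t \<and> t < 2 * f x} t) \<partial>lborel \<partial>lborel)"
  proof (rule nn_integral_mono)
    fix t :: real
    show "(\<integral>\<^sup>+x. ennreal (p * t powr (p - 1)) * indicator {t. 0 < t \<and> ennreal t < ?M x} t \<partial>lborel)
      \<le> (\<integral>\<^sup>+x. ennreal (2 * ?C * p * f x) * (ennreal (t powr (p - 1 - 1)) * indicator {t. 0 < t \<and> t < 2 * f x} t) \<partial>lborel)"
    proof (cases "0 < t")
      case True
      have "(\<integral>\<^sup>+x. ennreal (p * t powr (p - 1)) * indicator {t. 0 < t \<and> ennreal t < ?M x} t \<partial>lborel)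
        = (\<integral>\<^sup>+x. ennreal (p * t powr (p - 1)) * indicator {x. ennreal t < ?M x} x \<partial>lborel)"
        using True by (intro nn_integral_cong) (auto simp: indicator_def)
      also have "\<dots> = ennreal (p * t powr (p - 1)) * emeasure lborel {x. ennreal t < ?M x}"
        by (intro nn_integral_cmult_indicator) simp
      also have "\<dots> \<le> ennreal (p * t powr (p - 1)) * (\<integral>\<^sup>+x. ennreal (2 * ?C / t * f x) * indicator {x. t / 2 < f x} x \<partial>lborel)"
        by (intro mult_left_mono weak True) auto
      also have "\<dots> = (\<integral>\<^sup>+x. ennreal (p * t powr (p - 1)) * (ennreal (2 * ?C / t * f x) * indicator {x. t / 2 < f x} x) \<partial>lborel)"
        by (rule nn_integral_cmult[symmetric]) simp
      also have "\<dots> = (\<integral>\<^sup>+x. ennreal (2 * ?C * p * f x) * (ennreal (t powr (p - 1 - 1)) * indicator {t. 0 < t \<and> t < 2 * f x} t) \<partial>lborel)"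
      proof (intro nn_integral_cong)
        fix x
        have "t powr (p - 1) = t * t powr (p - 1 - 1)"
          using True by (simp add: powr_mult_base)
        then have "p * t powr (p - 1) * (2 * ?C / t * f x) = 2 * ?C * p * f x * t powr (p - 1 - 1)"
          using True by simp
        then have "ennreal (p * t powr (p - 1)) * ennreal (2 * ?C / t * f x) = ennreal (2 * ?C * p * f x) * ennreal (t powr (p - 1 - 1))"
          using p True f(2)[of x] by (simp only: ennreal_mult[symmetric] mult_nonneg_nonneg divide_nonneg_pos powr_ge_zero zero_le_power zero_le_numeral less_imp_le zero_less_one order.strict_trans[of 0 1 p])
        then show "ennreal (p * t powr (p - 1)) * (ennreal (2 * ?C / t * f x) * indicator {x. t / 2 < f x} x)
          = ennreal (2 * ?C * p * f x) * (ennreal (t powr (p - 1 - 1)) * indicator {t. 0 < t \<and> t < 2 * f x} t)"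
          using True by (simp add: mult.assoc[symmetric]) (auto simp: indicator_def)
      qed
      finally show ?thesis .
    qed simp
  qed
  also have "\<dots> = (\<integral>\<^sup>+x. \<integral>\<^sup>+t. ennreal (2 * ?C * p * f x) * (ennreal (t powr (p - 1 - 1)) * indicator {t. 0 < t \<and> t < 2 * f x} t) \<partial>lborel \<partial>lborel)"
    by (rule lborel_pair.Fubini') measurable
  also have "\<dots> = (\<integral>\<^sup>+x. ennreal (2 * ?C * p * f x) * ennreal ((2 * f x) powr (p - 1) / (p - 1)) \<partial>lborel)"
  proof (rule nn_integral_cong)
    fix x
    show "(\<integral>\<^sup>+t. ennreal (2 * ?C * p * f x) * (ennreal (t powr (p - 1 - 1)) * indicator {t. 0 < t \<and> t < 2 * f x} t) \<partial>lborel)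
      = ennreal (2 * ?C * p * f x) * ennreal ((2 * f x) powr (p - 1) / (p - 1))"
      using nn_integral_powr_less[of "p - 1" "2 * f x"] p f(2)[of x]
      by (simp add: nn_integral_cmult greaterThanLessThan_def greaterThan_def lessThan_def Int_def)
  qed
  also have "\<dots> = (\<integral>\<^sup>+x. ennreal (2 * ?C * p * 2 powr (p - 1) / (p - 1)) * ennreal (norm (f x) powr p) \<partial>lborel)"
  proof (rule nn_integral_cong)
    fix x
    have "f x * f x powr (p - 1) = f x powr p"
      using f(2)[of x] p by (cases "f x = 0") (auto simp: powr_mult_base)
    then have "2 * ?C * p * f x * ((2 * f x) powr (p - 1) / (p - 1)) = 2 * ?C * p * 2 powr (p - 1) / (p - 1) * f x powr p"
      using f(2)[of x] by (simp add: powr_mult mult_ac)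
    then show "ennreal (2 * ?C * p * f x) * ennreal ((2 * f x) powr (p - 1) / (p - 1))
      = ennreal (2 * ?C * p * 2 powr (p - 1) / (p - 1)) * ennreal (norm (f x) powr p)"
      using f(2)[of x] p by (simp add: ennreal_mult[symmetric] del: times_divide_eq_left times_divide_eq_right)
  qed
  also have "\<dots> = ennreal (2 * ?C * p * 2 powr (p - 1) / (p - 1)) * Lp_pow p f"
    by (simp add: nn_integral_cmult Lp_pow_def)
  finally show ?thesis .
qed

section \<open>Averages over moving balls\<close>

lemma mollify_eq_convolve: "mollify r v = convolve (mollifier r) v"
  by (simp add: mollify_def[abs_def] convolve_def[abs_def])

text \<open>The derivative falls on the kernel, which as a function of \<open>y\<close> is a test
  function in \<open>\<Omega>\<close>, and the weak formulation moves it to \<open>g\<close>.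
  Globally locally integrable \<open>f'\<close>, \<open>g'\<close> stand in for \<open>f\<close>,
  \<open>g\<close>, since only values on the closed ball enter.\<close>

lemma mollify_wgrad_has_derivative:
  fixes f :: "'a::euclidean_space \<Rightarrow> real"
  assumes w: "wgrad \<Omega> f g" and r: "0 < r" "cball x r \<subseteq> \<Omega>"
    and f': "loc_int UNIV f'" and g': "loc_int UNIV g'" and eq: "\<And>y. y \<in> cball x r \<Longrightarrow> f' y = f y \<and> g' y = g y"
  shows "(mollify r f' has_derivative (\<lambda>e. mollify r g' x \<bullet> e)) (at x)"
proof -
  let ?m = "mollifier r :: 'a \<Rightarrow> real"
  let ?\<psi> = "\<lambda>y. mollifier r (x - y)"
  let ?D = "\<lambda>e. \<integral>y. frechet_derivative ?m (at (x - y)) e * f' y \<partial>lborel"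
  have m: "?m \<in> test_functions UNIV" using r(1) by (rule mollifier_test_functions)
  have t: "?\<psi> \<in> test_functions \<Omega>" using r by (rule mollifier_reflect_test_functions)
  have z: "?\<psi> y = 0" if "y \<notin> cball x r" for y
    using that r(1) by (intro mollifier_support) (auto simp: dist_norm)
  have d: "(convolve ?m f' has_derivative ?D) (at x)" by (rule convolve_has_derivative[OF m f'])
  have D: "?D b = mollify r g' x \<bullet> b" if b: "b \<in> Basis" for b
  proof -
    have "?D b = - (\<integral>y. f y * frechet_derivative ?\<psi> (at y) b \<partial>lborel)"
    proof -
      have "frechet_derivative ?m (at (x - y)) b * f' y = - (f y * frechet_derivative ?\<psi> (at y) b)" for y
      proof (cases "y \<in> cball x r")
        case True
        then show ?thesis using eq[of y] frechet_derivative_reflect[OF m, of x y b] by simp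
      next
        case False
        then have "frechet_derivative ?\<psi> (at y) b = 0"
          using test_functions_deriv_zero[OF t _ z, of "cball x r" y b] by auto
        then show ?thesis using frechet_derivative_reflect[OF m, of x y b] by simp
      qed
      then show ?thesis by simp
    qed
    also have "\<dots> = (\<integral>y. (g y \<bullet> b) * ?\<psi> y \<partial>lborel)"
      using w t b by (simp add: wgrad_def)
    also have "\<dots> = (\<integral>y. (mollifier r (x - y) *\<^sub>R g' y) \<bullet> b \<partial>lborel)"
    proof (intro Bochner_Integration.integral_cong refl)
      fix y show "(g y \<bullet> b) * ?\<psi> y = (mollifier r (x - y) *\<^sub>R g' y) \<bullet> b"
        using eq[of y] z[of y] by (cases "y \<in> cball x r") auto
    qed
    also have "\<dots> = mollify r g' x \<bullet> b"
      unfolding mollify_def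
      using loc_int_test[OF g' test_functions_mono[OF t]] by (intro integral_inner_left) auto
    finally show ?thesis .
  qed
  have "?D = (\<lambda>e. mollify r g' x \<bullet> e)"
    by (rule linear_eq_stdbasis[OF has_derivative_linear[OF d]])
      (auto intro: bounded_linear.linear bounded_linear_inner_right simp: D)
  then show ?thesis using d by (simp add: mollify_eq_convolve)
qed

text \<open>Componentwise a convolution. The continuity is what makes the smoothed gradient
  integrable along curves.\<close>

lemma continuous_on_mollify:
  fixes v :: "'a::euclidean_space \<Rightarrow> 'b::euclidean_space"
  assumes r: "0 < r" and v: "loc_int UNIV v"
  shows "continuous_on UNIV (mollify r v)"
proof (subst continuous_on_componentwise, intro ballI)
  fix b :: 'b
  have [measurable]: "v \<in> borel_measurable borel" using v by (rule loc_int_borel)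
  have vb: "loc_int UNIV (\<lambda>y. v y \<bullet> b)"
    unfolding loc_int_def
  proof (intro conjI allI impI)
    fix K :: "'a set" assume "compact K \<and> K \<subseteq> UNIV"
    then have "integrable lborel (\<lambda>y. (indicator K y *\<^sub>R v y) \<bullet> b)"
      by (intro integrable_inner_left loc_int_compact[OF v]) auto
    then show "integrable lborel (\<lambda>y. indicator K y *\<^sub>R (v y \<bullet> b))" by simp
  qed simp
  have "mollify r v x \<bullet> b = convolve (mollifier r) (\<lambda>y. v y \<bullet> b) x" for x
  proof -
    have "integrable lborel (\<lambda>y. mollifier r (x - y) *\<^sub>R v y)"
      by (rule loc_int_test[OF v mollifier_reflect_test_functions]) (use r in auto)
    then show ?thesis
      unfolding mollify_def convolve_def by (subst integral_inner_left[symmetric]) auto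
  qed
  moreover have "continuous_on UNIV (convolve (mollifier r) (\<lambda>y. v y \<bullet> b))"
    using Ck_convolve[OF vb mollifier_test_functions[OF r], of 0] by simp
  ultimately show "continuous_on UNIV (\<lambda>x. mollify r v x \<bullet> b)" by simp
qed

section \<open>Moving balls parametrised by the unit ball\<close>

lemma nn_integral_ball_unit_ball:
  fixes F :: "'a::euclidean_space \<Rightarrow> ennreal"
  assumes F[measurable]: "F \<in> borel_measurable borel" and r: "0 < r"
  shows "(\<integral>\<^sup>+y\<in>ball x r. F y \<partial>lborel) = ennreal (r ^ DIM('a)) * (\<integral>\<^sup>+z\<in>ball 0 1. F (x + r *\<^sub>R z) \<partial>lborel)"
proof -
  have [measurable]: "ball x r \<in> sets borel" "ball (0::'a) 1 \<in> sets borel" by simp_all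
  have "(\<integral>\<^sup>+y\<in>ball x r. F y \<partial>lborel) = (\<integral>\<^sup>+z. ennreal (\<bar>r\<bar> ^ DIM('a)) * (F (x + r *\<^sub>R z) * indicator (ball x r) (x + r *\<^sub>R z)) \<partial>lborel)"
    using r by (subst lborel_affine[of r x]) (auto simp: nn_integral_density nn_integral_distr)
  also have "\<dots> = ennreal (r ^ DIM('a)) * (\<integral>\<^sup>+z. F (x + r *\<^sub>R z) * indicator (ball x r) (x + r *\<^sub>R z) \<partial>lborel)"
    using r by (subst nn_integral_cmult) auto
  also have "(\<lambda>z. F (x + r *\<^sub>R z) * indicator (ball x r) (x + r *\<^sub>R z)) = (\<lambda>z. F (x + r *\<^sub>R z) * indicator (ball 0 1) z)"
    using r by (auto simp: indicator_def fun_eq_iff dist_norm)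
  finally show ?thesis .
qed

text \<open>A crude bound, uniform over all centres and over radii bounded below by
  \<open>s\<close>; it lets \<open>L^1\<close> errors of mollification pass through averages over
  the moving balls.\<close>

lemma unit_ball_average_le:
  fixes F :: "'a::euclidean_space \<Rightarrow> ennreal"
  assumes F[measurable]: "F \<in> borel_measurable borel" and r: "0 < s" "s \<le> r"
  shows "(\<integral>\<^sup>+z\<in>ball 0 1. F (x + r *\<^sub>R z) \<partial>lborel) \<le> ennreal (1 / s ^ DIM('a)) * (\<integral>\<^sup>+y\<in>ball x r. F y \<partial>lborel)"
proof -
  have "1 \<le> 1 / s ^ DIM('a) * r ^ DIM('a)"
    using r by (simp add: power_mono)
  then have "ennreal 1 \<le> ennreal (1 / s ^ DIM('a) * r ^ DIM('a))" by (rule ennreal_leI)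
  from mult_right_mono[OF this zero_le]
  have "(\<integral>\<^sup>+z\<in>ball 0 1. F (x + r *\<^sub>R z) \<partial>lborel) \<le> ennreal (1 / s ^ DIM('a) * r ^ DIM('a)) * (\<integral>\<^sup>+z\<in>ball 0 1. F (x + r *\<^sub>R z) \<partial>lborel)"
    by (simp only: ennreal_1 mult_1)
  also have "\<dots> = ennreal (1 / s ^ DIM('a)) * (\<integral>\<^sup>+y\<in>ball x r. F y \<partial>lborel)"
    using r by (subst nn_integral_ball_unit_ball) (auto simp: ennreal_mult[symmetric] mult.assoc[symmetric])
  finally show ?thesis .
qed

text \<open>The centre has moved by \<open>t * dist x y\<close>, and since \<open>r \<le> R\<close>
  the radius is at most \<open>R - t * dist x y\<close>; the two add up to at most
  \<open>R\<close>.\<close>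

lemma segment_ball_subset:
  fixes x y z :: "'a::euclidean_space"
  assumes d: "dist x y \<le> R" and r: "0 < r" "r \<le> R" and t: "0 \<le> t" "t \<le> 1" and z: "norm z \<le> 1"
  shows "x + t *\<^sub>R (y - x) + (r * (1 - t * dist x y / R)) *\<^sub>R z \<in> cball x R"
proof -
  have R: "0 < R" using r by simp
  have dR: "dist x y / R \<le> 1" using d R by simp
  have "t * (dist x y / R) \<le> 1 * 1" using t dR R by (intro mult_mono) auto
  then have s0: "0 \<le> 1 - t * dist x y / R" by simp
  have "norm (t *\<^sub>R (y - x) + (r * (1 - t * dist x y / R)) *\<^sub>R z)
      \<le> t * dist x y + r * (1 - t * dist x y / R) * norm z"
    using t r s0 norm_triangle_ineq[of "t *\<^sub>R (y - x)" "(r * (1 - t * dist x y / R)) *\<^sub>R z"]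
    by (simp add: dist_norm norm_minus_commute abs_mult)
  also have "\<dots> \<le> t * dist x y + r * (1 - t * dist x y / R) * 1"
    using r s0 z by (intro add_left_mono mult_left_mono mult_nonneg_nonneg) auto
  also have "\<dots> \<le> t * dist x y + R * (1 - t * dist x y / R)"
    using r s0 by (simp add: mult_right_mono)
  also have "\<dots> = R" using R by (simp add: field_simps)
  finally have "norm (t *\<^sub>R (y - x) + (r * (1 - t * dist x y / R)) *\<^sub>R z) \<le> R" .
  moreover have "dist x (x + (u + v)) = norm (u + v)" for u v :: 'a
    by (metis add_diff_cancel_left' dist_commute dist_norm)
  ultimately show ?thesis by (simp only: mem_cball add.assoc)
qed

text \<open>The fundamental theorem of calculus along \<open>c\<close>. Its velocity has a part
  \<open>y - x\<close> from the centre and a part of length at most \<open>dist x y\<close> from the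
  shrinking radius, as \<open>r \<le> R\<close> and \<open>norm z \<le> 1\<close>; this is the
  factor 2.\<close>

lemma smooth_segment_estimate:
  fixes F :: "'a::euclidean_space \<Rightarrow> real" and G :: "'a \<Rightarrow> 'a"
  assumes d: "dist x y \<le> R" and r: "0 < r" "r \<le> R" and z: "norm z \<le> 1"
    and F: "\<And>w. w \<in> cball x R \<Longrightarrow> (F has_derivative (\<lambda>e. G w \<bullet> e)) (at w)"
    and G: "continuous_on UNIV G"
  defines "c \<equiv> \<lambda>t. x + t *\<^sub>R (y - x) + (r * (1 - t * dist x y / R)) *\<^sub>R z"
  shows "ennreal \<bar>F (c 0)\<bar> \<le> ennreal \<bar>F (c 1)\<bar>
    + ennreal (2 * dist x y) * (\<integral>\<^sup>+t. ennreal (norm (G (c t))) * indicator {0..1} t \<partial>lborel)"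
proof -
  define c' where "c' = (y - x) - (r * dist x y / R) *\<^sub>R z"
  have R: "0 < R" using r by simp
  have nc: "norm c' \<le> 2 * dist x y"
  proof -
    have "r * dist x y / R * norm z \<le> dist x y * 1"
    proof (rule mult_mono[OF _ z])
      show "r * dist x y / R \<le> dist x y"
        using mult_right_mono[OF r(2), of "dist x y"] R by (simp add: divide_le_eq mult.commute)
    qed auto
    then show ?thesis
      using norm_triangle_ineq4[of "y - x" "(r * dist x y / R) *\<^sub>R z"] r R
      by (simp add: c'_def dist_norm norm_minus_commute abs_mult)
  qed
  have dc: "(c has_vector_derivative c') (at t within S)" for t S
    unfolding c_def c'_def has_vector_derivative_def
    using R by (auto intro!: derivative_eq_intros simp: algebra_simps add_divide_distrib)
  have cc: "continuous_on S c" for S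
    unfolding continuous_on_eq_continuous_within using dc has_vector_derivative_continuous by blast
  have cR: "c t \<in> cball x R" if "t \<in> {0..1}" for t
    unfolding c_def using that by (intro segment_ball_subset d r z) auto
  have "((\<lambda>t. G (c t) \<bullet> c') has_integral (F (c 1) - F (c 0))) {0..1}"
  proof (rule fundamental_theorem_of_calculus)
    fix t :: real assume t: "t \<in> {0..1}"
    have "((\<lambda>t. F (c t)) has_derivative (\<lambda>s. G (c t) \<bullet> (s *\<^sub>R c'))) (at t within {0..1})"
      by (rule has_derivative_compose[of c "\<lambda>s. s *\<^sub>R c'" t "{0..1}" F "\<lambda>e. G (c t) \<bullet> e",
          OF dc[unfolded has_vector_derivative_def] F[OF cR[OF t]]])
    then show "((\<lambda>t. F (c t)) has_vector_derivative G (c t) \<bullet> c') (at t within {0..1})"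
      by (simp add: has_vector_derivative_def)
  qed simp
  then have FI: "F (c 1) - F (c 0) = integral {0..1} (\<lambda>t. G (c t) \<bullet> c')"
    by (simp add: integral_unique)
  have Gc: "continuous_on {0..1} (\<lambda>t. G (c t))"
    by (rule continuous_on_compose2[OF G cc]) auto
  have hi: "(\<lambda>t. 2 * dist x y * norm (G (c t))) integrable_on {0..1}"
    by (intro integrable_continuous_interval continuous_intros Gc)
  have "norm (F (c 1) - F (c 0)) \<le> integral {0..1} (\<lambda>t. 2 * dist x y * norm (G (c t)))"
    unfolding FI
  proof (rule integral_norm_bound_integral[OF _ hi])
    show "(\<lambda>t. G (c t) \<bullet> c') integrable_on {0..1}"
      by (intro integrable_continuous_interval continuous_intros Gc)
    fix t
    show "norm (G (c t) \<bullet> c') \<le> 2 * dist x y * norm (G (c t))"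
      using Cauchy_Schwarz_ineq2[of "G (c t)" c'] mult_left_mono[OF nc, of "norm (G (c t))"] by (simp add: mult.commute)
  qed
  then have "ennreal \<bar>F (c 0)\<bar> \<le> ennreal (\<bar>F (c 1)\<bar> + integral {0..1} (\<lambda>t. 2 * dist x y * norm (G (c t))))"
    by (intro ennreal_leI) auto
  also have "\<dots> = ennreal \<bar>F (c 1)\<bar> + ennreal (integral {0..1} (\<lambda>t. 2 * dist x y * norm (G (c t))))"
    by (intro ennreal_plus integral_nonneg hi) auto
  also have "ennreal (integral {0..1} (\<lambda>t. 2 * dist x y * norm (G (c t))))
      = (\<integral>\<^sup>+t. ennreal (2 * dist x y * norm (G (c t))) * indicator {0..1} t \<partial>lborel)"
    by (rule nn_integral_has_integral_lebesgue'[OF _ integrable_integral[OF hi], symmetric]) simp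
  also have "\<dots> = ennreal (2 * dist x y) * (\<integral>\<^sup>+t. ennreal (norm (G (c t))) * indicator {0..1} t \<partial>lborel)"
  proof -
    have [measurable]: "(\<lambda>t. G (c t)) \<in> borel_measurable borel"
      using continuous_on_compose2[OF G cc[of UNIV]] by (intro borel_measurable_continuous_onI) auto
    show ?thesis
      by (subst nn_integral_cmult[symmetric]) (auto simp: ennreal_mult mult.assoc)
  qed
  finally show ?thesis .
qed

text \<open>The radius shrinks linearly from \<open>r\<close> while the centre moves from \<open>x\<close> to \<open>y\<close>, so that all balls
  stay in \<open>cball x R\<close> and every point of the moving ball has speed at most \<open>2 dist x y\<close>.\<close>

lemma average_segment_estimate:
  fixes f :: "'a::euclidean_space \<Rightarrow> real"
  assumes w: "wgrad \<Omega> f g" and \<Omega>: "open \<Omega>" and R: "cball x R \<subseteq> \<Omega>" and d: "dist x y < R" and r: "0 < r" "r \<le> R"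
  defines "s \<equiv> \<lambda>t. r * (1 - t * dist x y / R)" and "c \<equiv> \<lambda>t. x + t *\<^sub>R (y - x)"
  shows "(\<integral>\<^sup>+z\<in>ball 0 1. ennreal \<bar>f (x + r *\<^sub>R z)\<bar> \<partial>lborel)
    \<le> (\<integral>\<^sup>+z\<in>ball 0 1. ennreal \<bar>f (y + s 1 *\<^sub>R z)\<bar> \<partial>lborel)
      + ennreal (2 * dist x y) * (\<integral>\<^sup>+t. (\<integral>\<^sup>+z\<in>ball 0 1. ennreal (norm (g (c t + s t *\<^sub>R z))) \<partial>lborel) * indicator {0..1} t \<partial>lborel)"
proof -
  have R0: "0 < R" using r by simp
  have fm[measurable]: "f \<in> borel_measurable borel" "g \<in> borel_measurable borel"
    using w loc_int_borel by (auto simp: wgrad_def)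
  have [measurable]: "ball (0::'a) 1 \<in> sets borel" by simp
  \<comment> \<open>The strict inequality \<open>dist x y < R\<close> keeps even the final radius
    positive; it is the smallest one along the path.\<close>
  have s1: "0 < s 1" using r d R0 by (simp add: s_def)
  have st: "s 1 \<le> s t" "0 < s t" "s t \<le> r" if "0 \<le> t" "t \<le> 1" for t
  proof -
    have "t * dist x y / R \<le> 1 * dist x y / R" using that R0 by (intro divide_right_mono mult_right_mono) auto
    then show "s 1 \<le> s t" using r by (simp add: s_def)
    then show "0 < s t" using s1 by simp
    have "0 \<le> t * dist x y / R" using that R0 by simp
    then show "s t \<le> r" using r unfolding s_def by (simp add: mult_le_cancel_left1)
  qed
  obtain e where e: "e > 0" "(\<Union>u\<in>cball x R. cball u e) \<subseteq> \<Omega>"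
    using compact_subset_open_imp_cball_epsilon_subset[OF compact_cball \<Omega> R] by blast
  define K where "K = {u + v | u v. u \<in> cball x R \<and> v \<in> cball (0::'a) e}"
  have K: "compact K" unfolding K_def by (intro compact_cball_enlarge) simp
  have KI: "v \<in> K" if "u \<in> cball x R" "v \<in> cball u e" for u v
    unfolding K_def using that by (intro CollectI exI[of _ u] exI[of _ "v - u"]) (auto simp: dist_norm norm_minus_commute)
  have KO: "K \<subseteq> \<Omega>"
  proof
    fix q assume "q \<in> K"
    then obtain u v where "q = u + v" "u \<in> cball x R" "norm v \<le> e" by (auto simp: K_def)
    then have "u \<in> cball x R" "q \<in> cball u e" by (auto simp: dist_norm)
    then show "q \<in> \<Omega>" using e(2) by blast
  qed
  have [measurable]: "K \<in> sets borel" using K by (rule borel_compact)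
  define f' where "f' v = indicator K v *\<^sub>R f v" for v
  define g' where "g' v = indicator K v *\<^sub>R g v" for v
  have fi: "integrable lborel f'" "integrable lborel g'"
    unfolding f'_def g'_def using w K KO by (auto simp: wgrad_def intro!: loc_int_compact simp flip: real_scaleR_def)
  have [measurable]: "f' \<in> borel_measurable borel" "g' \<in> borel_measurable borel"
    unfolding f'_def[abs_def] g'_def[abs_def] by measurable
  have li: "loc_int UNIV f'" "loc_int UNIV g'" using fi by (auto intro: loc_int_integrable)
  have eqK: "f' v = f v" "g' v = g v" if "v \<in> cball x R" for v
  proof -
    have "v \<in> K" using KI[OF that, of v] e(1) by simp
    then show "f' v = f v" "g' v = g v" by (auto simp: f'_def g'_def)
  qed
  define X where "X F u q = (\<integral>\<^sup>+z\<in>ball 0 1. F (u + q *\<^sub>R z) \<partial>lborel)" for F :: "'a \<Rightarrow> ennreal" and u q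
  \<comment> \<open>\<open>X F u q\<close> is the average of \<open>F\<close> over
    \<open>ball u q\<close> times the volume of the unit ball. As all radii are at least
    \<open>s 1\<close>, this one constant bounds every \<open>X\<close> by the integral of
    \<open>F\<close>.\<close>
  define N where "N = 1 / s 1 ^ DIM('a)"
  have N0: "0 \<le> N" using s1 by (simp add: N_def)
  have XN: "X F u q \<le> ennreal N * (\<integral>\<^sup>+v. F v \<partial>lborel)" if [measurable]: "F \<in> borel_measurable borel" and q: "s 1 \<le> q" for F u q
  proof -
    have "X F u q \<le> ennreal N * (\<integral>\<^sup>+v\<in>ball u q. F v \<partial>lborel)"
      unfolding X_def N_def using s1 q by (intro unit_ball_average_le) auto
    also have "\<dots> \<le> ennreal N * (\<integral>\<^sup>+v. F v \<partial>lborel)"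
      by (intro mult_left_mono nn_integral_mono) (auto simp: indicator_def)
    finally show ?thesis .
  qed
  have Xtri: "X (\<lambda>v. ennreal (norm (a v))) u q \<le> X (\<lambda>v. ennreal (norm (b v))) u q + ennreal N * Lp_pow 1 (\<lambda>v. b v - a v)"
    if ab[measurable]: "a \<in> borel_measurable borel" "b \<in> borel_measurable borel" and q: "s 1 \<le> q"
    for a b :: "'a \<Rightarrow> 'c::euclidean_space" and u q
  proof -
    have "X (\<lambda>v. ennreal (norm (a v))) u q
      \<le> (\<integral>\<^sup>+z. ennreal (norm (b (u + q *\<^sub>R z))) * indicator (ball 0 1) z + ennreal (norm (b (u + q *\<^sub>R z) - a (u + q *\<^sub>R z))) * indicator (ball 0 1) z \<partial>lborel)"
      unfolding X_def
    proof (rule nn_integral_mono)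
      fix z
      have "ennreal (norm (a (u + q *\<^sub>R z))) \<le> ennreal (norm (b (u + q *\<^sub>R z)) + norm (b (u + q *\<^sub>R z) - a (u + q *\<^sub>R z)))"
        using norm_triangle_sub[of "a (u + q *\<^sub>R z)" "b (u + q *\<^sub>R z)"]
        by (intro ennreal_leI) (simp add: norm_minus_commute)
      then show "ennreal (norm (a (u + q *\<^sub>R z))) * indicator (ball 0 1) z
        \<le> ennreal (norm (b (u + q *\<^sub>R z))) * indicator (ball 0 1) z + ennreal (norm (b (u + q *\<^sub>R z) - a (u + q *\<^sub>R z))) * indicator (ball 0 1) z"
        by (auto simp: indicator_def)
    qed
    also have "\<dots> = X (\<lambda>v. ennreal (norm (b v))) u q + X (\<lambda>v. ennreal (norm (b v - a v))) u q"
      unfolding X_def by (rule nn_integral_add) measurable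
    also have "\<dots> \<le> X (\<lambda>v. ennreal (norm (b v))) u q + ennreal N * Lp_pow 1 (\<lambda>v. b v - a v)"
      unfolding Lp_pow_one by (intro add_left_mono XN q) measurable
    finally show ?thesis .
  qed
  define T where "T G = (\<integral>\<^sup>+t. X (\<lambda>v. ennreal (norm (G v))) (c t) (s t) * indicator {0..1} t \<partial>lborel)" for G :: "'a \<Rightarrow> 'a"
  have ct[measurable]: "c \<in> borel_measurable borel" "s \<in> borel_measurable borel"
    unfolding c_def s_def by measurable
  \<comment> \<open>For mollifications with \<open>\<rho> < e\<close> the estimate along a single
    curve holds for each \<open>z\<close> in the unit ball; integrating in \<open>z\<close> and
    exchanging the integrals gives the claim for balls. The passage
    \<open>\<rho> \<rightarrow> 0\<close> follows.\<close>
  have est: "X (\<lambda>v. ennreal \<bar>mollify \<rho> f' v\<bar>) x r \<le> X (\<lambda>v. ennreal \<bar>mollify \<rho> f' v\<bar>) y (s 1) + ennreal (2 * dist x y) * T (mollify \<rho> g')"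
    if \<rho>: "0 < \<rho>" "\<rho> < e" for \<rho>
  proof -
    have "(mollify \<rho> f' has_derivative (\<lambda>e. mollify \<rho> g' v \<bullet> e)) (at v)" if v: "v \<in> cball x R" for v
    proof (rule mollify_wgrad_has_derivative[OF w \<rho>(1) _ li])
      have sub: "u \<in> K" if "u \<in> cball v \<rho>" for u
        using KI[OF v, of u] that \<rho>(2) by auto
      then show "cball v \<rho> \<subseteq> \<Omega>" using KO by blast
      show "f' u = f u \<and> g' u = g u" if "u \<in> cball v \<rho>" for u
        using sub[OF that] by (simp add: f'_def g'_def)
    qed
    note seg = smooth_segment_estimate[OF less_imp_le[OF d] r _ this continuous_on_mollify[OF \<rho>(1) li(2)]]
    have "X (\<lambda>v. ennreal \<bar>mollify \<rho> f' v\<bar>) x r \<le> (\<integral>\<^sup>+z. ennreal \<bar>mollify \<rho> f' (y + s 1 *\<^sub>R z)\<bar> * indicator (ball 0 1) z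
       + ennreal (2 * dist x y) * (\<integral>\<^sup>+t. ennreal (norm (mollify \<rho> g' (c t + s t *\<^sub>R z))) * indicator (ball 0 1) z * indicator {0..1} t \<partial>lborel) \<partial>lborel)"
      unfolding X_def
    proof (rule nn_integral_mono)
      fix z :: 'a
      show "ennreal \<bar>mollify \<rho> f' (x + r *\<^sub>R z)\<bar> * indicator (ball 0 1) z \<le> ennreal \<bar>mollify \<rho> f' (y + s 1 *\<^sub>R z)\<bar> * indicator (ball 0 1) z
       + ennreal (2 * dist x y) * (\<integral>\<^sup>+t. ennreal (norm (mollify \<rho> g' (c t + s t *\<^sub>R z))) * indicator (ball 0 1) z * indicator {0..1} t \<partial>lborel)"
        using seg[of z] by (cases "norm z < 1") (auto simp: s_def c_def)
    qed
    also have "\<dots> = X (\<lambda>v. ennreal \<bar>mollify \<rho> f' v\<bar>) y (s 1) + ennreal (2 * dist x y) *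
        (\<integral>\<^sup>+z. (\<integral>\<^sup>+t. ennreal (norm (mollify \<rho> g' (c t + s t *\<^sub>R z))) * indicator (ball 0 1) z * indicator {0..1} t \<partial>lborel) \<partial>lborel)"
      unfolding X_def by (subst nn_integral_add) (auto simp: nn_integral_cmult)
    also have "(\<integral>\<^sup>+z. (\<integral>\<^sup>+t. ennreal (norm (mollify \<rho> g' (c t + s t *\<^sub>R z))) * indicator (ball 0 1) z * indicator {0..1} t \<partial>lborel) \<partial>lborel)
      = (\<integral>\<^sup>+t. (\<integral>\<^sup>+z. ennreal (norm (mollify \<rho> g' (c t + s t *\<^sub>R z))) * indicator (ball 0 1) z * indicator {0..1} t \<partial>lborel) \<partial>lborel)"
      by (rule lborel_pair.Fubini'[symmetric]) measurable
    also have "\<dots> = T (mollify \<rho> g')"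
      unfolding T_def X_def by (intro nn_integral_cong nn_integral_multc) measurable
    finally show ?thesis .
  qed
  let ?E = "\<lambda>\<rho>. ennreal N * Lp_pow 1 (\<lambda>v. mollify \<rho> f' v - f' v)"
  let ?E' = "\<lambda>\<rho>. ennreal N * Lp_pow 1 (\<lambda>v. mollify \<rho> g' v - g' v)"
  have TT: "T (mollify \<rho> g') \<le> T g' + ?E' \<rho>" for \<rho>
  proof -
    have "T (mollify \<rho> g') \<le> (\<integral>\<^sup>+t. X (\<lambda>v. ennreal (norm (g' v))) (c t) (s t) * indicator {0..1} t + ?E' \<rho> * indicator {0..1} t \<partial>lborel)"
      unfolding T_def
    proof (rule nn_integral_mono)
      fix t :: real
      show "X (\<lambda>v. ennreal (norm (mollify \<rho> g' v))) (c t) (s t) * indicator {0..1} t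
        \<le> X (\<lambda>v. ennreal (norm (g' v))) (c t) (s t) * indicator {0..1} t + ?E' \<rho> * indicator {0..1} t"
        using Xtri[of "mollify \<rho> g'" g' "s t" "c t"] st(1)[of t]
        by (auto simp: indicator_def Lp_pow_minus_commute[of 1 g'])
    qed
    also have "\<dots> = T g' + ?E' \<rho>"
      unfolding T_def X_def by (subst nn_integral_add) (auto simp: nn_integral_cmult_indicator)
    finally show ?thesis .
  qed
  let ?L = "X (\<lambda>v. ennreal \<bar>f' v\<bar>) x r"
  let ?U = "X (\<lambda>v. ennreal \<bar>f' v\<bar>) y (s 1) + ennreal (2 * dist x y) * T g'"
  have main: "?L \<le> ?U + (2 * ?E \<rho> + ennreal (2 * dist x y) * ?E' \<rho>)" if \<rho>: "0 < \<rho>" "\<rho> < e" for \<rho>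
  proof -
    have "?L \<le> X (\<lambda>v. ennreal \<bar>mollify \<rho> f' v\<bar>) x r + ?E \<rho>"
      using Xtri[of f' "mollify \<rho> f'" r x] st(1,3)[of 0] by (simp add: s_def)
    also have "\<dots> \<le> (X (\<lambda>v. ennreal \<bar>mollify \<rho> f' v\<bar>) y (s 1) + ennreal (2 * dist x y) * T (mollify \<rho> g')) + ?E \<rho>"
      by (intro add_right_mono est \<rho>)
    also have "\<dots> \<le> ((X (\<lambda>v. ennreal \<bar>f' v\<bar>) y (s 1) + ?E \<rho>) + ennreal (2 * dist x y) * (T g' + ?E' \<rho>)) + ?E \<rho>"
      using Xtri[of "mollify \<rho> f'" f' "s 1" y]
      by (intro add_mono mult_left_mono TT order_refl) (simp_all add: Lp_pow_minus_commute[of 1 f'])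
    also have "\<dots> = ?U + (2 * ?E \<rho> + ennreal (2 * dist x y) * ?E' \<rho>)"
    proof -
      have "a + b + c * (d + e) + b = a + c * d + (2 * b + c * e)" for a b c d e :: ennreal
        by (simp only: distrib_left mult_2 mult_2_right ac_simps)
      then show ?thesis .
    qed
    finally show ?thesis .
  qed
  have lim: "((\<lambda>\<rho>. ?U + (2 * ?E \<rho> + ennreal (2 * dist x y) * ?E' \<rho>)) \<longlongrightarrow> ?U + (2 * (ennreal N * 0) + ennreal (2 * dist x y) * (ennreal N * 0))) (at_right 0)"
    using fi by (intro tendsto_add tendsto_const ennreal_tendsto_cmult mollify_tendsto_Lp)
      (auto simp: Lp_pow_one integrable_iff_bounded ennreal_mult_less_top)
  have "?L \<le> ?U + (2 * (ennreal N * 0) + ennreal (2 * dist x y) * (ennreal N * 0))"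
  proof (rule tendsto_lowerbound[OF lim])
    have "\<forall>\<^sub>F \<rho> in at_right 0. 0 < \<rho> \<and> \<rho> < e"
      using e(1) by (auto simp: eventually_at_right_field)
    then show "\<forall>\<^sub>F \<rho> in at_right 0. ?L \<le> ?U + (2 * ?E \<rho> + ennreal (2 * dist x y) * ?E' \<rho>)"
      by eventually_elim (rule main, auto)
  qed simp
  then have "?L \<le> ?U" by simp
  moreover have in0: "c t + s t *\<^sub>R z \<in> cball x R" if "0 \<le> t" "t \<le> 1" "norm z \<le> 1" for t z
    unfolding c_def s_def using that d r by (intro segment_ball_subset) auto
  have "?L = (\<integral>\<^sup>+z\<in>ball 0 1. ennreal \<bar>f (x + r *\<^sub>R z)\<bar> \<partial>lborel)"
    unfolding X_def using in0[of 0] by (intro nn_integral_cong) (auto simp: eqK c_def s_def indicator_def)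
  moreover have "X (\<lambda>v. ennreal \<bar>f' v\<bar>) y (s 1) = (\<integral>\<^sup>+z\<in>ball 0 1. ennreal \<bar>f (y + s 1 *\<^sub>R z)\<bar> \<partial>lborel)"
    unfolding X_def using in0[of 1] by (intro nn_integral_cong) (auto simp: eqK c_def indicator_def)
  moreover have "T g' = (\<integral>\<^sup>+t. (\<integral>\<^sup>+z\<in>ball 0 1. ennreal (norm (g (c t + s t *\<^sub>R z))) \<partial>lborel) * indicator {0..1} t \<partial>lborel)"
    unfolding T_def X_def
  proof (intro nn_integral_cong)
    fix t :: real
    have "(\<integral>\<^sup>+z\<in>ball 0 1. ennreal (norm (g' (c t + s t *\<^sub>R z))) \<partial>lborel) = (\<integral>\<^sup>+z\<in>ball 0 1. ennreal (norm (g (c t + s t *\<^sub>R z))) \<partial>lborel)" if "t \<in> {0..1}"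
      using in0[of t] that by (intro nn_integral_cong) (auto simp: eqK indicator_def)
    then show "(\<integral>\<^sup>+z\<in>ball 0 1. ennreal (norm (g' (c t + s t *\<^sub>R z))) \<partial>lborel) * indicator {0..1} t
      = (\<integral>\<^sup>+z\<in>ball 0 1. ennreal (norm (g (c t + s t *\<^sub>R z))) \<partial>lborel) * indicator {0..1} t"
      by (cases "t \<in> {0..1}") auto
  qed
  ultimately show ?thesis by simp
qed

section \<open>Regularity of the maximal function\<close>

definition growth_weight :: "'a::euclidean_space itself \<Rightarrow> real \<Rightarrow> real \<Rightarrow> real" where
  "growth_weight _ \<gamma> r = growth \<gamma> (ball_vol TYPE('a) r) * ball_vol TYPE('a) r"

abbreviation maximal :: "real \<Rightarrow> 'a::euclidean_space set \<Rightarrow> ('a \<Rightarrow> ennreal) \<Rightarrow> 'a \<Rightarrow> ennreal" where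
  "maximal \<gamma> \<equiv> ball_sup (growth_weight TYPE('a) \<gamma>)"

lemma growth_ge_1: "0 \<le> \<gamma> \<Longrightarrow> 0 \<le> t \<Longrightarrow> 1 \<le> growth \<gamma> t"
  by (simp add: growth_def ge_one_powr_ge_zero)

lemma growth_mono: "0 \<le> \<gamma> \<Longrightarrow> 0 \<le> s \<Longrightarrow> s \<le> t \<Longrightarrow> growth \<gamma> s \<le> growth \<gamma> t"
  by (simp add: growth_def powr_mono2)

lemma growth_weight_ge:
  assumes "0 \<le> \<gamma>" "0 < r"
  shows "0 < ball_vol TYPE('a::euclidean_space) r" "ball_vol TYPE('a) r \<le> growth_weight TYPE('a) \<gamma> r" "0 < growth_weight TYPE('a) \<gamma> r"
proof -
  show p: "0 < ball_vol TYPE('a) r" using assms(2) by (rule ball_vol_pos)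
  then have g: "1 \<le> growth \<gamma> (ball_vol TYPE('a) r)" using assms(1) by (simp add: growth_ge_1)
  then show "ball_vol TYPE('a) r \<le> growth_weight TYPE('a) \<gamma> r"
    using p by (simp add: growth_weight_def mult_le_cancel_right1)
  then show "0 < growth_weight TYPE('a) \<gamma> r" using p by linarith
qed

text \<open>Balls with admissible radius lie in \<open>\<Omega>\<close>, so agreement almost
  everywhere on \<open>\<Omega>\<close> suffices, and for a Borel function completing the measure
  does not change the integrals.\<close>

lemma local_maximal_eq_maximal:
  fixes \<Omega> :: "'a::euclidean_space set"
  assumes \<Omega>: "open \<Omega>" and F: "F \<in> borel_measurable borel"
    and eq: "AE y in lebesgue. y \<in> \<Omega> \<longrightarrow> ennreal \<bar>f y\<bar> = F y"
  shows "local_maximal (growth \<gamma>) \<Omega> f x = maximal \<gamma> \<Omega> F x"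
  unfolding local_maximal_def ball_sup_def
proof (rule SUP_cong)
  show "admissible_radii \<Omega> x = {r. 0 < r \<and> cball x r \<subseteq> \<Omega>}"
    using admissible_radii_iff[OF \<Omega>] by auto
  fix r assume r: "r \<in> {r. 0 < r \<and> cball x r \<subseteq> \<Omega>}"
  then have sub: "ball x r \<subseteq> \<Omega>" using ball_subset_cball by blast
  have "(\<integral>\<^sup>+y\<in>ball x r. ennreal \<bar>f y\<bar> \<partial>lebesgue) = (\<integral>\<^sup>+y\<in>ball x r. F y \<partial>lebesgue)"
    using eq by (intro nn_integral_cong_AE, eventually_elim) (use sub in \<open>auto simp: indicator_def\<close>)
  also have "\<dots> = (\<integral>\<^sup>+y\<in>ball x r. F y \<partial>lborel)"
    using F by (intro nn_integral_completion)
  finally show "(\<integral>\<^sup>+y\<in>ball x r. ennreal \<bar>f y\<bar> \<partial>lebesgue) / ennreal (growth \<gamma> (measure lebesgue (ball x r)) * measure lebesgue (ball x r))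
    = (\<integral>\<^sup>+y\<in>ball x r. F y \<partial>lborel) / ennreal (growth_weight TYPE('a) \<gamma> r)"
    using r by (simp only: measure_ball_vol growth_weight_def mem_Collect_eq)
qed

lemma maximal_outside: "x \<notin> \<Omega> \<Longrightarrow> maximal \<gamma> \<Omega> F x = 0"
proof -
  assume x: "x \<notin> \<Omega>"
  have "{r. 0 < r \<and> cball x r \<subseteq> \<Omega>} = {}"
    using x by force
  then show ?thesis by (simp only: ball_sup_def image_empty Sup_empty bot_ennreal)
qed

text \<open>Rescaling to the unit ball cancels the power of \<open>r\<close>. What remains in the
  denominator is the growth factor, which is monotone in the radius.\<close>

lemma ball_quotient_eq:
  fixes F :: "'a::euclidean_space \<Rightarrow> ennreal"
  assumes F: "F \<in> borel_measurable borel" and r: "0 < r" and \<gamma>: "0 \<le> \<gamma>"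
  shows "(\<integral>\<^sup>+y\<in>ball x r. F y \<partial>lborel) / ennreal (growth_weight TYPE('a) \<gamma> r)
    = (\<integral>\<^sup>+z\<in>ball 0 1. F (x + r *\<^sub>R z) \<partial>lborel) / ennreal (growth \<gamma> (ball_vol TYPE('a) r) * unit_ball_vol (real DIM('a)))"
proof -
  have *: "ennreal a * X / ennreal (k * a) = X / ennreal k" if "0 < a" "0 < k" for a k X
  proof (cases X rule: ennreal_cases)
    case (real x)
    then show ?thesis using that by (simp add: ennreal_mult[symmetric] divide_ennreal)
  qed (use that in \<open>simp add: ennreal_mult_top ennreal_top_divide\<close>)
  have g: "0 < growth \<gamma> (ball_vol TYPE('a) r)"
    using growth_ge_1[OF \<gamma>, of "ball_vol TYPE('a) r"] ball_vol_pos[OF r, where 'a='a] by linarith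
  show ?thesis
    unfolding nn_integral_ball_unit_ball[OF F r]
    using *[of "r ^ DIM('a)" "growth \<gamma> (ball_vol TYPE('a) r) * unit_ball_vol (real DIM('a))"] r g
    by (simp add: growth_weight_def ball_vol_def mult.assoc)
qed

text \<open>Room beyond the given radius is needed because the moving-ball estimate asks for
  \<open>dist x y < R\<close> strictly.\<close>

lemma ball_subset_larger:
  fixes x :: "'a::euclidean_space"
  assumes "open \<Omega>" "0 < r" "cball x r \<subseteq> \<Omega>"
  obtains R where "r < R" "cball x R \<subseteq> \<Omega>"
proof (cases "\<Omega> = UNIV")
  case True
  then show ?thesis using that[of "r + 1"] by simp
next
  case False
  have "r \<in> admissible_radii \<Omega> x" using assms admissible_radii_iff by blast
  then have "r < infdist x (- \<Omega>)" using False by (simp add: admissible_radii_def)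
  then obtain R where "r < R" "R < infdist x (- \<Omega>)" using dense by blast
  then have "R \<in> admissible_radii \<Omega> x" using assms(2) by (simp add: admissible_radii_def)
  then show ?thesis using that \<open>r < R\<close> admissible_radii_iff[OF assms(1)] by blast
qed

text \<open>An inequality in \<open>ennreal\<close> for every admissible pair of points; finiteness
  matters only later, when a difference is formed.\<close>

theorem maximal_segment:
  fixes f :: "'a::euclidean_space \<Rightarrow> real"
  assumes w: "wgrad \<Omega> f g" and \<Omega>: "open \<Omega>" and \<gamma>: "0 \<le> \<gamma>" and xy: "cball x (dist x y) \<subseteq> \<Omega>"
  shows "maximal \<gamma> \<Omega> (\<lambda>v. ennreal \<bar>f v\<bar>) x \<le> maximal \<gamma> \<Omega> (\<lambda>v. ennreal \<bar>f v\<bar>) y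
    + ennreal (2 * dist x y) * (\<integral>\<^sup>+t. maximal \<gamma> \<Omega> (\<lambda>v. ennreal (norm (g v))) (x + t *\<^sub>R (y - x)) * indicator {0..1} t \<partial>lborel)"
  (is "?L \<le> ?U")
proof -
  have fm[measurable]: "f \<in> borel_measurable borel" "g \<in> borel_measurable borel"
    using w loc_int_borel by (auto simp: wgrad_def)
  let ?\<omega> = "unit_ball_vol (real DIM('a))"
  have "(\<integral>\<^sup>+v\<in>ball x r. ennreal \<bar>f v\<bar> \<partial>lborel) / ennreal (growth_weight TYPE('a) \<gamma> r) \<le> ?U"
    if r: "0 < r" "cball x r \<subseteq> \<Omega>" for r
  proof -
    define \<kappa> where "\<kappa> q = growth \<gamma> (ball_vol TYPE('a) q) * ?\<omega>" for q
    \<comment> \<open>The outer radius must be at least \<open>r\<close> and larger than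
      \<open>dist x y\<close>. Both closed balls are in \<open>\<Omega>\<close>, hence so is the
      larger one.\<close>
    define m where "m = max r (dist x y)"
    have m: "0 < m" "cball x m \<subseteq> \<Omega>" using r xy by (auto simp: m_def max_def)
    obtain R where R: "m < R" "cball x R \<subseteq> \<Omega>" using ball_subset_larger[OF \<Omega> m] .
    have dR: "dist x y < R" "r \<le> R" "0 < R" using R(1) r by (auto simp: m_def)
    define s where "s t = r * (1 - t * dist x y / R)" for t
    define c where "c t = x + t *\<^sub>R (y - x)" for t
    have s: "0 < s t" "s t \<le> r" if "0 \<le> t" "t \<le> 1" for t
    proof -
      have "t * (dist x y / R) \<le> 1 * (dist x y / R)" using that dR by (intro mult_right_mono) auto
      also have "\<dots> < 1" using dR by simp
      finally show "0 < s t" using r by (simp add: s_def)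
      have "0 \<le> t * dist x y / R" using that dR by simp
      then show "s t \<le> r" using r unfolding s_def by (simp add: mult_le_cancel_left1)
    qed
    have [measurable]: "c \<in> borel_measurable borel" "s \<in> borel_measurable borel"
      unfolding c_def s_def by measurable
    have [measurable]: "ball (0::'a) 1 \<in> sets borel" by simp
    have cs: "cball (c t) (s t) \<subseteq> \<Omega>" if t: "0 \<le> t" "t \<le> 1" for t
    proof
      fix v assume v: "v \<in> cball (c t) (s t)"
      define z where "z = (1 / s t) *\<^sub>R (v - c t)"
      have "norm z \<le> 1" using v s[OF t] by (simp add: z_def dist_norm norm_minus_commute)
      then have "c t + s t *\<^sub>R z \<in> cball x R"
        unfolding c_def s_def using dR r t by (intro segment_ball_subset) auto
      moreover have "c t + s t *\<^sub>R z = v" using s[OF t] by (simp add: z_def)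
      ultimately show "v \<in> \<Omega>" using R(2) by auto
    qed
    have \<kappa>: "0 < \<kappa> q" "\<kappa> q \<le> \<kappa> r" if "0 < q" "q \<le> r" for q
    proof -
      have "0 < ball_vol TYPE('a) q" using that(1) by (rule ball_vol_pos)
      moreover have "ball_vol TYPE('a) q \<le> ball_vol TYPE('a) r"
        using that by (simp add: ball_vol_def power_mono)
      ultimately show "\<kappa> q \<le> \<kappa> r" "0 < \<kappa> q"
        using growth_mono[OF \<gamma>, of "ball_vol TYPE('a) q" "ball_vol TYPE('a) r"] growth_ge_1[OF \<gamma>, of "ball_vol TYPE('a) q"]
        by (auto simp: \<kappa>_def)
    qed
    have \<kappa>r: "0 < \<kappa> r" using \<kappa>[of r] r by simp
    \<comment> \<open>Here shrinking pays off: \<open>s t \<le> r\<close> gives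
      \<open>\<kappa> (s t) \<le> \<kappa> r\<close>, so dividing by \<open>\<kappa> r\<close> gives
      at most the quotient that belongs to the ball of radius \<open>s t\<close>, which is itself
      admissible at \<open>c t\<close>.\<close>
    have bd: "(\<integral>\<^sup>+z\<in>ball 0 1. F (c t + s t *\<^sub>R z) \<partial>lborel) / ennreal (\<kappa> r) \<le> maximal \<gamma> \<Omega> F (c t)"
      if F: "F \<in> borel_measurable borel" and t: "0 \<le> t" "t \<le> 1" for F :: "'a \<Rightarrow> ennreal" and t
    proof -
      have "(\<integral>\<^sup>+z\<in>ball 0 1. F (c t + s t *\<^sub>R z) \<partial>lborel) / ennreal (\<kappa> r) \<le> (\<integral>\<^sup>+z\<in>ball 0 1. F (c t + s t *\<^sub>R z) \<partial>lborel) / ennreal (\<kappa> (s t))"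
        using \<kappa> s[OF t] by (intro ennreal_divide_antimono)
      also have "\<dots> = (\<integral>\<^sup>+y\<in>ball (c t) (s t). F y \<partial>lborel) / ennreal (growth_weight TYPE('a) \<gamma> (s t))"
        unfolding \<kappa>_def by (rule ball_quotient_eq[OF F _ \<gamma>, symmetric]) (use s[OF t] in simp)
      also have "\<dots> \<le> maximal \<gamma> \<Omega> F (c t)"
        unfolding ball_sup_def using cs[OF t] s[OF t] by (intro SUP_upper) auto
      finally show ?thesis .
    qed
    have "(\<integral>\<^sup>+v\<in>ball x r. ennreal \<bar>f v\<bar> \<partial>lborel) / ennreal (growth_weight TYPE('a) \<gamma> r)
        = (\<integral>\<^sup>+z\<in>ball 0 1. ennreal \<bar>f (x + r *\<^sub>R z)\<bar> \<partial>lborel) / ennreal (\<kappa> r)"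
      unfolding \<kappa>_def using r \<gamma> by (intro ball_quotient_eq) auto
    also have "\<dots> \<le> ((\<integral>\<^sup>+z\<in>ball 0 1. ennreal \<bar>f (y + s 1 *\<^sub>R z)\<bar> \<partial>lborel)
      + ennreal (2 * dist x y) * (\<integral>\<^sup>+t. (\<integral>\<^sup>+z\<in>ball 0 1. ennreal (norm (g (c t + s t *\<^sub>R z))) \<partial>lborel) * indicator {0..1} t \<partial>lborel)) / ennreal (\<kappa> r)"
      unfolding s_def c_def by (intro divide_right_mono_ennreal average_segment_estimate[OF w \<Omega> R(2)]) (use dR r in auto)
    also have "\<dots> = (\<integral>\<^sup>+z\<in>ball 0 1. ennreal \<bar>f (c 1 + s 1 *\<^sub>R z)\<bar> \<partial>lborel) / ennreal (\<kappa> r)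
      + ennreal (2 * dist x y) * (\<integral>\<^sup>+t. (\<integral>\<^sup>+z\<in>ball 0 1. ennreal (norm (g (c t + s t *\<^sub>R z))) \<partial>lborel) * indicator {0..1} t / ennreal (\<kappa> r) \<partial>lborel)"
      by (subst nn_integral_divide) (auto simp: c_def add_divide_distrib_ennreal ennreal_times_divide)
    also have "\<dots> \<le> ?U"
    proof (intro add_mono mult_left_mono)
      show "(\<integral>\<^sup>+z\<in>ball 0 1. ennreal \<bar>f (c 1 + s 1 *\<^sub>R z)\<bar> \<partial>lborel) / ennreal (\<kappa> r) \<le> maximal \<gamma> \<Omega> (\<lambda>v. ennreal \<bar>f v\<bar>) y"
        using bd[of "\<lambda>v. ennreal \<bar>f v\<bar>" 1] by (simp add: c_def)
      show "(\<integral>\<^sup>+t. (\<integral>\<^sup>+z\<in>ball 0 1. ennreal (norm (g (c t + s t *\<^sub>R z))) \<partial>lborel) * indicator {0..1} t / ennreal (\<kappa> r) \<partial>lborel)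
        \<le> (\<integral>\<^sup>+t. maximal \<gamma> \<Omega> (\<lambda>v. ennreal (norm (g v))) (x + t *\<^sub>R (y - x)) * indicator {0..1} t \<partial>lborel)"
      proof (rule nn_integral_mono)
        fix t :: real
        show "(\<integral>\<^sup>+z\<in>ball 0 1. ennreal (norm (g (c t + s t *\<^sub>R z))) \<partial>lborel) * indicator {0..1} t / ennreal (\<kappa> r)
          \<le> maximal \<gamma> \<Omega> (\<lambda>v. ennreal (norm (g v))) (x + t *\<^sub>R (y - x)) * indicator {0..1} t"
          using bd[of "\<lambda>v. ennreal (norm (g v))" t] by (cases "t \<in> {0..1}") (auto simp: c_def)
      qed
    qed auto
    finally show ?thesis .
  qed
  then show ?thesis
    unfolding ball_sup_def[of _ _ _ x] by (intro SUP_least) auto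
qed

section \<open>Integrability and weak gradients of maximal functions\<close>

lemma borel_measurable_maximal [measurable]:
  "F \<in> borel_measurable borel \<Longrightarrow> open \<Omega> \<Longrightarrow> 0 \<le> \<gamma> \<Longrightarrow> maximal \<gamma> \<Omega> F \<in> borel_measurable borel"
  by (intro borel_measurable_ball_sup) (auto intro: growth_weight_ge)

definition maximal_const :: "nat \<Rightarrow> real \<Rightarrow> real" where
  "maximal_const n p = 2 * 5 ^ n * p * 2 powr (p - 1) / (p - 1)"

text \<open>The growth factor is at least 1 and the local supremum runs over fewer radii, so the
  operator is dominated by the Hardy-Littlewood one.\<close>

lemma maximal_Lp:
  fixes f :: "'a::euclidean_space \<Rightarrow> 'b::euclidean_space"
  assumes f[measurable]: "f \<in> borel_measurable borel" and fin: "Lp_pow p f < \<infinity>" and p: "1 < p" and \<Omega>: "open \<Omega>" and \<gamma>: "0 \<le> \<gamma>"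
  defines "M \<equiv> maximal \<gamma> \<Omega> (\<lambda>v. ennreal (norm (f v)))"
  shows "AE x in lborel. M x < \<infinity>"
    and "Lp_pow p (\<lambda>x. enn2real (M x)) \<le> ennreal (maximal_const DIM('a) p) * Lp_pow p f"
proof -
  let ?H = "HL_maximal (\<lambda>v. ennreal (norm (f v)))"
  have [measurable]: "?H \<in> borel_measurable borel"
    by (intro borel_measurable_ball_sup) (auto simp: ball_vol_pos)
  have [measurable]: "M \<in> borel_measurable borel" unfolding M_def using \<Omega> \<gamma> by measurable
  have MH: "M x \<le> ?H x" for x
    unfolding M_def using growth_weight_ge[OF \<gamma>] by (intro ball_sup_mono) auto
  have [measurable]: "(\<lambda>x. ennpow (?H x) p) \<in> borel_measurable borel"
    unfolding ennpow_def by measurable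
  have b: "(\<integral>\<^sup>+x. ennpow (?H x) p \<partial>lborel) \<le> ennreal (maximal_const DIM('a) p) * Lp_pow p f"
    using HL_maximal_strong_type[of "\<lambda>x. norm (f x)" p] p by (simp add: maximal_const_def Lp_pow_def)
  also have "\<dots> < \<infinity>" using fin by (simp add: ennreal_mult_less_top)
  finally have "AE x in lborel. ennpow (?H x) p \<noteq> \<infinity>"
    by (intro nn_integral_PInf_AE) auto
  then show fi: "AE x in lborel. M x < \<infinity>"
  proof eventually_elim
    case (elim x)
    then have "?H x < \<infinity>" by (auto simp: ennpow_def less_top split: if_splits)
    with MH[of x] show ?case by (rule le_less_trans)
  qed
  have "Lp_pow p (\<lambda>x. enn2real (M x)) \<le> (\<integral>\<^sup>+x. ennpow (?H x) p \<partial>lborel)"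
    unfolding Lp_pow_def
  proof (rule nn_integral_mono)
    fix x
    show "ennreal (norm (enn2real (M x)) powr p) \<le> ennpow (?H x) p"
      using MH[of x] p by (auto simp: ennpow_def less_top intro!: ennreal_leI powr_mono2 enn2real_mono)
  qed
  then show "Lp_pow p (\<lambda>x. enn2real (M x)) \<le> ennreal (maximal_const DIM('a) p) * Lp_pow p f"
    using b by (rule order_trans)
qed

lemma ennreal_abs_diff_le:
  assumes "0 \<le> a" "0 \<le> b" "ennreal a \<le> ennreal b + c" "ennreal b \<le> ennreal a + c"
  shows "ennreal \<bar>a - b\<bar> \<le> c"
proof (cases c rule: ennreal_cases)
  case (real r)
  then have "a \<le> b + r" "b \<le> a + r"
    using assms by (simp_all add: ennreal_plus[symmetric] del: ennreal_plus)
  then show ?thesis using real by (auto intro!: ennreal_leI)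
qed simp

lemma nn_integral_unit_interval_reflect:
  assumes [measurable]: "F \<in> borel_measurable borel"
  shows "(\<integral>\<^sup>+t. F (1 - t) * indicator {0..1} t \<partial>lborel) = (\<integral>\<^sup>+t. F t * indicator {0..1} (t::real) \<partial>lborel)"
proof -
  have "(\<integral>\<^sup>+t. F t * indicator {0..1} t \<partial>lborel) = (\<integral>\<^sup>+t. F (1 + (-1) * t) * indicator {0..1} (1 + (-1) * t) \<partial>lborel)"
    by (subst nn_integral_real_affine[where c="-1" and t=1]) auto
  also have "\<dots> = (\<integral>\<^sup>+t. F (1 - t) * indicator {0..1} t \<partial>lborel)"
    by (intro nn_integral_cong) (auto simp: indicator_def)
  finally show ?thesis by simp
qed

text \<open>For every fixed \<open>t\<close> a translate of a null set is null; Fubini exchanges the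
  two quantifiers.\<close>

lemma AE_segment_AE:
  fixes P :: "'a::euclidean_space \<Rightarrow> bool"
  assumes "AE x in lborel. P x"
  shows "AE x in lborel. AE t in lborel. P (x + t *\<^sub>R w)"
proof -
  obtain N where N: "\<And>x. x \<in> space lborel - N \<Longrightarrow> P x" "N \<in> null_sets lborel"
    by (rule AE_E3[OF assms], rule that)
  then have [measurable]: "N \<in> sets borel" by auto
  have "AE t in lborel. AE x in lborel. x + t *\<^sub>R w \<notin> N" for w
    by (rule AE_I2) (rule AE_lborel_translate[OF AE_not_in[OF N(2)]])
  moreover have "{z \<in> space (lborel \<Otimes>\<^sub>M lborel). fst z + snd z *\<^sub>R w \<notin> N} \<in> sets (lborel \<Otimes>\<^sub>M lborel)"
    by measurable
  ultimately have "AE x in lborel. AE t in lborel. x + t *\<^sub>R w \<notin> N"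
    by (subst lborel_pair.AE_commute)
  then show ?thesis
    by (rule eventually_mono) (erule eventually_mono, use N(1) in auto)
qed

text \<open>The one-sided comparison is used from \<open>x\<close> to \<open>x + w\<close> and back.
  Values that are infinite only on a null set are discarded at both endpoints and at almost every
  point of the segment.\<close>

lemma maximal_difference_quotient:
  fixes f :: "'a::euclidean_space \<Rightarrow> real"
  assumes w: "wgrad \<Omega> f g" and \<Omega>: "open \<Omega>" and \<gamma>: "0 \<le> \<gamma>" and p: "1 < p"
    and fin: "Lp_pow p f < \<infinity>" "Lp_pow p g < \<infinity>" and K: "compact K" "K \<subseteq> \<Omega>"
  defines "u \<equiv> \<lambda>x. enn2real (maximal \<gamma> \<Omega> (\<lambda>v. ennreal \<bar>f v\<bar>) x)"
    and "G \<equiv> \<lambda>x. 2 * enn2real (maximal \<gamma> \<Omega> (\<lambda>v. ennreal (norm (g v))) x)"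
  shows "\<exists>d>0. \<forall>w. norm w < d \<longrightarrow> (AE x in lborel. x \<in> K \<longrightarrow>
    ennreal \<bar>u (x + w) - u x\<bar> \<le> ennreal (norm w) * (\<integral>\<^sup>+t. ennreal (G (x + t *\<^sub>R w)) * indicator {0..1} t \<partial>lborel))"
proof -
  have fm[measurable]: "f \<in> borel_measurable borel" "g \<in> borel_measurable borel"
    using w loc_int_borel by (auto simp: wgrad_def)
  let ?F = "maximal \<gamma> \<Omega> (\<lambda>v. ennreal \<bar>f v\<bar>)"
  let ?M = "maximal \<gamma> \<Omega> (\<lambda>v. ennreal (norm (g v)))"
  have [measurable]: "?F \<in> borel_measurable borel" "?M \<in> borel_measurable borel"
    using \<Omega> \<gamma> by measurable
  have F: "AE x in lborel. ?F x < \<infinity>" using maximal_Lp(1)[OF fm(1) fin(1) p \<Omega> \<gamma>] by simp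
  have M: "AE x in lborel. ?M x < \<infinity>" using maximal_Lp(1)[OF fm(2) fin(2) p \<Omega> \<gamma>] by simp
  obtain e where e: "e > 0" "(\<Union>x\<in>K. cball x e) \<subseteq> \<Omega>"
    using compact_subset_open_imp_cball_epsilon_subset[OF K(1) \<Omega> K(2)] by blast
  show ?thesis
  \<comment> \<open>With \<open>norm w < e / 2\<close> the balls of radius \<open>norm w\<close>
    around \<open>x\<close> and around \<open>x + w\<close> both lie in
    \<open>cball x e\<close>.\<close>
  proof (intro exI[of _ "e / 2"] conjI allI impI)
    fix w :: 'a assume nw: "norm w < e / 2"
    have "AE x in lborel. x \<in> K \<longrightarrow> ?F x < \<infinity> \<and> ?F (x + w) < \<infinity> \<and> (AE t in lborel. ?M (x + t *\<^sub>R w) < \<infinity>)"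
      using F AE_lborel_translate[OF F, of w] AE_segment_AE[OF M, of w] by eventually_elim auto
    then show "AE x in lborel. x \<in> K \<longrightarrow>
      ennreal \<bar>u (x + w) - u x\<bar> \<le> ennreal (norm w) * (\<integral>\<^sup>+t. ennreal (G (x + t *\<^sub>R w)) * indicator {0..1} t \<partial>lborel)"
    proof eventually_elim
      case (elim x)
      show ?case
      proof
        assume x: "x \<in> K"
        have fx: "?F x = ennreal (u x)" "?F (x + w) = ennreal (u (x + w))"
          using elim x by (auto simp: u_def)
        have u0: "0 \<le> u x" "0 \<le> u (x + w)" by (auto simp: u_def)
        have d: "dist x (x + w) = norm w" "dist (x + w) x = norm w" by (simp_all add: dist_norm)
        let ?S = "\<integral>\<^sup>+t. ?M (x + t *\<^sub>R w) * indicator {0..1} t \<partial>lborel"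
        have c1: "cball x (dist x (x + w)) \<subseteq> \<Omega>"
        proof -
          have "cball x (norm w) \<subseteq> cball x e" using nw e(1) by auto
          then show ?thesis using e(2) x d by auto
        qed
        have c2: "cball (x + w) (dist (x + w) x) \<subseteq> \<Omega>"
        proof -
          have "cball (x + w) (norm w) \<subseteq> cball x e"
          proof
            fix v assume "v \<in> cball (x + w) (norm w)"
            then show "v \<in> cball x e"
              using dist_triangle[of x v "x + w"] d nw by simp
          qed
          then show ?thesis using e(2) x d by auto
        qed
        have "?F x \<le> ?F (x + w) + ennreal (2 * norm w) * ?S"
          using maximal_segment[OF assms(1) \<Omega> \<gamma> c1] by (simp add: d)
        \<comment> \<open>The segment is now traversed backwards; substituting \<open>1 - t\<close>
          for \<open>t\<close> shows that its integral is the same.\<close>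
        moreover have "?F (x + w) \<le> ?F x + ennreal (2 * norm w) * ?S"
        proof -
          have "(\<integral>\<^sup>+t. ?M ((x + w) + t *\<^sub>R (x - (x + w))) * indicator {0..1} t \<partial>lborel)
            = (\<integral>\<^sup>+t. ?M (x + (1 - t) *\<^sub>R w) * indicator {0..1} t \<partial>lborel)"
            by (intro nn_integral_cong) (simp add: algebra_simps)
          also have "\<dots> = ?S"
            by (rule nn_integral_unit_interval_reflect[of "\<lambda>t. ?M (x + t *\<^sub>R w)"]) simp
          finally show ?thesis
            using maximal_segment[OF assms(1) \<Omega> \<gamma> c2] by (simp add: d)
        qed
        ultimately have "ennreal \<bar>u (x + w) - u x\<bar> \<le> ennreal (2 * norm w) * ?S"
          unfolding fx using u0 by (intro ennreal_abs_diff_le)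
        also have "?S = (\<integral>\<^sup>+t. ennreal (G (x + t *\<^sub>R w) / 2) * indicator {0..1} t \<partial>lborel)"
          using elim x by (intro nn_integral_cong_AE) (auto simp: G_def)
        also have "ennreal (2 * norm w) * \<dots> = (\<integral>\<^sup>+t. ennreal (2 * norm w) * (ennreal (G (x + t *\<^sub>R w) / 2) * indicator {0..1} t) \<partial>lborel)"
          unfolding G_def by (rule nn_integral_cmult[symmetric]) simp
        also have "\<dots> = (\<integral>\<^sup>+t. ennreal (norm w) * (ennreal (G (x + t *\<^sub>R w)) * indicator {0..1} t) \<partial>lborel)"
        proof (intro nn_integral_cong)
          fix t
          have "0 \<le> G (x + t *\<^sub>R w)" by (simp add: G_def)
          then have "ennreal (2 * norm w) * ennreal (G (x + t *\<^sub>R w) / 2) = ennreal (norm w) * ennreal (G (x + t *\<^sub>R w))"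
            by (simp add: ennreal_mult[symmetric])
          then show "ennreal (2 * norm w) * (ennreal (G (x + t *\<^sub>R w) / 2) * indicator {0..1} t)
            = ennreal (norm w) * (ennreal (G (x + t *\<^sub>R w)) * indicator {0..1} t)"
            by (simp only: mult.assoc[symmetric])
        qed
        also have "\<dots> = ennreal (norm w) * (\<integral>\<^sup>+t. ennreal (G (x + t *\<^sub>R w)) * indicator {0..1} t \<partial>lborel)"
          unfolding G_def by (rule nn_integral_cmult) simp
        finally show "ennreal \<bar>u (x + w) - u x\<bar> \<le> ennreal (norm w) * (\<integral>\<^sup>+t. ennreal (G (x + t *\<^sub>R w)) * indicator {0..1} t \<partial>lborel)" .
      qed
    qed
  qed (use e in auto)
qed

lemma maximal_wgrad:
  fixes f :: "'a::euclidean_space \<Rightarrow> real"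
  assumes w: "wgrad \<Omega> f g" and \<Omega>: "open \<Omega>" and \<gamma>: "0 \<le> \<gamma>" and p: "1 < p"
    and fin: "Lp_pow p f < \<infinity>" "Lp_pow p g < \<infinity>"
  obtains h where "wgrad \<Omega> (\<lambda>x. enn2real (maximal \<gamma> \<Omega> (\<lambda>v. ennreal \<bar>f v\<bar>) x)) h"
    "AE x in lborel. x \<in> \<Omega> \<longrightarrow> norm (h x) \<le> 2 * enn2real (maximal \<gamma> \<Omega> (\<lambda>v. ennreal (norm (g v))) x)"
proof -
  have fm[measurable]: "f \<in> borel_measurable borel" "g \<in> borel_measurable borel"
    using w loc_int_borel by (auto simp: wgrad_def)
  define u where "u x = enn2real (maximal \<gamma> \<Omega> (\<lambda>v. ennreal \<bar>f v\<bar>) x)" for x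
  define G where "G x = 2 * enn2real (maximal \<gamma> \<Omega> (\<lambda>v. ennreal (norm (g v))) x)" for x
  have [measurable]: "u \<in> borel_measurable borel" "G \<in> borel_measurable borel"
    unfolding u_def[abs_def] G_def[abs_def] using \<Omega> \<gamma> by measurable
  have "Lp_pow p u < \<infinity>"
    using maximal_Lp(2)[OF fm(1) fin(1) p \<Omega> \<gamma>] fin(1) by (simp add: u_def[abs_def] ennreal_mult_less_top le_less_trans)
  then have u: "loc_int \<Omega> u" using p by (intro loc_int_Lp[of _ p]) auto
  have "Lp_pow p (\<lambda>x. enn2real (maximal \<gamma> \<Omega> (\<lambda>v. ennreal (norm (g v))) x)) < \<infinity>"
    using maximal_Lp(2)[OF fm(2) fin(2) p \<Omega> \<gamma>] fin(2) by (simp add: ennreal_mult_less_top le_less_trans)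
  then have "Lp_pow p G < \<infinity>"
    using p unfolding G_def[abs_def] Lp_pow_def
    using \<Omega> \<gamma> by (simp add: abs_mult powr_mult ennreal_mult nn_integral_cmult ennreal_mult_less_top)
  then have G: "loc_int UNIV G" using p by (intro loc_int_Lp[of _ p]) auto
  show ?thesis
  \<comment> \<open>A single function needs only the first bound: the second is zero and its set
    empty.\<close>
  proof (rule wgrad_difference_quotient[OF \<Omega> u G, of "\<lambda>_. 0" "{}"])
    fix K assume K: "compact K" "K \<subseteq> \<Omega>"
    show "\<exists>d>0. \<forall>w. norm w < d \<longrightarrow> (AE x in lborel. x \<in> K \<longrightarrow> ennreal \<bar>u (x + w) - u x\<bar> \<le> ennreal (norm w) *
      (\<integral>\<^sup>+t. ennreal (G (x + t *\<^sub>R w) + (indicator {} x + indicator {} (x + w)) * 0) * indicator {0..1} t \<partial>lborel))"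
      using maximal_difference_quotient[OF w \<Omega> \<gamma> p fin K] by (simp add: u_def G_def)
  next
    fix h assume "wgrad \<Omega> u h" "AE x in lborel. x \<in> \<Omega> \<longrightarrow> norm (h x) \<le> G x + 2 * indicator {} x * 0"
    then show thesis using that[of h] by (simp add: u_def[abs_def] G_def)
  qed (auto simp: G_def loc_int_def)
qed

text \<open>The roles are asymmetric on purpose: \<open>G2\<close> is counted everywhere,
  \<open>G1\<close> only where \<open>u1\<close> is the smaller function. In the application the
  second function is small in the Sobolev norm and the set \<open>u1 < u2\<close> is what
  shrinks.\<close>

lemma min_maximal_wgrad:
  fixes f1 f2 :: "'a::euclidean_space \<Rightarrow> real"
  assumes w1: "wgrad \<Omega> f1 g1" and w2: "wgrad \<Omega> f2 g2" and \<Omega>: "open \<Omega>" and \<gamma>: "0 \<le> \<gamma>" and p: "1 < p"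
    and fin1: "Lp_pow p f1 < \<infinity>" "Lp_pow p g1 < \<infinity>" and fin2: "Lp_pow p f2 < \<infinity>" "Lp_pow p g2 < \<infinity>"
  defines "u1 \<equiv> \<lambda>x. enn2real (maximal \<gamma> \<Omega> (\<lambda>v. ennreal \<bar>f1 v\<bar>) x)"
    and "u2 \<equiv> \<lambda>x. enn2real (maximal \<gamma> \<Omega> (\<lambda>v. ennreal \<bar>f2 v\<bar>) x)"
    and "G1 \<equiv> \<lambda>x. 2 * enn2real (maximal \<gamma> \<Omega> (\<lambda>v. ennreal (norm (g1 v))) x)"
    and "G2 \<equiv> \<lambda>x. 2 * enn2real (maximal \<gamma> \<Omega> (\<lambda>v. ennreal (norm (g2 v))) x)"
  obtains h where "wgrad \<Omega> (\<lambda>x. min (u1 x) (u2 x)) h"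
    "AE x in lborel. x \<in> \<Omega> \<longrightarrow> norm (h x) \<le> G2 x + 2 * indicator {x. u1 x < u2 x} x * G1 x"
proof -
  have fm[measurable]: "f1 \<in> borel_measurable borel" "g1 \<in> borel_measurable borel"
    "f2 \<in> borel_measurable borel" "g2 \<in> borel_measurable borel"
    using w1 w2 loc_int_borel by (auto simp: wgrad_def)
  have [measurable]: "u1 \<in> borel_measurable borel" "G1 \<in> borel_measurable borel"
    "u2 \<in> borel_measurable borel" "G2 \<in> borel_measurable borel"
    unfolding u1_def G1_def u2_def G2_def using \<Omega> \<gamma> by measurable
  let ?A = "{x. u1 x < u2 x}"
  have G: "loc_int UNIV (\<lambda>x. 2 * enn2real (maximal \<gamma> \<Omega> (\<lambda>v. ennreal (norm (g v))) x))"
    if [measurable]: "g \<in> borel_measurable borel" and f: "Lp_pow p g < \<infinity>" for g :: "'a \<Rightarrow> 'a"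
  proof -
    have "Lp_pow p (\<lambda>x. enn2real (maximal \<gamma> \<Omega> (\<lambda>v. ennreal (norm (g v))) x)) < \<infinity>"
      using maximal_Lp(2)[OF that p \<Omega> \<gamma>] f by (simp add: ennreal_mult_less_top le_less_trans)
    then have "Lp_pow p (\<lambda>x. 2 * enn2real (maximal \<gamma> \<Omega> (\<lambda>v. ennreal (norm (g v))) x)) < \<infinity>"
      using p unfolding Lp_pow_def
      using \<Omega> \<gamma> by (simp add: abs_mult powr_mult ennreal_mult nn_integral_cmult ennreal_mult_less_top)
    then show ?thesis using p \<Omega> \<gamma> by (intro loc_int_Lp[of _ p]) auto
  qed
  have Lu: "Lp_pow p u1 < \<infinity>"
    using maximal_Lp(2)[OF fm(1) fin1(1) p \<Omega> \<gamma>] fin1(1) by (simp add: u1_def ennreal_mult_less_top le_less_trans)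
  have u0: "0 \<le> u1 x" "0 \<le> u2 x" for x by (auto simp: u1_def u2_def)
  have "Lp_pow p (\<lambda>x. min (u1 x) (u2 x)) \<le> Lp_pow p u1"
    using u0 p by (intro Lp_pow_mono_AE AE_I2) auto
  then have m: "loc_int \<Omega> (\<lambda>x. min (u1 x) (u2 x))"
    using p Lu by (intro loc_int_Lp[of _ p]) auto
  have Gl: "loc_int UNIV G1" "loc_int UNIV G2"
    unfolding G1_def G2_def by (rule G[OF fm(2) fin1(2)], rule G[OF fm(4) fin2(2)])
  show ?thesis
  proof (rule wgrad_difference_quotient[OF \<Omega> m Gl(2) _ Gl(1), of ?A])
    show "?A \<in> sets borel" by simp
    fix K assume K: "compact K" "K \<subseteq> \<Omega>"
    obtain d1 where d1: "d1 > 0" "\<And>w. norm w < d1 \<Longrightarrow> AE x in lborel. x \<in> K \<longrightarrow>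
      ennreal \<bar>u1 (x + w) - u1 x\<bar> \<le> ennreal (norm w) * (\<integral>\<^sup>+t. ennreal (G1 (x + t *\<^sub>R w)) * indicator {0..1} t \<partial>lborel)"
      using maximal_difference_quotient[OF w1 \<Omega> \<gamma> p fin1 K] unfolding u1_def G1_def by blast
    obtain d2 where d2: "d2 > 0" "\<And>w. norm w < d2 \<Longrightarrow> AE x in lborel. x \<in> K \<longrightarrow>
      ennreal \<bar>u2 (x + w) - u2 x\<bar> \<le> ennreal (norm w) * (\<integral>\<^sup>+t. ennreal (G2 (x + t *\<^sub>R w)) * indicator {0..1} t \<partial>lborel)"
      using maximal_difference_quotient[OF w2 \<Omega> \<gamma> p fin2 K] unfolding u2_def G2_def by blast
    have G0: "0 \<le> G1 x" "0 \<le> G2 x" for x by (auto simp: G1_def G2_def)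
    show "\<exists>d>0. \<forall>w. norm w < d \<longrightarrow> (AE x in lborel. x \<in> K \<longrightarrow> ennreal \<bar>min (u1 (x + w)) (u2 (x + w)) - min (u1 x) (u2 x)\<bar> \<le> ennreal (norm w) *
      (\<integral>\<^sup>+t. ennreal (G2 (x + t *\<^sub>R w) + (indicator ?A x + indicator ?A (x + w)) * G1 (x + t *\<^sub>R w)) * indicator {0..1} t \<partial>lborel))"
    proof (intro exI[of _ "min d1 d2"] conjI allI impI)
      fix w :: 'a assume nw: "norm w < min d1 d2"
      from nw have "norm w < d1" "norm w < d2" by auto
      from d1(2)[OF this(1)] d2(2)[OF this(2)]
      show "AE x in lborel. x \<in> K \<longrightarrow> ennreal \<bar>min (u1 (x + w)) (u2 (x + w)) - min (u1 x) (u2 x)\<bar> \<le> ennreal (norm w) *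
        (\<integral>\<^sup>+t. ennreal (G2 (x + t *\<^sub>R w) + (indicator ?A x + indicator ?A (x + w)) * G1 (x + t *\<^sub>R w)) * indicator {0..1} t \<partial>lborel)"
        (is "AE x in lborel. x \<in> K \<longrightarrow> ?D x \<le> ennreal (norm w) * ?R x")
      proof eventually_elim
        case (elim x)
        show ?case
        proof
          assume x: "x \<in> K"
          have R2: "(\<integral>\<^sup>+t. ennreal (G2 (x + t *\<^sub>R w)) * indicator {0..1} t \<partial>lborel) \<le> ?R x"
            using G0 by (intro nn_integral_mono mult_right_mono ennreal_leI) auto
          have b2: "ennreal \<bar>u2 (x + w) - u2 x\<bar> \<le> ennreal (norm w) * ?R x"
            using elim(2) x R2 by (meson mult_left_mono order_trans zero_le)
          show "?D x \<le> ennreal (norm w) * ?R x"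
          \<comment> \<open>If neither endpoint lies in \<open>?A\<close>, the minimum is
            \<open>u2\<close> at both. Otherwise the indicator sum is at least 1, so the integrand
            dominates \<open>G1\<close> as well as \<open>G2\<close>, and the change of a minimum is
            at most the larger of the two changes.\<close>
          proof (cases "x \<in> ?A \<or> x + w \<in> ?A")
            case False
            then show ?thesis using b2 by simp
          next
            case True
            then have ge: "1 \<le> indicator ?A x + (indicator ?A (x + w) :: real)"
              by (auto simp: indicator_def)
            have "(\<integral>\<^sup>+t. ennreal (G1 (x + t *\<^sub>R w)) * indicator {0..1} t \<partial>lborel) \<le> ?R x"
            proof (intro nn_integral_mono mult_right_mono ennreal_leI)
              fix t :: real
              have "1 * G1 (x + t *\<^sub>R w) \<le> (indicator ?A x + indicator ?A (x + w)) * G1 (x + t *\<^sub>R w)"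
                using ge G0 by (intro mult_right_mono)
              then show "G1 (x + t *\<^sub>R w) \<le> G2 (x + t *\<^sub>R w) + (indicator ?A x + indicator ?A (x + w)) * G1 (x + t *\<^sub>R w)"
                using G0(2)[of "x + t *\<^sub>R w"] by linarith
            qed auto
            then have b1: "ennreal \<bar>u1 (x + w) - u1 x\<bar> \<le> ennreal (norm w) * ?R x"
              using elim(1) x by (meson mult_left_mono order_trans zero_le)
            have "?D x \<le> ennreal (max \<bar>u1 (x + w) - u1 x\<bar> \<bar>u2 (x + w) - u2 x\<bar>)"
              by (intro ennreal_leI) (auto simp: min_def max_def)
            also have "\<dots> \<le> ennreal (norm w) * ?R x"
              using b1 b2 by (simp add: max_def)
            finally show ?thesis .
          qed
        qed
      qed
    qed (use d1 d2 in auto)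
  next
    fix h assume "wgrad \<Omega> (\<lambda>x. min (u1 x) (u2 x)) h"
      "AE x in lborel. x \<in> \<Omega> \<longrightarrow> norm (h x) \<le> G2 x + 2 * indicator ?A x * G1 x"
    then show thesis by (rule that)
  qed (auto simp: G1_def G2_def)
qed

section \<open>Calculus of weak gradients\<close>

lemma loc_int_mono: "loc_int \<Omega> f \<Longrightarrow> U \<subseteq> \<Omega> \<Longrightarrow> loc_int U f"
  by (auto simp: loc_int_def)

lemma wgrad_mono: "wgrad \<Omega> f g \<Longrightarrow> U \<subseteq> \<Omega> \<Longrightarrow> wgrad U f g"
  unfolding wgrad_def by (auto intro: loc_int_mono test_functions_mono)

lemma loc_int_diff: "loc_int \<Omega> f \<Longrightarrow> loc_int \<Omega> g \<Longrightarrow> loc_int \<Omega> (\<lambda>x. f x - g x)"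
  by (auto simp: loc_int_def scaleR_diff_right)

lemma wgrad_test_integrable:
  assumes "wgrad \<Omega> f g" "\<psi> \<in> test_functions \<Omega>"
  shows "integrable lborel (\<lambda>x. f x * frechet_derivative \<psi> (at x) b)" "integrable lborel (\<lambda>x. (g x \<bullet> b) * \<psi> x)"
proof -
  show "integrable lborel (\<lambda>x. f x * frechet_derivative \<psi> (at x) b)"
    using loc_int_test_deriv[of \<Omega> f \<psi> b] assms by (simp add: wgrad_def mult.commute)
  show "integrable lborel (\<lambda>x. (g x \<bullet> b) * \<psi> x)"
    using integrable_inner_left[OF loc_int_test[of \<Omega> g \<psi>], of b] assms by (simp add: wgrad_def mult.commute)
qed

lemma wgrad_diff:
  assumes "wgrad \<Omega> f g" "wgrad \<Omega> f' g'"
  shows "wgrad \<Omega> (\<lambda>x. f x - f' x) (\<lambda>x. g x - g' x)"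
  unfolding wgrad_def
proof (intro conjI ballI)
  show "loc_int \<Omega> (\<lambda>x. f x - f' x)" "loc_int \<Omega> (\<lambda>x. g x - g' x)"
    using assms by (auto simp: wgrad_def intro: loc_int_diff)
  fix \<psi> b assume t: "\<psi> \<in> test_functions \<Omega>" "b \<in> (Basis :: 'a set)"
  note i = wgrad_test_integrable[OF assms(1) t(1), of b] wgrad_test_integrable[OF assms(2) t(1), of b]
  show "(\<integral>x. (f x - f' x) * frechet_derivative \<psi> (at x) b \<partial>lborel) = - (\<integral>x. ((g x - g' x) \<bullet> b) * \<psi> x \<partial>lborel)"
    using assms t i by (simp add: wgrad_def left_diff_distrib inner_diff_left)
qed

text \<open>The difference of two candidates is a weak gradient of the zero function, so each
  component integrates to zero against all test functions.\<close>

lemma wgrad_unique: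
  fixes g g' :: "'a::euclidean_space \<Rightarrow> 'a"
  assumes \<Omega>: "open \<Omega>" and w: "wgrad \<Omega> f g" "wgrad \<Omega> f g'"
  shows "AE x in lborel. x \<in> \<Omega> \<longrightarrow> g x = g' x"
proof -
  have d: "wgrad \<Omega> (\<lambda>x. f x - f x) (\<lambda>x. g x - g' x)" using w by (rule wgrad_diff)
  have "AE x in lborel. x \<in> \<Omega> \<longrightarrow> (g x - g' x) \<bullet> b = 0" if b: "b \<in> Basis" for b
  proof (rule zero_AE_if_zero_test[OF \<Omega>])
    have l: "loc_int \<Omega> (\<lambda>x. g x - g' x)" using d by (simp add: wgrad_def)
    show "loc_int \<Omega> (\<lambda>x. (g x - g' x) \<bullet> b)"
      unfolding loc_int_def
    proof (intro conjI allI impI)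
      show "(\<lambda>x. (g x - g' x) \<bullet> b) \<in> borel_measurable borel"
        using loc_int_borel[OF l] by measurable
      fix K assume "compact K \<and> K \<subseteq> \<Omega>"
      then have "integrable lborel (\<lambda>x. (indicator K x *\<^sub>R (g x - g' x)) \<bullet> b)"
        by (intro integrable_inner_left loc_int_compact[OF l]) auto
      then show "integrable lborel (\<lambda>x. indicator K x *\<^sub>R ((g x - g' x) \<bullet> b))" by simp
    qed
    show "(\<integral>x. ((g x - g' x) \<bullet> b) * \<psi> x \<partial>lborel) = 0" if "\<psi> \<in> test_functions \<Omega>" for \<psi>
      using d that b by (simp add: wgrad_def)
  qed
  then have "AE x in lborel. \<forall>b\<in>Basis. x \<in> \<Omega> \<longrightarrow> (g x - g' x) \<bullet> b = 0"
    by (subst AE_ball_countable) (auto simp: countable_finite)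
  then show ?thesis
    by eventually_elim (auto simp: inner_diff_left intro: euclidean_eqI)
qed

lemma integral_cong_AE_off_support:
  fixes f f' :: "'a::euclidean_space \<Rightarrow> real"
  assumes "f \<in> borel_measurable borel" "f' \<in> borel_measurable borel" "k \<in> borel_measurable borel"
    "AE x in lborel. x \<in> \<Omega> \<longrightarrow> f x = f' x" "\<And>x. x \<notin> \<Omega> \<Longrightarrow> k x = 0"
  shows "(\<integral>x. f x * k x \<partial>lborel) = (\<integral>x. f' x * k x \<partial>lborel)"
proof (rule integral_cong_AE)
  show "AE x in lborel. f x * k x = f' x * k x"
    using assms(4)
  proof eventually_elim
    case (elim x)
    then show ?case using assms(5)[of x] by (cases "x \<in> \<Omega>") auto
  qed
qed (use assms in auto)

lemma loc_int_cong_AE: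
  fixes f f' :: "'a::euclidean_space \<Rightarrow> 'b::euclidean_space"
  assumes f: "loc_int \<Omega> f" and f'[measurable]: "f' \<in> borel_measurable borel"
    and eq: "AE x in lborel. x \<in> \<Omega> \<longrightarrow> f x = f' x"
  shows "loc_int \<Omega> f'"
  unfolding loc_int_def
proof (intro conjI allI impI f')
  have [measurable]: "f \<in> borel_measurable borel" using f by (rule loc_int_borel)
  fix K assume K: "compact K \<and> K \<subseteq> \<Omega>"
  then have [measurable]: "K \<in> sets borel" by (simp add: borel_compact)
  have "integrable lborel (\<lambda>x. indicator K x *\<^sub>R f x)"
    using K by (intro loc_int_compact[OF f]) auto
  then show "integrable lborel (\<lambda>x. indicator K x *\<^sub>R f' x)"
  proof (rule integrable_cong_AE_imp)
    show "AE x in lborel. indicator K x *\<^sub>R f x = indicator K x *\<^sub>R f' x"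
      using eq by eventually_elim (use K in \<open>auto simp: indicator_def\<close>)
  qed simp
qed

lemma test_functions_zero_outside:
  assumes "\<psi> \<in> test_functions \<Omega>" "x \<notin> \<Omega>"
  shows "\<psi> x = 0" "frechet_derivative \<psi> (at x) e = 0"
proof -
  obtain K where K: "compact K" "K \<subseteq> \<Omega>" "\<And>x. x \<notin> K \<Longrightarrow> \<psi> x = 0"
    using assms(1) by (rule test_functions_support) blast
  then show "\<psi> x = 0" using assms(2) by blast
  show "frechet_derivative \<psi> (at x) e = 0"
    using K assms by (intro test_functions_deriv_zero[OF assms(1) K(1,3)]) auto
qed

lemma wgrad_cong_AE:
  assumes w: "wgrad \<Omega> f g" and m[measurable]: "f' \<in> borel_measurable borel" "g' \<in> borel_measurable borel"
    and eq: "AE x in lborel. x \<in> \<Omega> \<longrightarrow> f x = f' x" "AE x in lborel. x \<in> \<Omega> \<longrightarrow> g x = g' x"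
  shows "wgrad \<Omega> f' g'"
  unfolding wgrad_def
proof (intro conjI ballI)
  have [measurable]: "f \<in> borel_measurable borel" "g \<in> borel_measurable borel"
    using w loc_int_borel by (auto simp: wgrad_def)
  show "loc_int \<Omega> f'" "loc_int \<Omega> g'"
    using w by (auto simp: wgrad_def intro: loc_int_cong_AE[OF _ m(1) eq(1)] loc_int_cong_AE[OF _ m(2) eq(2)])
  fix \<psi> b assume t: "\<psi> \<in> test_functions \<Omega>" "b \<in> (Basis :: 'a set)"
  have [measurable]: "\<psi> \<in> borel_measurable borel" "(\<lambda>x. frechet_derivative \<psi> (at x) b) \<in> borel_measurable borel"
    using t by (auto intro: test_functions_borel test_functions_deriv_borel)
  have "(\<integral>x. f' x * frechet_derivative \<psi> (at x) b \<partial>lborel) = (\<integral>x. f x * frechet_derivative \<psi> (at x) b \<partial>lborel)"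
    using t eq by (intro integral_cong_AE_off_support[of _ _ _ \<Omega>]) (auto simp: test_functions_zero_outside)
  moreover have "(\<integral>x. (g' x \<bullet> b) * \<psi> x \<partial>lborel) = (\<integral>x. (g x \<bullet> b) * \<psi> x \<partial>lborel)"
    using t eq by (intro integral_cong_AE_off_support[of _ _ _ \<Omega>]) (auto simp: test_functions_zero_outside)
  ultimately show "(\<integral>x. f' x * frechet_derivative \<psi> (at x) b \<partial>lborel) = - (\<integral>x. (g' x \<bullet> b) * \<psi> x \<partial>lborel)"
    using w t by (simp add: wgrad_def)
qed

lemma wgrad_zero: "wgrad \<Omega> (\<lambda>_. 0) (\<lambda>_. 0)"
  by (simp add: wgrad_def loc_int_def)

text \<open>Weak gradients restrict to open subsets; on \<open>U\<close> both \<open>g\<close> and 0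
  are weak gradients of the same function.\<close>

lemma wgrad_zero_local:
  assumes U: "open U" "U \<subseteq> \<Omega>" and w: "wgrad \<Omega> f g" and z: "AE x in lborel. x \<in> U \<longrightarrow> f x = 0"
  shows "AE x in lborel. x \<in> U \<longrightarrow> g x = 0"
proof -
  have wU: "wgrad U f g" using w U(2) by (rule wgrad_mono)
  have "wgrad U (\<lambda>_. 0) g"
    using wU z loc_int_borel by (intro wgrad_cong_AE[OF wU]) (auto simp: wgrad_def)
  then show ?thesis using wgrad_unique[OF U(1) _ wgrad_zero] by blast
qed

text \<open>Convolution with the constant 1 is constant by translation invariance, and the integral
  in question is, up to sign, its derivative.\<close>

lemma integral_test_deriv_zero:
  assumes "\<eta> \<in> test_functions UNIV"
  shows "(\<integral>y. frechet_derivative \<eta> (at y) e \<partial>lborel) = 0"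
proof -
  define \<eta>' where "\<eta>' y = \<eta> (0 - y)" for y
  have t: "\<eta>' \<in> test_functions UNIV" unfolding \<eta>'_def by (rule test_functions_reflect[OF assms])
  have one: "loc_int UNIV (\<lambda>_::'a. 1::real)"
    by (auto simp: loc_int_def borel_compact intro!: integrable_real_indicator emeasure_compact_finite)
  have [measurable]: "\<eta> \<in> borel_measurable borel" using assms by (rule test_functions_borel)
  have "convolve \<eta>' (\<lambda>_. 1) x = convolve \<eta>' (\<lambda>_. 1) 0" for x
  proof -
    have "convolve \<eta>' (\<lambda>_. 1) x = (\<integral>y. \<eta> (y + - x) \<partial>lborel)" by (simp add: convolve_def \<eta>'_def)
    also have "\<dots> = (\<integral>y. \<eta> y \<partial>lborel)" by (rule integral_lborel_translate) simp
    finally show ?thesis by (simp add: convolve_def \<eta>'_def)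
  qed
  then have "convolve \<eta>' (\<lambda>_. 1) = (\<lambda>_. convolve \<eta>' (\<lambda>_. 1) 0)" by blast
  then have "(convolve \<eta>' (\<lambda>_. 1) has_derivative (\<lambda>_. 0)) (at 0)"
    by (metis has_derivative_const)
  from has_derivative_unique[OF this convolve_has_derivative[OF t one]]
  have "(\<integral>y. frechet_derivative \<eta>' (at (0 - y)) e * 1 \<partial>lborel) = 0"
    by (metis (no_types, lifting))
  moreover have "frechet_derivative \<eta>' (at (0 - y)) e = - frechet_derivative \<eta> (at y) e" for y
    unfolding \<eta>'_def[abs_def] by (subst frechet_derivative_reflect[OF assms]) simp
  ultimately show ?thesis by simp
qed

text \<open>Integration by parts in the form that the derivative of the product of two test
  functions has integral zero.\<close>

lemma wgrad_test_functions:
  fixes \<theta> :: "'a::euclidean_space \<Rightarrow> real"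
  assumes t: "\<theta> \<in> test_functions \<Omega>"
  shows "wgrad \<Omega> \<theta> (\<lambda>x. \<Sum>b\<in>Basis. frechet_derivative \<theta> (at x) b *\<^sub>R b)"
  unfolding wgrad_def
proof (intro conjI ballI)
  have ti: "integrable lborel (\<lambda>x. frechet_derivative \<theta> (at x) b)" if "b \<in> Basis" for b
    using that by (intro integrable_test_functions[OF test_functions_deriv[OF t]])
  show "loc_int \<Omega> \<theta>" by (intro loc_int_integrable integrable_test_functions[OF t])
  show "loc_int \<Omega> (\<lambda>x. \<Sum>b\<in>Basis. frechet_derivative \<theta> (at x) b *\<^sub>R b)"
    by (intro loc_int_integrable Bochner_Integration.integrable_sum integrable_scaleR_left ti)
  fix \<psi> b assume p: "\<psi> \<in> test_functions \<Omega>" and b: "b \<in> (Basis :: 'a set)"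
  have tp: "(\<lambda>x. \<theta> x * \<psi> x) \<in> test_functions UNIV"
    using t p by (intro test_functions_mult test_functions_mono[OF p]) (auto simp: test_functions_Ck)
  have "frechet_derivative (\<lambda>x. \<theta> x * \<psi> x) (at x) b = \<theta> x * frechet_derivative \<psi> (at x) b + frechet_derivative \<theta> (at x) b * \<psi> x" for x
    by (simp add: frechet_derivative_at[OF has_derivative_mult[OF test_functions_has_derivative[OF t] test_functions_has_derivative[OF p]], symmetric])
  then have "0 = (\<integral>x. \<theta> x * frechet_derivative \<psi> (at x) b + frechet_derivative \<theta> (at x) b * \<psi> x \<partial>lborel)"
    using integral_test_deriv_zero[OF tp, of b] by simp
  also have "\<dots> = (\<integral>x. \<theta> x * frechet_derivative \<psi> (at x) b \<partial>lborel) + (\<integral>x. frechet_derivative \<theta> (at x) b * \<psi> x \<partial>lborel)"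
  proof (rule Bochner_Integration.integral_add)
    show "integrable lborel (\<lambda>x. \<theta> x * frechet_derivative \<psi> (at x) b)"
      by (intro integrable_test_functions[of _ \<Omega>] test_functions_mult test_functions_deriv p b) (simp add: test_functions_Ck[OF t])
    show "integrable lborel (\<lambda>x. frechet_derivative \<theta> (at x) b * \<psi> x)"
      by (intro integrable_test_functions[of _ \<Omega>] test_functions_mult p) (simp add: test_functions_Ck[OF test_functions_deriv[OF t b]])
  qed
  finally show "(\<integral>x. \<theta> x * frechet_derivative \<psi> (at x) b \<partial>lborel)
      = - (\<integral>x. ((\<Sum>b\<in>Basis. frechet_derivative \<theta> (at x) b *\<^sub>R b) \<bullet> b) * \<psi> x \<partial>lborel)"
    using b by (simp add: inner_sum_left inner_Basis if_distrib cong: if_cong)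
qed

lemma ennreal_divide_eq_0: "0 < w \<Longrightarrow> a / ennreal w = 0 \<longleftrightarrow> a = 0"
  by (simp add: divide_ennreal_def ennreal_inverse_eq_0_iff)

text \<open>A zero of the maximal function makes \<open>f\<close> vanish almost everywhere on each
  admissible ball, and then so does its weak gradient. This controls the gradient bound on the zero
  set of the maximal function.\<close>

lemma maximal_grad_zero:
  fixes f :: "'a::euclidean_space \<Rightarrow> real"
  assumes w: "wgrad \<Omega> f g" and \<Omega>: "open \<Omega>" and \<gamma>: "0 \<le> \<gamma>"
    and z: "maximal \<gamma> \<Omega> (\<lambda>v. ennreal \<bar>f v\<bar>) x = 0"
  shows "maximal \<gamma> \<Omega> (\<lambda>v. ennreal (norm (g v))) x = 0"
proof -
  have fm[measurable]: "f \<in> borel_measurable borel" "g \<in> borel_measurable borel"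
    using w loc_int_borel by (auto simp: wgrad_def)
  have "(\<integral>\<^sup>+v\<in>ball x r. ennreal (norm (g v)) \<partial>lborel) / ennreal (growth_weight TYPE('a) \<gamma> r) = 0"
    if r: "0 < r" "cball x r \<subseteq> \<Omega>" for r
  proof -
    have [measurable]: "ball x r \<in> sets borel" by simp
    have W: "0 < growth_weight TYPE('a) \<gamma> r" using growth_weight_ge(3)[OF \<gamma> r(1)] .
    have "(\<integral>\<^sup>+v\<in>ball x r. ennreal \<bar>f v\<bar> \<partial>lborel) / ennreal (growth_weight TYPE('a) \<gamma> r) \<le> maximal \<gamma> \<Omega> (\<lambda>v. ennreal \<bar>f v\<bar>) x"
      unfolding ball_sup_def using r by (intro SUP_upper) auto
    then have "(\<integral>\<^sup>+v\<in>ball x r. ennreal \<bar>f v\<bar> \<partial>lborel) = 0"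
      using z W by (simp add: ennreal_divide_eq_0)
    then have "AE v in lborel. v \<in> ball x r \<longrightarrow> f v = 0"
      by (subst (asm) nn_integral_0_iff_AE) (auto simp: indicator_def)
    then have "AE v in lborel. v \<in> ball x r \<longrightarrow> g v = 0"
      using r ball_subset_cball by (intro wgrad_zero_local[OF _ _ w]) auto
    then have "(\<integral>\<^sup>+v\<in>ball x r. ennreal (norm (g v)) \<partial>lborel) = 0"
      by (subst nn_integral_0_iff_AE) (auto simp: indicator_def)
    then show ?thesis by simp
  qed
  then show ?thesis
    unfolding ball_sup_def by (intro antisym SUP_least) auto
qed

section \<open>Approximation by test functions\<close>

lemma Lp_pow_scaleR:
  assumes [measurable]: "f \<in> borel_measurable borel"
  shows "Lp_pow p (\<lambda>x. c *\<^sub>R f x) = ennreal (\<bar>c\<bar> powr p) * Lp_pow p f"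
  by (simp add: Lp_pow_def powr_mult ennreal_mult nn_integral_cmult)

lemma Lp_pow_finite_scaleR:
  assumes "f \<in> borel_measurable borel" "Lp_pow p f < \<infinity>"
  shows "Lp_pow p (\<lambda>x. c *\<^sub>R f x) < \<infinity>"
  using assms by (simp add: Lp_pow_scaleR ennreal_mult_less_top)

lemma Lp_pow_finite_add:
  assumes "f \<in> borel_measurable borel" "g \<in> borel_measurable borel" "0 \<le> p" "Lp_pow p f < \<infinity>" "Lp_pow p g < \<infinity>"
  shows "Lp_pow p (\<lambda>x. f x + g x) < \<infinity>"
  using Lp_pow_add[OF assms(1-3)] assms(4,5) by (simp add: ennreal_mult_less_top le_less_trans)

lemma Lp_pow_add_le_real:
  assumes m: "f \<in> borel_measurable borel" "g \<in> borel_measurable borel" and p: "0 \<le> p"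
    and q: "Lp_pow p f \<le> ennreal q" "Lp_pow p g \<le> ennreal q" "0 \<le> q"
  shows "Lp_pow p (\<lambda>x. f x + g x) \<le> ennreal (2 * 2 powr p * q)"
proof -
  have "Lp_pow p (\<lambda>x. f x + g x) \<le> ennreal (2 powr p) * (ennreal q + ennreal q)"
    using Lp_pow_add[OF m p] mult_left_mono[OF add_mono[OF q(1,2)], of "ennreal (2 powr p)"] by (rule order_trans) simp
  also have "\<dots> = ennreal (2 * 2 powr p * q)"
    using q(3) by (simp add: ennreal_plus[symmetric] ennreal_mult[symmetric] mult_ac del: ennreal_plus)
  finally show ?thesis .
qed

lemma Lp_pow_norm: "Lp_pow p (\<lambda>x. norm (f x)) = Lp_pow p f"
  by (simp add: Lp_pow_def)

lemma mollify_zero_AE: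
  assumes r: "0 < r" and z: "AE y in lborel. y \<in> ball x r \<longrightarrow> v y = 0"
  shows "mollify r v x = 0"
proof -
  have "AE y in lborel. mollifier r (x - y) *\<^sub>R v y = 0"
    using z
  proof eventually_elim
    case (elim y)
    then show ?case using mollifier_support[OF r, of "x - y"] by (cases "y \<in> ball x r") (auto simp: dist_norm)
  qed
  then show ?thesis unfolding mollify_def by (rule integral_eq_zero_AE)
qed

text \<open>If the kernel at \<open>x\<close> reaches out of \<open>\<Omega>\<close>, then
  \<open>x\<close> is so close to the complement that \<open>v\<close> vanishes near
  \<open>x\<close>, and so do both mollifications. Otherwise the interior formula applies.\<close>

lemma mollify_wgrad_has_derivative_everywhere:
  fixes v :: "'a::euclidean_space \<Rightarrow> real"
  assumes w: "wgrad \<Omega> v h" and \<Omega>: "open \<Omega>" and l: "loc_int UNIV v" "loc_int UNIV h"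
    and h0: "\<And>x. x \<notin> \<Omega> \<Longrightarrow> h x = 0"
    and c: "AE x in lborel. v x \<noteq> 0 \<longrightarrow> cball x c \<subseteq> \<Omega>" and r: "0 < r" "4 * r \<le> c"
  shows "(mollify r v has_derivative (\<lambda>e. mollify r h x \<bullet> e)) (at x)"
proof (cases "cball x r \<subseteq> \<Omega>")
  case True
  then show ?thesis
    by (intro mollify_wgrad_has_derivative[OF w r(1)] l) auto
next
  case False
  \<comment> \<open>For such \<open>y\<close> the ball \<open>cball x r\<close> is within distance
    \<open>3 * r \<le> c\<close> of \<open>y\<close>. If \<open>v y\<close> were nonzero,
    \<open>cball x r\<close> would generally lie in \<open>\<Omega>\<close>, against the case
    assumption.\<close>
  have v0: "AE y in lborel. y \<in> ball x (2 * r) \<longrightarrow> v y = 0"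
    using c
  proof eventually_elim
    case (elim y)
    show ?case
    proof (rule impI, rule ccontr)
      assume y: "y \<in> ball x (2 * r)" and "v y \<noteq> 0"
      then have "cball y c \<subseteq> \<Omega>" using elim by blast
      moreover have "cball x r \<subseteq> cball y c"
      proof
        fix z assume "z \<in> cball x r"
        then show "z \<in> cball y c" using y r dist_triangle[of y z x] by (simp add: dist_commute)
      qed
      ultimately show False using False by blast
    qed
  qed
  have "AE y in lborel. y \<in> \<Omega> \<inter> ball x (2 * r) \<longrightarrow> h y = 0"
    by (rule wgrad_zero_local[OF _ _ w]) (use \<Omega> v0 in auto)
  then have "AE y in lborel. y \<in> ball x r \<longrightarrow> h y = 0"
    by eventually_elim (use h0 r(1) in auto)
  then have hz: "mollify r h x = 0" by (rule mollify_zero_AE[OF r(1)])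
  have vz: "mollify r v x' = 0" if "x' \<in> ball x r" for x'
  proof (rule mollify_zero_AE[OF r(1)])
    show "AE y in lborel. y \<in> ball x' r \<longrightarrow> v y = 0"
      using v0
    proof eventually_elim
      case (elim y)
      then show ?case using that dist_triangle[of x y x'] by auto
    qed
  qed
  have "((\<lambda>_. 0) has_derivative (\<lambda>_. 0)) (at x)" by simp
  then have "(mollify r v has_derivative (\<lambda>_. 0)) (at x)"
    by (rule has_derivative_transform_within_open[of _ _ _ _ "ball x r"]) (use r vz in auto)
  then show ?thesis using hz by simp
qed

text \<open>Mollification at a scale below the margin \<open>c\<close> keeps the support away from
  the boundary. Multiplication by a dilated bump makes it compact, at the cost of a gradient term
  that tends to zero.\<close>

lemma dense_test_functions:
  fixes v :: "'a::euclidean_space \<Rightarrow> real"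
  assumes w: "wgrad \<Omega> v h" and \<Omega>: "open \<Omega>" and p: "1 \<le> p"
    and fin: "Lp_pow p v < \<infinity>" "Lp_pow p h < \<infinity>" and h0: "\<And>x. x \<notin> \<Omega> \<Longrightarrow> h x = 0"
    and c: "0 < c" "AE x in lborel. v x \<noteq> 0 \<longrightarrow> cball x c \<subseteq> \<Omega>" and \<epsilon>: "0 < \<epsilon>"
  shows "\<exists>\<theta> \<Theta>. \<theta> \<in> test_functions \<Omega> \<and> wgrad \<Omega> \<theta> \<Theta> \<and>
    Lp_pow p (\<lambda>x. v x - \<theta> x) \<le> ennreal \<epsilon> \<and> Lp_pow p (\<lambda>x. h x - \<Theta> x) \<le> ennreal \<epsilon>"
proof -
  have [measurable]: "v \<in> borel_measurable borel" "h \<in> borel_measurable borel"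
    using w loc_int_borel by (auto simp: wgrad_def)
  have l: "loc_int UNIV v" "loc_int UNIV h" using fin p by (auto intro: loc_int_Lp)
  \<comment> \<open>Two errors of size \<open>q\<close>, one from mollifying and one from cutting
    off, add up to \<open>\<epsilon>\<close> under the quasi-triangle inequality.\<close>
  define q where "q = \<epsilon> / (2 * 2 powr p)"
  have q: "0 < q" "2 * 2 powr p * q = \<epsilon>" using \<epsilon> by (auto simp: q_def)
  have "\<forall>\<^sub>F r in at_right 0. Lp_pow p (\<lambda>x. mollify r v x - v x) < ennreal q"
    "\<forall>\<^sub>F r in at_right 0. Lp_pow p (\<lambda>x. mollify r h x - h x) < ennreal q"
    using q(1) by (auto intro!: order_tendstoD(2)[OF mollify_tendsto_Lp] fin p)
  moreover have "\<forall>\<^sub>F r in at_right 0. 0 < r \<and> r < c / 4"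
    using c(1) by (auto simp: eventually_at_right_field intro!: exI[of _ "c / 4"])
  ultimately have "\<forall>\<^sub>F r in at_right 0. Lp_pow p (\<lambda>x. mollify r v x - v x) < ennreal q \<and>
    Lp_pow p (\<lambda>x. mollify r h x - h x) < ennreal q \<and> 0 < r \<and> r < c / 4"
    by eventually_elim simp
  then obtain r where r: "Lp_pow p (\<lambda>x. mollify r v x - v x) < ennreal q"
    "Lp_pow p (\<lambda>x. mollify r h x - h x) < ennreal q" "0 < r" "r < c / 4"
    using eventually_happens[of _ "at_right (0::real)"] trivial_limit_at_right_real by blast
  define V where "V = mollify r v"
  define H where "H = mollify r h"
  have [measurable]: "V \<in> borel_measurable borel" "H \<in> borel_measurable borel" by (simp_all add: V_def H_def)
  have dV: "(V has_derivative (\<lambda>e. H x \<bullet> e)) (at x)" for x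
    unfolding V_def H_def using r by (intro mollify_wgrad_has_derivative_everywhere[OF w \<Omega> l h0 c(2)]) auto
  have V0: "V x = 0" if "z \<notin> \<Omega>" "dist x z < c / 2" for x z
    unfolding V_def
  proof (rule mollify_zero_AE[OF r(3)])
    show "AE y in lborel. y \<in> ball x r \<longrightarrow> v y = 0"
      using c(2)
    proof eventually_elim
      case (elim y)
      show ?case
      proof (rule impI, rule ccontr)
        assume y: "y \<in> ball x r" and "v y \<noteq> 0"
        then have "cball y c \<subseteq> \<Omega>" using elim by blast
        moreover have "z \<in> cball y c" using y that(2) r(4) c(1) dist_triangle[of y z x] by (simp add: dist_commute)
        ultimately show False using that(1) by blast
      qed
    qed
  qed
  have Vfin: "Lp_pow p V < \<infinity>" "Lp_pow p H < \<infinity>"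
  proof -
    have "Lp_pow p (\<lambda>x. V x - v x) < \<infinity>" "Lp_pow p (\<lambda>x. H x - h x) < \<infinity>"
      using r(1,2) unfolding V_def H_def by (auto intro: less_trans[OF _ ennreal_less_top])
    then have "Lp_pow p (\<lambda>x. (V x - v x) + v x) < \<infinity>" "Lp_pow p (\<lambda>x. (H x - h x) + h x) < \<infinity>"
      using p fin by (intro Lp_pow_finite_add; simp)+
    then show "Lp_pow p V < \<infinity>" "Lp_pow p H < \<infinity>" by simp_all
  qed
  \<comment> \<open>A bump with value 1 at the origin. Its dilates \<open>\<zeta>n\<close> tend to 1
    pointwise by continuity, with gradients of order \<open>1 / Suc n\<close>.\<close>
  define \<zeta> where "\<zeta> x = inverse (mollifier 1 (0::'a)) * mollifier 1 x" for x :: 'a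
  have "0 < mollifier 1 (0::'a)" by (rule mollifier_pos) auto
  then have "mollifier 1 (0::'a) \<noteq> 0" by (rule less_imp_neq[symmetric])
  then have z0: "\<zeta> 0 = 1" by (simp add: \<zeta>_def)
  have zt: "\<zeta> \<in> test_functions UNIV"
    unfolding \<zeta>_def by (intro test_functions_cmult mollifier_test_functions) simp
  obtain B where B: "0 \<le> B" "\<And>x. \<bar>\<zeta> x\<bar> \<le> B" using zt by (rule test_functions_bounded) blast
  obtain B' where B': "0 \<le> B'" "\<And>x e. \<bar>frechet_derivative \<zeta> (at x) e\<bar> \<le> B' * norm e"
    using zt by (rule test_functions_deriv_bounded) blast
  define \<zeta>n where "\<zeta>n n x = \<zeta> ((1 / real (Suc n)) *\<^sub>R x)" for n x
  have znk: "Ck k (\<zeta>n n)" for k n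
    using Ck_affine[OF test_functions_Ck[OF zt], of k "1 / real (Suc n)" 0] by (simp add: \<zeta>n_def[abs_def])
  have dz: "(\<zeta>n n has_derivative (\<lambda>e. (1 / real (Suc n)) * frechet_derivative \<zeta> (at ((1 / real (Suc n)) *\<^sub>R x)) e)) (at x)" for n x
  proof -
    let ?s = "1 / real (Suc n)"
    have a: "((\<lambda>x. ?s *\<^sub>R x) has_derivative (\<lambda>e. ?s *\<^sub>R e)) (at x)" by (auto intro!: derivative_eq_intros)
    have "((\<lambda>x. \<zeta> (?s *\<^sub>R x)) has_derivative (\<lambda>e. frechet_derivative \<zeta> (at (?s *\<^sub>R x)) (?s *\<^sub>R e))) (at x)"
      by (rule has_derivative_compose[of "\<lambda>x. ?s *\<^sub>R x" "\<lambda>e. ?s *\<^sub>R e" x UNIV \<zeta>, OF a test_functions_has_derivative[OF zt]])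
    moreover have "frechet_derivative \<zeta> (at (?s *\<^sub>R x)) (?s *\<^sub>R e) = ?s * frechet_derivative \<zeta> (at (?s *\<^sub>R x)) e" for e
      using linear_cmul[OF has_derivative_linear[OF test_functions_has_derivative[OF zt]], of "?s *\<^sub>R x" ?s e] by simp
    ultimately show ?thesis by (simp add: \<zeta>n_def[abs_def])
  qed
  define Z where "Z n x = (\<Sum>b\<in>Basis. ((1 / real (Suc n)) * frechet_derivative \<zeta> (at ((1 / real (Suc n)) *\<^sub>R x)) b) *\<^sub>R b)" for n x
  have Zb: "norm (Z n x) \<le> (1 / real (Suc n)) * (DIM('a) * B')" for n x
  proof -
    have "norm (Z n x) \<le> (\<Sum>b\<in>(Basis::'a set). (1 / real (Suc n)) * B')"
      unfolding Z_def
    proof (intro order_trans[OF norm_sum] sum_mono)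
      fix b :: 'a assume b: "b \<in> Basis"
      have "\<bar>frechet_derivative \<zeta> (at ((1 / real (Suc n)) *\<^sub>R x)) b\<bar> \<le> B'"
        using B'(2)[of "(1 / real (Suc n)) *\<^sub>R x" b] b by simp
      from mult_left_mono[OF this, of "1 / real (Suc n)"]
      show "norm (((1 / real (Suc n)) * frechet_derivative \<zeta> (at ((1 / real (Suc n)) *\<^sub>R x)) b) *\<^sub>R b) \<le> (1 / real (Suc n)) * B'"
        using b by (simp add: abs_mult)
    qed
    then show ?thesis by (simp add: mult_ac)
  qed
  define \<theta> where "\<theta> n x = \<zeta>n n x * V x" for n x
  define \<Theta> where "\<Theta> n x = \<zeta>n n x *\<^sub>R H x + V x *\<^sub>R Z n x" for n x
  have \<theta>t: "\<theta> n \<in> test_functions \<Omega>" for n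
  proof (rule test_functionsI)
    \<comment> \<open>Points closer than \<open>c / 2\<close> to the complement are lost because
      \<open>r < c / 4\<close>: the support of \<open>v\<close> keeps distance \<open>c\<close>, so
      the mollification vanishes there.\<close>
    let ?K = "{x. \<forall>z\<in>- \<Omega>. c / 2 \<le> dist x z} \<inter> cball (0::'a) (real (Suc n))"
    have "closed {x. \<forall>z\<in>- \<Omega>. c / 2 \<le> dist x z}"
    proof -
      have "{x. \<forall>z\<in>- \<Omega>. c / 2 \<le> dist x z} = (\<Inter>z\<in>- \<Omega>. {x. c / 2 \<le> dist x z})" by auto
      moreover have "closed {x. c / 2 \<le> dist x z}" for z :: 'a
        by (intro closed_Collect_le continuous_intros)
      ultimately show ?thesis by auto
    qed
    then show "compact ?K" by (rule closed_Int_compact) simp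
    show "?K \<subseteq> \<Omega>"
    proof
      fix x assume "x \<in> ?K"
      then show "x \<in> \<Omega>" using c(1) by (cases "x \<in> \<Omega>") force+
    qed
    show "Ck k (\<theta> n)" for k
    proof -
      have "Ck k V" unfolding V_def mollify_eq_convolve
        by (rule Ck_convolve[OF l(1) mollifier_test_functions[OF r(3)]])
      then show ?thesis unfolding \<theta>_def[abs_def] by (intro Ck_mult znk)
    qed
    show "\<theta> n x = 0" if "x \<notin> ?K" for x
    proof (cases "\<exists>z\<in>- \<Omega>. dist x z < c / 2")
      case True
      then show ?thesis using V0[of _ x] by (auto simp: \<theta>_def)
    next
      case False
      then have "\<not> norm x \<le> real (Suc n)" using that by (auto simp: not_less)
      then have "\<not> norm ((1 / real (Suc n)) *\<^sub>R x) < 1" by (simp add: divide_less_eq)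
      then have "\<zeta>n n x = 0" unfolding \<zeta>n_def \<zeta>_def by (simp add: mollifier_support)
      then show ?thesis by (simp add: \<theta>_def)
    qed
  qed
  have \<theta>w: "wgrad \<Omega> (\<theta> n) (\<Theta> n)" for n
  proof -
    have "(\<Sum>b\<in>Basis. frechet_derivative (\<theta> n) (at x) b *\<^sub>R b) = \<Theta> n x" for x
    proof (rule euclidean_eqI)
      fix b :: 'a assume b: "b \<in> Basis"
      have "(\<theta> n has_derivative (\<lambda>e. \<zeta>n n x * (H x \<bullet> e) + (1 / real (Suc n)) * frechet_derivative \<zeta> (at ((1 / real (Suc n)) *\<^sub>R x)) e * V x)) (at x)"
        unfolding \<theta>_def[abs_def] by (rule has_derivative_mult[OF dz dV])
      from frechet_derivative_at[OF this]
      have "frechet_derivative (\<theta> n) (at x) b = \<zeta>n n x * (H x \<bullet> b) + (1 / real (Suc n)) * frechet_derivative \<zeta> (at ((1 / real (Suc n)) *\<^sub>R x)) b * V x"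
        by metis
      moreover have "Z n x \<bullet> b = (1 / real (Suc n)) * frechet_derivative \<zeta> (at ((1 / real (Suc n)) *\<^sub>R x)) b"
        unfolding Z_def using b by (simp add: inner_sum_left inner_Basis if_distrib cong: if_cong)
      ultimately show "(\<Sum>b\<in>Basis. frechet_derivative (\<theta> n) (at x) b *\<^sub>R b) \<bullet> b = \<Theta> n x \<bullet> b"
        using b by (simp add: \<Theta>_def inner_sum_left inner_Basis inner_add_left if_distrib cong: if_cong)
    qed
    then show ?thesis using wgrad_test_functions[OF \<theta>t[of n]] by simp
  qed
  have \<Theta>m[measurable]: "\<Theta> n \<in> borel_measurable borel" "\<theta> n \<in> borel_measurable borel" for n
    using \<theta>w[of n] loc_int_borel by (auto simp: wgrad_def)
  have zlim: "(\<lambda>n. \<zeta>n n x) \<longlonglongrightarrow> 1" for x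
  proof -
    have "(\<lambda>n. (1 / real (Suc n)) *\<^sub>R x) \<longlonglongrightarrow> 0 *\<^sub>R x"
      by (intro tendsto_scaleR tendsto_const LIMSEQ_Suc[OF lim_1_over_n])
    moreover have "isCont \<zeta> 0"
      using test_functions_continuous[OF zt] by (simp add: continuous_on_eq_continuous_at)
    ultimately show ?thesis
      unfolding \<zeta>n_def z0[symmetric] by (intro isCont_tendsto_compose[of 0 \<zeta>]) auto
  qed
  have Zlim: "(\<lambda>n. Z n x) \<longlonglongrightarrow> 0" for x
  proof (rule Lim_null_comparison[of _ "\<lambda>n. (1 / real (Suc n)) * (DIM('a) * B')"])
    show "\<forall>\<^sub>F n in sequentially. norm (Z n x) \<le> (1 / real (Suc n)) * (DIM('a) * B')"
      by (intro always_eventually allI Zb)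
    have "(\<lambda>n. (1 / real (Suc n)) * (DIM('a) * B')) \<longlonglongrightarrow> 0 * (DIM('a) * B')"
      by (intro tendsto_mult tendsto_const LIMSEQ_Suc[OF lim_1_over_n])
    then show "(\<lambda>n. (1 / real (Suc n)) * (DIM('a) * B')) \<longlonglongrightarrow> 0" by simp
  qed
  have zb: "\<bar>\<zeta>n n x - 1\<bar> \<le> B + 1" for n x
    using B(2)[of "(1 / real (Suc n)) *\<^sub>R x"] by (simp add: \<zeta>n_def)
  have lim1: "(\<lambda>n. Lp_pow p (\<lambda>x. \<theta> n x - V x)) \<longlonglongrightarrow> 0"
  proof (rule Lp_pow_dominated[where w="\<lambda>x. (B + 1) *\<^sub>R V x"])
    show "AE x in lborel. (\<lambda>n. \<theta> n x) \<longlonglongrightarrow> V x"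
      using tendsto_mult_right[OF zlim] by (intro AE_I2) (force simp: \<theta>_def)
    have "\<bar>\<theta> n x - V x\<bar> \<le> (B + 1) * \<bar>V x\<bar>" for n x
    proof -
      have "\<theta> n x - V x = (\<zeta>n n x - 1) * V x" by (simp add: \<theta>_def algebra_simps)
      then show ?thesis using mult_right_mono[OF zb[of n x], of "\<bar>V x\<bar>"] by (simp add: abs_mult)
    qed
    then show "AE x in lborel. norm (\<theta> n x - V x) \<le> norm ((B + 1) *\<^sub>R V x)" for n
      using B(1) by (simp add: abs_mult)
    show "Lp_pow p (\<lambda>x. (B + 1) *\<^sub>R V x) < \<infinity>" by (intro Lp_pow_finite_scaleR Vfin) simp
  qed (use p in auto)
  let ?W = "\<lambda>x. (B + 1) *\<^sub>R norm (H x) + (DIM('a) * B') *\<^sub>R norm (V x)"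
  have lim2: "(\<lambda>n. Lp_pow p (\<lambda>x. \<Theta> n x - H x)) \<longlonglongrightarrow> 0"
  proof (rule Lp_pow_dominated[where w="?W"])
    have "(\<lambda>n. \<Theta> n x) \<longlonglongrightarrow> 1 *\<^sub>R H x + V x *\<^sub>R 0" for x
      unfolding \<Theta>_def by (intro tendsto_intros zlim Zlim)
    then show "AE x in lborel. (\<lambda>n. \<Theta> n x) \<longlonglongrightarrow> H x" by simp
    have "norm (\<Theta> n x - H x) \<le> ?W x" for n x
    proof -
      have "\<Theta> n x - H x = (\<zeta>n n x - 1) *\<^sub>R H x + V x *\<^sub>R Z n x" by (simp add: \<Theta>_def algebra_simps)
      then have "norm (\<Theta> n x - H x) \<le> \<bar>\<zeta>n n x - 1\<bar> * norm (H x) + \<bar>V x\<bar> * norm (Z n x)"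
        by (metis norm_scaleR norm_triangle_ineq)
      also have "\<dots> \<le> (B + 1) * norm (H x) + \<bar>V x\<bar> * (DIM('a) * B')"
      proof (intro add_mono mult_right_mono zb mult_left_mono)
        have "(1 / real (Suc n)) * (DIM('a) * B') \<le> 1 * (DIM('a) * B')"
          using B'(1) by (intro mult_right_mono) auto
        then show "norm (Z n x) \<le> DIM('a) * B'" using Zb[of n x] by simp
      qed auto
      finally show ?thesis by (simp add: mult.commute)
    qed
    then have "norm (\<Theta> n x - H x) \<le> norm (?W x)" for n x
      using abs_ge_self[of "?W x"] unfolding real_norm_def by (meson order_trans)
    then show "AE x in lborel. norm (\<Theta> n x - H x) \<le> norm (?W x)" for n by blast
    show "Lp_pow p ?W < \<infinity>"
      using Vfin p by (intro Lp_pow_finite_add Lp_pow_finite_scaleR) (auto simp: Lp_pow_norm Lp_pow_norm[of p V, simplified])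
  qed (use p in auto)
  have "\<forall>\<^sub>F n in sequentially. Lp_pow p (\<lambda>x. \<theta> n x - V x) < ennreal q"
    "\<forall>\<^sub>F n in sequentially. Lp_pow p (\<lambda>x. \<Theta> n x - H x) < ennreal q"
    using q(1) by (auto intro: order_tendstoD(2)[OF lim1] order_tendstoD(2)[OF lim2])
  then have "\<forall>\<^sub>F n in sequentially. Lp_pow p (\<lambda>x. \<theta> n x - V x) < ennreal q \<and> Lp_pow p (\<lambda>x. \<Theta> n x - H x) < ennreal q"
    by eventually_elim simp
  then obtain n where n: "Lp_pow p (\<lambda>x. \<theta> n x - V x) < ennreal q" "Lp_pow p (\<lambda>x. \<Theta> n x - H x) < ennreal q"
    by (auto simp: eventually_sequentially)
  have "Lp_pow p (\<lambda>x. (v x - V x) + (V x - \<theta> n x)) \<le> ennreal (2 * 2 powr p * q)"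
    using r n p q(1)
    by (intro Lp_pow_add_le_real)
      (auto simp: V_def Lp_pow_minus_commute[of p v] Lp_pow_minus_commute[of p _ "\<theta> n"] less_imp_le)
  moreover have "Lp_pow p (\<lambda>x. (h x - H x) + (H x - \<Theta> n x)) \<le> ennreal (2 * 2 powr p * q)"
    using r n p q(1)
    by (intro Lp_pow_add_le_real)
      (auto simp: H_def Lp_pow_minus_commute[of p h] Lp_pow_minus_commute[of p _ "\<Theta> n"] less_imp_le)
  ultimately show ?thesis
    using \<theta>t[of n] \<theta>w[of n] by (intro exI[of _ "\<theta> n"] exI[of _ "\<Theta> n"]) (simp add: q(2))
qed

section \<open>Approximation of the maximal function by test functions\<close>

text \<open>Geometric decay makes the sum of the \<open>p\<close>-th powers integrable, hence finite
  almost everywhere, and the terms of a convergent series tend to zero.\<close>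

lemma AE_tendsto_zero_if_Lp_pow_summable:
  fixes e :: "nat \<Rightarrow> 'a::euclidean_space \<Rightarrow> real"
  assumes [measurable]: "\<And>j. e j \<in> borel_measurable borel" and b: "\<And>j. Lp_pow p (e j) \<le> ennreal (C * (1/2) ^ j)"
    and C: "0 \<le> C" and p: "0 < p"
  shows "AE x in lborel. (\<lambda>j. e j x) \<longlonglongrightarrow> 0"
proof -
  have "(\<integral>\<^sup>+x. (\<Sum>j. ennreal (\<bar>e j x\<bar> powr p)) \<partial>lborel) = (\<Sum>j. Lp_pow p (e j))"
    unfolding Lp_pow_def real_norm_def by (rule nn_integral_suminf) simp
  also have "\<dots> \<le> (\<Sum>j. ennreal (C * (1/2) ^ j))"
    by (intro suminf_le b) auto
  also have "\<dots> = ennreal (\<Sum>j. C * (1/2) ^ j)"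
    using C by (intro suminf_ennreal2) (auto intro!: summable_mult summable_geometric)
  also have "\<dots> < \<infinity>" by simp
  finally have "AE x in lborel. (\<Sum>j. ennreal (\<bar>e j x\<bar> powr p)) \<noteq> \<infinity>"
    by (intro nn_integral_PInf_AE) auto
  then show ?thesis
  proof eventually_elim
    case (elim x)
    then have "summable (\<lambda>j. \<bar>e j x\<bar> powr p)"
      by (intro summable_suminf_not_top) auto
    then have "(\<lambda>j. \<bar>e j x\<bar> powr p) \<longlonglongrightarrow> 0" by (rule summable_LIMSEQ_zero)
    then have "(\<lambda>j. (\<bar>e j x\<bar> powr p) powr (1 / p)) \<longlonglongrightarrow> 0 powr (1 / p)"
      using p by (intro tendsto_powr2) auto
    then have "(\<lambda>j. \<bar>e j x\<bar>) \<longlonglongrightarrow> 0" using p by (simp add: powr_powr)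
    then show ?case by (simp add: tendsto_rabs_zero_iff)
  qed
qed

lemma maximal_subadditive:
  fixes f g :: "'a::euclidean_space \<Rightarrow> real"
  assumes [measurable]: "f \<in> borel_measurable borel" "g \<in> borel_measurable borel"
  shows "maximal \<gamma> \<Omega> (\<lambda>v. ennreal \<bar>f v\<bar>) x \<le> maximal \<gamma> \<Omega> (\<lambda>v. ennreal \<bar>g v\<bar>) x + maximal \<gamma> \<Omega> (\<lambda>v. ennreal \<bar>f v - g v\<bar>) x"
proof -
  have "(\<integral>\<^sup>+v\<in>ball x r. ennreal \<bar>f v\<bar> \<partial>lborel) / ennreal (growth_weight TYPE('a) \<gamma> r)
      \<le> maximal \<gamma> \<Omega> (\<lambda>v. ennreal \<bar>g v\<bar>) x + maximal \<gamma> \<Omega> (\<lambda>v. ennreal \<bar>f v - g v\<bar>) x"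
    if r: "0 < r" "cball x r \<subseteq> \<Omega>" for r
  proof -
    have [measurable]: "ball x r \<in> sets borel" by simp
    have "(\<integral>\<^sup>+v\<in>ball x r. ennreal \<bar>f v\<bar> \<partial>lborel)
        \<le> (\<integral>\<^sup>+v. ennreal \<bar>g v\<bar> * indicator (ball x r) v + ennreal \<bar>f v - g v\<bar> * indicator (ball x r) v \<partial>lborel)"
    proof (rule nn_integral_mono)
      fix v
      have "ennreal \<bar>f v\<bar> \<le> ennreal (\<bar>g v\<bar> + \<bar>f v - g v\<bar>)" by (intro ennreal_leI) linarith
      then show "ennreal \<bar>f v\<bar> * indicator (ball x r) v \<le> ennreal \<bar>g v\<bar> * indicator (ball x r) v + ennreal \<bar>f v - g v\<bar> * indicator (ball x r) v"
        by (auto simp: indicator_def)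
    qed
    also have "\<dots> = (\<integral>\<^sup>+v\<in>ball x r. ennreal \<bar>g v\<bar> \<partial>lborel) + (\<integral>\<^sup>+v\<in>ball x r. ennreal \<bar>f v - g v\<bar> \<partial>lborel)"
      by (rule nn_integral_add) auto
    finally have "(\<integral>\<^sup>+v\<in>ball x r. ennreal \<bar>f v\<bar> \<partial>lborel) / ennreal (growth_weight TYPE('a) \<gamma> r)
      \<le> (\<integral>\<^sup>+v\<in>ball x r. ennreal \<bar>g v\<bar> \<partial>lborel) / ennreal (growth_weight TYPE('a) \<gamma> r)
        + (\<integral>\<^sup>+v\<in>ball x r. ennreal \<bar>f v - g v\<bar> \<partial>lborel) / ennreal (growth_weight TYPE('a) \<gamma> r)"
      unfolding add_divide_distrib_ennreal[symmetric] by (rule divide_right_mono_ennreal)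
    also have "\<dots> \<le> maximal \<gamma> \<Omega> (\<lambda>v. ennreal \<bar>g v\<bar>) x + maximal \<gamma> \<Omega> (\<lambda>v. ennreal \<bar>f v - g v\<bar>) x"
      unfolding ball_sup_def using r by (intro add_mono SUP_upper) auto
    finally show ?thesis .
  qed
  then show ?thesis unfolding ball_sup_def[of _ _ "\<lambda>v. ennreal \<bar>f v\<bar>"] by (intro SUP_least) auto
qed

text \<open>A nonzero value needs an admissible ball that meets the support of
  \<open>\<psi>\<close>. Either its radius is at least \<open>e / 2\<close>, or \<open>x\<close> is
  within \<open>e / 2\<close> of the support; in both cases \<open>e / 2\<close> is a uniform
  margin.\<close>

lemma maximal_test_support:
  fixes \<psi> :: "'a::euclidean_space \<Rightarrow> real"
  assumes t: "\<psi> \<in> test_functions \<Omega>" and \<Omega>: "open \<Omega>"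
  obtains c where "0 < c" "\<And>x. maximal \<gamma> \<Omega> (\<lambda>v. ennreal \<bar>\<psi> v\<bar>) x \<noteq> 0 \<Longrightarrow> cball x c \<subseteq> \<Omega>"
proof -
  obtain K where K: "compact K" "K \<subseteq> \<Omega>" "\<And>x. x \<notin> K \<Longrightarrow> \<psi> x = 0"
    using t by (rule test_functions_support) blast
  obtain e where e: "e > 0" "(\<Union>x\<in>K. cball x e) \<subseteq> \<Omega>"
    using compact_subset_open_imp_cball_epsilon_subset[OF K(1) \<Omega> K(2)] by blast
  have "cball x (e / 2) \<subseteq> \<Omega>" if x: "maximal \<gamma> \<Omega> (\<lambda>v. ennreal \<bar>\<psi> v\<bar>) x \<noteq> 0" for x
  proof -
    have "0 < maximal \<gamma> \<Omega> (\<lambda>v. ennreal \<bar>\<psi> v\<bar>) x" using x by (simp add: zero_less_iff_neq_zero)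
    then obtain r where r: "0 < r" "cball x r \<subseteq> \<Omega>"
      "0 < (\<integral>\<^sup>+v\<in>ball x r. ennreal \<bar>\<psi> v\<bar> \<partial>lborel) / ennreal (growth_weight TYPE('a) \<gamma> r)"
      by (auto simp: ball_sup_def less_SUP_iff)
    have "\<exists>z\<in>ball x r. \<psi> z \<noteq> 0"
    proof (rule ccontr)
      assume "\<not> (\<exists>z\<in>ball x r. \<psi> z \<noteq> 0)"
      then have z: "ennreal \<bar>\<psi> v\<bar> * indicator (ball x r) v = 0" for v by (cases "v \<in> ball x r") auto
      have "(\<integral>\<^sup>+v\<in>ball x r. ennreal \<bar>\<psi> v\<bar> \<partial>lborel) = 0" unfolding z by simp
      then show False using r(3) by simp
    qed
    then obtain z where "dist x z < r" "\<psi> z \<noteq> 0" by auto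
    then have z: "z \<in> K" "dist x z < r" using K(3) by blast+
    show ?thesis
    proof (cases "e / 2 \<le> r")
      case True
      then show ?thesis using r(2) by (meson order_trans subset_cball)
    next
      case False
      have "cball x (e / 2) \<subseteq> cball z e"
      proof
        fix y assume "y \<in> cball x (e / 2)"
        then show "y \<in> cball z e" using z(2) False dist_triangle[of z y x] by (simp add: dist_commute)
      qed
      then show ?thesis using e(2) z(1) by blast
    qed
  qed
  then show ?thesis using that[of "e / 2"] e(1) by auto
qed

text \<open>Writing \<open>e\<^sub>k\<close> for the maximal function of \<open>f - \<psi>\<^sub>k\<close>, sublinearity makes \<open>(u - e\<^sub>k)\<^sup>+ = u - min u e\<^sub>k\<close>
  vanish near the boundary, and \<open>min u e\<^sub>k\<close> tends to \<open>0\<close> in the Sobolev norm because the gradient of \<open>u\<close>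
  only survives on \<open>{u < e\<^sub>k}\<close>, which shrinks to \<open>{u = 0}\<close>, where it vanishes.\<close>

lemma maximal_approx_test_functions:
  fixes f :: "'a::euclidean_space \<Rightarrow> real"
  assumes w: "wgrad \<Omega> f g" and \<Omega>: "open \<Omega>" and \<gamma>: "0 \<le> \<gamma>" and p: "1 < p"
    and fin: "Lp_pow p f < \<infinity>" "Lp_pow p g < \<infinity>"
    and h: "wgrad \<Omega> (\<lambda>x. enn2real (maximal \<gamma> \<Omega> (\<lambda>v. ennreal \<bar>f v\<bar>) x)) h" "Lp_pow p h < \<infinity>" "\<And>x. x \<notin> \<Omega> \<Longrightarrow> h x = 0"
    and \<psi>: "\<And>k. \<psi> k \<in> test_functions \<Omega>" "\<And>k. wgrad \<Omega> (\<lambda>x. f x - \<psi> k x) (q k)"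
    and lim: "(\<lambda>k. Lp_pow p (\<lambda>x. f x - \<psi> k x)) \<longlonglongrightarrow> 0" "(\<lambda>k. Lp_pow p (q k)) \<longlonglongrightarrow> 0" and \<epsilon>: "0 < \<epsilon>"
  shows "\<exists>\<theta> \<Theta>. \<theta> \<in> test_functions \<Omega> \<and> wgrad \<Omega> \<theta> \<Theta> \<and>
    Lp_pow p (\<lambda>x. enn2real (maximal \<gamma> \<Omega> (\<lambda>v. ennreal \<bar>f v\<bar>) x) - \<theta> x) \<le> ennreal \<epsilon> \<and>
    Lp_pow p (\<lambda>x. h x - \<Theta> x) \<le> ennreal \<epsilon>"
proof -
  define u where "u x = enn2real (maximal \<gamma> \<Omega> (\<lambda>v. ennreal \<bar>f v\<bar>) x)" for x
  define G where "G x = 2 * enn2real (maximal \<gamma> \<Omega> (\<lambda>v. ennreal (norm (g v))) x)" for x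
  have fm[measurable]: "f \<in> borel_measurable borel" "g \<in> borel_measurable borel" "h \<in> borel_measurable borel"
    using w h loc_int_borel by (auto simp: wgrad_def)
  have qm[measurable]: "(\<lambda>x. f x - \<psi> k x) \<in> borel_measurable borel" "q k \<in> borel_measurable borel" for k
    using \<psi>(2)[of k] loc_int_borel by (auto simp: wgrad_def)
  have psm[measurable]: "\<psi> k \<in> borel_measurable borel" for k using \<psi>(1) by (rule test_functions_borel)
  have um[measurable]: "u \<in> borel_measurable borel" "G \<in> borel_measurable borel"
    unfolding u_def[abs_def] G_def[abs_def] using \<Omega> \<gamma> by measurable
  define C where "C = maximal_const DIM('a) p"
  have C0: "0 \<le> C" using p by (simp add: C_def maximal_const_def)
  have p0: "0 < p" "0 \<le> p" "1 \<le> p" using p by auto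
  have Lu: "Lp_pow p u < \<infinity>"
    using maximal_Lp(2)[OF fm(1) fin(1) p \<Omega> \<gamma>] fin(1) by (simp add: u_def[abs_def] ennreal_mult_less_top le_less_trans)
  have LG: "Lp_pow p (\<lambda>x. 2 *\<^sub>R G x) < \<infinity>"
  proof -
    have "Lp_pow p (\<lambda>x. enn2real (maximal \<gamma> \<Omega> (\<lambda>v. ennreal (norm (g v))) x)) < \<infinity>"
      using maximal_Lp(2)[OF fm(2) fin(2) p \<Omega> \<gamma>] fin(2) by (simp add: ennreal_mult_less_top le_less_trans)
    then have "Lp_pow p (\<lambda>x. 4 *\<^sub>R enn2real (maximal \<gamma> \<Omega> (\<lambda>v. ennreal (norm (g v))) x)) < \<infinity>"
      using \<Omega> \<gamma> by (intro Lp_pow_finite_scaleR) auto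
    then show ?thesis by (simp add: G_def)
  qed
  \<comment> \<open>Norm convergence alone gives no pointwise limit; a geometric rate along a
    subsequence does.\<close>
  have "\<exists>k. Lp_pow p (\<lambda>x. f x - \<psi> k x) \<le> ennreal ((1/2) ^ j) \<and> Lp_pow p (q k) \<le> ennreal ((1/2) ^ j)" for j :: nat
  proof -
    have "\<forall>\<^sub>F k in sequentially. Lp_pow p (\<lambda>x. f x - \<psi> k x) < ennreal ((1/2) ^ j)"
      "\<forall>\<^sub>F k in sequentially. Lp_pow p (q k) < ennreal ((1/2) ^ j)"
      by (rule order_tendstoD(2)[OF lim(1)], simp, rule order_tendstoD(2)[OF lim(2)], simp)
    then have "\<forall>\<^sub>F k in sequentially. Lp_pow p (\<lambda>x. f x - \<psi> k x) < ennreal ((1/2) ^ j) \<and> Lp_pow p (q k) < ennreal ((1/2) ^ j)"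
      by eventually_elim simp
    then obtain k where "Lp_pow p (\<lambda>x. f x - \<psi> k x) < ennreal ((1/2) ^ j)" "Lp_pow p (q k) < ennreal ((1/2) ^ j)"
      using eventually_happens'[OF sequentially_bot] by blast
    then show ?thesis by (intro exI[of _ k] conjI less_imp_le)
  qed
  then obtain \<kappa> where \<kappa>: "\<And>j. Lp_pow p (\<lambda>x. f x - \<psi> (\<kappa> j) x) \<le> ennreal ((1/2) ^ j)"
    "\<And>j. Lp_pow p (q (\<kappa> j)) \<le> ennreal ((1/2) ^ j)"
    by metis
  have \<kappa>fin: "Lp_pow p (\<lambda>x. f x - \<psi> (\<kappa> j) x) < \<infinity>" "Lp_pow p (q (\<kappa> j)) < \<infinity>" for j
    using \<kappa>[of j] by (auto intro: le_less_trans)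
  define e where "e j x = enn2real (maximal \<gamma> \<Omega> (\<lambda>v. ennreal \<bar>f v - \<psi> (\<kappa> j) v\<bar>) x)" for j x
  define E where "E j x = 2 * enn2real (maximal \<gamma> \<Omega> (\<lambda>v. ennreal (norm (q (\<kappa> j) v))) x)" for j x
  have em[measurable]: "e j \<in> borel_measurable borel" "E j \<in> borel_measurable borel" for j
    unfolding e_def[abs_def] E_def[abs_def] using \<Omega> \<gamma> by measurable
  have Le: "Lp_pow p (e j) \<le> ennreal (C * (1/2) ^ j)" for j
  proof -
    have "Lp_pow p (e j) \<le> ennreal C * Lp_pow p (\<lambda>x. f x - \<psi> (\<kappa> j) x)"
      using maximal_Lp(2)[OF qm(1) \<kappa>fin(1) p \<Omega> \<gamma>, of j] by (simp add: e_def[abs_def] C_def)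
    also have "\<dots> \<le> ennreal C * ennreal ((1/2) ^ j)" by (intro mult_left_mono \<kappa>) simp
    finally show ?thesis using C0 by (simp add: ennreal_mult)
  qed
  have LE: "Lp_pow p (E j) \<le> ennreal (2 powr p * C * (1/2) ^ j)" for j
  proof -
    have "Lp_pow p (E j) = ennreal (2 powr p) * Lp_pow p (\<lambda>x. enn2real (maximal \<gamma> \<Omega> (\<lambda>v. ennreal (norm (q (\<kappa> j) v))) x))"
      using Lp_pow_scaleR[of "\<lambda>x. enn2real (maximal \<gamma> \<Omega> (\<lambda>v. ennreal (norm (q (\<kappa> j) v))) x)" p 2] \<Omega> \<gamma>
      by (simp add: E_def[abs_def])
    also have "\<dots> \<le> ennreal (2 powr p) * (ennreal C * ennreal ((1/2) ^ j))"
      using maximal_Lp(2)[OF qm(2) \<kappa>fin(2) p \<Omega> \<gamma>, of j]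
      by (intro mult_left_mono order_trans[OF _ mult_left_mono[OF \<kappa>(2)]]) (auto simp: C_def)
    finally show ?thesis using C0 by (simp add: ennreal_mult mult.assoc)
  qed
  have geo: "(\<lambda>j. ennreal (A * (1/2) ^ j)) \<longlonglongrightarrow> 0" for A :: real
  proof -
    have "(\<lambda>j. A * (1/2) ^ j) \<longlonglongrightarrow> A * 0" by (intro tendsto_intros LIMSEQ_power_zero) simp
    from tendsto_ennrealI[OF this] show ?thesis by simp
  qed
  have eAE: "AE x in lborel. (\<lambda>j. e j x) \<longlonglongrightarrow> 0"
    using Le C0 p0 by (intro AE_tendsto_zero_if_Lp_pow_summable[of e p C]) auto
  have u0: "0 \<le> u x" "0 \<le> e j x" "0 \<le> G x" "0 \<le> E j x" for x j by (auto simp: u_def e_def G_def E_def)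
  have fAE: "AE x in lborel. maximal \<gamma> \<Omega> (\<lambda>v. ennreal \<bar>f v\<bar>) x < \<infinity>"
    using maximal_Lp(1)[OF fm(1) fin(1) p \<Omega> \<gamma>] by simp
  let ?A = "\<lambda>j. {x. u x < e j x}"
  have "\<exists>m. wgrad \<Omega> (\<lambda>x. min (u x) (e j x)) m \<and> (AE x in lborel. x \<in> \<Omega> \<longrightarrow> norm (m x) \<le> E j x + 2 * indicator (?A j) x * G x)" for j
    using min_maximal_wgrad[OF w \<psi>(2)[of "\<kappa> j"] \<Omega> \<gamma> p fin \<kappa>fin] unfolding u_def e_def G_def E_def by blast
  then have "\<exists>m0. \<forall>j. wgrad \<Omega> (\<lambda>x. min (u x) (e j x)) (m0 j) \<and>
      (AE x in lborel. x \<in> \<Omega> \<longrightarrow> norm (m0 j x) \<le> E j x + 2 * indicator (?A j) x * G x)"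
    by (intro choice allI)
  then obtain m0 where m0: "\<And>j. wgrad \<Omega> (\<lambda>x. min (u x) (e j x)) (m0 j)"
    "\<And>j. AE x in lborel. x \<in> \<Omega> \<longrightarrow> norm (m0 j x) \<le> E j x + 2 * indicator (?A j) x * G x"
    by blast
  \<comment> \<open>Values off \<open>\<Omega>\<close> are set to zero: the density result requires
    it, and the norm over the whole space then agrees with that over
    \<open>\<Omega>\<close>.\<close>
  define m where "m j x = indicator \<Omega> x *\<^sub>R m0 j x" for j x
  have [measurable]: "\<Omega> \<in> sets borel" using \<Omega> by simp
  have [measurable]: "m0 j \<in> borel_measurable borel" for j
    using m0(1)[of j] loc_int_borel by (auto simp: wgrad_def)
  have [measurable]: "m j \<in> borel_measurable borel" for j unfolding m_def[abs_def] by measurable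
  have mw: "wgrad \<Omega> (\<lambda>x. min (u x) (e j x)) (m j)" for j
    by (rule wgrad_cong_AE[OF m0(1)]) (auto simp: m_def)
  have lim1: "(\<lambda>j. Lp_pow p (\<lambda>x. min (u x) (e j x))) \<longlonglongrightarrow> 0"
  proof (rule tendsto_sandwich[OF _ _ tendsto_const geo])
    show "\<forall>\<^sub>F j in sequentially. Lp_pow p (\<lambda>x. min (u x) (e j x)) \<le> ennreal (C * (1/2) ^ j)"
    proof (intro always_eventually allI order_trans[OF _ Le])
      show "Lp_pow p (\<lambda>x. min (u x) (e j x)) \<le> Lp_pow p (e j)" for j
        using u0 p0 by (intro Lp_pow_mono_AE AE_I2) (auto simp: min_def)
    qed
  qed simp
  have limG: "(\<lambda>j. Lp_pow p (\<lambda>x. 2 * indicator (?A j) x * G x - 0)) \<longlonglongrightarrow> 0"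
  proof (rule Lp_pow_dominated[where w="\<lambda>x. 2 *\<^sub>R G x", OF _ _ _ _ _ LG p0(1)])
    show "AE x in lborel. (\<lambda>j. 2 * indicator (?A j) x * G x) \<longlonglongrightarrow> 0"
      using eAE fAE
    proof eventually_elim
      case (elim x)
      show ?case
      proof (cases "u x = 0")
        case True
        then have "maximal \<gamma> \<Omega> (\<lambda>v. ennreal \<bar>f v\<bar>) x = 0"
          using elim(2) by (auto simp: u_def enn2real_eq_0_iff)
        then have "G x = 0" using maximal_grad_zero[OF w \<Omega> \<gamma>] by (simp add: G_def)
        then show ?thesis by simp
      next
        case False
        then have "0 < u x" using u0(1)[of x] by simp
        then have "\<forall>\<^sub>F j in sequentially. e j x < u x" by (rule order_tendstoD(2)[OF elim(1)])
        then have "\<forall>\<^sub>F j in sequentially. 0 = 2 * indicator (?A j) x * G x"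
          by eventually_elim (auto simp: indicator_def)
        then show ?thesis by (rule Lim_transform_eventually[OF tendsto_const])
      qed
    qed
    show "AE x in lborel. norm (2 * indicator (?A j) x * G x - 0) \<le> norm (2 *\<^sub>R G x)" for j
      by (auto simp: indicator_def)
  qed auto
  have lim2: "(\<lambda>j. Lp_pow p (m j)) \<longlonglongrightarrow> 0"
  proof (rule tendsto_sandwich[OF _ _ tendsto_const])
    show "\<forall>\<^sub>F j in sequentially. Lp_pow p (m j) \<le> ennreal (2 powr p) * (Lp_pow p (E j) + Lp_pow p (\<lambda>x. 2 * indicator (?A j) x * G x - 0))"
    proof (intro always_eventually allI)
      fix j
      have "Lp_pow p (m j) \<le> Lp_pow p (\<lambda>x. E j x + (2 * indicator (?A j) x * G x - 0))"
      proof (rule Lp_pow_mono_AE)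
        show "AE x in lborel. norm (m j x) \<le> norm (E j x + (2 * indicator (?A j) x * G x - 0))"
          using m0(2)[of j] by eventually_elim (use u0 in \<open>auto simp: m_def indicator_def\<close>)
      qed (use p0 in simp)
      also have "\<dots> \<le> ennreal (2 powr p) * (Lp_pow p (E j) + Lp_pow p (\<lambda>x. 2 * indicator (?A j) x * G x - 0))"
        using p0 by (intro Lp_pow_add) auto
      finally show "Lp_pow p (m j) \<le> ennreal (2 powr p) * (Lp_pow p (E j) + Lp_pow p (\<lambda>x. 2 * indicator (?A j) x * G x - 0))" .
    qed
    have "(\<lambda>j. Lp_pow p (E j)) \<longlonglongrightarrow> 0"
      by (rule tendsto_sandwich[OF _ _ tendsto_const geo]) (auto intro!: always_eventually LE)
    then have "(\<lambda>j. ennreal (2 powr p) * (Lp_pow p (E j) + Lp_pow p (\<lambda>x. 2 * indicator (?A j) x * G x - 0))) \<longlonglongrightarrow> ennreal (2 powr p) * (0 + 0)"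
      by (intro ennreal_tendsto_cmult tendsto_add limG) auto
    then show "(\<lambda>j. ennreal (2 powr p) * (Lp_pow p (E j) + Lp_pow p (\<lambda>x. 2 * indicator (?A j) x * G x - 0))) \<longlonglongrightarrow> 0" by simp
  qed simp
  define q' where "q' = \<epsilon> / (2 * 2 powr p)"
  have q': "0 < q'" "2 * 2 powr p * q' = \<epsilon>" using \<epsilon> by (auto simp: q'_def)
  have "\<forall>\<^sub>F j in sequentially. Lp_pow p (\<lambda>x. min (u x) (e j x)) < ennreal q'"
    "\<forall>\<^sub>F j in sequentially. Lp_pow p (m j) < ennreal q'"
    using q'(1) by (auto intro: order_tendstoD(2)[OF lim1] order_tendstoD(2)[OF lim2])
  then have "\<forall>\<^sub>F j in sequentially. Lp_pow p (\<lambda>x. min (u x) (e j x)) < ennreal q' \<and> Lp_pow p (m j) < ennreal q'"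
    by eventually_elim simp
  then obtain j where j: "Lp_pow p (\<lambda>x. min (u x) (e j x)) < ennreal q'" "Lp_pow p (m j) < ennreal q'"
    by (auto simp: eventually_sequentially)
  define v where "v x = u x - min (u x) (e j x)" for x
  have hw: "wgrad \<Omega> u h" using h(1) by (simp add: u_def[abs_def])
  have vw: "wgrad \<Omega> v (\<lambda>x. h x - m j x)" unfolding v_def[abs_def] by (rule wgrad_diff[OF hw mw])
  have vm[measurable]: "v \<in> borel_measurable borel" unfolding v_def[abs_def] by measurable
  obtain c where c: "0 < c" "\<And>x. maximal \<gamma> \<Omega> (\<lambda>v. ennreal \<bar>\<psi> (\<kappa> j) v\<bar>) x \<noteq> 0 \<Longrightarrow> cball x c \<subseteq> \<Omega>"
    using maximal_test_support[OF \<psi>(1) \<Omega>] by blast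
  have cAE: "AE x in lborel. v x \<noteq> 0 \<longrightarrow> cball x c \<subseteq> \<Omega>"
    using fAE maximal_Lp(1)[OF qm(1) \<kappa>fin(1) p \<Omega> \<gamma>, of j]
  proof eventually_elim
    case (elim x)
    show ?case
    proof
      assume "v x \<noteq> 0"
      then have "e j x < u x" by (auto simp: v_def min_def split: if_splits)
      then have "ennreal (e j x) < ennreal (u x)" using u0 by (simp add: ennreal_less_iff)
      then have "maximal \<gamma> \<Omega> (\<lambda>v. ennreal \<bar>f v - \<psi> (\<kappa> j) v\<bar>) x < maximal \<gamma> \<Omega> (\<lambda>v. ennreal \<bar>f v\<bar>) x"
        using elim by (simp add: e_def u_def)
      \<comment> \<open>If this were zero, sublinearity would bound the maximal function of
        \<open>f\<close> by that of \<open>f - \<psi> (\<kappa> j)\<close>, which is strictly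
        smaller at \<open>x\<close>.\<close>
      then have "maximal \<gamma> \<Omega> (\<lambda>v. ennreal \<bar>\<psi> (\<kappa> j) v\<bar>) x \<noteq> 0"
        using maximal_subadditive[OF fm(1) psm, of \<gamma> \<Omega> x "\<kappa> j"] by auto
      then show "cball x c \<subseteq> \<Omega>" by (rule c(2))
    qed
  qed
  have vfin: "Lp_pow p v < \<infinity>"
  proof -
    have "Lp_pow p v \<le> Lp_pow p u"
      using u0 p0 by (intro Lp_pow_mono_AE AE_I2) (auto simp: v_def min_def)
    then show ?thesis using Lu by simp
  qed
  have hfin: "Lp_pow p (\<lambda>x. h x - m j x) < \<infinity>"
  proof -
    have "Lp_pow p (\<lambda>x. h x - m j x) \<le> ennreal (2 powr p) * (Lp_pow p h + Lp_pow p (m j))"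
      using p0 by (intro Lp_pow_diff) auto
    also have "\<dots> < \<infinity>" using h(2) j(2) by (auto simp: ennreal_mult_less_top intro: less_trans[OF _ ennreal_less_top])
    finally show ?thesis .
  qed
  obtain \<theta> \<Theta> where \<theta>: "\<theta> \<in> test_functions \<Omega>" "wgrad \<Omega> \<theta> \<Theta>"
    "Lp_pow p (\<lambda>x. v x - \<theta> x) \<le> ennreal q'" "Lp_pow p (\<lambda>x. h x - m j x - \<Theta> x) \<le> ennreal q'"
    using dense_test_functions[OF vw \<Omega> p0(3) vfin hfin _ c(1) cAE q'(1)] h(3) by (auto simp: m_def)
  have [measurable]: "\<theta> \<in> borel_measurable borel" "\<Theta> \<in> borel_measurable borel"
    using \<theta>(2) loc_int_borel by (auto simp: wgrad_def)
  \<comment> \<open>\<open>u - \<theta>\<close> is the discarded minimum plus the error of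
    approximating \<open>v\<close>; the gradients split in the same way through
    \<open>m j\<close>.\<close>
  have "Lp_pow p (\<lambda>x. min (u x) (e j x) + (v x - \<theta> x)) \<le> ennreal (2 * 2 powr p * q')"
    using j \<theta> q' p0 by (intro Lp_pow_add_le_real) auto
  moreover have "Lp_pow p (\<lambda>x. m j x + (h x - m j x - \<Theta> x)) \<le> ennreal (2 * 2 powr p * q')"
    using j \<theta> q' p0 by (intro Lp_pow_add_le_real) auto
  ultimately show ?thesis
    using \<theta>(1,2) by (intro exI[of _ \<theta>] exI[of _ \<Theta>]) (simp add: v_def q'(2) u_def)
qed

section \<open>Borel representatives\<close>

lemma borel_measurable_lebesgue_on:
  fixes f :: "'a::euclidean_space \<Rightarrow> 'b::topological_space"
  assumes "f \<in> borel_measurable borel"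
  shows "f \<in> borel_measurable (lebesgue_on \<Omega>)"
proof (intro measurable_restrict_space1 measurable_completion)
  show "f \<in> borel_measurable lborel" using assms by simp
qed

text \<open>Fubini and translation arguments need functions that are Borel measurable on the whole space, so
  a function on \<open>\<Omega>\<close> enters through a Borel representative extended by zero.\<close>

definition borel_rep :: "'a::euclidean_space set \<Rightarrow> ('a \<Rightarrow> 'b::euclidean_space) \<Rightarrow> ('a \<Rightarrow> 'b) \<Rightarrow> bool" where
  "borel_rep \<Omega> f f' \<longleftrightarrow> f \<in> borel_measurable (lebesgue_on \<Omega>) \<and> f' \<in> borel_measurable borel \<and>
    (\<forall>x. x \<notin> \<Omega> \<longrightarrow> f' x = 0) \<and> (AE x in lborel. x \<in> \<Omega> \<longrightarrow> f x = f' x)"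

lemma borel_repD:
  assumes "borel_rep \<Omega> f f'"
  shows "f \<in> borel_measurable (lebesgue_on \<Omega>)" "f' \<in> borel_measurable borel" "x \<notin> \<Omega> \<Longrightarrow> f' x = 0"
    "AE x in lborel. x \<in> \<Omega> \<longrightarrow> f x = f' x"
  using assms by (auto simp: borel_rep_def)

text \<open>After extension by zero each component is measurable for the completion, hence almost
  everywhere equal to a Borel function.\<close>

lemma ex_borel_rep:
  fixes f :: "'a::euclidean_space \<Rightarrow> 'b::euclidean_space"
  assumes \<Omega>: "open \<Omega>" and f: "f \<in> borel_measurable (lebesgue_on \<Omega>)"
  obtains f' where "borel_rep \<Omega> f f'"
proof -
  have [measurable]: "\<Omega> \<in> sets borel" using \<Omega> by simp
  let ?g = "\<lambda>x. indicator \<Omega> x *\<^sub>R f x"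
  have gm: "?g \<in> borel_measurable lebesgue"
    using f \<Omega> by (subst (asm) borel_measurable_restrict_space_iff) auto
  have "\<exists>k. k \<in> borel_measurable borel \<and> (AE x in lborel. ?g x \<bullet> b = k x)" for b
  proof -
    have "(\<lambda>x. ?g x \<bullet> b) \<in> borel_measurable (completion lborel)"
      by (rule borel_measurable_inner[OF gm borel_measurable_const])
    from completion_ex_borel_measurable_real[OF this] show ?thesis by auto
  qed
  then obtain k where k: "\<And>b. k b \<in> borel_measurable borel" "\<And>b. AE x in lborel. ?g x \<bullet> b = k b x" by metis
  define f' where "f' x = indicator \<Omega> x *\<^sub>R (\<Sum>b\<in>Basis. k b x *\<^sub>R b)" for x
  have [measurable]: "k b \<in> borel_measurable borel" for b by (rule k)
  have "AE x in lborel. \<forall>b\<in>Basis. ?g x \<bullet> b = k b x"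
    using k(2) by (subst AE_ball_countable) (auto simp: countable_finite)
  then have "AE x in lborel. x \<in> \<Omega> \<longrightarrow> f x = f' x"
  proof eventually_elim
    case (elim x)
    show ?case
    proof
      assume x: "x \<in> \<Omega>"
      have "f x = (\<Sum>b\<in>Basis. (f x \<bullet> b) *\<^sub>R b)" by (simp add: euclidean_representation)
      then show "f x = f' x" using elim x by (simp add: f'_def)
    qed
  qed
  moreover have "f' \<in> borel_measurable borel" unfolding f'_def[abs_def] by measurable
  ultimately show ?thesis
    using f by (intro that[of f']) (auto simp: borel_rep_def f'_def)
qed

lemma borel_rep_nn_integral:
  fixes f :: "'a::euclidean_space \<Rightarrow> 'b::euclidean_space"
  assumes \<Omega>: "open \<Omega>" and r: "borel_rep \<Omega> f f'" and p: "0 < p"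
  shows "(\<integral>\<^sup>+x. ennreal (norm (f x) powr p) \<partial>lebesgue_on \<Omega>) = Lp_pow p f'"
proof -
  have "(\<integral>\<^sup>+x. ennreal (norm (f x) powr p) \<partial>lebesgue_on \<Omega>) = (\<integral>\<^sup>+x. ennreal (norm (f x) powr p) * indicator \<Omega> x \<partial>lebesgue)"
    using \<Omega> by (subst nn_integral_restrict_space) auto
  also have "\<dots> = (\<integral>\<^sup>+x. ennreal (norm (f' x) powr p) \<partial>lebesgue)"
  proof (rule nn_integral_cong_AE)
    show "AE x in lebesgue. ennreal (norm (f x) powr p) * indicator \<Omega> x = ennreal (norm (f' x) powr p)"
      using AE_completion[OF borel_repD(4)[OF r]]
      by eventually_elim (use borel_repD(3)[OF r] in \<open>auto simp: indicator_def\<close>)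
  qed
  also have "\<dots> = Lp_pow p f'" unfolding Lp_pow_def by (rule nn_integral_completion)
  finally show ?thesis .
qed

lemma borel_rep_Lp_space:
  assumes \<Omega>: "open \<Omega>" and r: "borel_rep \<Omega> f f'" and p: "0 < p"
  shows "f \<in> Lp_space p \<Omega> \<longleftrightarrow> Lp_pow p f' < \<infinity>"
  unfolding Lp_space_def using borel_repD(1)[OF r] borel_rep_nn_integral[OF assms]
  by (simp add: integrable_iff_bounded)

lemma borel_rep_Lp_norm:
  assumes \<Omega>: "open \<Omega>" and r: "borel_rep \<Omega> f f'" and p: "0 < p"
  shows "Lp_norm p \<Omega> f = enn2real (Lp_pow p f') powr (1 / p)"
  unfolding Lp_norm_def using borel_repD(1)[OF r]
  by (subst integral_eq_nn_integral) (auto simp: borel_rep_nn_integral[OF assms])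

lemma borel_rep_locally_integrable:
  fixes f :: "'a::euclidean_space \<Rightarrow> 'b::euclidean_space"
  assumes \<Omega>: "open \<Omega>" and r: "borel_rep \<Omega> f f'"
  shows "locally_integrable \<Omega> f \<longleftrightarrow> loc_int \<Omega> f'"
proof -
  have f'm[measurable]: "f' \<in> borel_measurable borel" using r by (rule borel_repD)
  have gm: "(\<lambda>x. indicator \<Omega> x *\<^sub>R f x) \<in> borel_measurable lebesgue"
    using borel_repD(1)[OF r] \<Omega> by (subst (asm) borel_measurable_restrict_space_iff) auto
  have "integrable (lebesgue_on K) f \<longleftrightarrow> integrable lborel (\<lambda>x. indicator K x *\<^sub>R f' x)" if K: "compact K" "K \<subseteq> \<Omega>" for K
  proof -
    have [measurable]: "K \<in> sets borel" using K by (simp add: borel_compact)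
    have "(\<lambda>x. indicator K x *\<^sub>R (indicator \<Omega> x *\<^sub>R f x)) \<in> borel_measurable lebesgue"
      by (rule borel_measurable_scaleR[OF borel_measurable_indicator gm]) simp
    moreover have "(\<lambda>x. indicator K x *\<^sub>R (indicator \<Omega> x *\<^sub>R f x)) = (\<lambda>x. indicator K x *\<^sub>R f x)"
      using K by (auto simp: indicator_def fun_eq_iff)
    ultimately have m: "(\<lambda>x. indicator K x *\<^sub>R f x) \<in> borel_measurable lebesgue" by simp
    have m': "(\<lambda>x. indicator K x *\<^sub>R f' x) \<in> borel_measurable lborel" by simp
    have "integrable (lebesgue_on K) f \<longleftrightarrow> integrable lebesgue (\<lambda>x. indicator K x *\<^sub>R f x)"
      by (rule integrable_restrict_space) simp
    also have "\<dots> \<longleftrightarrow> integrable lebesgue (\<lambda>x. indicator K x *\<^sub>R f' x)"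
    proof (rule integrable_cong_AE[OF m measurable_completion[OF m']])
      show "AE x in lebesgue. indicator K x *\<^sub>R f x = indicator K x *\<^sub>R f' x"
        using AE_completion[OF borel_repD(4)[OF r]] by eventually_elim (use K in \<open>auto simp: indicator_def\<close>)
    qed
    also have "\<dots> \<longleftrightarrow> integrable lborel (\<lambda>x. indicator K x *\<^sub>R f' x)"
      by (rule integrable_completion[OF m'])
    finally show ?thesis .
  qed
  then show ?thesis unfolding locally_integrable_def loc_int_def using f'm by blast
qed

lemma borel_rep_integral:
  fixes f :: "'a::euclidean_space \<Rightarrow> real"
  assumes \<Omega>: "open \<Omega>" and r: "borel_rep \<Omega> f f'" and k[measurable]: "k \<in> borel_measurable borel" and z: "\<And>x. x \<notin> \<Omega> \<Longrightarrow> k x = 0"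
  shows "(LINT x|lebesgue_on \<Omega>. f x * k x) = (\<integral>x. f' x * k x \<partial>lborel)"
proof -
  have f'm[measurable]: "f' \<in> borel_measurable borel" using r by (rule borel_repD)
  have gm: "(\<lambda>x. indicator \<Omega> x *\<^sub>R f x) \<in> borel_measurable lebesgue"
    using borel_repD(1)[OF r] \<Omega> by (subst (asm) borel_measurable_restrict_space_iff) auto
  have km: "k \<in> borel_measurable lebesgue" by (intro measurable_completion) simp
  have m': "(\<lambda>x. f' x * k x) \<in> borel_measurable lborel" by simp
  have "(LINT x|lebesgue_on \<Omega>. f x * k x) = (LINT x|lebesgue. indicator \<Omega> x *\<^sub>R (f x * k x))"
    using \<Omega> by (intro integral_restrict_space) auto
  also have "\<dots> = (LINT x|lebesgue. f' x * k x)"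
  proof (rule integral_cong_AE)
    show "(\<lambda>x. indicator \<Omega> x *\<^sub>R (f x * k x)) \<in> borel_measurable lebesgue"
      using borel_measurable_times[OF gm km] by (simp add: mult.assoc)
    show "(\<lambda>x. f' x * k x) \<in> borel_measurable lebesgue" by (rule measurable_completion[OF m'])
    show "AE x in lebesgue. indicator \<Omega> x *\<^sub>R (f x * k x) = f' x * k x"
      using AE_completion[OF borel_repD(4)[OF r]] by eventually_elim (use z in \<open>auto simp: indicator_def\<close>)
  qed
  also have "\<dots> = (\<integral>x. f' x * k x \<partial>lborel)" by (rule integral_completion[OF m'])
  finally show ?thesis .
qed

lemma borel_rep_inner: "borel_rep \<Omega> g g' \<Longrightarrow> borel_rep \<Omega> (\<lambda>x. g x \<bullet> b) (\<lambda>x. g' x \<bullet> b)"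
  unfolding borel_rep_def by (auto elim!: eventually_mono)

lemma borel_rep_weak_gradient:
  assumes \<Omega>: "open \<Omega>" and f: "borel_rep \<Omega> f f'" and g: "borel_rep \<Omega> g g'"
  shows "has_weak_gradient \<Omega> f g \<longleftrightarrow> wgrad \<Omega> f' g'"
proof -
  have "(LINT x|lebesgue_on \<Omega>. f x * frechet_derivative \<psi> (at x) b) = (\<integral>x. f' x * frechet_derivative \<psi> (at x) b \<partial>lborel)"
    "(LINT x|lebesgue_on \<Omega>. (g x \<bullet> b) * \<psi> x) = (\<integral>x. (g' x \<bullet> b) * \<psi> x \<partial>lborel)"
    if t: "\<psi> \<in> test_functions \<Omega>" for \<psi> b
    using t test_functions_zero_outside[OF t]
    by (auto intro!: borel_rep_integral[OF \<Omega>] f borel_rep_inner[OF g] test_functions_borel test_functions_deriv_borel)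
  then show ?thesis
    unfolding has_weak_gradient_def wgrad_def borel_rep_locally_integrable[OF \<Omega> f] borel_rep_locally_integrable[OF \<Omega> g]
    by simp
qed

section \<open>Transfer of weak gradients and Sobolev norms\<close>

text \<open>An open set is a countable union of closed boxes, and integrability on each box includes
  measurability there.\<close>

lemma locally_integrable_measurable:
  fixes f :: "'a::euclidean_space \<Rightarrow> 'b::euclidean_space"
  assumes \<Omega>: "open \<Omega>" and f: "locally_integrable \<Omega> f"
  shows "f \<in> borel_measurable (lebesgue_on \<Omega>)"
proof -
  obtain \<D> where D: "countable \<D>" "\<D> \<subseteq> Pow \<Omega>" "\<And>X. X \<in> \<D> \<Longrightarrow> \<exists>a b. X = cbox a b" "\<Union>\<D> = \<Omega>"
    by (rule open_countable_Union_open_cbox[OF \<Omega>], rule that)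
  show ?thesis
  proof (rule measurable_piecewise_restrict[OF D(1)])
    show "space (lebesgue_on \<Omega>) \<subseteq> \<Union>\<D>" using D(4) by simp
    fix X assume X: "X \<in> \<D>"
    then obtain a b where ab: "X = cbox a b" using D(3) by blast
    have sub: "X \<subseteq> \<Omega>" using X D(2) by auto
    then have "X \<inter> \<Omega> = X" "\<Omega> \<inter> X = X" by auto
    have "X \<in> sets lebesgue" by (simp add: ab)
    then show "X \<inter> space (lebesgue_on \<Omega>) \<in> sets (lebesgue_on \<Omega>)"
      using sub \<Omega> by (simp add: Int_absorb2 sets_restrict_space_iff)
    have "integrable (lebesgue_on X) f" using f sub by (simp add: locally_integrable_def ab)
    then have "f \<in> borel_measurable (lebesgue_on X)" by (rule borel_measurable_integrable)
    moreover have "restrict_space (lebesgue_on \<Omega>) X = lebesgue_on X"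
      using \<open>\<Omega> \<inter> X = X\<close> \<Omega> \<open>X \<in> sets lebesgue\<close> by (subst restrict_restrict_space) auto
    ultimately show "f \<in> borel_measurable (restrict_space (lebesgue_on \<Omega>) X)" by simp
  qed
qed

text \<open>\<open>weak_gradient\<close> is an arbitrary choice. Once some weak gradient exists the
  choice is one too, and uniqueness ties its values on \<open>\<Omega>\<close> to \<open>h'\<close>
  almost everywhere.\<close>

lemma weak_gradient_borel_rep:
  assumes \<Omega>: "open \<Omega>" and f: "borel_rep \<Omega> f f'" and h: "wgrad \<Omega> f' h'" "\<And>x. x \<notin> \<Omega> \<Longrightarrow> h' x = 0"
  shows "borel_rep \<Omega> (weak_gradient \<Omega> f) h'"
proof -
  have h'm[measurable]: "h' \<in> borel_measurable borel" using h(1) loc_int_borel by (auto simp: wgrad_def)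
  have "h' \<in> borel_measurable (lebesgue_on \<Omega>)"
    using h'm by (rule borel_measurable_lebesgue_on)
  then have "borel_rep \<Omega> h' h'" using h(2) by (simp add: borel_rep_def)
  then have "has_weak_gradient \<Omega> f h'" using borel_rep_weak_gradient[OF \<Omega> f] h(1) by blast
  then have g: "has_weak_gradient \<Omega> f (weak_gradient \<Omega> f)"
    unfolding weak_gradient_def by (rule someI[of "has_weak_gradient \<Omega> f"])
  then have "locally_integrable \<Omega> (weak_gradient \<Omega> f)" by (simp add: has_weak_gradient_def)
  then have gm: "weak_gradient \<Omega> f \<in> borel_measurable (lebesgue_on \<Omega>)" by (rule locally_integrable_measurable[OF \<Omega>])
  obtain g' where g': "borel_rep \<Omega> (weak_gradient \<Omega> f) g'" using ex_borel_rep[OF \<Omega> gm] .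
  then have "wgrad \<Omega> f' g'" using borel_rep_weak_gradient[OF \<Omega> f] g by blast
  then have "AE x in lborel. x \<in> \<Omega> \<longrightarrow> g' x = h' x" using wgrad_unique[OF \<Omega> _ h(1)] by blast
  with borel_repD(4)[OF g'] have "AE x in lborel. x \<in> \<Omega> \<longrightarrow> weak_gradient \<Omega> f x = h' x"
    by eventually_elim auto
  then show ?thesis using gm h(2) by (simp add: borel_rep_def)
qed

lemma sobolev_W1_borel_rep:
  assumes \<Omega>: "open \<Omega>" and p: "0 < p" and f: "f \<in> sobolev_W1 p \<Omega>"
  obtains f' g' where "borel_rep \<Omega> f f'" "borel_rep \<Omega> (weak_gradient \<Omega> f) g'" "wgrad \<Omega> f' g'"
    "Lp_pow p f' < \<infinity>" "Lp_pow p g' < \<infinity>"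
proof -
  obtain g where g: "has_weak_gradient \<Omega> f g" "g \<in> Lp_space p \<Omega>" and fL: "f \<in> Lp_space p \<Omega>"
    using f by (auto simp: sobolev_W1_def)
  obtain f' where f': "borel_rep \<Omega> f f'" using ex_borel_rep[OF \<Omega>, of f] fL by (auto simp: Lp_space_def)
  obtain g' where g': "borel_rep \<Omega> g g'" using ex_borel_rep[OF \<Omega>, of g] g(2) by (auto simp: Lp_space_def)
  have w: "wgrad \<Omega> f' g'" using borel_rep_weak_gradient[OF \<Omega> f' g'] g(1) by blast
  show ?thesis
    using that[OF f' weak_gradient_borel_rep[OF \<Omega> f' w borel_repD(3)[OF g']] w]
      borel_rep_Lp_space[OF \<Omega> f' p] borel_rep_Lp_space[OF \<Omega> g' p] fL g(2) by blast
qed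

lemma sobolev_W1I:
  assumes \<Omega>: "open \<Omega>" and p: "0 < p" and f: "borel_rep \<Omega> f f'" and h: "wgrad \<Omega> f' h'" "\<And>x. x \<notin> \<Omega> \<Longrightarrow> h' x = 0"
    and fin: "Lp_pow p f' < \<infinity>" "Lp_pow p h' < \<infinity>"
  shows "f \<in> sobolev_W1 p \<Omega>"
    and "sobolev_norm p \<Omega> f = enn2real (Lp_pow p f') powr (1 / p) + enn2real (Lp_pow p h') powr (1 / p)"
proof -
  have g: "borel_rep \<Omega> (weak_gradient \<Omega> f) h'" by (rule weak_gradient_borel_rep[OF \<Omega> f h])
  have "has_weak_gradient \<Omega> f (weak_gradient \<Omega> f)"
    using borel_rep_weak_gradient[OF \<Omega> f g] h(1) by blast
  then show "f \<in> sobolev_W1 p \<Omega>"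
    using borel_rep_Lp_space[OF \<Omega> f p] borel_rep_Lp_space[OF \<Omega> g p] fin by (auto simp: sobolev_W1_def)
  show "sobolev_norm p \<Omega> f = enn2real (Lp_pow p f') powr (1 / p) + enn2real (Lp_pow p h') powr (1 / p)"
    by (simp add: sobolev_norm_def borel_rep_Lp_norm[OF \<Omega> f p] borel_rep_Lp_norm[OF \<Omega> g p])
qed

section \<open>The theorem\<close>

lemma AE_lebesgue_on_iff:
  fixes \<Omega> :: "'a::euclidean_space set"
  assumes "open \<Omega>"
  shows "(AE x in lebesgue_on \<Omega>. P x) \<longleftrightarrow> (AE x in lborel. x \<in> \<Omega> \<longrightarrow> P x)"
proof -
  have "(AE x in lebesgue_on \<Omega>. P x) \<longleftrightarrow> (AE x in lebesgue. x \<in> \<Omega> \<longrightarrow> P x)"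
    using assms by (intro AE_restrict_space_iff) auto
  then show ?thesis by (simp add: AE_completion_iff)
qed

lemma enn2real_powr_le:
  assumes "X \<le> ennreal c * Y" "Y < \<infinity>" "0 \<le> c" "0 < p"
  shows "enn2real X powr (1 / p) \<le> c powr (1 / p) * enn2real Y powr (1 / p)"
proof -
  have "enn2real X \<le> enn2real (ennreal c * Y)"
    using assms by (intro enn2real_mono) (auto simp: ennreal_mult_less_top)
  also have "\<dots> = c * enn2real Y" using assms(3) by (simp add: enn2real_mult)
  finally have "enn2real X powr (1 / p) \<le> (c * enn2real Y) powr (1 / p)"
    using assms(4) by (intro powr_mono2) auto
  then show ?thesis using assms(3) by (simp add: powr_mult)
qed

section \<open>Norm bounds and zero boundary values on a fixed domain\<close>

context
  fixes \<Omega> :: "'a::euclidean_space set" and \<gamma> p :: real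
  assumes \<Omega>: "open \<Omega>" and \<gamma>: "0 \<le> \<gamma>" and p: "1 < p"
begin

lemma local_maximal_borel_rep:
  assumes f: "borel_rep \<Omega> f f'"
  shows "local_maximal (growth \<gamma>) \<Omega> f x = maximal \<gamma> \<Omega> (\<lambda>v. ennreal \<bar>f' v\<bar>) x"
    and "borel_rep \<Omega> (local_maximal_real (growth \<gamma>) \<Omega> f) (\<lambda>x. enn2real (maximal \<gamma> \<Omega> (\<lambda>v. ennreal \<bar>f' v\<bar>) x))"
proof -
  have [measurable]: "f' \<in> borel_measurable borel" using f by (rule borel_repD)
  show eq: "local_maximal (growth \<gamma>) \<Omega> f x = maximal \<gamma> \<Omega> (\<lambda>v. ennreal \<bar>f' v\<bar>) x" for x
  proof (rule local_maximal_eq_maximal[OF \<Omega>])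
    show "AE y in lebesgue. y \<in> \<Omega> \<longrightarrow> ennreal \<bar>f y\<bar> = ennreal \<bar>f' y\<bar>"
      using AE_completion[OF borel_repD(4)[OF f]] by eventually_elim auto
  qed simp
  have m: "(\<lambda>x. enn2real (maximal \<gamma> \<Omega> (\<lambda>v. ennreal \<bar>f' v\<bar>) x)) \<in> borel_measurable borel"
    using \<Omega> \<gamma> by measurable
  then have "(\<lambda>x. enn2real (maximal \<gamma> \<Omega> (\<lambda>v. ennreal \<bar>f' v\<bar>) x)) \<in> borel_measurable (lebesgue_on \<Omega>)"
    by (rule borel_measurable_lebesgue_on)
  then show "borel_rep \<Omega> (local_maximal_real (growth \<gamma>) \<Omega> f) (\<lambda>x. enn2real (maximal \<gamma> \<Omega> (\<lambda>v. ennreal \<bar>f' v\<bar>) x))"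
    using m by (simp add: borel_rep_def local_maximal_real_def[abs_def] eq maximal_outside)
qed

lemma local_maximal_gradient_borel_rep:
  assumes g: "borel_rep \<Omega> g g'"
  shows "local_maximal (growth \<gamma>) \<Omega> (\<lambda>y. norm (g y)) x = maximal \<gamma> \<Omega> (\<lambda>v. ennreal (norm (g' v))) x"
proof (rule local_maximal_eq_maximal[OF \<Omega>])
  have [measurable]: "g' \<in> borel_measurable borel" using g by (rule borel_repD)
  show "(\<lambda>v. ennreal (norm (g' v))) \<in> borel_measurable borel" by simp
  show "AE y in lebesgue. y \<in> \<Omega> \<longrightarrow> ennreal \<bar>norm (g y)\<bar> = ennreal (norm (g' y))"
    using AE_completion[OF borel_repD(4)[OF g]] by eventually_elim auto
qed

lemma maximal_sobolev:
  assumes f: "borel_rep \<Omega> f f'" and g: "borel_rep \<Omega> (weak_gradient \<Omega> f) g'" and w: "wgrad \<Omega> f' g'"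
    and fin: "Lp_pow p f' < \<infinity>" "Lp_pow p g' < \<infinity>"
  obtains h where "wgrad \<Omega> (\<lambda>x. enn2real (maximal \<gamma> \<Omega> (\<lambda>v. ennreal \<bar>f' v\<bar>) x)) h" "\<forall>x. x \<notin> \<Omega> \<longrightarrow> h x = 0"
    "AE x in lborel. norm (h x) \<le> 2 * enn2real (maximal \<gamma> \<Omega> (\<lambda>v. ennreal (norm (g' v))) x)"
    "Lp_pow p (\<lambda>x. enn2real (maximal \<gamma> \<Omega> (\<lambda>v. ennreal \<bar>f' v\<bar>) x)) \<le> ennreal (maximal_const DIM('a) p) * Lp_pow p f'"
    "Lp_pow p h \<le> ennreal (2 powr p * maximal_const DIM('a) p) * Lp_pow p g'"
proof -
  have m[measurable]: "f' \<in> borel_measurable borel" "g' \<in> borel_measurable borel" using borel_repD(2) f g by blast+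
  let ?u = "\<lambda>x. enn2real (maximal \<gamma> \<Omega> (\<lambda>v. ennreal \<bar>f' v\<bar>) x)"
  let ?G = "\<lambda>x. enn2real (maximal \<gamma> \<Omega> (\<lambda>v. ennreal (norm (g' v))) x)"
  have [measurable]: "?u \<in> borel_measurable borel" "?G \<in> borel_measurable borel" using \<Omega> \<gamma> by measurable
  have [measurable]: "\<Omega> \<in> sets borel" using \<Omega> by simp
  obtain h0 where h0: "wgrad \<Omega> ?u h0" "AE x in lborel. x \<in> \<Omega> \<longrightarrow> norm (h0 x) \<le> 2 * ?G x"
    using maximal_wgrad[OF w \<Omega> \<gamma> p fin] .
  have [measurable]: "h0 \<in> borel_measurable borel" using h0(1) loc_int_borel by (auto simp: wgrad_def)
  \<comment> \<open>With zero values off \<open>\<Omega>\<close> the pointwise bound holds on the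
    whole space, so the norms can be compared there.\<close>
  define h where "h x = indicator \<Omega> x *\<^sub>R h0 x" for x
  have [measurable]: "h \<in> borel_measurable borel" unfolding h_def[abs_def] by measurable
  have hw: "wgrad \<Omega> ?u h" by (rule wgrad_cong_AE[OF h0(1)]) (auto simp: h_def)
  have hb: "AE x in lborel. norm (h x) \<le> 2 * ?G x"
    using h0(2) by eventually_elim (auto simp: h_def indicator_def)
  have "Lp_pow p h \<le> Lp_pow p (\<lambda>x. 2 *\<^sub>R ?G x)"
    using hb p by (intro Lp_pow_mono_AE) auto
  also have "\<dots> = ennreal (2 powr p) * Lp_pow p ?G" by (subst Lp_pow_scaleR) auto
  also have "\<dots> \<le> ennreal (2 powr p) * (ennreal (maximal_const DIM('a) p) * Lp_pow p g')"
    by (intro mult_left_mono maximal_Lp(2)[OF m(2) fin(2) p \<Omega> \<gamma>]) simp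
  also have "\<dots> = ennreal (2 powr p * maximal_const DIM('a) p) * Lp_pow p g'"
  proof -
    have "0 \<le> maximal_const DIM('a) p" using p by (simp add: maximal_const_def)
    then show ?thesis by (simp add: ennreal_mult mult.assoc)
  qed
  finally have hp: "Lp_pow p h \<le> ennreal (2 powr p * maximal_const DIM('a) p) * Lp_pow p g'" .
  show ?thesis
    using that[OF hw _ hb _ hp] maximal_Lp(2)[OF m(1) fin(1) p \<Omega> \<gamma>] by (simp add: h_def)
qed

text \<open>The approximating sequence of \<open>f\<close> is carried over to Borel representatives,
  where convergence in the Sobolev norm becomes convergence of the \<open>p\<close>-th powers for
  function and gradient separately; the approximants of the maximal function are carried
  back.\<close>

lemma maximal_zero_boundary:
  assumes f: "f \<in> sobolev_W1_zero p \<Omega>"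
  shows "local_maximal_real (growth \<gamma>) \<Omega> f \<in> sobolev_W1_zero p \<Omega>"
proof -
  have p0: "0 < p" using p by simp
  obtain \<psi> where fW: "f \<in> sobolev_W1 p \<Omega>" and \<psi>: "\<And>k::nat. \<psi> k \<in> test_functions \<Omega>"
    and lim: "(\<lambda>k. sobolev_norm p \<Omega> (\<lambda>x. f x - \<psi> k x)) \<longlonglongrightarrow> 0"
    using f by (auto simp: sobolev_W1_zero_def)
  obtain f' g' where f': "borel_rep \<Omega> f f'" and g': "borel_rep \<Omega> (weak_gradient \<Omega> f) g'" and w: "wgrad \<Omega> f' g'"
    and fin: "Lp_pow p f' < \<infinity>" "Lp_pow p g' < \<infinity>"
    using sobolev_W1_borel_rep[OF \<Omega> p0 fW] .
  have m[measurable]: "f' \<in> borel_measurable borel" "g' \<in> borel_measurable borel" using borel_repD(2) f' g' by blast+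
  let ?u = "\<lambda>x. enn2real (maximal \<gamma> \<Omega> (\<lambda>v. ennreal \<bar>f' v\<bar>) x)"
  obtain h where h: "wgrad \<Omega> ?u h" "\<forall>x. x \<notin> \<Omega> \<longrightarrow> h x = 0"
    "AE x in lborel. norm (h x) \<le> 2 * enn2real (maximal \<gamma> \<Omega> (\<lambda>v. ennreal (norm (g' v))) x)"
    "Lp_pow p ?u \<le> ennreal (maximal_const DIM('a) p) * Lp_pow p f'"
    "Lp_pow p h \<le> ennreal (2 powr p * maximal_const DIM('a) p) * Lp_pow p g'"
    using maximal_sobolev[OF f' g' w fin] .
  have h0: "h x = 0" if "x \<notin> \<Omega>" for x using h(2) that by blast
  have ufin: "Lp_pow p ?u < \<infinity>" "Lp_pow p h < \<infinity>"
    using h(4,5) fin by (auto simp: ennreal_mult_less_top intro: le_less_trans)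
  note ur = local_maximal_borel_rep(2)[OF f']
  have sub: "borel_rep \<Omega> (\<lambda>x. k x - \<theta> x) (\<lambda>x. k' x - \<theta> x)"
    if k: "borel_rep \<Omega> k k'" and t: "\<theta> \<in> test_functions \<Omega>" for k k' \<theta>
  proof -
    have tm: "\<theta> \<in> borel_measurable borel" using t by (rule test_functions_borel)
    have "\<theta> \<in> borel_measurable (lebesgue_on \<Omega>)"
      using tm by (rule borel_measurable_lebesgue_on)
    then show ?thesis
      using k tm test_functions_zero_outside(1)[OF t] unfolding borel_rep_def by (auto elim!: eventually_mono)
  qed
  define D where "D k x = (\<Sum>b\<in>Basis. frechet_derivative (\<psi> k) (at x) b *\<^sub>R b)" for k x
  have Dw: "wgrad \<Omega> (\<psi> k) (D k)" for k unfolding D_def by (rule wgrad_test_functions[OF \<psi>])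
  have D0: "D k x = 0" if "x \<notin> \<Omega>" for k x
    using test_functions_zero_outside(2)[OF \<psi> that] by (simp add: D_def)
  have [measurable]: "\<psi> k \<in> borel_measurable borel" "D k \<in> borel_measurable borel" for k
    using Dw[of k] loc_int_borel by (auto simp: wgrad_def)
  have tL: "Lp_pow p \<theta> < \<infinity>" if t: "\<theta> \<in> test_functions \<Omega>" for \<theta>
  proof -
    obtain B where B: "0 \<le> B" "\<And>x. \<bar>\<theta> x\<bar> \<le> B" using t by (rule test_functions_bounded) blast
    obtain K where K: "compact K" "\<And>x. x \<notin> K \<Longrightarrow> \<theta> x = 0" using t by (rule test_functions_support) blast
    have "Lp_pow p \<theta> \<le> (\<integral>\<^sup>+x. ennreal (B powr p) * indicator K x \<partial>lborel)"
      unfolding Lp_pow_def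
    proof (rule nn_integral_mono)
      fix x
      show "ennreal (norm (\<theta> x) powr p) \<le> ennreal (B powr p) * indicator K x"
        using K(2)[of x] B p by (cases "x \<in> K") (auto intro!: ennreal_leI powr_mono2)
    qed
    also have "\<dots> = ennreal (B powr p) * emeasure lborel K"
      using K(1) by (intro nn_integral_cmult_indicator) (simp add: borel_compact)
    also have "\<dots> < \<infinity>" using emeasure_compact_finite[OF K(1)] by (simp add: ennreal_mult_less_top)
    finally show ?thesis .
  qed
  have DL: "Lp_pow p (D k) < \<infinity>" for k
    unfolding D_def
  proof -
    have "Lp_pow p (\<lambda>x. \<Sum>b\<in>I. frechet_derivative (\<psi> k) (at x) b *\<^sub>R b) < \<infinity>" if "I \<subseteq> Basis" for I
      using finite_subset[OF that finite_Basis] that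
    proof (induction I rule: finite_induct)
      case empty
      then show ?case by (simp add: Lp_pow_def)
    next
      case (insert b I)
      have [measurable]: "(\<lambda>x. frechet_derivative (\<psi> k) (at x) c) \<in> borel_measurable borel" for c
        by (rule test_functions_deriv_borel[OF \<psi>])
      have "Lp_pow p (\<lambda>x. frechet_derivative (\<psi> k) (at x) b *\<^sub>R b) = Lp_pow p (\<lambda>x. frechet_derivative (\<psi> k) (at x) b)"
        using insert.prems by (simp add: Lp_pow_def)
      also have "\<dots> < \<infinity>" using insert.prems by (intro tL test_functions_deriv \<psi>) auto
      finally show ?case
        unfolding sum.insert[OF insert.hyps] using insert p by (intro Lp_pow_finite_add) auto
    qed
    from this[of Basis] show "Lp_pow p (\<lambda>x. \<Sum>b\<in>Basis. frechet_derivative (\<psi> k) (at x) b *\<^sub>R b) < \<infinity>" by simp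
  qed
  have dw: "wgrad \<Omega> (\<lambda>x. f' x - \<psi> k x) (\<lambda>x. g' x - D k x)" for k by (rule wgrad_diff[OF w Dw])
  have dfin: "Lp_pow p (\<lambda>x. f' x - \<psi> k x) < \<infinity>" "Lp_pow p (\<lambda>x. g' x - D k x) < \<infinity>" for k
    using Lp_pow_diff[of f' "\<psi> k" p] Lp_pow_diff[of g' "D k" p] fin tL[OF \<psi>] DL p
    by (auto simp: ennreal_mult_less_top intro: le_less_trans)
  have dn: "sobolev_norm p \<Omega> (\<lambda>x. f x - \<psi> k x) = enn2real (Lp_pow p (\<lambda>x. f' x - \<psi> k x)) powr (1 / p)
      + enn2real (Lp_pow p (\<lambda>x. g' x - D k x)) powr (1 / p)" for k
    using sobolev_W1I(2)[OF \<Omega> p0 sub[OF f' \<psi>] dw _ dfin] borel_repD(3)[OF g'] D0 by simp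
  \<comment> \<open>Each summand of the Sobolev norm is squeezed between 0 and the norm; finiteness
    of \<open>X k\<close> is needed because \<open>enn2real\<close> would also send infinity to
    0.\<close>
  have to0: "(\<lambda>k. X k) \<longlonglongrightarrow> 0"
    if X: "\<And>k. X k < \<infinity>" "\<And>k. enn2real (X k) powr (1 / p) \<le> sobolev_norm p \<Omega> (\<lambda>x. f x - \<psi> k x)" for X :: "nat \<Rightarrow> ennreal"
  proof -
    have "(\<lambda>k. enn2real (X k) powr (1 / p)) \<longlonglongrightarrow> 0"
      by (rule tendsto_sandwich[OF _ _ tendsto_const lim]) (auto intro!: always_eventually X)
    then have "(\<lambda>k. (enn2real (X k) powr (1 / p)) powr p) \<longlonglongrightarrow> 0 powr p"
      using p by (intro tendsto_powr2) auto
    then have "(\<lambda>k. enn2real (X k)) \<longlonglongrightarrow> 0" using p by (simp add: powr_powr)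
    from tendsto_ennrealI[OF this] show ?thesis using X(1) by simp
  qed
  have l1: "(\<lambda>k. Lp_pow p (\<lambda>x. f' x - \<psi> k x)) \<longlonglongrightarrow> 0" "(\<lambda>k. Lp_pow p (\<lambda>x. g' x - D k x)) \<longlonglongrightarrow> 0"
    by (intro to0 dfin; simp add: dn)+
  have "\<exists>\<theta>. \<theta> \<in> test_functions \<Omega> \<and> sobolev_norm p \<Omega> (\<lambda>x. local_maximal_real (growth \<gamma>) \<Omega> f x - \<theta> x) \<le> 2 * (1 / real (Suc j)) powr (1 / p)"
    for j
  proof -
    have \<epsilon>: "0 < 1 / real (Suc j)" by simp
    obtain \<theta> \<Theta> where \<theta>: "\<theta> \<in> test_functions \<Omega>" "wgrad \<Omega> \<theta> \<Theta>"
      "Lp_pow p (\<lambda>x. ?u x - \<theta> x) \<le> ennreal (1 / real (Suc j))" "Lp_pow p (\<lambda>x. h x - \<Theta> x) \<le> ennreal (1 / real (Suc j))"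
      using maximal_approx_test_functions[OF w \<Omega> \<gamma> p fin h(1) ufin(2) h0 \<psi> dw l1 \<epsilon>] by blast
    have [measurable]: "\<Theta> \<in> borel_measurable borel" "\<Omega> \<in> sets borel"
      using \<theta>(2) loc_int_borel \<Omega> by (auto simp: wgrad_def)
    \<comment> \<open>Replacing the gradient by zero off \<open>\<Omega>\<close> makes it a
      representative. The error does not grow, since \<open>h\<close> vanishes there as
      well.\<close>
    define \<Theta>' where "\<Theta>' x = indicator \<Omega> x *\<^sub>R \<Theta> x" for x
    have [measurable]: "\<Theta>' \<in> borel_measurable borel" unfolding \<Theta>'_def[abs_def] by measurable
    have tm: "\<theta> \<in> borel_measurable borel" using \<theta>(1) by (rule test_functions_borel)
    have w': "wgrad \<Omega> \<theta> \<Theta>'"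
      by (rule wgrad_cong_AE[OF \<theta>(2) tm]) (auto simp: \<Theta>'_def)
    have L': "Lp_pow p (\<lambda>x. h x - \<Theta>' x) \<le> ennreal (1 / real (Suc j))"
    proof (rule order_trans[OF _ \<theta>(4)])
      show "Lp_pow p (\<lambda>x. h x - \<Theta>' x) \<le> Lp_pow p (\<lambda>x. h x - \<Theta> x)"
        using p h0 by (intro Lp_pow_mono_AE AE_I2) (auto simp: \<Theta>'_def indicator_def)
    qed
    have "sobolev_norm p \<Omega> (\<lambda>x. local_maximal_real (growth \<gamma>) \<Omega> f x - \<theta> x)
        = enn2real (Lp_pow p (\<lambda>x. ?u x - \<theta> x)) powr (1 / p) + enn2real (Lp_pow p (\<lambda>x. h x - \<Theta>' x)) powr (1 / p)"
      using \<theta>(3) L' h0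
      by (intro sobolev_W1I(2)[OF \<Omega> p0 sub[OF ur \<theta>(1)] wgrad_diff[OF h(1) w']])
        (auto simp: \<Theta>'_def intro: le_less_trans)
    also have "\<dots> \<le> (1 / real (Suc j)) powr (1 / p) + (1 / real (Suc j)) powr (1 / p)"
      using enn2real_mono[OF \<theta>(3)] enn2real_mono[OF L'] p by (intro add_mono powr_mono2) auto
    finally show ?thesis using \<theta>(1) by auto
  qed
  then obtain \<theta> where \<theta>: "\<And>j. \<theta> j \<in> test_functions \<Omega>"
    "\<And>j. sobolev_norm p \<Omega> (\<lambda>x. local_maximal_real (growth \<gamma>) \<Omega> f x - \<theta> j x) \<le> 2 * (1 / real (Suc j)) powr (1 / p)"
    by metis
  have "(\<lambda>j. sobolev_norm p \<Omega> (\<lambda>x. local_maximal_real (growth \<gamma>) \<Omega> f x - \<theta> j x)) \<longlonglongrightarrow> 0"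
  proof (rule tendsto_sandwich[OF _ _ tendsto_const])
    show "\<forall>\<^sub>F j in sequentially. 0 \<le> sobolev_norm p \<Omega> (\<lambda>x. local_maximal_real (growth \<gamma>) \<Omega> f x - \<theta> j x)"
      by (simp add: sobolev_norm_def Lp_norm_def)
    show "\<forall>\<^sub>F j in sequentially. sobolev_norm p \<Omega> (\<lambda>x. local_maximal_real (growth \<gamma>) \<Omega> f x - \<theta> j x) \<le> 2 * (1 / real (Suc j)) powr (1 / p)"
      by (intro always_eventually allI \<theta>)
    have "(\<lambda>j. 2 * (1 / real (Suc j)) powr (1 / p)) \<longlonglongrightarrow> 2 * 0 powr (1 / p)"
      using p by (intro tendsto_mult tendsto_const tendsto_powr2 LIMSEQ_Suc[OF lim_1_over_n]) auto
    then show "(\<lambda>j. 2 * (1 / real (Suc j)) powr (1 / p)) \<longlonglongrightarrow> 0" by simp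
  qed
  moreover have "local_maximal_real (growth \<gamma>) \<Omega> f \<in> sobolev_W1 p \<Omega>"
    by (rule sobolev_W1I(1)[OF \<Omega> p0 ur h(1) h0 ufin])
  ultimately show ?thesis using \<theta>(1) by (auto simp: sobolev_W1_zero_def)
qed

end

theorem corollary1p10:
  fixes \<Omega> :: "'a::euclidean_space set" and \<gamma> p :: real
  assumes "open \<Omega>" and "connected \<Omega>" and "\<Omega> \<noteq> {}"
    and "0 \<le> \<gamma>" and "1 < p"
  shows
    "(\<forall>f\<in>sobolev_W1 p \<Omega>.
        (AE x in lebesgue_on \<Omega>. local_maximal (growth \<gamma>) \<Omega> f x < \<infinity>) \<and>
        local_maximal_real (growth \<gamma>) \<Omega> f \<in> sobolev_W1 p \<Omega> \<and>
        (AE x in lebesgue_on \<Omega>.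
          ennreal (norm (weak_gradient \<Omega> (local_maximal_real (growth \<gamma>) \<Omega> f) x)) \<le>
            ennreal (\<gamma> * real DIM('a)) * local_maximal (growth \<gamma>) \<Omega> f x +
            2 * local_maximal (growth \<gamma>) \<Omega> (\<lambda>y. norm (weak_gradient \<Omega> f y)) x))
     \<and> (\<exists>C>0. \<forall>f\<in>sobolev_W1 p \<Omega>.
          sobolev_norm p \<Omega> (local_maximal_real (growth \<gamma>) \<Omega> f) \<le> C * sobolev_norm p \<Omega> f)
     \<and> (\<forall>f\<in>sobolev_W1_zero p \<Omega>.
          local_maximal_real (growth \<gamma>) \<Omega> f \<in> sobolev_W1_zero p \<Omega>)"
proof -
  note \<Omega> = assms(1) and \<gamma> = assms(4) and p = assms(5)
  have p0: "0 < p" using p by simp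
  let ?M = "local_maximal_real (growth \<gamma>) \<Omega>"
  define A where "A = maximal_const DIM('a) p"
  \<comment> \<open>The gradient bound carries the factor \<open>2 powr p * A\<close>, whose
    \<open>p\<close>-th root is exactly this; it also dominates the root of \<open>A\<close> from
    the function itself.\<close>
  define C where "C = 2 * A powr (1 / p)"
  have A: "0 < A" using p by (simp add: A_def maximal_const_def)
  have C: "0 < C" using A by (simp add: C_def)
  have main: "(AE x in lebesgue_on \<Omega>. local_maximal (growth \<gamma>) \<Omega> f x < \<infinity>) \<and> ?M f \<in> sobolev_W1 p \<Omega> \<and>
      (AE x in lebesgue_on \<Omega>. ennreal (norm (weak_gradient \<Omega> (?M f) x)) \<le>
        ennreal (\<gamma> * real DIM('a)) * local_maximal (growth \<gamma>) \<Omega> f x +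
        2 * local_maximal (growth \<gamma>) \<Omega> (\<lambda>y. norm (weak_gradient \<Omega> f y)) x) \<and>
      sobolev_norm p \<Omega> (?M f) \<le> C * sobolev_norm p \<Omega> f"
    if f: "f \<in> sobolev_W1 p \<Omega>" for f
  proof -
    obtain f' g' where f': "borel_rep \<Omega> f f'" and g': "borel_rep \<Omega> (weak_gradient \<Omega> f) g'" and w: "wgrad \<Omega> f' g'"
      and fin: "Lp_pow p f' < \<infinity>" "Lp_pow p g' < \<infinity>"
      using sobolev_W1_borel_rep[OF \<Omega> p0 f] .
    let ?u = "\<lambda>x. enn2real (maximal \<gamma> \<Omega> (\<lambda>v. ennreal \<bar>f' v\<bar>) x)"
    obtain h where h: "wgrad \<Omega> ?u h" "\<forall>x. x \<notin> \<Omega> \<longrightarrow> h x = 0"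
      "AE x in lborel. norm (h x) \<le> 2 * enn2real (maximal \<gamma> \<Omega> (\<lambda>v. ennreal (norm (g' v))) x)"
      "Lp_pow p ?u \<le> ennreal A * Lp_pow p f'" "Lp_pow p h \<le> ennreal (2 powr p * A) * Lp_pow p g'"
      using maximal_sobolev[OF \<Omega> \<gamma> p f' g' w fin] unfolding A_def .
    have h0: "h x = 0" if "x \<notin> \<Omega>" for x using h(2) that by blast
    have ufin: "Lp_pow p ?u < \<infinity>" "Lp_pow p h < \<infinity>"
      using h(4,5) fin by (auto simp: ennreal_mult_less_top intro: le_less_trans)
    note eq = local_maximal_borel_rep[OF \<Omega> \<gamma> p f']
    have ae: "AE x in lborel. maximal \<gamma> \<Omega> (\<lambda>v. ennreal \<bar>f' v\<bar>) x < \<infinity>"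
      using maximal_Lp(1)[OF borel_repD(2)[OF f'] fin(1) p \<Omega> \<gamma>] by simp
    have 1: "AE x in lebesgue_on \<Omega>. local_maximal (growth \<gamma>) \<Omega> f x < \<infinity>"
      unfolding AE_lebesgue_on_iff[OF \<Omega>] eq using ae by eventually_elim simp
    have 2: "?M f \<in> sobolev_W1 p \<Omega>"
      by (rule sobolev_W1I(1)[OF \<Omega> p0 eq(2) h(1) h0 ufin])
    have wr: "borel_rep \<Omega> (weak_gradient \<Omega> (?M f)) h"
      by (rule weak_gradient_borel_rep[OF \<Omega> eq(2) h(1) h0])
    have 3: "AE x in lebesgue_on \<Omega>. ennreal (norm (weak_gradient \<Omega> (?M f) x)) \<le>
        ennreal (\<gamma> * real DIM('a)) * local_maximal (growth \<gamma>) \<Omega> f x +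
        2 * local_maximal (growth \<gamma>) \<Omega> (\<lambda>y. norm (weak_gradient \<Omega> f y)) x"
      unfolding AE_lebesgue_on_iff[OF \<Omega>] local_maximal_gradient_borel_rep[OF \<Omega> \<gamma> p g']
      using borel_repD(4)[OF wr] h(3)
    proof eventually_elim
      case (elim x)
      let ?G = "maximal \<gamma> \<Omega> (\<lambda>v. ennreal (norm (g' v))) x"
      show ?case
      proof
        assume "x \<in> \<Omega>"
        then have "ennreal (norm (weak_gradient \<Omega> (?M f) x)) \<le> ennreal (2 * enn2real ?G)"
          using elim by (intro ennreal_leI) simp
        also have "\<dots> = 2 * ennreal (enn2real ?G)" by (simp add: ennreal_mult)
        also have "\<dots> \<le> 2 * ?G"
          by (intro mult_left_mono) (cases ?G rule: ennreal_cases, auto)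
        also have "\<dots> \<le> ennreal (\<gamma> * real DIM('a)) * local_maximal (growth \<gamma>) \<Omega> f x + 2 * ?G"
          by simp
        finally show "ennreal (norm (weak_gradient \<Omega> (?M f) x)) \<le> ennreal (\<gamma> * real DIM('a)) * local_maximal (growth \<gamma>) \<Omega> f x + 2 * ?G" .
      qed
    qed
    have "sobolev_norm p \<Omega> (?M f) = enn2real (Lp_pow p ?u) powr (1 / p) + enn2real (Lp_pow p h) powr (1 / p)"
      by (rule sobolev_W1I(2)[OF \<Omega> p0 eq(2) h(1) h0 ufin])
    also have "\<dots> \<le> A powr (1 / p) * enn2real (Lp_pow p f') powr (1 / p) + (2 powr p * A) powr (1 / p) * enn2real (Lp_pow p g') powr (1 / p)"
      using h(4,5) fin A p0 by (intro add_mono enn2real_powr_le) auto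
    also have "\<dots> \<le> C * enn2real (Lp_pow p f') powr (1 / p) + C * enn2real (Lp_pow p g') powr (1 / p)"
      using A p0 by (intro add_mono mult_right_mono) (auto simp: C_def powr_mult powr_powr)
    also have "\<dots> = C * sobolev_norm p \<Omega> f"
      by (simp add: sobolev_norm_def borel_rep_Lp_norm[OF \<Omega> f' p0] borel_rep_Lp_norm[OF \<Omega> g' p0] distrib_left)
    finally show ?thesis using 1 2 3 by blast
  qed
  show ?thesis
    using main C maximal_zero_boundary[OF \<Omega> \<gamma> p] by blast
qed

end
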